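(* Let $A_0$ and $A_1$ be OPCAs such that the pseudocoproduct of the realizability toposes $\mathsf{RT}(A_0)$ and $\mathsf{RT}(A_1)$ over $\mathsf{Set}$ is again a realizability topos (i.e. is equivalent to $\mathsf{RT}(C)$ for some OPCA $C$). Then at least one of $A_0$ and $A_1$ is trivial.
   Context: The Axiom of Choice is assumed for sets. Partiality: for possibly undefined expressions, $e\downarrow$ means that $e$ (and all its subexpressions) is defined; $e'\preceq e$ means: if $e\downarrow$, then $e'\downarrow$ and $e'\leq e$; $e'\leq e$ means that both are defined and the inequality holds. Application associates to the left: $abc=(ab)c$; $a\cdot b$ also denotes $ab$. OPCAs: an ordered partial applicative structure (OPAS) is a poset $A$ with a partial binary map $A\times A\rightharpoonup A$, $(a,b)\mapsto ab$, such that if $a'\leq a$, $b'\leq b$ and $ab\downarrow$, then $a'b'\downarrow$ and $a'b'\leq ab$. An OPAS $A$ is an ordered partial combinatory algebra (OPCA) if there exist $\mathsf{k},\mathsf{s}\in A$ such that for all $a,b,c\in A$: $\mathsf{k}ab\leq a$; $\mathsf{s}ab\downarrow$; $\mathsf{s}abc\preceq ac(bc)$. Trivial OPCAs: a morphism of OPCAs $f\colon A\to B$ is a function for which there exist $t\in B$ with $t\cdot f(a)\cdot f(a')\preceq f(aa')$ for all $a,a'\in A$, and $u\in B$ with $u\cdot f(a')\leq f(a)$ whenever $a'\leq a$; $f\leq f'$ means that there is $s\in B$ with $s\cdot f(a)\leq f'(a)$ for all $a$. This yields a preorder-enriched category $\mathsf{OPCA}$. An OPCA is trivial if it is equivalent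 in $\mathsf{OPCA}$ to the one-element OPCA $\mathbf{1}=\{*\}$ with $**=*$; equivalently, if it has a least element. Assemblies: let $TA$ be the set of nonempty downsets of an OPCA $A$. An assembly over $A$ is a pair $X=(|X|,E_X)$ with $|X|$ a set and $E_X\colon|X|\to TA$ a function. A morphism of assemblies $X\to Y$ is a function $f\colon|X|\to|Y|$ for which there is $r\in A$ such that for all $x\in|X|$ and $a\in E_X(x)$, $ra\downarrow$ and $ra\in E_Y(f(x))$. These form a regular category (indeed a quasitopos) $\mathsf{Asm}(A)$. There are regular functors $\Gamma_A\colon\mathsf{Asm}(A)\to\mathsf{Set}$, $X\mapsto|X|$, and $\nabla_A\colon\mathsf{Set}\to\mathsf{Asm}(A)$, $Y\mapsto(Y,y\mapsto A)$, with $\Gamma_A\dashv\nabla_A$ and $\Gamma_A\nabla_A\cong\mathrm{id}$. Realizability toposes: the realizability topos $\mathsf{RT}(A)$ is the ex/reg completion of $\mathsf{Asm}(A)$; it is an (elementary) topos. Viewing $\nabla_A$ as a functor $\mathsf{Set}\to\mathsf{RT}(A)$ and extending $\Gamma_A$ to a regular functor $\hat\Gamma_A\colon\mathsf{RT}(A)\to\mathsf{Set}$, the adjunction $\hat\Gamma_A\dashv\nabla_A$ is a geometric inclusion $\mathsf{Set}\hookrightarrow\mathsf{RT}(A)$ (with direct image $\nabla_A$ and inverse image $\hat\Gamma_A$), namely the inclusion of $\neg\neg$-sheaves. The pseudocoproduct of $\mathsf{RT}(A_0)$ and $\mathsf{RT}(A_1)$ over $\mathsf{Set}$ is the pseudopushout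 $\mathcal{E}$, in the 2-category of toposes and geometric morphisms, of the inclusions $\mathsf{Set}\hookrightarrow\mathsf{RT}(A_0)$ and $\mathsf{Set}\hookrightarrow\mathsf{RT}(A_1)$. This pseudopushout always exists, and with its inverse image functors it is the pseudopullback of categories of $\hat\Gamma_{A_0}$ and $\hat\Gamma_{A_1}$. Here "pseudo" means that cones commute up to coherent specified isomorphism and the universal property is an equivalence of categories. *)

theory Defs
  imports Main "HOL-Library.FuncSet"
begin

unbundle cardinal_syntax

section \<open>The universe of sets\<close>

text \<open>
  The category of sets is taken relative to a universe: a type whose cardinality is
  (strongly) inaccessible. A set over any type is small if it has strictly fewer elements than
  the universe, and the objects of the category of sets are the small subsets of the universe;
  this category is equivalent to the category of sets in a Grothendieck universe of the same
  cardinality. Subsets of the universe play the role of classes.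
\<close>

definition small :: "'u itself \<Rightarrow> 'x set \<Rightarrow> bool" where
  "small U X \<longleftrightarrow> |X| <o |UNIV :: 'u set|"

definition set_universe :: "'u itself \<Rightarrow> bool" where
  "set_universe U \<longleftrightarrow>
     (\<exists>X :: 'u set. infinite X \<and> small U X) \<and>
     (\<forall>X :: 'u set. small U X \<longrightarrow> small U (Pow X)) \<and>
     (\<forall>(I :: 'u set) (F :: 'u \<Rightarrow> 'u set).
        small U I \<and> (\<forall>i\<in>I. small U (F i)) \<longrightarrow> small U (\<Union>i\<in>I. F i))"


section \<open>Ordered partial combinatory algebras\<close>

record 'a opas =
  elts :: "'a set"
  le :: "'a \<Rightarrow> 'a \<Rightarrow> bool"
  app :: "'a \<Rightarrow> 'a \<Rightarrow> 'a option"

text \<open>Possibly undefined expressions are interpreted as options.\<close>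

definition oapp :: "'a opas \<Rightarrow> 'a option \<Rightarrow> 'a option \<Rightarrow> 'a option" where
  "oapp A x y = (case x of None \<Rightarrow> None | Some a \<Rightarrow>
                  (case y of None \<Rightarrow> None | Some b \<Rightarrow> app A a b))"

definition ole :: "'a opas \<Rightarrow> 'a option \<Rightarrow> 'a option \<Rightarrow> bool" where
  "ole A e' e \<longleftrightarrow> (\<exists>x y. e' = Some x \<and> e = Some y \<and> le A x y)"

definition opreceq :: "'a opas \<Rightarrow> 'a option \<Rightarrow> 'a option \<Rightarrow> bool" where
  "opreceq A e' e \<longleftrightarrow> (e \<noteq> None \<longrightarrow> ole A e' e)"

definition opas :: "'a opas \<Rightarrow> bool" where
  "opas A \<longleftrightarrow>
     (\<forall>a\<in>elts A. le A a a) \<and>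
     (\<forall>a\<in>elts A. \<forall>b\<in>elts A. \<forall>c\<in>elts A. le A a b \<and> le A b c \<longrightarrow> le A a c) \<and>
     (\<forall>a\<in>elts A. \<forall>b\<in>elts A. le A a b \<and> le A b a \<longrightarrow> a = b) \<and>
     (\<forall>a\<in>elts A. \<forall>b\<in>elts A. \<forall>c. app A a b = Some c \<longrightarrow> c \<in> elts A) \<and>
     (\<forall>a\<in>elts A. \<forall>b\<in>elts A. \<forall>a'\<in>elts A. \<forall>b'\<in>elts A.
        le A a' a \<and> le A b' b \<longrightarrow> opreceq A (app A a' b') (app A a b))"

definition opca :: "'a opas \<Rightarrow> bool" where
  "opca A \<longleftrightarrow> opas A \<and>
     (\<exists>k\<in>elts A. \<exists>s\<in>elts A. \<forall>a\<in>elts A. \<forall>b\<in>elts A. \<forall>c\<in>elts A.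
        ole A (oapp A (app A k a) (Some b)) (Some a) \<and>
        oapp A (app A s a) (Some b) \<noteq> None \<and>
        opreceq A (oapp A (oapp A (app A s a) (Some b)) (Some c))
                  (oapp A (app A a c) (app A b c)))"

definition opca_morphism :: "'a opas \<Rightarrow> 'b opas \<Rightarrow> ('a \<Rightarrow> 'b) \<Rightarrow> bool" where
  "opca_morphism A B f \<longleftrightarrow> f ` elts A \<subseteq> elts B \<and>
     (\<exists>t\<in>elts B. \<forall>a\<in>elts A. \<forall>a'\<in>elts A.
        opreceq B (oapp B (app B t (f a)) (Some (f a'))) (map_option f (app A a a'))) \<and>
     (\<exists>u\<in>elts B. \<forall>a\<in>elts A. \<forall>a'\<in>elts A.
        le A a' a \<longrightarrow> ole B (app B u (f a')) (Some (f a)))"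

definition opca_morphism_le :: "'a opas \<Rightarrow> 'b opas \<Rightarrow> ('a \<Rightarrow> 'b) \<Rightarrow> ('a \<Rightarrow> 'b) \<Rightarrow> bool" where
  "opca_morphism_le A B f f' \<longleftrightarrow>
     (\<exists>s\<in>elts B. \<forall>a\<in>elts A. ole B (app B s (f a)) (Some (f' a)))"

definition opca_equivalent :: "'a opas \<Rightarrow> 'b opas \<Rightarrow> bool" where
  "opca_equivalent A B \<longleftrightarrow>
     (\<exists>f g. opca_morphism A B f \<and> opca_morphism B A g \<and>
        opca_morphism_le A A (g \<circ> f) id \<and> opca_morphism_le A A id (g \<circ> f) \<and>
        opca_morphism_le B B (f \<circ> g) id \<and> opca_morphism_le B B id (f \<circ> g))"

definition one_opca :: "unit opas" where
  "one_opca = \<lparr>elts = UNIV, le = (\<lambda>_ _. True), app = (\<lambda>_ _. Some ())\<rparr>"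

definition trivial_opca :: "'a opas \<Rightarrow> bool" where
  "trivial_opca A \<longleftrightarrow> opca_equivalent A one_opca"

definition downsets :: "'a opas \<Rightarrow> 'a set set" where
  "downsets A = {D. D \<subseteq> elts A \<and> D \<noteq> {} \<and> (\<forall>a\<in>D. \<forall>b\<in>elts A. le A b a \<longrightarrow> b \<in> D)}"


section \<open>Categories, functors and natural transformations\<close>

record ('o, 'm) cat =
  ob :: "'o set"
  arr :: "'m set"
  dom :: "'m \<Rightarrow> 'o"
  cod :: "'m \<Rightarrow> 'o"
  ident :: "'o \<Rightarrow> 'm"
  comp :: "'m \<Rightarrow> 'm \<Rightarrow> 'm"

text \<open>\<open>comp C g f\<close> is \<open>g\<close> after \<open>f\<close>.\<close>

definition hom :: "('o, 'm) cat \<Rightarrow> 'o \<Rightarrow> 'o \<Rightarrow> 'm set" where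
  "hom C X Y = {f \<in> arr C. dom C f = X \<and> cod C f = Y}"

definition category :: "('o, 'm) cat \<Rightarrow> bool" where
  "category C \<longleftrightarrow>
     (\<forall>f\<in>arr C. dom C f \<in> ob C \<and> cod C f \<in> ob C) \<and>
     (\<forall>X\<in>ob C. ident C X \<in> hom C X X) \<and>
     (\<forall>f\<in>arr C. \<forall>g\<in>arr C. cod C f = dom C g \<longrightarrow> comp C g f \<in> hom C (dom C f) (cod C g)) \<and>
     (\<forall>f\<in>arr C. comp C f (ident C (dom C f)) = f \<and> comp C (ident C (cod C f)) f = f) \<and>
     (\<forall>f\<in>arr C. \<forall>g\<in>arr C. \<forall>h\<in>arr C. cod C f = dom C g \<and> cod C g = dom C h \<longrightarrow>
        comp C h (comp C g f) = comp C (comp C h g) f)"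

definition iso_arr :: "('o, 'm) cat \<Rightarrow> 'm \<Rightarrow> bool" where
  "iso_arr C f \<longleftrightarrow> f \<in> arr C \<and>
     (\<exists>g \<in> hom C (cod C f) (dom C f).
        comp C g f = ident C (dom C f) \<and> comp C f g = ident C (cod C f))"

record ('o, 'm, 'p, 'n) func =
  fob :: "'o \<Rightarrow> 'p"
  far :: "'m \<Rightarrow> 'n"

definition is_functor :: "('o, 'm) cat \<Rightarrow> ('p, 'n) cat \<Rightarrow> ('o, 'm, 'p, 'n) func \<Rightarrow> bool" where
  "is_functor C D F \<longleftrightarrow>
     (\<forall>X\<in>ob C. fob F X \<in> ob D) \<and>
     (\<forall>f\<in>arr C. far F f \<in> hom D (fob F (dom C f)) (fob F (cod C f))) \<and>
     (\<forall>X\<in>ob C. far F (ident C X) = ident D (fob F X)) \<and>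
     (\<forall>f\<in>arr C. \<forall>g\<in>arr C. cod C f = dom C g \<longrightarrow>
        far F (comp C g f) = comp D (far F g) (far F f))"

definition id_func :: "('o, 'm, 'o, 'm) func" where
  "id_func = \<lparr>fob = id, far = id\<rparr>"

definition comp_func ::
    "('p, 'n, 'q, 'l) func \<Rightarrow> ('o, 'm, 'p, 'n) func \<Rightarrow> ('o, 'm, 'q, 'l) func" where
  "comp_func G F = \<lparr>fob = fob G \<circ> fob F, far = far G \<circ> far F\<rparr>"

definition nat_trans :: "('o, 'm) cat \<Rightarrow> ('p, 'n) cat \<Rightarrow>
    ('o, 'm, 'p, 'n) func \<Rightarrow> ('o, 'm, 'p, 'n) func \<Rightarrow> ('o \<Rightarrow> 'n) \<Rightarrow> bool" where
  "nat_trans C D F G \<tau> \<longleftrightarrow> \<tau> \<in> extensional (ob C) \<and>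
     (\<forall>X\<in>ob C. \<tau> X \<in> hom D (fob F X) (fob G X)) \<and>
     (\<forall>f\<in>arr C. comp D (\<tau> (cod C f)) (far F f) = comp D (far G f) (\<tau> (dom C f)))"

definition nat_iso :: "('o, 'm) cat \<Rightarrow> ('p, 'n) cat \<Rightarrow>
    ('o, 'm, 'p, 'n) func \<Rightarrow> ('o, 'm, 'p, 'n) func \<Rightarrow> ('o \<Rightarrow> 'n) \<Rightarrow> bool" where
  "nat_iso C D F G \<tau> \<longleftrightarrow> nat_trans C D F G \<tau> \<and> (\<forall>X\<in>ob C. iso_arr D (\<tau> X))"

definition equivalence_functor ::
    "('o, 'm) cat \<Rightarrow> ('p, 'n) cat \<Rightarrow> ('o, 'm, 'p, 'n) func \<Rightarrow> bool" where
  "equivalence_functor C D F \<longleftrightarrow> is_functor C D F \<and>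
     (\<exists>G. is_functor D C G \<and>
        (\<exists>\<eta>. nat_iso C C id_func (comp_func G F) \<eta>) \<and>
        (\<exists>\<epsilon>. nat_iso D D (comp_func F G) id_func \<epsilon>))"

definition equivalent_cats :: "('o, 'm) cat \<Rightarrow> ('p, 'n) cat \<Rightarrow> bool" where
  "equivalent_cats C D \<longleftrightarrow> (\<exists>F. equivalence_functor C D F)"

text \<open>\<open>adjoint C D L R\<close>: the functor \<open>L\<close> from \<open>C\<close> to \<open>D\<close> is left adjoint to \<open>R\<close>.\<close>

definition adjoint :: "('o, 'm) cat \<Rightarrow> ('p, 'n) cat \<Rightarrow>
    ('o, 'm, 'p, 'n) func \<Rightarrow> ('p, 'n, 'o, 'm) func \<Rightarrow> bool" where
  "adjoint C D L R \<longleftrightarrow>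
     (\<exists>\<eta> \<epsilon>. nat_trans C C id_func (comp_func R L) \<eta> \<and>
            nat_trans D D (comp_func L R) id_func \<epsilon> \<and>
            (\<forall>X\<in>ob C. comp D (\<epsilon> (fob L X)) (far L (\<eta> X)) = ident D (fob L X)) \<and>
            (\<forall>Y\<in>ob D. comp C (far R (\<epsilon> Y)) (\<eta> (fob R Y)) = ident C (fob R Y)))"


section \<open>Elementary toposes and geometric morphisms\<close>

definition is_terminal :: "('o, 'm) cat \<Rightarrow> 'o \<Rightarrow> bool" where
  "is_terminal C t \<longleftrightarrow> t \<in> ob C \<and> (\<forall>X\<in>ob C. \<exists>!f. f \<in> hom C X t)"

definition is_product :: "('o, 'm) cat \<Rightarrow> 'o \<Rightarrow> 'o \<Rightarrow> 'o \<Rightarrow> 'm \<Rightarrow> 'm \<Rightarrow> bool" where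
  "is_product C X Y P p q \<longleftrightarrow> p \<in> hom C P X \<and> q \<in> hom C P Y \<and>
     (\<forall>Z\<in>ob C. \<forall>f \<in> hom C Z X. \<forall>g \<in> hom C Z Y.
        \<exists>!h. h \<in> hom C Z P \<and> comp C p h = f \<and> comp C q h = g)"

text \<open>\<open>is_pullback C f g p q\<close>: the square \<open>f p = g q\<close> is a pullback.\<close>

definition is_pullback :: "('o, 'm) cat \<Rightarrow> 'm \<Rightarrow> 'm \<Rightarrow> 'm \<Rightarrow> 'm \<Rightarrow> bool" where
  "is_pullback C f g p q \<longleftrightarrow>
     f \<in> arr C \<and> g \<in> arr C \<and> cod C f = cod C g \<and>
     p \<in> hom C (dom C p) (dom C f) \<and> q \<in> hom C (dom C p) (dom C g) \<and>
     comp C f p = comp C g q \<and>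
     (\<forall>Z\<in>ob C. \<forall>a \<in> hom C Z (dom C f). \<forall>b \<in> hom C Z (dom C g).
        comp C f a = comp C g b \<longrightarrow>
        (\<exists>!h. h \<in> hom C Z (dom C p) \<and> comp C p h = a \<and> comp C q h = b))"

definition has_finite_limits :: "('o, 'm) cat \<Rightarrow> bool" where
  "has_finite_limits C \<longleftrightarrow> (\<exists>t. is_terminal C t) \<and>
     (\<forall>f\<in>arr C. \<forall>g\<in>arr C. cod C f = cod C g \<longrightarrow> (\<exists>p q. is_pullback C f g p q))"

definition preserves_finite_limits ::
    "('o, 'm) cat \<Rightarrow> ('p, 'n) cat \<Rightarrow> ('o, 'm, 'p, 'n) func \<Rightarrow> bool" where
  "preserves_finite_limits C D F \<longleftrightarrow>
     (\<forall>t. is_terminal C t \<longrightarrow> is_terminal D (fob F t)) \<and>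
     (\<forall>f g p q. is_pullback C f g p q \<longrightarrow>
        is_pullback D (far F f) (far F g) (far F p) (far F q))"

definition monic :: "('o, 'm) cat \<Rightarrow> 'm \<Rightarrow> bool" where
  "monic C m \<longleftrightarrow> m \<in> arr C \<and>
     (\<forall>Z\<in>ob C. \<forall>f \<in> hom C Z (dom C m). \<forall>g \<in> hom C Z (dom C m).
        comp C m f = comp C m g \<longrightarrow> f = g)"

text \<open>
  The evaluation is \<open>ev : P \<rightarrow> Y\<close>, where \<open>P\<close> is a product of the exponential \<open>E\<close> and \<open>X\<close>;
  \<open>u\<close> is the arrow \<open>k \<times> X\<close>.
\<close>

definition cartesian_closed :: "('o, 'm) cat \<Rightarrow> bool" where
  "cartesian_closed C \<longleftrightarrow>
     (\<exists>t. is_terminal C t) \<and>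
     (\<forall>X\<in>ob C. \<forall>Y\<in>ob C. \<exists>P p q. is_product C X Y P p q) \<and>
     (\<forall>X\<in>ob C. \<forall>Y\<in>ob C. \<exists>E P p q ev. E \<in> ob C \<and> is_product C E X P p q \<and> ev \<in> hom C P Y \<and>
        (\<forall>Z Q r s h. Z \<in> ob C \<and> is_product C Z X Q r s \<and> h \<in> hom C Q Y \<longrightarrow>
           (\<exists>!k. k \<in> hom C Z E \<and>
              (\<exists>u \<in> hom C Q P. comp C p u = comp C k r \<and> comp C q u = s \<and> comp C ev u = h))))"

definition has_subobject_classifier :: "('o, 'm) cat \<Rightarrow> bool" where
  "has_subobject_classifier C \<longleftrightarrow>
     (\<exists>t \<Omega> tr. is_terminal C t \<and> tr \<in> hom C t \<Omega> \<and>
        (\<forall>m. monic C m \<longrightarrow>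
           (\<exists>!\<chi>. \<chi> \<in> hom C (cod C m) \<Omega> \<and>
              (\<exists>u \<in> hom C (dom C m) t. is_pullback C \<chi> tr m u))))"

definition topos :: "('o, 'm) cat \<Rightarrow> bool" where
  "topos C \<longleftrightarrow>
     category C \<and> has_finite_limits C \<and> cartesian_closed C \<and> has_subobject_classifier C"

text \<open>
  A geometric morphism is given by its inverse and direct image functors; the adjunction is
  required to exist but is not part of the data. This does not change the 2-category up to
  biequivalence, as the 2-cells are the natural transformations between inverse images.
\<close>

record ('eo, 'em, 'fo, 'fm) geom =
  inverse_image :: "('fo, 'fm, 'eo, 'em) func"
  direct_image :: "('eo, 'em, 'fo, 'fm) func"

definition geometric_morphism ::
    "('eo, 'em) cat \<Rightarrow> ('fo, 'fm) cat \<Rightarrow> ('eo, 'em, 'fo, 'fm) geom \<Rightarrow> bool" where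
  "geometric_morphism E F f \<longleftrightarrow>
     is_functor F E (inverse_image f) \<and> is_functor E F (direct_image f) \<and>
     adjoint F E (inverse_image f) (direct_image f) \<and>
     preserves_finite_limits F E (inverse_image f)"

definition comp_geom :: "('fo, 'fm, 'go, 'gm) geom \<Rightarrow> ('eo, 'em, 'fo, 'fm) geom \<Rightarrow>
    ('eo, 'em, 'go, 'gm) geom" where
  "comp_geom g f =
     \<lparr>inverse_image = comp_func (inverse_image f) (inverse_image g),
      direct_image = comp_func (direct_image g) (direct_image f)\<rparr>"

definition geom_cat :: "('eo, 'em) cat \<Rightarrow> ('fo, 'fm) cat \<Rightarrow>
    (('eo, 'em, 'fo, 'fm) geom,
     ('eo, 'em, 'fo, 'fm) geom \<times> ('fo \<Rightarrow> 'em) \<times> ('eo, 'em, 'fo, 'fm) geom) cat" where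
  "geom_cat E F =
     \<lparr>ob = {f. geometric_morphism E F f},
      arr = {(f, \<alpha>, g). geometric_morphism E F f \<and> geometric_morphism E F g \<and>
               nat_trans F E (inverse_image f) (inverse_image g) \<alpha>},
      dom = (\<lambda>(f, \<alpha>, g). f),
      cod = (\<lambda>(f, \<alpha>, g). g),
      ident = (\<lambda>f. (f, \<lambda>X\<in>ob F. ident E (fob (inverse_image f) X), f)),
      comp = (\<lambda>(g, \<beta>, h) (f, \<alpha>, _). (f, \<lambda>X\<in>ob F. comp E (\<beta> X) (\<alpha> X), h))\<rparr>"


section \<open>Pseudopushouts of toposes\<close>

text \<open>
  The category of pseudococones under a span \<open>j0 : S \<rightarrow> E0\<close>, \<open>j1 : S \<rightarrow> E1\<close> with vertex \<open>T\<close>: its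
  objects are triples \<open>(g0, g1, \<theta>)\<close> with \<open>g0 : E0 \<rightarrow> T\<close>, \<open>g1 : E1 \<rightarrow> T\<close> and \<open>\<theta>\<close> an invertible
  2-cell from \<open>g0 j0\<close> to \<open>g1 j1\<close>; its arrows are pairs of 2-cells compatible with the \<open>\<theta>\<close>'s.
\<close>

definition cocone_cat ::
    "('so, 'sm) cat \<Rightarrow> ('ao, 'am) cat \<Rightarrow> ('bo, 'bm) cat \<Rightarrow>
     ('so, 'sm, 'ao, 'am) geom \<Rightarrow> ('so, 'sm, 'bo, 'bm) geom \<Rightarrow> ('to, 'tm) cat \<Rightarrow>
     (('ao, 'am, 'to, 'tm) geom \<times> ('bo, 'bm, 'to, 'tm) geom \<times> ('to \<Rightarrow> 'sm),
      (('ao, 'am, 'to, 'tm) geom \<times> ('bo, 'bm, 'to, 'tm) geom \<times> ('to \<Rightarrow> 'sm)) \<times>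
      (('to \<Rightarrow> 'am) \<times> ('to \<Rightarrow> 'bm)) \<times>
      (('ao, 'am, 'to, 'tm) geom \<times> ('bo, 'bm, 'to, 'tm) geom \<times> ('to \<Rightarrow> 'sm))) cat" where
  "cocone_cat S E0 E1 j0 j1 T =
     (let Ob = {(g0, g1, \<theta>). geometric_morphism E0 T g0 \<and> geometric_morphism E1 T g1 \<and>
                 nat_iso T S (inverse_image (comp_geom g0 j0)) (inverse_image (comp_geom g1 j1)) \<theta>}
      in \<lparr>ob = Ob,
          arr = {((g0, g1, \<theta>), (\<alpha>0, \<alpha>1), (h0, h1, \<kappa>)).
                   (g0, g1, \<theta>) \<in> Ob \<and> (h0, h1, \<kappa>) \<in> Ob \<and>
                   nat_trans T E0 (inverse_image g0) (inverse_image h0) \<alpha>0 \<and>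
                   nat_trans T E1 (inverse_image g1) (inverse_image h1) \<alpha>1 \<and>
                   (\<forall>X\<in>ob T. comp S (\<kappa> X) (far (inverse_image j0) (\<alpha>0 X)) =
                             comp S (far (inverse_image j1) (\<alpha>1 X)) (\<theta> X))},
          dom = (\<lambda>(P, \<alpha>, Q). P),
          cod = (\<lambda>(P, \<alpha>, Q). Q),
          ident = (\<lambda>(g0, g1, \<theta>). ((g0, g1, \<theta>),
                     (\<lambda>X\<in>ob T. ident E0 (fob (inverse_image g0) X),
                      \<lambda>X\<in>ob T. ident E1 (fob (inverse_image g1) X)), (g0, g1, \<theta>))),
          comp = (\<lambda>(Q, (\<beta>0, \<beta>1), W) (P, (\<alpha>0, \<alpha>1), _).
                     (P, (\<lambda>X\<in>ob T. comp E0 (\<beta>0 X) (\<alpha>0 X), \<lambda>X\<in>ob T. comp E1 (\<beta>1 X) (\<alpha>1 X)), W))\<rparr>)"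

text \<open>Composition with a given pseudococone \<open>(i0, i1, \<phi>)\<close> with vertex \<open>E\<close>.\<close>

definition cocone_of ::
    "('ao, 'am, 'eo, 'em) geom \<Rightarrow> ('bo, 'bm, 'eo, 'em) geom \<Rightarrow> ('eo \<Rightarrow> 'sm) \<Rightarrow>
     ('to, 'tm) cat \<Rightarrow> ('eo, 'em, 'to, 'tm) geom \<Rightarrow>
     ('ao, 'am, 'to, 'tm) geom \<times> ('bo, 'bm, 'to, 'tm) geom \<times> ('to \<Rightarrow> 'sm)" where
  "cocone_of i0 i1 \<phi> T h =
     (comp_geom h i0, comp_geom h i1, \<lambda>X\<in>ob T. \<phi> (fob (inverse_image h) X))"

definition comparison_functor ::
    "('ao, 'am, 'eo, 'em) geom \<Rightarrow> ('bo, 'bm, 'eo, 'em) geom \<Rightarrow> ('eo \<Rightarrow> 'sm) \<Rightarrow>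
     ('to, 'tm) cat \<Rightarrow>
     (('eo, 'em, 'to, 'tm) geom,
      ('eo, 'em, 'to, 'tm) geom \<times> ('to \<Rightarrow> 'em) \<times> ('eo, 'em, 'to, 'tm) geom,
      ('ao, 'am, 'to, 'tm) geom \<times> ('bo, 'bm, 'to, 'tm) geom \<times> ('to \<Rightarrow> 'sm),
      (('ao, 'am, 'to, 'tm) geom \<times> ('bo, 'bm, 'to, 'tm) geom \<times> ('to \<Rightarrow> 'sm)) \<times>
      (('to \<Rightarrow> 'am) \<times> ('to \<Rightarrow> 'bm)) \<times>
      (('ao, 'am, 'to, 'tm) geom \<times> ('bo, 'bm, 'to, 'tm) geom \<times> ('to \<Rightarrow> 'sm))) func" where
  "comparison_functor i0 i1 \<phi> T =
     \<lparr>fob = cocone_of i0 i1 \<phi> T,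
      far = (\<lambda>(h, \<alpha>, h'). (cocone_of i0 i1 \<phi> T h,
               (\<lambda>X\<in>ob T. far (inverse_image i0) (\<alpha> X), \<lambda>X\<in>ob T. far (inverse_image i1) (\<alpha> X)),
               cocone_of i0 i1 \<phi> T h'))\<rparr>"

text \<open>
  The universal property is tested against all toposes \<open>T\<close> whose collections of objects and of
  arrows are classes, that is, subsets of the universe. Up to isomorphism this covers all toposes
  with at most as many objects and arrows as there are elements of the universe, in particular
  the category of sets, all realizability toposes, and pseudopushouts of these.
\<close>

definition pseudopushout ::
    "'u itself \<Rightarrow> ('so, 'sm) cat \<Rightarrow> ('ao, 'am) cat \<Rightarrow> ('bo, 'bm) cat \<Rightarrow>
     ('so, 'sm, 'ao, 'am) geom \<Rightarrow> ('so, 'sm, 'bo, 'bm) geom \<Rightarrow>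
     ('eo, 'em) cat \<Rightarrow> ('ao, 'am, 'eo, 'em) geom \<Rightarrow> ('bo, 'bm, 'eo, 'em) geom \<Rightarrow>
     ('eo \<Rightarrow> 'sm) \<Rightarrow> bool" where
  "pseudopushout U S E0 E1 j0 j1 E i0 i1 \<phi> \<longleftrightarrow>
     topos S \<and> topos E0 \<and> topos E1 \<and> topos E \<and>
     geometric_morphism S E0 j0 \<and> geometric_morphism S E1 j1 \<and>
     geometric_morphism E0 E i0 \<and> geometric_morphism E1 E i1 \<and>
     nat_iso E S (inverse_image (comp_geom i0 j0)) (inverse_image (comp_geom i1 j1)) \<phi> \<and>
     (\<forall>T :: ('u, 'u) cat. topos T \<longrightarrow>
        equivalence_functor (geom_cat E T) (cocone_cat S E0 E1 j0 j1 T)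
          (comparison_functor i0 i1 \<phi> T))"


section \<open>The ex/reg completion of a regular category\<close>

definition regular_epi :: "('o, 'm) cat \<Rightarrow> 'm \<Rightarrow> bool" where
  "regular_epi C e \<longleftrightarrow> e \<in> arr C \<and>
     (\<exists>Z\<in>ob C. \<exists>a \<in> hom C Z (dom C e). \<exists>b \<in> hom C Z (dom C e). comp C e a = comp C e b \<and>
        (\<forall>W\<in>ob C. \<forall>h \<in> hom C (dom C e) W. comp C h a = comp C h b \<longrightarrow>
           (\<exists>!k. k \<in> hom C (cod C e) W \<and> comp C k e = h)))"

text \<open>
  A relation from \<open>X\<close> to \<open>Y\<close>, i.e. a subobject of \<open>X \<times> Y\<close>, is represented by a jointly monic
  span \<open>(a, b)\<close>. To have equality of subobjects as equality, it is encoded as the set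
  of all pairs of generalized elements \<open>(f, g) : Z \<rightarrow> X \<times> Y\<close> that factor through \<open>(a, b)\<close>.
\<close>

definition jointly_monic :: "('o, 'm) cat \<Rightarrow> 'm \<Rightarrow> 'm \<Rightarrow> bool" where
  "jointly_monic C a b \<longleftrightarrow> a \<in> arr C \<and> b \<in> arr C \<and> dom C a = dom C b \<and>
     (\<forall>Z\<in>ob C. \<forall>f \<in> hom C Z (dom C a). \<forall>g \<in> hom C Z (dom C a).
        comp C a f = comp C a g \<and> comp C b f = comp C b g \<longrightarrow> f = g)"

definition span_relation :: "('o, 'm) cat \<Rightarrow> 'm \<Rightarrow> 'm \<Rightarrow> ('m \<times> 'm) set" where
  "span_relation C a b = {(comp C a h, comp C b h) | h. h \<in> arr C \<and> cod C h = dom C a}"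

definition relations :: "('o, 'm) cat \<Rightarrow> 'o \<Rightarrow> 'o \<Rightarrow> ('m \<times> 'm) set set" where
  "relations C X Y =
     {span_relation C a b | a b. jointly_monic C a b \<and> cod C a = X \<and> cod C b = Y}"

text \<open>
  The composite of relations in a regular category is the image of their pullback. A generalized
  element factors through an image if and only if it lifts along some regular epimorphism.
\<close>

definition rel_comp ::
    "('o, 'm) cat \<Rightarrow> ('m \<times> 'm) set \<Rightarrow> ('m \<times> 'm) set \<Rightarrow> ('m \<times> 'm) set" where
  "rel_comp C R S = {(f, g). f \<in> arr C \<and> g \<in> arr C \<and> dom C f = dom C g \<and>
     (\<exists>e m. regular_epi C e \<and> cod C e = dom C f \<and>
        (comp C f e, m) \<in> R \<and> (m, comp C g e) \<in> S)}"

text \<open>An internal relation is an equivalence relation if it is one on generalized elements.\<close>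

definition internal_equiv :: "('o, 'm) cat \<Rightarrow> 'o \<Rightarrow> ('m \<times> 'm) set \<Rightarrow> bool" where
  "internal_equiv C X R \<longleftrightarrow>
     R \<in> relations C X X \<and> equiv {f \<in> arr C. cod C f = X} R"

definition functional_relation :: "('o, 'm) cat \<Rightarrow> 'o \<times> ('m \<times> 'm) set \<Rightarrow>
    'o \<times> ('m \<times> 'm) set \<Rightarrow> ('m \<times> 'm) set \<Rightarrow> bool" where
  "functional_relation C = (\<lambda>(X, R) (Y, S) F.
     F \<in> relations C X Y \<and> rel_comp C R F = F \<and> rel_comp C F S = F \<and>
     R \<subseteq> rel_comp C F (F\<inverse>) \<and> rel_comp C (F\<inverse>) F \<subseteq> S)"

definition ex_reg :: "('o, 'm) cat \<Rightarrow>
    ('o \<times> ('m \<times> 'm) set,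
     ('o \<times> ('m \<times> 'm) set) \<times> ('m \<times> 'm) set \<times> ('o \<times> ('m \<times> 'm) set)) cat" where
  "ex_reg C =
     (let Ob = {(X, R). X \<in> ob C \<and> internal_equiv C X R}
      in \<lparr>ob = Ob,
          arr = {(P, F, Q). P \<in> Ob \<and> Q \<in> Ob \<and> functional_relation C P Q F},
          dom = (\<lambda>(P, F, Q). P),
          cod = (\<lambda>(P, F, Q). Q),
          ident = (\<lambda>P. (P, snd P, P)),
          comp = (\<lambda>(Q, G, W) (P, F, _). (P, rel_comp C F G, W))\<rparr>)"

definition ex_reg_embedding :: "('o, 'm) cat \<Rightarrow>
    ('o, 'm, 'o \<times> ('m \<times> 'm) set,
     ('o \<times> ('m \<times> 'm) set) \<times> ('m \<times> 'm) set \<times> ('o \<times> ('m \<times> 'm) set)) func" where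
  "ex_reg_embedding C =
     (let y = (\<lambda>X. (X, {(g, g) | g. g \<in> arr C \<and> cod C g = X}))
      in \<lparr>fob = y,
          far = (\<lambda>f. (y (dom C f), {(g, comp C f g) | g. g \<in> arr C \<and> cod C g = dom C f},
                      y (cod C f)))\<rparr>)"


section \<open>Sets, assemblies and realizability toposes\<close>

text \<open>Categories of sets with structure: \<open>U P\<close> is the underlying set of \<open>P\<close>, and
  \<open>H P Q\<close> is the set of functions that are arrows from \<open>P\<close> to \<open>Q\<close>.\<close>

definition concrete_cat ::
    "'p set \<Rightarrow> ('p \<Rightarrow> 'u set) \<Rightarrow> ('p \<Rightarrow> 'p \<Rightarrow> ('u \<Rightarrow> 'u) set) \<Rightarrow>
     ('p, 'p \<times> ('u \<Rightarrow> 'u) \<times> 'p) cat" where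
  "concrete_cat Ob U H =
     \<lparr>ob = Ob,
      arr = {(P, f, Q). P \<in> Ob \<and> Q \<in> Ob \<and> f \<in> H P Q},
      dom = (\<lambda>(P, f, Q). P),
      cod = (\<lambda>(P, f, Q). Q),
      ident = (\<lambda>P. (P, \<lambda>x\<in>U P. x, P)),
      comp = (\<lambda>(Q, g, W) (P, f, _). (P, compose (U P) g f, W))\<rparr>"

type_synonym 'u set_arr = "'u set \<times> ('u \<Rightarrow> 'u) \<times> 'u set"

definition Set_cat :: "('u set, 'u set_arr) cat" where
  "Set_cat = concrete_cat {X. small TYPE('u) X} id (\<lambda>X Y. X \<rightarrow>\<^sub>E Y)"

type_synonym ('u, 'a) asm = "'u set \<times> ('u \<Rightarrow> 'a set)"
type_synonym ('u, 'a) asm_arr = "('u, 'a) asm \<times> ('u \<Rightarrow> 'u) \<times> ('u, 'a) asm"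

definition asm_hom :: "'a opas \<Rightarrow> ('u, 'a) asm \<Rightarrow> ('u, 'a) asm \<Rightarrow> ('u \<Rightarrow> 'u) set" where
  "asm_hom A P Q = {f \<in> fst P \<rightarrow>\<^sub>E fst Q.
     \<exists>r\<in>elts A. \<forall>x \<in> fst P. \<forall>a \<in> snd P x. \<exists>b. app A r a = Some b \<and> b \<in> snd Q (f x)}"

definition Asm :: "'a opas \<Rightarrow> (('u, 'a) asm, ('u, 'a) asm_arr) cat" where
  "Asm A = concrete_cat {(X, E). small TYPE('u) X \<and> E \<in> X \<rightarrow>\<^sub>E downsets A} fst (asm_hom A)"

definition Nabla :: "'a opas \<Rightarrow> ('u set, 'u set_arr, ('u, 'a) asm, ('u, 'a) asm_arr) func" where
  "Nabla A =
     (let N = (\<lambda>Y. (Y, \<lambda>y\<in>Y. elts A))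
      in \<lparr>fob = N, far = (\<lambda>(X, f, Y). (N X, f, N Y))\<rparr>)"

definition Gamma :: "(('u, 'a) asm, ('u, 'a) asm_arr, 'u set, 'u set_arr) func" where
  "Gamma = \<lparr>fob = fst, far = (\<lambda>(P, f, Q). (fst P, f, fst Q))\<rparr>"

type_synonym ('u, 'a) rt_ob = "('u, 'a) asm \<times> (('u, 'a) asm_arr \<times> ('u, 'a) asm_arr) set"
type_synonym ('u, 'a) rt_arr =
  "('u, 'a) rt_ob \<times> (('u, 'a) asm_arr \<times> ('u, 'a) asm_arr) set \<times> ('u, 'a) rt_ob"

definition RT :: "'a opas \<Rightarrow> (('u, 'a) rt_ob, ('u, 'a) rt_arr) cat" where
  "RT A = ex_reg (Asm A)"

text \<open>
  The extension of \<open>\<Gamma>\<close> to the ex/reg completion sends \<open>(X, R)\<close> to the quotient of \<open>\<Gamma> X\<close> by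
  \<open>\<Gamma> R\<close>, which is realized as a subset of \<open>\<Gamma> X\<close> by a choice of representatives.
\<close>

definition Gamma_rel :: "(('u, 'a) asm_arr \<times> ('u, 'a) asm_arr) set \<Rightarrow> ('u \<times> 'u) set" where
  "Gamma_rel R = {(f z, g z) | P Q Q' f g z. ((P, f, Q), (P, g, Q')) \<in> R \<and> z \<in> fst P}"

definition Gamma_repr :: "('u, 'a) rt_ob \<Rightarrow> 'u \<Rightarrow> 'u" where
  "Gamma_repr P x = (SOME x'. (x, x') \<in> Gamma_rel (snd P))"

definition Gamma_hat :: "(('u, 'a) rt_ob, ('u, 'a) rt_arr, 'u set, 'u set_arr) func" where
  "Gamma_hat =
     (let G = (\<lambda>P. Gamma_repr P ` fob Gamma (fst P))
      in \<lparr>fob = G,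
          far = (\<lambda>(P, F, Q).
                   (G P, \<lambda>x\<in>G P. Gamma_repr Q (SOME y. (x, y) \<in> Gamma_rel F), G Q))\<rparr>)"

definition Set_inclusion ::
    "'a opas \<Rightarrow> ('u set, 'u set_arr, ('u, 'a) rt_ob, ('u, 'a) rt_arr) geom" where
  "Set_inclusion A =
     \<lparr>inverse_image = Gamma_hat,
      direct_image = comp_func (ex_reg_embedding (Asm A)) (Nabla A)\<rparr>"

definition pseudocoproduct ::
    "'u itself \<Rightarrow> 'a opas \<Rightarrow> 'b opas \<Rightarrow> ('eo, 'em) cat \<Rightarrow>
     (('u, 'a) rt_ob, ('u, 'a) rt_arr, 'eo, 'em) geom \<Rightarrow>
     (('u, 'b) rt_ob, ('u, 'b) rt_arr, 'eo, 'em) geom \<Rightarrow>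
     ('eo \<Rightarrow> 'u set_arr) \<Rightarrow> bool" where
  "pseudocoproduct U A0 A1 E i0 i1 \<phi> \<longleftrightarrow>
     pseudopushout U (Set_cat :: ('u set, 'u set_arr) cat) (RT A0) (RT A1)
       (Set_inclusion A0) (Set_inclusion A1) E i0 i1 \<phi>"

definition realizability_topos :: "'u itself \<Rightarrow> 'c opas \<Rightarrow> ('eo, 'em) cat \<Rightarrow> bool" where
  "realizability_topos U C E \<longleftrightarrow> opca C \<and> small U (elts C) \<and>
     equivalent_cats E (RT C :: (('u, 'c) rt_ob, ('u, 'c) rt_arr) cat)"

end

theory Submission
 imports Defs
begin

text \<open>
 Let \<open>P\<close> be the pseudopullback of the two functors \<open>Gamma_hat\<close>: its objects are triples of an object
 of each realizability topos and a bijection between their underlying sets. It is a topos, and its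
 projections are inverse images of geometric morphisms (\<open>glue_topos\<close>, \<open>pr0_universal\<close>,
 \<open>pr1_universal\<close>), so the universal property of the pseudopushout \<open>E\<close> applies to it. If \<open>E\<close> is
 equivalent to \<open>RT C\<close>, this gives a functor \<open>H\<close> from \<open>P\<close> to \<open>RT C\<close> that preserves the terminal object and
 extremal epimorphisms, and a functor \<open>k\<close> back with \<open>k H\<close> isomorphic to the identity
 (\<open>comparison_retract\<close>). It remains to see that constant objects, which are projective
 in \<open>RT C\<close>, are then projective in \<open>P\<close>, and that this forces one of the algebras to have a least element.

 In a realizability topos the constant objects \<open>\<nabla>S\<close> are projective, and a point \<open>\<nabla>1 \<rightarrow> Q\<close> has a colour,
 one of its realizers, such that any small family of points of one colour is a single arrow
 \<open>\<nabla>S \<rightarrow> Q\<close> (\<open>colouring\<close>). The points of \<open>P\<close> are coloured in the same way by pairs of realizers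
 (\<open>glue_colourable\<close>). So there are only small sets of colours on both sides, and they allow to
 transport the projectivity of constant objects from \<open>RT C\<close> to \<open>P\<close> (\<open>constants_projective\<close>).
 The difficulty is that \<open>H\<close> need not send constant objects to constant objects, so that a family of
 points of the constant object on \<open>S\<close> need not become an arrow in \<open>RT C\<close>. One replaces \<open>S\<close> by the set of
 all functions from the set \<open>K\<close> of colours to \<open>S\<close>. These functions are the points of a constant object and
 hence coloured, and a diagonal argument finds a colour \<open>\<kappa>\<close> such that the functions of
 colour \<open>\<kappa>\<close> take all values at \<open>\<kappa>\<close> (\<open>diagonal_value\<close>). Choosing one function for each
 value embeds \<open>S\<close> in a set of points of one colour, with evaluation at \<open>\<kappa>\<close> as a retraction.

 On the other hand, let \<open>S\<close> be the set of pairs \<open>(a0, a1)\<close> of elements of the two algebras, and consider the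
 object of \<open>P\<close> on the set of all \<open>(a0, a1, b)\<close> with \<open>b\<close> a bit, where on the left the triples with
 bit \<open>1\<close> have the elements below \<open>a0\<close> as their realizers, on the right those with bit \<open>0\<close> have the elements
 below \<open>a1\<close>, and everything else is realized by all elements. Its projection to the constant object
 on \<open>S\<close> has a section on each side, though not one with the same underlying function, which makes it
 extremal in \<open>P\<close> (\<open>glue_extremal\<close>). As constant objects are projective, there is also a
 section in \<open>P\<close>: a choice of bits, with one realizer \<open>d0\<close> on the left and one realizer \<open>d1\<close> on the right.
 Then \<open>d0\<close> is below \<open>a0\<close> or \<open>d1\<close> is below \<open>a1\<close>, for all \<open>a0\<close> and \<open>a1\<close>; so \<open>d0\<close> or \<open>d1\<close> is a
 least element (\<open>least_element_of_splitting\<close>).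
\<close>

section \<open>Elementary category theory\<close>

abbreviation comp_in ("(_ o[_] _)" [71, 0, 70] 70) where "g o[C] f \<equiv> comp C g f"

lemma category_ob:
 assumes "category C" "f \<in> hom C X Y"
 shows "X \<in> ob C" "Y \<in> ob C"
 using assms by (auto simp: category_def hom_def)

lemma comp_hom:
 assumes "category C" "f \<in> hom C X Y" "g \<in> hom C Y Z"
 shows "g o[C] f \<in> hom C X Z"
 using assms by (auto simp: category_def hom_def)

lemma ident_hom: "category C ==> X \<in> ob C ==> ident C X \<in> hom C X X"
 by (auto simp: category_def)

lemma comp_ident:
 assumes "category C" "f \<in> hom C X Y"
 shows "f o[C] ident C X = f" "ident C Y o[C] f = f"
 using assms by (auto simp: category_def hom_def)

lemma comp_assoc:
 assumes "category C" "f \<in> hom C W X" "g \<in> hom C X Y" "h \<in> hom C Y Z"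
 shows "(h o[C] g) o[C] f = h o[C] (g o[C] f)"
 using assms by (auto simp: category_def hom_def)

lemma homI: "f \<in> arr C ==> f \<in> hom C (dom C f) (cod C f)"
 by (simp add: hom_def)

lemma functor_ob: "is_functor C D F ==> X \<in> ob C ==> fob F X \<in> ob D"
 by (simp add: is_functor_def)

lemma functor_hom:
 assumes "is_functor C D F" "f \<in> hom C X Y"
 shows "far F f \<in> hom D (fob F X) (fob F Y)"
 using assms by (auto simp: is_functor_def hom_def)

lemma functor_ident: "is_functor C D F ==> X \<in> ob C ==> far F (ident C X) = ident D (fob F X)"
 by (simp add: is_functor_def)

lemma functor_comp:
 assumes "is_functor C D F" "f \<in> hom C X Y" "g \<in> hom C Y Z"
 shows "far F (g o[C] f) = far F g o[D] far F f"
 using assms by (auto simp: is_functor_def hom_def)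

lemma is_functor_comp_func:
 assumes "is_functor C D F" "is_functor D E G"
 shows "is_functor C E (comp_func G F)"
 unfolding is_functor_def comp_func_def
proof (simp, intro conjI ballI impI)
 fix X assume "X \<in> ob C" then show "fob G (fob F X) \<in> ob E" using assms by (simp add: functor_ob)
next
 fix f assume "f \<in> arr C"
 then show "far G (far F f) \<in> hom E (fob G (fob F (dom C f))) (fob G (fob F (cod C f)))"
  using assms homI functor_hom by metis
next
 fix X assume "X \<in> ob C"
 then show "far G (far F (ident C X)) = ident E (fob G (fob F X))"
  using assms by (simp add: functor_ob functor_ident)
next
 fix f g assume fg: "f \<in> arr C" "g \<in> arr C" "cod C f = dom C g"
 then have "f \<in> hom C (dom C f) (cod C f)" "g \<in> hom C (cod C f) (cod C g)"
  by (auto simp: hom_def)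
 then show "far G (far F (g o[C] f)) = far G (far F g) o[E] far G (far F f)"
  using assms functor_hom functor_comp by metis
qed

lemma comp_func_simps [simp]:
 "fob (comp_func G F) X = fob G (fob F X)"
 "far (comp_func G F) f = far G (far F f)"
 "fob id_func X = X" "far id_func f = f"
 by (simp_all add: comp_func_def id_func_def)

lemma iso_arrE:
 assumes "iso_arr C f" "f \<in> hom C X Y"
 obtains g where "g \<in> hom C Y X" "g o[C] f = ident C X" "f o[C] g = ident C Y"
 using assms by (auto simp: iso_arr_def hom_def)

lemma iso_arrI:
 assumes "f \<in> hom C X Y" "g \<in> hom C Y X" "g o[C] f = ident C X" "f o[C] g = ident C Y"
 shows "iso_arr C f"
 using assms by (auto simp: iso_arr_def hom_def)

lemma iso_inverse:
 assumes "f \<in> hom C X Y" "g \<in> hom C Y X" "g o[C] f = ident C X" "f o[C] g = ident C Y"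
 shows "iso_arr C g"
 using assms by (auto simp: iso_arr_def hom_def)

lemma cancel_left:
 assumes C: "category C" and "f \<in> hom C X Y" "g \<in> hom C Y X" "g o[C] f = ident C X" and h: "h \<in> hom C W X"
 shows "g o[C] (f o[C] h) = h"
 using assms comp_assoc[OF C h assms(2,3)] comp_ident[OF C h] by simp

lemma cancel_right:
 assumes C: "category C" and "f \<in> hom C X Y" "g \<in> hom C Y X" "g o[C] f = ident C X" and h: "h \<in> hom C X W"
 shows "(h o[C] g) o[C] f = h"
 using assms comp_assoc[OF C assms(2,3) h] comp_ident[OF C h] by simp

lemma iso_comp:
 assumes C: "category C" and f: "f \<in> hom C X Y" "iso_arr C f" and g: "g \<in> hom C Y Z" "iso_arr C g"
 shows "iso_arr C (g o[C] f)"
proof -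
 obtain f' where f': "f' \<in> hom C Y X" "f' o[C] f = ident C X" "f o[C] f' = ident C Y"
  using iso_arrE f by metis
 obtain g' where g': "g' \<in> hom C Z Y" "g' o[C] g = ident C Y" "g o[C] g' = ident C Z"
  using iso_arrE g by metis
 have "(f' o[C] g') o[C] (g o[C] f) = ident C X"
  using cancel_left[OF C g(1) g'(1,2) f(1)] comp_assoc[OF C comp_hom[OF C f(1) g(1)] g'(1) f'(1)] f'(2) by simp
 moreover have "(g o[C] f) o[C] (f' o[C] g') = ident C Z"
  using cancel_left[OF C f'(1) f(1) f'(3) g'(1)] comp_assoc[OF C comp_hom[OF C g'(1) f'(1)] f(1) g(1)] g'(3) by simp
 ultimately show ?thesis
  using iso_arrI comp_hom[OF C] f(1) g(1) f'(1) g'(1) by metis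
qed

lemma iso_ident: "category C ==> X \<in> ob C ==> iso_arr C (ident C X)"
 using iso_arrI ident_hom comp_ident by metis

lemma functor_iso:
 assumes F: "is_functor C D F" and C: "category C" and f: "f \<in> hom C X Y" "iso_arr C f"
 shows "iso_arr D (far F f)"
proof -
 obtain g where g: "g \<in> hom C Y X" "g o[C] f = ident C X" "f o[C] g = ident C Y"
  using f iso_arrE by metis
 show ?thesis
  using functor_hom[OF F f(1)] functor_hom[OF F g(1)] functor_comp[OF F f(1) g(1)]
   functor_comp[OF F g(1) f(1)] g functor_ident[OF F] category_ob[OF C f(1)]
  by (metis iso_arrI)
qed

lemma monicD:
 assumes "monic C m" "m \<in> hom C X Y" "category C" "f \<in> hom C Z X" "g \<in> hom C Z X" "m o[C] f = m o[C] g"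
 shows "f = g"
 using assms category_ob(1)[OF assms(3,4)] by (auto simp: monic_def hom_def)

subsection \<open>Pullbacks and products\<close>

lemma pullbackD:
 assumes "is_pullback C f g p q" "f \<in> hom C X Z" "g \<in> hom C Y Z"
 shows "p \<in> hom C (dom C p) X" "q \<in> hom C (dom C p) Y" "f o[C] p = g o[C] q"
 using assms by (auto simp: is_pullback_def hom_def)

lemma pullback_ex1:
 assumes "is_pullback C f g p q" "f \<in> hom C X Z" "g \<in> hom C Y Z" "category C"
  and "a \<in> hom C V X" "b \<in> hom C V Y" "f o[C] a = g o[C] b"
 shows "\<exists>!h. h \<in> hom C V (dom C p) \<and> p o[C] h = a \<and> q o[C] h = b"
 using assms category_ob(1)[OF assms(4,5)] unfolding is_pullback_def by (auto simp: hom_def)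

lemma pullback_eqI:
 assumes pb: "is_pullback C f g p q" and fg: "f \<in> hom C X Z" "g \<in> hom C Y Z" and C: "category C"
  and h: "h \<in> hom C V (dom C p)" and k: "k \<in> hom C V (dom C p)"
  and "p o[C] h = p o[C] k" "q o[C] h = q o[C] k"
 shows "h = k"
proof -
 note d = pullbackD[OF pb fg]
 have "f o[C] (p o[C] k) = g o[C] (q o[C] k)"
  using comp_assoc[OF C k d(1) fg(1)] comp_assoc[OF C k d(2) fg(2)] d(3) by simp
 then show ?thesis
  using pullback_ex1[OF pb fg C comp_hom[OF C k d(1)] comp_hom[OF C k d(2)]] assms by blast
qed

lemma pullbackI:
 assumes "f \<in> hom C X Z" "g \<in> hom C Y Z" "p \<in> hom C P X" "q \<in> hom C P Y" "f o[C] p = g o[C] q"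
  and "\<And>V a b. V \<in> ob C ==> a \<in> hom C V X ==> b \<in> hom C V Y ==> f o[C] a = g o[C] b ==>
   \<exists>!h. h \<in> hom C V P \<and> p o[C] h = a \<and> q o[C] h = b"
 shows "is_pullback C f g p q"
proof -
 have "dom C f = X" "dom C g = Y" "dom C p = P" "f \<in> arr C" "g \<in> arr C" "cod C f = cod C g"
  using assms(1-4) by (auto simp: hom_def)
 then show ?thesis unfolding is_pullback_def using assms by simp
qed

text \<open>Variant of \<open>pullbackI\<close> in which uniqueness is left as joint monicity.\<close>

lemma pullbackI':
 assumes "f \<in> hom C X Z" "g \<in> hom C Y Z" "p \<in> hom C P X" "q \<in> hom C P Y" "f o[C] p = g o[C] q"
  and "\<And>V a b. V \<in> ob C ==> a \<in> hom C V X ==> b \<in> hom C V Y ==> f o[C] a = g o[C] b ==>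
   \<exists>h. h \<in> hom C V P \<and> p o[C] h = a \<and> q o[C] h = b"
  and "\<And>V h k. V \<in> ob C ==> h \<in> hom C V P ==> k \<in> hom C V P ==> p o[C] h = p o[C] k ==>
   q o[C] h = q o[C] k ==> h = k"
 shows "is_pullback C f g p q"
proof (rule pullbackI[OF assms(1-5)])
 fix V a b assume *: "V \<in> ob C" "a \<in> hom C V X" "b \<in> hom C V Y" "f o[C] a = g o[C] b"
 obtain h where h: "h \<in> hom C V P" "p o[C] h = a" "q o[C] h = b" using assms(6)[OF *] by blast
 have "\<And>k. k \<in> hom C V P ==> p o[C] k = a ==> q o[C] k = b ==> k = h"
  using assms(7)[OF *(1)] h by simp
 with h show "\<exists>!h. h \<in> hom C V P \<and> p o[C] h = a \<and> q o[C] h = b" by blast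
qed

lemma pullback_unique:
 assumes C: "category C" and fg: "f \<in> hom C X Z" "g \<in> hom C Y Z"
  and pb: "is_pullback C f g p q" and pb': "is_pullback C f g p' q'"
 obtains i where "i \<in> hom C (dom C p') (dom C p)" "iso_arr C i" "p o[C] i = p'" "q o[C] i = q'"
proof -
 note d = pullbackD[OF pb fg] and d' = pullbackD[OF pb' fg]
 obtain i where i: "i \<in> hom C (dom C p') (dom C p)" "p o[C] i = p'" "q o[C] i = q'"
  using pullback_ex1[OF pb fg C d'] by blast
 obtain k where k: "k \<in> hom C (dom C p) (dom C p')" "p' o[C] k = p" "q' o[C] k = q"
  using pullback_ex1[OF pb' fg C d] by blast
 have obs: "dom C p' \<in> ob C" "dom C p \<in> ob C" using category_ob[OF C i(1)] by auto
 have "k o[C] i = ident C (dom C p')"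
  by (rule pullback_eqI[OF pb' fg C comp_hom[OF C i(1) k(1)] ident_hom[OF C obs(1)]])
   (use i k d' comp_ident[OF C] comp_assoc[OF C i(1) k(1)] in \<open>simp_all\<close>, (metis)+)
 moreover have "i o[C] k = ident C (dom C p)"
  by (rule pullback_eqI[OF pb fg C comp_hom[OF C k(1) i(1)] ident_hom[OF C obs(2)]])
   (use i k d comp_ident[OF C] comp_assoc[OF C k(1) i(1)] in \<open>simp_all\<close>, (metis)+)
 ultimately show thesis using that i k iso_arrI by metis
qed

lemma pullback_iso:
 assumes C: "category C" and fg: "f \<in> hom C X Z" "g \<in> hom C Y Z"
  and pb: "is_pullback C f g p q" and i: "i \<in> hom C V (dom C p)" "iso_arr C i"
 shows "is_pullback C f g (p o[C] i) (q o[C] i)"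
proof -
 note d = pullbackD[OF pb fg]
 obtain k where k: "k \<in> hom C (dom C p) V" "k o[C] i = ident C V" "i o[C] k = ident C (dom C p)"
  using iso_arrE i by metis
 show ?thesis
 proof (rule pullbackI'[OF fg comp_hom[OF C i(1) d(1)] comp_hom[OF C i(1) d(2)]])
  show "f o[C] p o[C] i = g o[C] q o[C] i"
   using comp_assoc[OF C i(1) d(1) fg(1)] comp_assoc[OF C i(1) d(2) fg(2)] d(3) by simp
 next
  fix W a b assume *: "W \<in> ob C" "a \<in> hom C W X" "b \<in> hom C W Y" "f o[C] a = g o[C] b"
  then obtain h where h: "h \<in> hom C W (dom C p)" "p o[C] h = a" "q o[C] h = b"
   using pullback_ex1[OF pb fg C] by blast
  have "(p o[C] i) o[C] (k o[C] h) = a" "(q o[C] i) o[C] (k o[C] h) = b"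
   using comp_assoc[OF C comp_hom[OF C h(1) k(1)] i(1)] d cancel_left[OF C k(1) i(1) k(3) h(1)] h by metis+
  then show "\<exists>h. h \<in> hom C W V \<and> (p o[C] i) o[C] h = a \<and> (q o[C] i) o[C] h = b"
   using comp_hom[OF C h(1) k(1)] by blast
 next
  fix W h l assume *: "h \<in> hom C W V" "l \<in> hom C W V"
   "(p o[C] i) o[C] h = (p o[C] i) o[C] l" "(q o[C] i) o[C] h = (q o[C] i) o[C] l"
  have "i o[C] h = i o[C] l"
   by (rule pullback_eqI[OF pb fg C comp_hom[OF C *(1) i(1)] comp_hom[OF C *(2) i(1)]])
    (use * comp_assoc[OF C *(1) i(1)] comp_assoc[OF C *(2) i(1)] d in metis)+
  then show "h = l" using cancel_left[OF C i(1) k(1,2)] * by metis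
 qed
qed

text \<open>A functor that preserves one pullback of each cospan preserves them all.\<close>

lemma preserves_pullbackI:
 assumes C: "category C" and D: "category D" and F: "is_functor C D F"
  and fg: "f \<in> hom C X Z" "g \<in> hom C Y Z" and pb: "is_pullback C f g p q"
  and Fpb: "is_pullback D (far F f) (far F g) (far F p) (far F q)" and pb': "is_pullback C f g p' q'"
 shows "is_pullback D (far F f) (far F g) (far F p') (far F q')"
proof -
 note d = pullbackD[OF pb fg] and d' = pullbackD[OF pb' fg]
 obtain i where i: "i \<in> hom C (dom C p') (dom C p)" "iso_arr C i" "p o[C] i = p'" "q o[C] i = q'"
  using pullback_unique[OF C fg pb pb'] by metis
 have "dom D (far F p) = fob F (dom C p)" using functor_hom[OF F d(1)] by (simp add: hom_def)
 then show ?thesis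
  using pullback_iso[OF D functor_hom[OF F fg(1)] functor_hom[OF F fg(2)] Fpb, of "far F i"]
   functor_hom[OF F i(1)] functor_iso[OF F C i(1,2)] functor_comp[OF F i(1) d(1)]
   functor_comp[OF F i(1) d(2)] i by simp
qed

lemma terminal_hom:
 assumes "is_terminal C t" "X \<in> ob C"
 obtains f where "f \<in> hom C X t"
 using assms by (auto simp: is_terminal_def)

lemma terminal_eq: "is_terminal C t ==> category C ==> f \<in> hom C X t ==> g \<in> hom C X t ==> f = g"
 using category_ob(1) unfolding is_terminal_def by metis

lemma terminal_iso:
 assumes C: "category C" and "is_terminal C t" "is_terminal C t'" and f: "f \<in> hom C t t'"
 shows "iso_arr C f"
proof -
 obtain g where g: "g \<in> hom C t' t" using assms terminal_hom is_terminal_def by metis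
 have "g o[C] f = ident C t" "f o[C] g = ident C t'"
  using terminal_eq assms comp_hom[OF C f g] comp_hom[OF C g f] ident_hom[OF C] category_ob[OF C f] by metis+
 then show ?thesis using f g iso_arrI by metis
qed

lemma terminal_transfer:
 assumes C: "category C" and t: "is_terminal C t" and i: "i \<in> hom C t t'" "iso_arr C i"
 shows "is_terminal C t'"
 unfolding is_terminal_def
proof (intro conjI ballI)
 show "t' \<in> ob C" using category_ob[OF C i(1)] by simp
 fix X assume X: "X \<in> ob C"
 obtain f where f: "f \<in> hom C X t" using terminal_hom[OF t X] .
 obtain k where k: "k \<in> hom C t' t" "k o[C] i = ident C t" "i o[C] k = ident C t'" using iso_arrE i by metis
 have "g = i o[C] f" if "g \<in> hom C X t'" for g
  using terminal_eq[OF t C f comp_hom[OF C that k(1)]] cancel_left[OF C k(1) i(1) k(3) that] by simp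
 then show "\<exists>!f. f \<in> hom C X t'" using comp_hom[OF C f i(1)] by blast
qed

lemma preserves_terminalI:
 assumes C: "category C" and D: "category D" and F: "is_functor C D F"
  and t: "is_terminal C t" "is_terminal D (fob F t)" and t': "is_terminal C t'"
 shows "is_terminal D (fob F t')"
proof -
 obtain f where "f \<in> hom C t t'" using terminal_hom[OF t'] t(1) is_terminal_def by metis
 then show ?thesis using terminal_iso[OF C t(1) t'] functor_iso[OF F C] functor_hom[OF F] terminal_transfer[OF D t(2)]
  by metis
qed

text \<open>This reduces the preservation of products to that of terminal objects and pullbacks.\<close>

lemma product_iff_pullback:
 assumes C: "category C" and t: "is_terminal C t" and u: "u \<in> hom C X t" and v: "v \<in> hom C Y t"
 shows "is_product C X Y P p q \<longleftrightarrow> is_pullback C u v p q \<and> dom C p = P"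
proof -
 have eq: "u o[C] a = v o[C] b" if "a \<in> hom C Z X" "b \<in> hom C Z Y" for a b Z
  using terminal_eq[OF t C comp_hom[OF C that(1) u] comp_hom[OF C that(2) v]] .
 show ?thesis
  using u v eq by (auto simp: is_product_def is_pullback_def hom_def)
qed

lemma preserves_product:
 assumes C: "category C" and D: "category D" and F: "is_functor C D F" and lex: "preserves_finite_limits C D F"
  and t: "is_terminal C t" and pr: "is_product C X Y P p q"
 shows "is_product D (fob F X) (fob F Y) (fob F P) (far F p) (far F q)"
proof -
 have p: "p \<in> hom C P X" and q: "q \<in> hom C P Y" using pr by (auto simp: is_product_def)
 obtain u where u: "u \<in> hom C X t" using terminal_hom[OF t] category_ob[OF C p] by metis
 obtain v where v: "v \<in> hom C Y t" using terminal_hom[OF t] category_ob[OF C q] by metis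
 have "is_pullback C u v p q" using pr product_iff_pullback[OF C t u v] by simp
 then have "is_pullback D (far F u) (far F v) (far F p) (far F q)" "is_terminal D (fob F t)"
  using lex t by (auto simp: preserves_finite_limits_def)
 then show ?thesis
  using product_iff_pullback[OF D _ functor_hom[OF F u] functor_hom[OF F v]] functor_hom[OF F p]
  by (auto simp: hom_def)
qed

lemma product_exists:
 assumes C: "category C" and lim: "has_finite_limits C" and X: "X \<in> ob C" and Y: "Y \<in> ob C"
 shows "\<exists>P p q. is_product C X Y P p q"
proof -
 obtain t where t: "is_terminal C t" using lim by (auto simp: has_finite_limits_def)
 obtain u where u: "u \<in> hom C X t" using terminal_hom[OF t X] .
 obtain v where v: "v \<in> hom C Y t" using terminal_hom[OF t Y] .
 obtain p q where "is_pullback C u v p q" using lim u v by (fastforce simp: has_finite_limits_def hom_def)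
 then show ?thesis using product_iff_pullback[OF C t u v] by blast
qed

lemma pullback_exists:
 assumes "has_finite_limits C" "f \<in> hom C X Z" "g \<in> hom C Y Z"
 obtains p q where "is_pullback C f g p q"
 using assms by (fastforce simp: has_finite_limits_def hom_def)

text \<open>Monomorphisms are described by a pullback, which is why functors that preserve finite limits preserve them.\<close>

lemma monic_iff_pullback:
 assumes C: "category C" and m: "m \<in> hom C X Y"
 shows "monic C m \<longleftrightarrow> is_pullback C m m (ident C X) (ident C X)"
proof
 note i = ident_hom[OF C category_ob(1)[OF C m]]
 assume mm: "monic C m"
 show "is_pullback C m m (ident C X) (ident C X)"
 proof (rule pullbackI'[OF m m i i refl])
  fix V a b assume "V \<in> ob C" "a \<in> hom C V X" "b \<in> hom C V X" "m o[C] a = m o[C] b"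
  then show "\<exists>h. h \<in> hom C V X \<and> ident C X o[C] h = a \<and> ident C X o[C] h = b"
   using monicD[OF mm m C] comp_ident[OF C] by metis
 next
  fix V h k assume "h \<in> hom C V X" "k \<in> hom C V X" "ident C X o[C] h = ident C X o[C] k"
  then show "h = k" using comp_ident(2)[OF C] by metis
 qed
next
 assume pb: "is_pullback C m m (ident C X) (ident C X)"
 show "monic C m" unfolding monic_def
 proof (intro conjI ballI impI)
  show "m \<in> arr C" using m by (simp add: hom_def)
  fix Z f g assume "Z \<in> ob C" "f \<in> hom C Z (dom C m)" "g \<in> hom C Z (dom C m)" and e: "m o[C] f = m o[C] g"
  then have fg: "f \<in> hom C Z X" "g \<in> hom C Z X" using m by (auto simp: hom_def)
  obtain h where "h \<in> hom C Z (dom C (ident C X))" "ident C X o[C] h = f" "ident C X o[C] h = g"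
   using pullback_ex1[OF pb m m C fg e] by blast
  then show "f = g" by simp
 qed
qed

lemma lex_monic:
 assumes C: "category C" and D: "category D" and F: "is_functor C D F" and lex: "preserves_finite_limits C D F"
  and m: "monic C m" "m \<in> hom C X Y"
 shows "monic D (far F m)"
 using monic_iff_pullback[OF C m(2)] monic_iff_pullback[OF D functor_hom[OF F m(2)]] m lex
  functor_ident[OF F category_ob(1)[OF C m(2)]]
 by (auto simp: preserves_finite_limits_def) (metis)

subsection \<open>Adjunctions and extremal epimorphisms\<close>

locale adjunction =
 fixes C :: "('o, 'm) cat" and D :: "('p, 'n) cat" and L R \<eta> \<epsilon>
 assumes C: "category C" and D: "category D"
  and L: "is_functor C D L" and R: "is_functor D C R"
  and eta: "nat_trans C C id_func (comp_func R L) \<eta>"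
  and eps: "nat_trans D D (comp_func L R) id_func \<epsilon>"
  and triangle_L: "X \<in> ob C ==> \<epsilon> (fob L X) o[D] far L (\<eta> X) = ident D (fob L X)"
  and triangle_R: "Y \<in> ob D ==> far R (\<epsilon> Y) o[C] \<eta> (fob R Y) = ident C (fob R Y)"
begin

lemma eta_hom: "X \<in> ob C ==> \<eta> X \<in> hom C X (fob R (fob L X))"
 using eta by (simp add: nat_trans_def)

lemma eps_hom: "Y \<in> ob D ==> \<epsilon> Y \<in> hom D (fob L (fob R Y)) Y"
 using eps by (simp add: nat_trans_def)

lemma eta_nat: "f \<in> hom C X Y ==> \<eta> Y o[C] f = far R (far L f) o[C] \<eta> X"
 using eta by (auto simp: nat_trans_def hom_def)

lemma eps_nat: "f \<in> hom D X Y ==> \<epsilon> Y o[D] far L (far R f) = f o[D] \<epsilon> X"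
 using eps by (auto simp: nat_trans_def hom_def)

lemma transpose_eqI:
 assumes Y: "Y \<in> ob D" and f: "f \<in> hom C Z (fob R Y)" and g: "g \<in> hom C Z (fob R Y)"
  and eq: "\<epsilon> Y o[D] far L f = \<epsilon> Y o[D] far L g"
 shows "f = g"
proof -
 have *: "h = far R (\<epsilon> Y o[D] far L h) o[C] \<eta> Z" if h: "h \<in> hom C Z (fob R Y)" for h
 proof -
  have Z: "Z \<in> ob C" using category_ob[OF C h] by simp
  note Lh = functor_hom[OF L h]
  have "far R (\<epsilon> Y o[D] far L h) o[C] \<eta> Z = far R (\<epsilon> Y) o[C] (\<eta> (fob R Y) o[C] h)"
   using functor_comp[OF R Lh eps_hom[OF Y]] eta_nat[OF h]
    comp_assoc[OF C eta_hom[OF Z] functor_hom[OF R Lh] functor_hom[OF R eps_hom[OF Y]]] by simp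
  also have "\<dots> = h"
   using cancel_left[OF C eta_hom[OF functor_ob[OF R Y]] functor_hom[OF R eps_hom[OF Y]] triangle_R[OF Y] h] .
  finally show ?thesis by simp
 qed
 show ?thesis using *[OF f] *[OF g] eq by simp
qed

text \<open>The transpose of \<open>f : L Z \<rightarrow> Y\<close>.\<close>

lemma transpose:
 assumes Z: "Z \<in> ob C" and f: "f \<in> hom D (fob L Z) Y"
 shows "far R f o[C] \<eta> Z \<in> hom C Z (fob R Y)"
  and "\<epsilon> Y o[D] far L (far R f o[C] \<eta> Z) = f"
proof -
 note e = eta_hom[OF Z] and Rf = functor_hom[OF R f]
 have Y: "Y \<in> ob D" using category_ob[OF D f] by simp
 show "far R f o[C] \<eta> Z \<in> hom C Z (fob R Y)" using comp_hom[OF C e Rf] .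
 have "\<epsilon> Y o[D] far L (far R f o[C] \<eta> Z) = (f o[D] \<epsilon> (fob L Z)) o[D] far L (\<eta> Z)"
  using functor_comp[OF L e Rf] comp_assoc[OF D functor_hom[OF L e] functor_hom[OF L Rf] eps_hom[OF Y]]
   eps_nat[OF f] by simp
 also have "\<dots> = f"
  using cancel_right[OF D functor_hom[OF L e] eps_hom[OF functor_ob[OF L Z]] triangle_L[OF Z] f] .
 finally show "\<epsilon> Y o[D] far L (far R f o[C] \<eta> Z) = f" .
qed

lemma right_adjoint_monic:
 assumes m: "monic D m" "m \<in> hom D X Y"
 shows "monic C (far R m)"
 unfolding monic_def
proof (intro conjI ballI impI)
 note Rm = functor_hom[OF R m(2)]
 have X: "X \<in> ob D" using category_ob[OF D m(2)] by simp
 show "far R m \<in> arr C" using Rm by (simp add: hom_def)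
 fix Z f g assume Z: "Z \<in> ob C" and fg': "f \<in> hom C Z (dom C (far R m))" "g \<in> hom C Z (dom C (far R m))"
  and eq: "far R m o[C] f = far R m o[C] g"
 have f: "f \<in> hom C Z (fob R X)" and g: "g \<in> hom C Z (fob R X)" using fg' Rm by (auto simp: hom_def)
 have *: "m o[D] (\<epsilon> X o[D] far L h) = \<epsilon> Y o[D] far L (far R m o[C] h)" if h: "h \<in> hom C Z (fob R X)" for h
  using functor_comp[OF L h Rm] eps_nat[OF m(2)] comp_assoc[OF D functor_hom[OF L h] eps_hom[OF X] m(2)]
   comp_assoc[OF D functor_hom[OF L h] functor_hom[OF L Rm] eps_hom[OF category_ob(2)[OF D m(2)]]] by simp
 have "\<epsilon> X o[D] far L f = \<epsilon> X o[D] far L g"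
  using monicD[OF m D comp_hom[OF D functor_hom[OF L f] eps_hom[OF X]] comp_hom[OF D functor_hom[OF L g] eps_hom[OF X]]]
   *[OF f] *[OF g] eq by simp
 then show "f = g" using transpose_eqI[OF X f g] by simp
qed

end

lemma adjoint_adjunction:
 assumes "category C" "category D" "is_functor C D L" "is_functor D C R" "adjoint C D L R"
 obtains \<eta> \<epsilon> where "adjunction C D L R \<eta> \<epsilon>"
 using assms unfolding adjoint_def adjunction_def by blast

text \<open>
 Extremal epimorphisms, with ``is invertible'' weakened to ``has a section'', which for a
 monomorphism amounts to the same.
\<close>

definition extremal :: "('o, 'm) cat => 'm => bool" where
 "extremal C x \<longleftrightarrow> x \<in> arr C \<and>
   (\<forall>m g. monic C m \<and> cod C m = cod C x \<and> g \<in> hom C (dom C x) (dom C m) \<and> m o[C] g = x -->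
    (\<exists>t \<in> hom C (cod C x) (dom C m). m o[C] t = ident C (cod C x)))"

lemma extremalD:
 assumes "extremal C x" "x \<in> hom C X N" "monic C m" "m \<in> hom C J N" "g \<in> hom C X J" "m o[C] g = x"
 obtains t where "t \<in> hom C N J" "m o[C] t = ident C N"
proof -
 have *: "dom C x = X" "cod C x = N" "dom C m = J" "cod C m = N" using assms(2,4) by (auto simp: hom_def)
 have "monic C m \<and> cod C m = cod C x \<and> g \<in> hom C (dom C x) (dom C m) \<and> m o[C] g = x"
  using assms * by simp
 then have "\<exists>t \<in> hom C (cod C x) (dom C m). m o[C] t = ident C (cod C x)"
  using assms(1) unfolding extremal_def by blast
 then show thesis using that * by auto
qed

lemma extremalI:
 assumes x: "x \<in> hom C X N"
  and "\<And>m J g. monic C m ==> m \<in> hom C J N ==> g \<in> hom C X J ==> m o[C] g = x ==>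
   \<exists>t \<in> hom C N J. m o[C] t = ident C N"
 shows "extremal C x"
 unfolding extremal_def
proof (intro conjI allI impI)
 show "x \<in> arr C" using x by (simp add: hom_def)
 fix m g assume *: "monic C m \<and> cod C m = cod C x \<and> g \<in> hom C (dom C x) (dom C m) \<and> m o[C] g = x"
 have d: "dom C x = X" "cod C x = N" using x by (auto simp: hom_def)
 have "m \<in> hom C (dom C m) N" using * d by (auto simp: hom_def monic_def)
 then show "\<exists>t \<in> hom C (cod C x) (dom C m). m o[C] t = ident C (cod C x)"
  using assms(2)[of m "dom C m" g] * d by auto
qed

text \<open>
 A subobject \<open>m\<close> of \<open>L N\<close> through which \<open>L x\<close> factors yields, by pulling \<open>R m\<close> back along the
 unit, a subobject of \<open>N\<close> through which \<open>x\<close> factors; transposing a section of the latter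
 gives one of \<open>m\<close>.
\<close>

lemma (in adjunction) left_adjoint_extremal:
 assumes lim: "has_finite_limits C" and x: "extremal C x" "x \<in> hom C X N"
 shows "extremal D (far L x)"
proof (rule extremalI[OF functor_hom[OF L x(2)]])
 fix m J g assume m: "monic D m" "m \<in> hom D J (fob L N)" and g: "g \<in> hom D (fob L X) J" and mg: "m o[D] g = far L x"
 have X: "X \<in> ob C" and N: "N \<in> ob C" using category_ob[OF C x(2)] by auto
 have J: "J \<in> ob D" and LN: "fob L N \<in> ob D" using category_ob[OF D m(2)] by auto
 note Rm = functor_hom[OF R m(2)] and eN = eta_hom[OF N]
 obtain p q where pb: "is_pullback C (far R m) (\<eta> N) p q"
  using pullback_exists[OF lim Rm eN] .
 define P where "P = dom C p"
 have p: "p \<in> hom C P (fob R J)" and q: "q \<in> hom C P N" and pq: "far R m o[C] p = \<eta> N o[C] q"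
  using pullbackD[OF pb Rm eN] by (simp_all add: P_def)
 have q_monic: "monic C q" unfolding monic_def
 proof (intro conjI ballI impI)
  show "q \<in> arr C" using q by (simp add: hom_def)
  fix Z f h assume Z: "Z \<in> ob C" and fh': "f \<in> hom C Z (dom C q)" "h \<in> hom C Z (dom C q)" and e: "q o[C] f = q o[C] h"
  have f: "f \<in> hom C Z P" and h: "h \<in> hom C Z P" using fh' q by (auto simp: hom_def)
  have "far R m o[C] (p o[C] f) = far R m o[C] (p o[C] h)"
   using comp_assoc[OF C f p Rm] comp_assoc[OF C h p Rm] comp_assoc[OF C f q eN] comp_assoc[OF C h q eN] pq e by simp
  then have "p o[C] f = p o[C] h"
   using monicD[OF right_adjoint_monic[OF m] Rm C comp_hom[OF C f p] comp_hom[OF C h p]] by simp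
  then show "f = h" using pullback_eqI[OF pb Rm eN C] f h e P_def by simp
 qed
 note RgX = comp_hom[OF C eta_hom[OF X] functor_hom[OF R g]]
 have "far R m o[C] (far R g o[C] \<eta> X) = \<eta> N o[C] x"
  using comp_assoc[OF C eta_hom[OF X] functor_hom[OF R g] Rm] functor_comp[OF R g m(2)] mg eta_nat[OF x(2)] by simp
 then obtain w where w: "w \<in> hom C X P" "q o[C] w = x"
  using pullback_ex1[OF pb Rm eN C RgX x(2)] P_def by blast
 obtain t where t: "t \<in> hom C N P" "q o[C] t = ident C N" using extremalD[OF x q_monic q w] .
 note pt = comp_hom[OF C t(1) p] and eJ = eps_hom[OF J]
 note Lpt = functor_hom[OF L pt]
 have "m o[D] (\<epsilon> J o[D] far L (p o[C] t)) = \<epsilon> (fob L N) o[D] (far L (far R m) o[D] far L (p o[C] t))"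
  using comp_assoc[OF D Lpt eJ m(2)] eps_nat[OF m(2)] comp_assoc[OF D Lpt functor_hom[OF L Rm] eps_hom[OF LN]] by simp
 also have "far L (far R m) o[D] far L (p o[C] t) = far L (\<eta> N)"
  using functor_comp[OF L pt Rm] comp_assoc[OF C t(1) p Rm] comp_assoc[OF C t(1) q eN] pq t(2) comp_ident(1)[OF C eN] by simp
 finally have "m o[D] (\<epsilon> J o[D] far L (p o[C] t)) = ident D (fob L N)" using triangle_L[OF N] by simp
 then show "\<exists>t \<in> hom D (fob L N) J. m o[D] t = ident D (fob L N)" using comp_hom[OF D Lpt eJ] by blast
qed

text \<open>A functor with a universal arrow to each object has a right adjoint.\<close>

lemma adjoint_from_universal_arrows:
 assumes C: "category C" and D: "category D" and L: "is_functor C D L"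
  and univ: "\<And>Y. Y \<in> ob D ==> \<exists>G e. G \<in> ob C \<and> e \<in> hom D (fob L G) Y \<and>
   (\<forall>Z\<in>ob C. \<forall>f \<in> hom D (fob L Z) Y. \<exists>!g. g \<in> hom C Z G \<and> e o[D] far L g = f)"
 shows "\<exists>R. is_functor D C R \<and> adjoint C D L R"
proof -
 obtain G e where G: "\<And>Y. Y \<in> ob D ==> G Y \<in> ob C" and e: "\<And>Y. Y \<in> ob D ==> e Y \<in> hom D (fob L (G Y)) Y"
  and ex1: "\<And>Y Z f. Y \<in> ob D ==> Z \<in> ob C ==> f \<in> hom D (fob L Z) Y ==> \<exists>!g. g \<in> hom C Z (G Y) \<and> e Y o[D] far L g = f"
  using univ by metis
 define tr where "tr Y Z f = (THE g. g \<in> hom C Z (G Y) \<and> e Y o[D] far L g = f)" for Y Z f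
 have tr: "tr Y Z f \<in> hom C Z (G Y)" "e Y o[D] far L (tr Y Z f) = f"
  if "f \<in> hom D (fob L Z) Y" "Z \<in> ob C" for Y Z f
  using theI'[OF ex1[OF category_ob(2)[OF D that(1)] that(2,1)]] unfolding tr_def by auto
 have eqI: "g = h" if "g \<in> hom C Z (G Y)" "h \<in> hom C Z (G Y)" "e Y o[D] far L g = e Y o[D] far L h" "Y \<in> ob D" for g h Z Y
  using ex1[OF that(4) category_ob(1)[OF C that(1)] comp_hom[OF D functor_hom[OF L that(1)] e[OF that(4)]]] that by metis
 have ecomp: "e Y o[D] far L (g o[C] h) = (e Y o[D] far L g) o[D] far L h"
  if "Y \<in> ob D" "g \<in> hom C Z (G Y)" "h \<in> hom C W Z" for Y g h Z W
  using functor_comp[OF L that(3,2)] comp_assoc[OF D functor_hom[OF L that(3)] functor_hom[OF L that(2)] e[OF that(1)]] by simp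
 define R where "R = \<lparr>fob = G, far = (\<lambda>f. tr (cod D f) (G (dom D f)) (f o[D] e (dom D f)))\<rparr>"
 have Rob: "fob R Y = G Y" for Y by (simp add: R_def)
 have Rar: "far R f \<in> hom C (G X) (G Y)" "e Y o[D] far L (far R f) = f o[D] e X" if f: "f \<in> hom D X Y" for f X Y
  using tr[OF comp_hom[OF D e[OF category_ob(1)[OF D f]] f]] G[OF category_ob(1)[OF D f]] f
  by (auto simp: R_def hom_def)
 have R: "is_functor D C R" unfolding is_functor_def Rob
 proof (intro conjI ballI impI)
  show "G X \<in> ob C" if "X \<in> ob D" for X using that by (rule G)
  show "far R f \<in> hom C (G (dom D f)) (G (cod D f))" if "f \<in> arr D" for f using Rar(1)[OF homI[OF that]] .
  show "far R (ident D X) = ident C (G X)" if X: "X \<in> ob D" for X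
  proof (rule eqI[OF Rar(1)[OF ident_hom[OF D X]] ident_hom[OF C G[OF X]] _ X])
   show "e X o[D] far L (far R (ident D X)) = e X o[D] far L (ident C (G X))"
    using Rar(2)[OF ident_hom[OF D X]] functor_ident[OF L G[OF X]] comp_ident[OF D e[OF X]] by simp
  qed
  show "far R (g o[D] f) = far R g o[C] far R f" if fg': "f \<in> arr D" "g \<in> arr D" "cod D f = dom D g" for f g
  proof -
   obtain X Y Z where f: "f \<in> hom D X Y" and g: "g \<in> hom D Y Z" using fg' by (auto simp: hom_def)
   have obs: "X \<in> ob D" "Y \<in> ob D" "Z \<in> ob D" using category_ob[OF D f] category_ob[OF D g] by auto
   show ?thesis
   proof (rule eqI[OF Rar(1)[OF comp_hom[OF D f g]] comp_hom[OF C Rar(1)[OF f] Rar(1)[OF g]] _ obs(3)])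
    show "e Z o[D] far L (far R (g o[D] f)) = e Z o[D] far L (far R g o[C] far R f)"
     using ecomp[OF obs(3) Rar(1)[OF g] Rar(1)[OF f]] Rar(2)[OF comp_hom[OF D f g]] Rar(2)[OF f] Rar(2)[OF g]
      comp_assoc[OF D functor_hom[OF L Rar(1)[OF f]] e[OF obs(2)] g] comp_assoc[OF D e[OF obs(1)] f g] by simp
   qed
  qed
 qed
 define \<eta> where "\<eta> = (\<lambda>X\<in>ob C. tr (fob L X) X (ident D (fob L X)))"
 define \<epsilon> where "\<epsilon> = (\<lambda>Y\<in>ob D. e Y)"
 have eta: "\<eta> X \<in> hom C X (G (fob L X))" "e (fob L X) o[D] far L (\<eta> X) = ident D (fob L X)" if "X \<in> ob C" for X
  using tr[OF ident_hom[OF D functor_ob[OF L that]] that] that by (auto simp: \<eta>_def)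
 have "nat_trans C C id_func (comp_func R L) \<eta>" unfolding nat_trans_def comp_func_simps Rob
 proof (intro conjI ballI)
  show "\<eta> \<in> extensional (ob C)" by (simp add: \<eta>_def)
  show "\<eta> X \<in> hom C X (G (fob L X))" if "X \<in> ob C" for X using eta(1)[OF that] .
  fix f assume "f \<in> arr C"
  then obtain X Y where f: "f \<in> hom C X Y" by (auto simp: hom_def)
  have X: "X \<in> ob C" and Y: "Y \<in> ob C" using category_ob[OF C f] by auto
  note Lf = functor_hom[OF L f] and LY = functor_ob[OF L Y] and LX = functor_ob[OF L X]
  have "\<eta> Y o[C] f = far R (far L f) o[C] \<eta> X"
  proof (rule eqI[OF comp_hom[OF C f eta(1)[OF Y]] comp_hom[OF C eta(1)[OF X] Rar(1)[OF Lf]] _ LY])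
   show "e (fob L Y) o[D] far L (\<eta> Y o[C] f) = e (fob L Y) o[D] far L (far R (far L f) o[C] \<eta> X)"
    using ecomp[OF LY eta(1)[OF Y] f] ecomp[OF LY Rar(1)[OF Lf] eta(1)[OF X]] Rar(2)[OF Lf] eta(2)[OF Y] eta(2)[OF X]
     comp_ident[OF D Lf] comp_assoc[OF D functor_hom[OF L eta(1)[OF X]] e[OF LX] Lf] by simp
  qed
  then show "\<eta> (cod C f) o[C] f = far R (far L f) o[C] \<eta> (dom C f)" using f by (simp add: hom_def)
 qed
 moreover have "nat_trans D D (comp_func L R) id_func \<epsilon>" unfolding nat_trans_def comp_func_simps Rob
 proof (intro conjI ballI)
  show "\<epsilon> \<in> extensional (ob D)" by (simp add: \<epsilon>_def)
  show "\<epsilon> Y \<in> hom D (fob L (G Y)) Y" if "Y \<in> ob D" for Y using e[OF that] that by (simp add: \<epsilon>_def)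
  fix f assume "f \<in> arr D"
  then obtain X Y where f: "f \<in> hom D X Y" by (auto simp: hom_def)
  then show "\<epsilon> (cod D f) o[D] far L (far R f) = f o[D] \<epsilon> (dom D f)"
   using category_ob[OF D f] Rar(2)[OF f] by (simp add: \<epsilon>_def hom_def)
 qed
 moreover have "\<epsilon> (fob L X) o[D] far L (\<eta> X) = ident D (fob L X)" if "X \<in> ob C" for X
  using eta(2)[OF that] functor_ob[OF L that] by (simp add: \<epsilon>_def)
 moreover have "far R (\<epsilon> Y) o[C] \<eta> (fob R Y) = ident C (fob R Y)" if Y: "Y \<in> ob D" for Y
 proof -
  note GY = G[OF Y] and eY = e[OF Y]
  have "far R (e Y) o[C] \<eta> (G Y) = ident C (G Y)"
  proof (rule eqI[OF comp_hom[OF C eta(1)[OF GY] Rar(1)[OF eY]] ident_hom[OF C GY] _ Y])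
   show "e Y o[D] far L (far R (e Y) o[C] \<eta> (G Y)) = e Y o[D] far L (ident C (G Y))"
    using ecomp[OF Y Rar(1)[OF eY] eta(1)[OF GY]] Rar(2)[OF eY] eta(2)[OF GY] functor_ident[OF L GY]
     comp_assoc[OF D functor_hom[OF L eta(1)[OF GY]] e[OF functor_ob[OF L GY]] eY] by simp
  qed
  then show ?thesis using Y by (simp add: \<epsilon>_def Rob)
 qed
 ultimately have "adjoint C D L R" unfolding adjoint_def by blast
 with R show ?thesis by blast
qed

subsection \<open>Cartesian lifts along a reflection\<close>

text \<open>
 \<open>L : E \<rightarrow> S\<close> is a fibration up to isomorphism: every arrow \<open>W \<rightarrow> L Y\<close> is, up to an isomorphism
 \<open>\<omega>\<close>, the image of an arrow \<open>Z \<rightarrow> Y\<close> that is cartesian.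
\<close>

definition has_cartesian_lifts :: "('o, 'm) cat => ('p, 'n) cat => ('o, 'm, 'p, 'n) func => bool" where
 "has_cartesian_lifts E S L \<longleftrightarrow>
   (\<forall>Y\<in>ob E. \<forall>W\<in>ob S. \<forall>a \<in> hom S W (fob L Y). \<exists>Z\<in>ob E. \<exists>p \<in> hom E Z Y. \<exists>\<omega> \<in> hom S (fob L Z) W.
    iso_arr S \<omega> \<and> a o[S] \<omega> = far L p \<and>
    (\<forall>V\<in>ob E. \<forall>f \<in> hom E V Y. \<forall>v \<in> hom S (fob L V) W. a o[S] v = far L f -->
      (\<exists>!g. g \<in> hom E V Z \<and> p o[E] g = f \<and> \<omega> o[S] far L g = v)))"

text \<open>
 The lift of \<open>a : W \<rightarrow> L Y\<close> is the pullback of \<open>R a\<close> along the unit of \<open>Y\<close>. Since \<open>L\<close> inverts the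
 unit and preserves this pullback, it sends the lift to \<open>L R W \<cong> W\<close>.
\<close>

lemma reflection_has_cartesian_lifts:
 assumes E: "category E" and S: "category S" and lim: "has_finite_limits E"
  and L: "is_functor E S L" and R: "is_functor S E R" and adj: "adjunction E S L R \<eta> \<epsilon>"
  and lex: "preserves_finite_limits E S L" and counit: "\<And>Y. Y \<in> ob S ==> iso_arr S (\<epsilon> Y)"
 shows "has_cartesian_lifts E S L"
 unfolding has_cartesian_lifts_def
proof (intro ballI)
 interpret adjunction E S L R \<eta> \<epsilon> by (rule adj)
 fix Y W a assume Y: "Y \<in> ob E" and W: "W \<in> ob S" and a: "a \<in> hom S W (fob L Y)"
 note Ra = functor_hom[OF R a] and eY = eta_hom[OF Y] and LY = functor_ob[OF L Y]
 obtain p q where pb: "is_pullback E (\<eta> Y) (far R a) p q" using pullback_exists[OF lim eY Ra] .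
 define Z where "Z = dom E p"
 have p: "p \<in> hom E Z Y" and q: "q \<in> hom E Z (fob R W)" and pq: "\<eta> Y o[E] p = far R a o[E] q"
  using pullbackD[OF pb eY Ra] by (simp_all add: Z_def)
 have Z: "Z \<in> ob E" using category_ob[OF E p] by simp
 note Lp = functor_hom[OF L p] and Lq = functor_hom[OF L q] and LeY = functor_hom[OF L eY] and LRa = functor_hom[OF L Ra]
 note eW = eps_hom[OF W] and eLY = eps_hom[OF LY]
 have Lpb: "is_pullback S (far L (\<eta> Y)) (far L (far R a)) (far L p) (far L q)"
  using lex pb by (simp add: preserves_finite_limits_def)
 have domLp: "dom S (far L p) = fob L Z" using Lp by (simp add: hom_def)
 have LeY_inv: "far L (\<eta> Y) o[S] \<epsilon> (fob L Y) = ident S (fob L (fob R (fob L Y)))"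
 proof -
  obtain k where k: "k \<in> hom S (fob L Y) (fob L (fob R (fob L Y)))" "k o[S] \<epsilon> (fob L Y) = ident S (fob L (fob R (fob L Y)))"
   "\<epsilon> (fob L Y) o[S] k = ident S (fob L Y)" using iso_arrE[OF counit[OF LY] eLY] by blast
  have "far L (\<eta> Y) = k"
   using cancel_left[OF S eLY k(1,2) LeY] triangle_L[OF Y] comp_ident(1)[OF S k(1)] by simp
  then show ?thesis using k by simp
 qed
 have q_iso: "iso_arr S (far L q)"
 proof -
  have i: "ident S (fob L (fob R W)) \<in> hom S (fob L (fob R W)) (fob L (fob R W))"
   using ident_hom[OF S] category_ob(2)[OF S Lq] by simp
  define b where "b = \<epsilon> (fob L Y) o[S] far L (far R a)"
  have b: "b \<in> hom S (fob L (fob R W)) (fob L Y)" unfolding b_def using comp_hom[OF S LRa eLY] .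
  have "far L (\<eta> Y) o[S] b = far L (far R a) o[S] ident S (fob L (fob R W))"
   unfolding b_def using cancel_left[OF S eLY LeY LeY_inv LRa] comp_ident(1)[OF S LRa] by simp
  then obtain k where k: "k \<in> hom S (fob L (fob R W)) (fob L Z)" "far L p o[S] k = b"
   "far L q o[S] k = ident S (fob L (fob R W))"
   using pullback_ex1[OF Lpb LeY LRa S b i] domLp by auto
  have "k o[S] far L q = ident S (fob L Z)"
  proof (rule pullback_eqI[OF Lpb LeY LRa S])
   show "k o[S] far L q \<in> hom S (fob L Z) (dom S (far L p))" "ident S (fob L Z) \<in> hom S (fob L Z) (dom S (far L p))"
    using comp_hom[OF S Lq k(1)] ident_hom[OF S functor_ob[OF L Z]] domLp by simp_all
   have "far L p o[S] (k o[S] far L q) = \<epsilon> (fob L Y) o[S] (far L (far R a) o[S] far L q)"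
    using comp_assoc[OF S Lq k(1) Lp] k(2) comp_assoc[OF S Lq LRa eLY] b_def by simp
   also have "\<dots> = \<epsilon> (fob L Y) o[S] (far L (\<eta> Y) o[S] far L p)"
    using functor_comp[OF L p eY] functor_comp[OF L q Ra] pq by simp
   also have "\<dots> = far L p" using cancel_left[OF S LeY eLY triangle_L[OF Y] Lp] .
   finally show "far L p o[S] (k o[S] far L q) = far L p o[S] ident S (fob L Z)"
    using comp_ident(1)[OF S Lp] by simp
   show "far L q o[S] (k o[S] far L q) = far L q o[S] ident S (fob L Z)"
    using comp_assoc[OF S Lq k(1) Lq] k(3) comp_ident[OF S Lq] by simp
  qed
  then show ?thesis using iso_arrI[OF Lq k(1)] k(3) by simp
 qed
 define \<omega> where "\<omega> = \<epsilon> W o[S] far L q"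
 have \<omega>: "\<omega> \<in> hom S (fob L Z) W" unfolding \<omega>_def using comp_hom[OF S Lq eW] .
 have \<omega>_iso: "iso_arr S \<omega>" unfolding \<omega>_def using iso_comp[OF S Lq q_iso eW counit[OF W]] .
 have "a o[S] \<omega> = \<epsilon> (fob L Y) o[S] (far L (far R a) o[S] far L q)"
  unfolding \<omega>_def using comp_assoc[OF S Lq eW a] eps_nat[OF a] comp_assoc[OF S Lq LRa eLY] by simp
 also have "\<dots> = \<epsilon> (fob L Y) o[S] (far L (\<eta> Y) o[S] far L p)"
  using functor_comp[OF L p eY] functor_comp[OF L q Ra] pq by simp
 also have "\<dots> = far L p" using cancel_left[OF S LeY eLY triangle_L[OF Y] Lp] .
 finally have a\<omega>: "a o[S] \<omega> = far L p" .
 have \<omega>g: "\<omega> o[S] far L g = \<epsilon> W o[S] far L (q o[E] g)" if g: "g \<in> hom E V Z" for g V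
  unfolding \<omega>_def using functor_comp[OF L g q] comp_assoc[OF S functor_hom[OF L g] Lq eW] by simp
 have "\<exists>!g. g \<in> hom E V Z \<and> p o[E] g = f \<and> \<omega> o[S] far L g = v"
  if V: "V \<in> ob E" and f: "f \<in> hom E V Y" and v: "v \<in> hom S (fob L V) W" and av: "a o[S] v = far L f" for V f v
 proof -
  note tv = transpose[OF V v]
  have "\<eta> Y o[E] f = far R a o[E] (far R v o[E] \<eta> V)"
   using comp_assoc[OF E eta_hom[OF V] functor_hom[OF R v] Ra] functor_comp[OF R v a] av eta_nat[OF f] by simp
  then obtain g where g: "g \<in> hom E V Z" "p o[E] g = f" "q o[E] g = far R v o[E] \<eta> V"
   using pullback_ex1[OF pb eY Ra E f tv(1)] Z_def by auto
  have "h = g" if h: "h \<in> hom E V Z" "p o[E] h = f" "\<omega> o[S] far L h = v" for h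
  proof (rule pullback_eqI[OF pb eY Ra E])
   show "h \<in> hom E V (dom E p)" "g \<in> hom E V (dom E p)" using h g Z_def by auto
   show "p o[E] h = p o[E] g" using h g by simp
   show "q o[E] h = q o[E] g"
    using transpose_eqI[OF W comp_hom[OF E h(1) q] comp_hom[OF E g(1) q]] \<omega>g[OF h(1)] h(3) g(3) tv(2) by simp
  qed
  moreover have "\<omega> o[S] far L g = v" using \<omega>g[OF g(1)] g(3) tv(2) by simp
  ultimately show ?thesis using g by blast
 qed
 then show "\<exists>Z\<in>ob E. \<exists>p \<in> hom E Z Y. \<exists>\<omega> \<in> hom S (fob L Z) W.
    iso_arr S \<omega> \<and> a o[S] \<omega> = far L p \<and>
    (\<forall>V\<in>ob E. \<forall>f \<in> hom E V Y. \<forall>v \<in> hom S (fob L V) W. a o[S] v = far L f -->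
      (\<exists>!g. g \<in> hom E V Z \<and> p o[E] g = f \<and> \<omega> o[S] far L g = v))"
  using Z p \<omega> \<omega>_iso a\<omega> by blast
qed

section \<open>Pseudopullbacks of toposes\<close>

subsection \<open>More on pullbacks and products\<close>

text \<open>Characteristic arrows and cartesian lifts are only determined up to isomorphism, so pullbacks have to be transported along isomorphisms of the underlying cospans.\<close>

lemma pullback_cospan_iso:
 assumes C: "category C" and fg: "f \<in> hom C X Z" "g \<in> hom C Y Z"
  and fg': "f' \<in> hom C X' Z'" "g' \<in> hom C Y' Z'" and pb: "is_pullback C f' g' p q"
  and a: "a \<in> hom C X X'" "a' \<in> hom C X' X" "a' o[C] a = ident C X" "a o[C] a' = ident C X'"
  and b: "b \<in> hom C Y Y'" "b' \<in> hom C Y' Y" "b' o[C] b = ident C Y" "b o[C] b' = ident C Y'"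
  and c: "c \<in> hom C Z Z'" "c' \<in> hom C Z' Z" "c' o[C] c = ident C Z"
  and nat: "c o[C] f = f' o[C] a" "c o[C] g = g' o[C] b"
 shows "is_pullback C f g (a' o[C] p) (b' o[C] q)"
proof -
 define P where "P = dom C p"
 have p: "p \<in> hom C P X'" and q: "q \<in> hom C P Y'" and pq: "f' o[C] p = g' o[C] q"
  using pullbackD[OF pb fg'] by (simp_all add: P_def)
 note ap = comp_hom[OF C p a(2)] and bq = comp_hom[OF C q b(2)]
 have c_inj: "h = k" if "h \<in> hom C V Z" "k \<in> hom C V Z" "c o[C] h = c o[C] k" for h k V
  using cancel_left[OF C c that(1)] cancel_left[OF C c that(2)] that(3) by metis
 show ?thesis
 proof (rule pullbackI'[OF fg ap bq])
  show "f o[C] (a' o[C] p) = g o[C] (b' o[C] q)"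
  proof (rule c_inj[OF comp_hom[OF C ap fg(1)] comp_hom[OF C bq fg(2)]])
   have "c o[C] (f o[C] (a' o[C] p)) = f' o[C] p"
    using comp_assoc[OF C ap fg(1) c(1)] nat(1) comp_assoc[OF C ap a(1) fg'(1)] cancel_left[OF C a(2,1,4) p] by simp
   moreover have "c o[C] (g o[C] (b' o[C] q)) = g' o[C] q"
    using comp_assoc[OF C bq fg(2) c(1)] nat(2) comp_assoc[OF C bq b(1) fg'(2)] cancel_left[OF C b(2,1,4) q] by simp
   ultimately show "c o[C] (f o[C] (a' o[C] p)) = c o[C] (g o[C] (b' o[C] q))"
    using pq by simp
  qed
 next
  fix V x y assume x: "x \<in> hom C V X" and y: "y \<in> hom C V Y" and e: "f o[C] x = g o[C] y"
  have "f' o[C] (a o[C] x) = g' o[C] (b o[C] y)"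
   using comp_assoc[OF C x a(1) fg'(1)] comp_assoc[OF C y b(1) fg'(2)] nat[symmetric]
    comp_assoc[OF C x fg(1) c(1)] comp_assoc[OF C y fg(2) c(1)] e by simp
  then obtain h where h: "h \<in> hom C V P" "p o[C] h = a o[C] x" "q o[C] h = b o[C] y"
   using pullback_ex1[OF pb fg' C comp_hom[OF C x a(1)] comp_hom[OF C y b(1)]] P_def by blast
  have "(a' o[C] p) o[C] h = x" "(b' o[C] q) o[C] h = y"
   using comp_assoc[OF C h(1) p a(2)] comp_assoc[OF C h(1) q b(2)] h cancel_left[OF C a(1-3) x] cancel_left[OF C b(1-3) y] by simp_all
  then show "\<exists>h. h \<in> hom C V P \<and> (a' o[C] p) o[C] h = x \<and> (b' o[C] q) o[C] h = y" using h(1) by blast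
 next
  fix V h k assume h: "h \<in> hom C V P" and k: "k \<in> hom C V P"
   and e: "(a' o[C] p) o[C] h = (a' o[C] p) o[C] k" "(b' o[C] q) o[C] h = (b' o[C] q) o[C] k"
  have *: "a o[C] ((a' o[C] p) o[C] l) = p o[C] l" "b o[C] ((b' o[C] q) o[C] l) = q o[C] l" if l: "l \<in> hom C V P" for l
   using comp_assoc[OF C l p a(2)] comp_assoc[OF C l q b(2)] cancel_left[OF C a(2,1,4) comp_hom[OF C l p]]
    cancel_left[OF C b(2,1,4) comp_hom[OF C l q]] by simp_all
  show "h = k"
   using pullback_eqI[OF pb fg' C, of h V k] h k *[OF h] *[OF k] e P_def by simp
 qed
qed

lemma pullback_paste:
 assumes C: "category C" and f: "f \<in> hom C X Y" and g: "g \<in> hom C W Y" and h: "h \<in> hom C Y Z" and k: "k \<in> hom C V Z"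
  and l: "is_pullback C f g p q" and r: "is_pullback C h k g s"
 shows "is_pullback C (h o[C] f) k p (s o[C] q)"
proof -
 define P where "P = dom C p"
 have p: "p \<in> hom C P X" and q: "q \<in> hom C P W" and pq: "f o[C] p = g o[C] q"
  using pullbackD[OF l f g] by (simp_all add: P_def)
 have dg: "dom C g = W" using g by (simp add: hom_def)
 have s: "s \<in> hom C W V" and gs: "h o[C] g = k o[C] s"
  using pullbackD[OF r h k] dg by simp_all
 show ?thesis
 proof (rule pullbackI'[OF comp_hom[OF C f h] k p comp_hom[OF C q s]])
  show "(h o[C] f) o[C] p = k o[C] (s o[C] q)"
   using comp_assoc[OF C p f h] pq comp_assoc[OF C q g h] gs comp_assoc[OF C q s k] by simp
 next
  fix U a b assume a: "a \<in> hom C U X" and b: "b \<in> hom C U V" and e: "(h o[C] f) o[C] a = k o[C] b"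
  have "h o[C] (f o[C] a) = k o[C] b" using comp_assoc[OF C a f h] e by simp
  then obtain w where w: "w \<in> hom C U W" "g o[C] w = f o[C] a" "s o[C] w = b"
   using pullback_ex1[OF r h k C comp_hom[OF C a f] b] dg by auto
  then obtain z where z: "z \<in> hom C U P" "p o[C] z = a" "q o[C] z = w"
   using pullback_ex1[OF l f g C a w(1)] P_def by auto
  then show "\<exists>z. z \<in> hom C U P \<and> p o[C] z = a \<and> (s o[C] q) o[C] z = b"
   using comp_assoc[OF C z(1) q s] w by auto
 next
  fix U x y assume x: "x \<in> hom C U P" and y: "y \<in> hom C U P" and e: "p o[C] x = p o[C] y" "(s o[C] q) o[C] x = (s o[C] q) o[C] y"
  note qx = comp_hom[OF C x q] and qy = comp_hom[OF C y q]
  have "q o[C] x = q o[C] y"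
  proof (rule pullback_eqI[OF r h k C])
   show "q o[C] x \<in> hom C U (dom C g)" "q o[C] y \<in> hom C U (dom C g)" using qx qy dg by simp_all
   show "g o[C] (q o[C] x) = g o[C] (q o[C] y)"
    using comp_assoc[OF C x q g] comp_assoc[OF C y q g] pq comp_assoc[OF C x p f] comp_assoc[OF C y p f] e by simp
   show "s o[C] (q o[C] x) = s o[C] (q o[C] y)"
    using comp_assoc[OF C x q s] comp_assoc[OF C y q s] e by simp
  qed
  then show "x = y" using pullback_eqI[OF l f g C, of x U y] x y e P_def by simp
 qed
qed

lemma product_ex1:
 assumes "is_product C X Y P p q" "category C" "f \<in> hom C Z X" "g \<in> hom C Z Y"
 shows "\<exists>!h. h \<in> hom C Z P \<and> p o[C] h = f \<and> q o[C] h = g"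
 using assms category_ob(1)[OF assms(2,3)] unfolding is_product_def by auto

lemma product_eqI:
 assumes pr: "is_product C X Y P p q" and C: "category C" and h: "h \<in> hom C Z P" and k: "k \<in> hom C Z P"
  and "p o[C] h = p o[C] k" "q o[C] h = q o[C] k"
 shows "h = k"
proof -
 have "p \<in> hom C P X" "q \<in> hom C P Y" using pr by (auto simp: is_product_def)
 then show ?thesis using product_ex1[OF pr C comp_hom[OF C k] comp_hom[OF C k]] assms by blast
qed

lemma product_iso:
 assumes C: "category C" and pr: "is_product C X Y P p q" and b: "b \<in> hom C Y Y'" "iso_arr C b"
 shows "is_product C X Y' P p (b o[C] q)"
 unfolding is_product_def
proof (intro conjI ballI)
 have p: "p \<in> hom C P X" and q: "q \<in> hom C P Y" using pr by (auto simp: is_product_def)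
 show "p \<in> hom C P X" by (rule p)
 show "b o[C] q \<in> hom C P Y'" using comp_hom[OF C q b(1)] .
 obtain b' where b': "b' \<in> hom C Y' Y" "b' o[C] b = ident C Y" "b o[C] b' = ident C Y'" using iso_arrE[OF b(2,1)] by blast
 fix Z f g assume f: "f \<in> hom C Z X" and g: "g \<in> hom C Z Y'"
 have "(b o[C] q) o[C] h = g \<longleftrightarrow> q o[C] h = b' o[C] g" if h: "h \<in> hom C Z P" for h
  using comp_assoc[OF C h q b(1)] cancel_left[OF C b(1) b'(1,2) comp_hom[OF C h q]] cancel_left[OF C b'(1) b(1) b'(3) g] by auto
 then show "\<exists>!h. h \<in> hom C Z P \<and> p o[C] h = f \<and> (b o[C] q) o[C] h = g"
  using product_ex1[OF pr C f comp_hom[OF C g b'(1)]] by (metis (no_types, lifting))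
qed

text \<open>
 \<open>k\<close> is the exponential transpose of \<open>h : Q \<rightarrow> Y\<close>; here \<open>Q\<close> is a product with projections
 \<open>r\<close>, \<open>s\<close>, and \<open>ev\<close> is the evaluation of an exponential.
\<close>

definition transposes :: "('o, 'm) cat => 'o => 'm => 'm => 'm => 'o => 'm => 'm => 'm => 'm => bool" where
 "transposes C P p q ev Q r s h k \<longleftrightarrow>
   (\<exists>u \<in> hom C Q P. p o[C] u = k o[C] r \<and> q o[C] u = s \<and> ev o[C] u = h)"

definition exponential :: "('o, 'm) cat => 'o => 'o => 'o => 'o => 'm => 'm => 'm => bool" where
 "exponential C X Y E P p q ev \<longleftrightarrow> E \<in> ob C \<and> is_product C E X P p q \<and> ev \<in> hom C P Y \<and>
   (\<forall>Z Q r s h. Z \<in> ob C \<and> is_product C Z X Q r s \<and> h \<in> hom C Q Y -->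
    (\<exists>!k. k \<in> hom C Z E \<and> transposes C P p q ev Q r s h k))"

lemma cartesian_closed_alt:
 "cartesian_closed C \<longleftrightarrow> (\<exists>t. is_terminal C t) \<and>
   (\<forall>X\<in>ob C. \<forall>Y\<in>ob C. \<exists>P p q. is_product C X Y P p q) \<and>
   (\<forall>X\<in>ob C. \<forall>Y\<in>ob C. \<exists>E P p q ev. exponential C X Y E P p q ev)"
 by (simp add: cartesian_closed_def exponential_def transposes_def)

text \<open>\<open>\<chi>\<close> is the characteristic arrow of \<open>m\<close> with respect to \<open>tr : t \<rightarrow> \<Omega>\<close>.\<close>

definition classifies :: "('o, 'm) cat => 'o => 'm => 'm => 'm => bool" where
 "classifies C t tr m \<chi> \<longleftrightarrow> (\<exists>u \<in> hom C (dom C m) t. is_pullback C \<chi> tr m u)"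

definition subobject_classifier :: "('o, 'm) cat => 'o => 'o => 'm => bool" where
 "subobject_classifier C t \<Omega> tr \<longleftrightarrow> is_terminal C t \<and> tr \<in> hom C t \<Omega> \<and>
   (\<forall>m. monic C m --> (\<exists>!\<chi>. \<chi> \<in> hom C (cod C m) \<Omega> \<and> classifies C t tr m \<chi>))"

lemma has_subobject_classifier_alt:
 "has_subobject_classifier C \<longleftrightarrow> (\<exists>t \<Omega> tr. subobject_classifier C t \<Omega> tr)"
 by (simp add: has_subobject_classifier_def subobject_classifier_def classifies_def)

text \<open>Hence truth, and its image under a functor that preserves terminal objects, can be classified.\<close>

lemma monic_from_terminal:
 assumes "category C" "is_terminal C t" "m \<in> hom C t X"
 shows "monic C m"
 unfolding monic_def
proof (intro conjI ballI impI)
 show "m \<in> arr C" using assms(3) by (simp add: hom_def)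
 fix Z f g assume "f \<in> hom C Z (dom C m)" "g \<in> hom C Z (dom C m)"
 moreover have "dom C m = t" using assms(3) by (simp add: hom_def)
 ultimately show "f = g" using terminal_eq[OF assms(2,1)] by simp
qed

subsection \<open>The pseudopullback of two functors\<close>

type_synonym ('ao, 'bo, 'sm) glue_ob = "'ao \<times> 'bo \<times> 'sm"
type_synonym ('ao, 'am, 'bo, 'bm, 'sm) glue_arr =
 "('ao, 'bo, 'sm) glue_ob \<times> ('am \<times> 'bm) \<times> ('ao, 'bo, 'sm) glue_ob"

definition glue :: "('so, 'sm) cat => ('ao, 'am) cat => ('bo, 'bm) cat =>
  ('ao, 'am, 'so, 'sm) func => ('bo, 'bm, 'so, 'sm) func =>
  (('ao, 'bo, 'sm) glue_ob, ('ao, 'am, 'bo, 'bm, 'sm) glue_arr) cat" where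
 "glue S E0 E1 L0 L1 =
   (let Ob = {(X0, X1, \<theta>). X0 \<in> ob E0 \<and> X1 \<in> ob E1 \<and> \<theta> \<in> hom S (fob L0 X0) (fob L1 X1) \<and> iso_arr S \<theta>}
   in \<lparr>ob = Ob,
     arr = {(X, (f0, f1), Y). X \<in> Ob \<and> Y \<in> Ob \<and> f0 \<in> hom E0 (fst X) (fst Y) \<and>
          f1 \<in> hom E1 (fst (snd X)) (fst (snd Y)) \<and>
          snd (snd Y) o[S] far L0 f0 = far L1 f1 o[S] snd (snd X)},
     dom = (\<lambda>(X, f, Y). X),
     cod = (\<lambda>(X, f, Y). Y),
     ident = (\<lambda>X. (X, (ident E0 (fst X), ident E1 (fst (snd X))), X)),
     comp = (\<lambda>(Y, (g0, g1), Z) (X, (f0, f1), _). (X, (g0 o[E0] f0, g1 o[E1] f1), Z))\<rparr>)"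

definition glue_pr0 :: "(('ao, 'bo, 'sm) glue_ob, ('ao, 'am, 'bo, 'bm, 'sm) glue_arr, 'ao, 'am) func" where
 "glue_pr0 = \<lparr>fob = fst, far = (\<lambda>(X, f, Y). fst f)\<rparr>"

definition glue_pr1 :: "(('ao, 'bo, 'sm) glue_ob, ('ao, 'am, 'bo, 'bm, 'sm) glue_arr, 'bo, 'bm) func" where
 "glue_pr1 = \<lparr>fob = (\<lambda>X. fst (snd X)), far = (\<lambda>(X, f, Y). snd f)\<rparr>"

lemma glue_pr_simps [simp]:
 "fob glue_pr0 X = fst X" "fob glue_pr1 X = fst (snd X)"
 "far glue_pr0 (X, (f0, f1), Y) = f0" "far glue_pr1 (X, (f0, f1), Y) = f1"
 by (simp_all add: glue_pr0_def glue_pr1_def)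

locale gluing =
 fixes S :: "('so, 'sm) cat" and E0 :: "('ao, 'am) cat" and E1 :: "('bo, 'bm) cat" and L0 L1
 assumes topos_S: "topos S" and topos_E0: "topos E0" and topos_E1: "topos E1"
  and L0: "is_functor E0 S L0" and L1: "is_functor E1 S L1"
  and lex0: "preserves_finite_limits E0 S L0" and lex1: "preserves_finite_limits E1 S L1"
  and lifts0: "has_cartesian_lifts E0 S L0" and lifts1: "has_cartesian_lifts E1 S L1"
begin

abbreviation "P \<equiv> glue S E0 E1 L0 L1"
abbreviation ob0 :: "('ao, 'bo, 'sm) glue_ob => 'ao" where "ob0 X \<equiv> fst X"
abbreviation ob1 :: "('ao, 'bo, 'sm) glue_ob => 'bo" where "ob1 X \<equiv> fst (snd X)"
abbreviation "ar0 \<equiv> far (glue_pr0 :: (('ao, 'bo, 'sm) glue_ob, ('ao, 'am, 'bo, 'bm, 'sm) glue_arr, 'ao, 'am) func)"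
abbreviation "ar1 \<equiv> far (glue_pr1 :: (('ao, 'bo, 'sm) glue_ob, ('ao, 'am, 'bo, 'bm, 'sm) glue_arr, 'bo, 'bm) func)"
abbreviation theta :: "('ao, 'bo, 'sm) glue_ob => 'sm" where "theta X \<equiv> snd (snd X)"

lemma S: "category S" and E0: "category E0" and E1: "category E1"
 using topos_S topos_E0 topos_E1 by (auto simp: topos_def)

lemma lim0: "has_finite_limits E0" and lim1: "has_finite_limits E1" and limS: "has_finite_limits S"
 using topos_S topos_E0 topos_E1 by (auto simp: topos_def)

lemma glue_ob_iff: "X \<in> ob P \<longleftrightarrow> ob0 X \<in> ob E0 \<and> ob1 X \<in> ob E1 \<and> theta X \<in> hom S (fob L0 (ob0 X)) (fob L1 (ob1 X)) \<and> iso_arr S (theta X)"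
 by (cases X) (simp add: glue_def)

lemma glue_obI: "X0 \<in> ob E0 ==> X1 \<in> ob E1 ==> \<theta> \<in> hom S (fob L0 X0) (fob L1 X1) ==> iso_arr S \<theta> ==> (X0, X1, \<theta>) \<in> ob P"
 by (simp add: glue_ob_iff)

lemma theta_hom: "X \<in> ob P ==> theta X \<in> hom S (fob L0 (ob0 X)) (fob L1 (ob1 X))"
 by (simp add: glue_ob_iff)

lemma theta_iso: "X \<in> ob P ==> iso_arr S (theta X)"
 by (simp add: glue_ob_iff)

lemma glue_hom_iff:
 "f \<in> hom P X Y \<longleftrightarrow> X \<in> ob P \<and> Y \<in> ob P \<and> f = (X, (ar0 f, ar1 f), Y) \<and> ar0 f \<in> hom E0 (ob0 X) (ob0 Y) \<and>
   ar1 f \<in> hom E1 (ob1 X) (ob1 Y) \<and> theta Y o[S] far L0 (ar0 f) = far L1 (ar1 f) o[S] theta X"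
proof -
 obtain X' f0 f1 Y' where "f = (X', (f0, f1), Y')" by (metis prod.collapse)
 then show ?thesis unfolding hom_def[of P] by (auto simp: glue_def glue_pr0_def glue_pr1_def)
qed

lemma glue_homI:
 assumes "X \<in> ob P" "Y \<in> ob P" "f0 \<in> hom E0 (ob0 X) (ob0 Y)" "f1 \<in> hom E1 (ob1 X) (ob1 Y)"
  "theta Y o[S] far L0 f0 = far L1 f1 o[S] theta X"
 shows "(X, (f0, f1), Y) \<in> hom P X Y"
 using assms unfolding glue_hom_iff by simp

lemma ar_hom:
 assumes "f \<in> hom P X Y"
 shows "ar0 f \<in> hom E0 (ob0 X) (ob0 Y)" "ar1 f \<in> hom E1 (ob1 X) (ob1 Y)"
 using assms unfolding glue_hom_iff by auto

lemma ar_nat: "f \<in> hom P X Y ==> theta Y o[S] far L0 (ar0 f) = far L1 (ar1 f) o[S] theta X"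
 unfolding glue_hom_iff by auto

lemma glue_eqI:
 assumes "f \<in> hom P X Y" "g \<in> hom P X Y" "ar0 f = ar0 g" "ar1 f = ar1 g"
 shows "f = g"
 using assms unfolding glue_hom_iff by metis

lemma ar_comp:
 "ar0 (comp P g f) = ar0 g o[E0] ar0 f" "ar1 (comp P g f) = ar1 g o[E1] ar1 f"
 by (auto simp: glue_def glue_pr0_def glue_pr1_def split: prod.splits)

lemma ar_ident: "ar0 (ident P X) = ident E0 (ob0 X)" "ar1 (ident P X) = ident E1 (ob1 X)"
 by (simp_all add: glue_def glue_pr0_def glue_pr1_def)

lemma ident_glue_hom:
 assumes X: "X \<in> ob P"
 shows "ident P X \<in> hom P X X"
proof -
 have o: "ob0 X \<in> ob E0" "ob1 X \<in> ob E1" using X by (auto simp: glue_ob_iff)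
 have "ident P X = (X, (ident E0 (ob0 X), ident E1 (ob1 X)), X)" by (simp add: glue_def glue_pr0_def glue_pr1_def)
 moreover have "(X, (ident E0 (ob0 X), ident E1 (ob1 X)), X) \<in> hom P X X"
  using glue_homI[OF X X ident_hom[OF E0 o(1)] ident_hom[OF E1 o(2)]] functor_ident[OF L0 o(1)] functor_ident[OF L1 o(2)]
   comp_ident[OF S theta_hom[OF X]] by simp
 ultimately show ?thesis by simp
qed

lemma comp_glue_hom:
 assumes f: "f \<in> hom P X Y" and g: "g \<in> hom P Y Z"
 shows "comp P g f \<in> hom P X Z"
proof -
 note f' = ar_hom[OF f] and g' = ar_hom[OF g]
 have X: "X \<in> ob P" and Y: "Y \<in> ob P" and Z: "Z \<in> ob P" using f g by (auto simp: glue_hom_iff)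
 note t = theta_hom[OF X] theta_hom[OF Y] theta_hom[OF Z]
 have "theta Z o[S] far L0 (ar0 g o[E0] ar0 f) = (theta Z o[S] far L0 (ar0 g)) o[S] far L0 (ar0 f)"
  using functor_comp[OF L0 f'(1) g'(1)] comp_assoc[OF S functor_hom[OF L0 f'(1)] functor_hom[OF L0 g'(1)] t(3)] by simp
 also have "\<dots> = far L1 (ar1 g) o[S] (far L1 (ar1 f) o[S] theta X)"
  using ar_nat[OF g] comp_assoc[OF S functor_hom[OF L0 f'(1)] t(2) functor_hom[OF L1 g'(2)]] ar_nat[OF f] by simp
 also have "\<dots> = far L1 (ar1 g o[E1] ar1 f) o[S] theta X"
  using functor_comp[OF L1 f'(2) g'(2)] comp_assoc[OF S t(1) functor_hom[OF L1 f'(2)] functor_hom[OF L1 g'(2)]] by simp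
 finally have "(X, (ar0 g o[E0] ar0 f, ar1 g o[E1] ar1 f), Z) \<in> hom P X Z"
  by (rule glue_homI[OF X Z comp_hom[OF E0 f'(1) g'(1)] comp_hom[OF E1 f'(2) g'(2)]])
 moreover have "comp P g f = (X, (ar0 g o[E0] ar0 f, ar1 g o[E1] ar1 f), Z)"
 proof -
  have f_eq: "f = (X, (ar0 f, ar1 f), Y)" using f unfolding glue_hom_iff by blast
  have g_eq: "g = (Y, (ar0 g, ar1 g), Z)" using g unfolding glue_hom_iff by blast
  show ?thesis by (rule trans[OF arg_cong2[OF g_eq f_eq, of "comp P"]]) (simp add: glue_def)
 qed
 ultimately show ?thesis by simp
qed

lemma category_glue: "category P"
 unfolding category_def
proof (intro conjI ballI impI)
 fix f assume "f \<in> arr P"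
 then have f: "f \<in> hom P (dom P f) (cod P f)" by (rule homI)
 show "dom P f \<in> ob P" "cod P f \<in> ob P" using f by (auto simp: glue_hom_iff)
 then have i: "ident P (dom P f) \<in> hom P (dom P f) (dom P f)" "ident P (cod P f) \<in> hom P (cod P f) (cod P f)"
  by (simp_all add: ident_glue_hom)
 show "comp P f (ident P (dom P f)) = f" "comp P (ident P (cod P f)) f = f"
  using glue_eqI[OF comp_glue_hom[OF i(1) f] f] glue_eqI[OF comp_glue_hom[OF f i(2)] f] ar_hom[OF f]
  by (simp_all add: ar_comp ar_ident comp_ident[OF E0] comp_ident[OF E1])
next
 show "ident P X \<in> hom P X X" if "X \<in> ob P" for X using ident_glue_hom[OF that] .
next
 fix f g assume fg: "f \<in> arr P" "g \<in> arr P" "cod P f = dom P g"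
 show "comp P g f \<in> hom P (dom P f) (cod P g)" using comp_glue_hom fg homI by metis
next
 fix f g h assume a: "f \<in> arr P" "g \<in> arr P" "h \<in> arr P" "cod P f = dom P g \<and> cod P g = dom P h"
 define W X Y Z where d: "W = dom P f" "X = cod P f" "Y = cod P g" "Z = cod P h"
 have f: "f \<in> hom P W X" and g: "g \<in> hom P X Y" and h: "h \<in> hom P Y Z" using a by (auto simp: hom_def[of P] d)
 show "comp P h (comp P g f) = comp P (comp P h g) f"
  using glue_eqI[OF comp_glue_hom[OF comp_glue_hom[OF f g] h] comp_glue_hom[OF f comp_glue_hom[OF g h]]]
   comp_assoc[OF E0 ar_hom(1)[OF f] ar_hom(1)[OF g] ar_hom(1)[OF h]]
   comp_assoc[OF E1 ar_hom(2)[OF f] ar_hom(2)[OF g] ar_hom(2)[OF h]] by (simp add: ar_comp)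
qed

lemma pr0: "is_functor P E0 glue_pr0" and pr1: "is_functor P E1 glue_pr1"
proof -
 have *: "ar0 f \<in> hom E0 (ob0 (dom P f)) (ob0 (cod P f)) \<and> ar1 f \<in> hom E1 (ob1 (dom P f)) (ob1 (cod P f))"
  if "f \<in> arr P" for f
  using ar_hom[OF homI[OF that]] by blast
 show "is_functor P E0 glue_pr0" "is_functor P E1 glue_pr1"
  unfolding is_functor_def glue_pr_simps ar_comp ar_ident using * by (auto simp: glue_ob_iff)
qed

subsection \<open>Finite limits\<close>

text \<open>Limits in the pseudopullback are computed componentwise, since both functors to \<open>S\<close> preserve them; the gluing isomorphism is the induced comparison.\<close>

lemma glue_pullback:
 assumes f: "f \<in> hom P X Z" and g: "g \<in> hom P Y Z"
  and pb0: "is_pullback E0 (ar0 f) (ar0 g) p0 q0" and pb1: "is_pullback E1 (ar1 f) (ar1 g) p1 q1"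
 obtains p q where "is_pullback P f g p q" "ar0 p = p0" "ar0 q = q0" "ar1 p = p1" "ar1 q = q1"
proof -
 note f' = ar_hom[OF f] and g' = ar_hom[OF g]
 define Q0 Q1 where Q: "Q0 = dom E0 p0" "Q1 = dom E1 p1"
 have X: "X \<in> ob P" and Y: "Y \<in> ob P" and Z: "Z \<in> ob P" using f g by (auto simp: glue_hom_iff)
 have p0: "p0 \<in> hom E0 Q0 (ob0 X)" and q0: "q0 \<in> hom E0 Q0 (ob0 Y)" and c0: "ar0 f o[E0] p0 = ar0 g o[E0] q0"
  using pullbackD[OF pb0 f'(1) g'(1)] by (simp_all add: Q)
 have p1: "p1 \<in> hom E1 Q1 (ob1 X)" and q1: "q1 \<in> hom E1 Q1 (ob1 Y)" and c1: "ar1 f o[E1] p1 = ar1 g o[E1] q1"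
  using pullbackD[OF pb1 f'(2) g'(2)] by (simp_all add: Q)
 note tX = theta_hom[OF X] and tY = theta_hom[OF Y] and tZ = theta_hom[OF Z]
 obtain tX' where tX': "tX' \<in> hom S (fob L1 (ob1 X)) (fob L0 (ob0 X))" "tX' o[S] theta X = ident S (fob L0 (ob0 X))"
   "theta X o[S] tX' = ident S (fob L1 (ob1 X))"
  using iso_arrE[OF theta_iso[OF X] tX] by blast
 obtain tY' where tY': "tY' \<in> hom S (fob L1 (ob1 Y)) (fob L0 (ob0 Y))" "tY' o[S] theta Y = ident S (fob L0 (ob0 Y))"
   "theta Y o[S] tY' = ident S (fob L1 (ob1 Y))"
  using iso_arrE[OF theta_iso[OF Y] tY] by blast
 obtain tZ' where tZ': "tZ' \<in> hom S (fob L1 (ob1 Z)) (fob L0 (ob0 Z))" "tZ' o[S] theta Z = ident S (fob L0 (ob0 Z))"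
  using iso_arrE[OF theta_iso[OF Z] tZ] by blast
 note Lf0 = functor_hom[OF L0 f'(1)] and Lg0 = functor_hom[OF L0 g'(1)]
 note Lf1 = functor_hom[OF L1 f'(2)] and Lg1 = functor_hom[OF L1 g'(2)]
 note Lp0 = functor_hom[OF L0 p0] and Lq0 = functor_hom[OF L0 q0] and Lp1 = functor_hom[OF L1 p1] and Lq1 = functor_hom[OF L1 q1]
 have Lpb0: "is_pullback S (far L0 (ar0 f)) (far L0 (ar0 g)) (far L0 p0) (far L0 q0)"
  using lex0 pb0 by (simp add: preserves_finite_limits_def)
 have Lpb1: "is_pullback S (far L1 (ar1 f)) (far L1 (ar1 g)) (far L1 p1) (far L1 q1)"
  using lex1 pb1 by (simp add: preserves_finite_limits_def)
 have pbt: "is_pullback S (far L0 (ar0 f)) (far L0 (ar0 g)) (tX' o[S] far L1 p1) (tY' o[S] far L1 q1)"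
  by (rule pullback_cospan_iso[OF S Lf0 Lg0 Lf1 Lg1 Lpb1 tX tX' tY tY' tZ tZ' ar_nat[OF f] ar_nat[OF g]])
 obtain \<delta> where d: "\<delta> \<in> hom S (dom S (far L0 p0)) (dom S (tX' o[S] far L1 p1))" "iso_arr S \<delta>"
   "(tX' o[S] far L1 p1) o[S] \<delta> = far L0 p0" "(tY' o[S] far L1 q1) o[S] \<delta> = far L0 q0"
  using pullback_unique[OF S Lf0 Lg0 pbt Lpb0] by blast
 have \<delta>: "\<delta> \<in> hom S (fob L0 Q0) (fob L1 Q1)"
  using d(1) Lp0 comp_hom[OF S Lp1 tX'(1)] by (simp add: hom_def)
 have dp: "theta X o[S] far L0 p0 = far L1 p1 o[S] \<delta>" and dq: "theta Y o[S] far L0 q0 = far L1 q1 o[S] \<delta>"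
  using d(3,4) comp_assoc[OF S \<delta> Lp1 tX'(1)] comp_assoc[OF S \<delta> Lq1 tY'(1)]
   cancel_left[OF S tX'(1) tX tX'(3) comp_hom[OF S \<delta> Lp1]] cancel_left[OF S tY'(1) tY tY'(3) comp_hom[OF S \<delta> Lq1]] by simp_all
 define Q where "Q = (Q0, Q1, \<delta>)"
 have Qo: "Q \<in> ob P" unfolding Q_def
  using glue_obI[OF _ _ \<delta> d(2)] category_ob[OF E0 p0] category_ob[OF E1 p1] by simp
 define p q where pq: "p = (Q, (p0, p1), X)" "q = (Q, (q0, q1), Y)"
 have p: "p \<in> hom P Q X" and q: "q \<in> hom P Q Y" unfolding pq
  using glue_homI[OF Qo X, of p0 p1] glue_homI[OF Qo Y, of q0 q1] p0 p1 q0 q1 dp dq by (simp_all add: Q_def)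
 have "is_pullback P f g p q"
 proof (rule pullbackI'[OF f g p q])
  show "comp P f p = comp P g q"
   using glue_eqI[OF comp_glue_hom[OF p f] comp_glue_hom[OF q g]] c0 c1 by (simp add: ar_comp pq)
 next
  fix V a b assume a: "a \<in> hom P V X" and b: "b \<in> hom P V Y" and e: "comp P f a = comp P g b"
  have V: "V \<in> ob P" using a by (simp add: glue_hom_iff)
  note a' = ar_hom[OF a] and b' = ar_hom[OF b] and tV = theta_hom[OF V]
  have e0: "ar0 f o[E0] ar0 a = ar0 g o[E0] ar0 b" and e1: "ar1 f o[E1] ar1 a = ar1 g o[E1] ar1 b"
   using arg_cong[OF e, of ar0] arg_cong[OF e, of ar1] by (simp_all add: ar_comp)
  obtain h0 where h0: "h0 \<in> hom E0 (ob0 V) Q0" "p0 o[E0] h0 = ar0 a" "q0 o[E0] h0 = ar0 b"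
   using pullback_ex1[OF pb0 f'(1) g'(1) E0 a'(1) b'(1) e0] Q by blast
  obtain h1 where h1: "h1 \<in> hom E1 (ob1 V) Q1" "p1 o[E1] h1 = ar1 a" "q1 o[E1] h1 = ar1 b"
   using pullback_ex1[OF pb1 f'(2) g'(2) E1 a'(2) b'(2) e1] Q by blast
  note Lh0 = functor_hom[OF L0 h0(1)] and Lh1 = functor_hom[OF L1 h1(1)]
  have dom1: "dom S (far L1 p1) = fob L1 Q1" using Lp1 by (simp add: hom_def)
  have "\<delta> o[S] far L0 h0 = far L1 h1 o[S] theta V"
  proof (rule pullback_eqI[OF Lpb1 Lf1 Lg1 S])
   show "\<delta> o[S] far L0 h0 \<in> hom S (fob L0 (ob0 V)) (dom S (far L1 p1))"
    "far L1 h1 o[S] theta V \<in> hom S (fob L0 (ob0 V)) (dom S (far L1 p1))"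
    using comp_hom[OF S Lh0 \<delta>] comp_hom[OF S tV Lh1] dom1 by simp_all
   have "far L1 p1 o[S] (\<delta> o[S] far L0 h0) = theta X o[S] far L0 (ar0 a)"
    using comp_assoc[OF S Lh0 \<delta> Lp1] dp[symmetric] comp_assoc[OF S Lh0 Lp0 tX] functor_comp[OF L0 h0(1) p0] h0(2) by simp
   then show "far L1 p1 o[S] (\<delta> o[S] far L0 h0) = far L1 p1 o[S] (far L1 h1 o[S] theta V)"
    using ar_nat[OF a] comp_assoc[OF S tV Lh1 Lp1] functor_comp[OF L1 h1(1) p1] h1(2) by simp
   have "far L1 q1 o[S] (\<delta> o[S] far L0 h0) = theta Y o[S] far L0 (ar0 b)"
    using comp_assoc[OF S Lh0 \<delta> Lq1] dq[symmetric] comp_assoc[OF S Lh0 Lq0 tY] functor_comp[OF L0 h0(1) q0] h0(3) by simp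
   then show "far L1 q1 o[S] (\<delta> o[S] far L0 h0) = far L1 q1 o[S] (far L1 h1 o[S] theta V)"
    using ar_nat[OF b] comp_assoc[OF S tV Lh1 Lq1] functor_comp[OF L1 h1(1) q1] h1(3) by simp
  qed
  then have h: "(V, (h0, h1), Q) \<in> hom P V Q" using glue_homI[OF V Qo, of h0 h1] h0(1) h1(1) by (simp add: Q_def)
  have "comp P p (V, (h0, h1), Q) = a" "comp P q (V, (h0, h1), Q) = b"
   using glue_eqI[OF comp_glue_hom[OF h p] a] glue_eqI[OF comp_glue_hom[OF h q] b] h0 h1 by (simp_all add: ar_comp pq)
  then show "\<exists>h. h \<in> hom P V Q \<and> comp P p h = a \<and> comp P q h = b" using h by blast
 next
  fix V h k assume h: "h \<in> hom P V Q" and k: "k \<in> hom P V Q" and e: "comp P p h = comp P p k" "comp P q h = comp P q k"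
  have "ar0 h = ar0 k"
   using pullback_eqI[OF pb0 f'(1) g'(1) E0, of "ar0 h" "ob0 V" "ar0 k"] ar_hom(1)[OF h] ar_hom(1)[OF k]
    arg_cong[OF e(1), of ar0] arg_cong[OF e(2), of ar0] by (simp add: ar_comp pq Q Q_def)
  moreover have "ar1 h = ar1 k"
   using pullback_eqI[OF pb1 f'(2) g'(2) E1, of "ar1 h" "ob1 V" "ar1 k"] ar_hom(2)[OF h] ar_hom(2)[OF k]
    arg_cong[OF e(1), of ar1] arg_cong[OF e(2), of ar1] by (simp add: ar_comp pq Q Q_def)
  ultimately show "h = k" using glue_eqI[OF h k] by simp
 qed
 moreover have "ar0 p = p0" "ar0 q = q0" unfolding pq by simp_all
 moreover have "ar1 p = p1" "ar1 q = q1" unfolding pq by simp_all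
 ultimately show thesis by (rule that)
qed

lemma glue_terminal:
 assumes X: "X \<in> ob P" and t0: "is_terminal E0 (ob0 X)" and t1: "is_terminal E1 (ob1 X)"
 shows "is_terminal P X"
 unfolding is_terminal_def
proof (intro conjI ballI)
 show "X \<in> ob P" by (rule X)
 fix Z assume Z: "Z \<in> ob P"
 then have "ob0 Z \<in> ob E0" "ob1 Z \<in> ob E1" by (auto simp: glue_ob_iff)
 then obtain f0 f1 where f: "f0 \<in> hom E0 (ob0 Z) (ob0 X)" "f1 \<in> hom E1 (ob1 Z) (ob1 X)"
  using terminal_hom t0 t1 by metis
 have LX: "is_terminal S (fob L1 (ob1 X))" using lex1 t1 by (simp add: preserves_finite_limits_def)
 have "theta X o[S] far L0 f0 = far L1 f1 o[S] theta Z"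
  using terminal_eq[OF LX S comp_hom[OF S functor_hom[OF L0 f(1)] theta_hom[OF X]]
   comp_hom[OF S theta_hom[OF Z] functor_hom[OF L1 f(2)]]] .
 then have "(Z, (f0, f1), X) \<in> hom P Z X" using glue_homI[OF Z X f] by simp
 moreover have "g = h" if "g \<in> hom P Z X" "h \<in> hom P Z X" for g h
  using glue_eqI[OF that] terminal_eq[OF t0 E0] terminal_eq[OF t1 E1] ar_hom[OF that(1)] ar_hom[OF that(2)] by metis
 ultimately show "\<exists>!f. f \<in> hom P Z X" by blast
qed

lemma glue_terminal_exists:
 assumes t0: "is_terminal E0 t0" and t1: "is_terminal E1 t1"
 obtains \<theta> where "is_terminal P (t0, t1, \<theta>)"
proof -
 have LT: "is_terminal S (fob L0 t0)" "is_terminal S (fob L1 t1)"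
  using lex0 lex1 t0 t1 by (auto simp: preserves_finite_limits_def)
 then obtain \<theta> where \<theta>: "\<theta> \<in> hom S (fob L0 t0) (fob L1 t1)" using terminal_hom is_terminal_def by metis
 have "(t0, t1, \<theta>) \<in> ob P"
  using glue_obI[OF _ _ \<theta> terminal_iso[OF S LT \<theta>]] t0 t1 by (auto simp: is_terminal_def)
 then show thesis using that glue_terminal[of "(t0, t1, \<theta>)"] t0 t1 by simp
qed

lemma glue_finite_limits: "has_finite_limits P"
 unfolding has_finite_limits_def
proof (intro conjI ballI impI)
 show "\<exists>t. is_terminal P t" using lim0 lim1 glue_terminal_exists unfolding has_finite_limits_def by metis
 fix f g assume a: "f \<in> arr P" "g \<in> arr P" "cod P f = cod P g"
 define X Y Z where d: "X = dom P f" "Y = dom P g" "Z = cod P f"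
 have f: "f \<in> hom P X Z" and g: "g \<in> hom P Y Z" using a by (auto simp: hom_def[of P] d)
 obtain p0 q0 where pb0: "is_pullback E0 (ar0 f) (ar0 g) p0 q0"
  using pullback_exists[OF lim0 ar_hom(1)[OF f] ar_hom(1)[OF g]] .
 obtain p1 q1 where pb1: "is_pullback E1 (ar1 f) (ar1 g) p1 q1"
  using pullback_exists[OF lim1 ar_hom(2)[OF f] ar_hom(2)[OF g]] .
 show "\<exists>p q. is_pullback P f g p q" using glue_pullback[OF f g pb0 pb1] by blast
qed

lemma pr0_lex: "preserves_finite_limits P E0 glue_pr0" and pr1_lex: "preserves_finite_limits P E1 glue_pr1"
proof -
 have T: "is_terminal E0 (ob0 t) \<and> is_terminal E1 (ob1 t)" if t: "is_terminal P t" for t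
 proof -
  obtain t0 t1 where t01: "is_terminal E0 t0" "is_terminal E1 t1"
   using lim0 lim1 unfolding has_finite_limits_def by auto
  obtain \<theta> where th: "is_terminal P (t0, t1, \<theta>)" using glue_terminal_exists[OF t01] .
  show ?thesis
   using preserves_terminalI[OF category_glue E0 pr0 th _ t] preserves_terminalI[OF category_glue E1 pr1 th _ t] t01 by simp
 qed
 have B: "is_pullback E0 (ar0 f) (ar0 g) (ar0 p) (ar0 q) \<and> is_pullback E1 (ar1 f) (ar1 g) (ar1 p) (ar1 q)"
  if pb: "is_pullback P f g p q" for f g p q
 proof -
  define X Y Z where d: "X = dom P f" "Y = dom P g" "Z = cod P f"
  have f: "f \<in> hom P X Z" and g: "g \<in> hom P Y Z" using pb by (auto simp: is_pullback_def hom_def[of P] d)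
  obtain p0 q0 where pb0: "is_pullback E0 (ar0 f) (ar0 g) p0 q0"
   using pullback_exists[OF lim0 ar_hom(1)[OF f] ar_hom(1)[OF g]] .
  obtain p1 q1 where pb1: "is_pullback E1 (ar1 f) (ar1 g) p1 q1"
   using pullback_exists[OF lim1 ar_hom(2)[OF f] ar_hom(2)[OF g]] .
  obtain p' q' where pq: "is_pullback P f g p' q'" "ar0 p' = p0" "ar0 q' = q0" "ar1 p' = p1" "ar1 q' = q1"
   using glue_pullback[OF f g pb0 pb1] .
  show ?thesis
   using preserves_pullbackI[OF category_glue E0 pr0 f g pq(1) _ pb] preserves_pullbackI[OF category_glue E1 pr1 f g pq(1) _ pb]
    pb0 pb1 pq by simp
 qed
 show "preserves_finite_limits P E0 glue_pr0" "preserves_finite_limits P E1 glue_pr1"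
  using T B by (auto simp: preserves_finite_limits_def)
qed

text \<open>The components of a monomorphism are monic because the projections preserve finite limits.\<close>

lemma glue_monic:
 assumes "monic P m" "m \<in> hom P X Y"
 shows "monic E0 (ar0 m)" "monic E1 (ar1 m)"
 using lex_monic[OF category_glue E0 pr0 pr0_lex assms] lex_monic[OF category_glue E1 pr1 pr1_lex assms] .

text \<open>
 An arrow between the underlying objects of \<open>P\<close> is compatible with the gluing isomorphisms as
 soon as it is so after composition with a monomorphism of \<open>P\<close>.
\<close>

lemma glue_hom_through_monic:
 assumes m: "monic P m" "m \<in> hom P U X" and a: "a \<in> hom P V X"
  and h0: "h0 \<in> hom E0 (ob0 V) (ob0 U)" "ar0 m o[E0] h0 = ar0 a"
  and h1: "h1 \<in> hom E1 (ob1 V) (ob1 U)" "ar1 m o[E1] h1 = ar1 a"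
 shows "(V, (h0, h1), U) \<in> hom P V U" "comp P m (V, (h0, h1), U) = a"
proof -
 have U: "U \<in> ob P" and V: "V \<in> ob P" and X: "X \<in> ob P" using m a by (auto simp: glue_hom_iff)
 note m' = ar_hom[OF m(2)] and tV = theta_hom[OF V] and tU = theta_hom[OF U] and tX = theta_hom[OF X]
 note Lm0 = functor_hom[OF L0 m'(1)] and Lm1 = functor_hom[OF L1 m'(2)]
 note Lh0 = functor_hom[OF L0 h0(1)] and Lh1 = functor_hom[OF L1 h1(1)]
 have Lm: "monic S (far L1 (ar1 m))" using lex_monic[OF E1 S L1 lex1 glue_monic(2)[OF m] m'(2)] .
 have "far L1 (ar1 m) o[S] (theta U o[S] far L0 h0) = theta X o[S] far L0 (ar0 a)"
  using comp_assoc[OF S Lh0 tU Lm1] ar_nat[OF m(2), symmetric] comp_assoc[OF S Lh0 Lm0 tX]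
   functor_comp[OF L0 h0(1) m'(1)] h0(2) by simp
 also have "\<dots> = far L1 (ar1 m) o[S] (far L1 h1 o[S] theta V)"
  using ar_nat[OF a] comp_assoc[OF S tV Lh1 Lm1] functor_comp[OF L1 h1(1) m'(2)] h1(2) by simp
 finally have "theta U o[S] far L0 h0 = far L1 h1 o[S] theta V"
  using monicD[OF Lm Lm1 S comp_hom[OF S Lh0 tU] comp_hom[OF S tV Lh1]] by simp
 then show h: "(V, (h0, h1), U) \<in> hom P V U" using glue_homI[OF V U h0(1) h1(1)] by simp
 show "comp P m (V, (h0, h1), U) = a"
  using glue_eqI[OF comp_glue_hom[OF h m(2)] a] h0 h1 by (simp add: ar_comp)
qed

text \<open>If both components of \<open>x\<close> split, then \<open>x\<close> is extremal, even when the sections do not fit together.\<close>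

lemma glue_extremal:
 assumes x: "x \<in> hom P X N"
  and s0: "s0 \<in> hom E0 (ob0 N) (ob0 X)" "ar0 x o[E0] s0 = ident E0 (ob0 N)"
  and s1: "s1 \<in> hom E1 (ob1 N) (ob1 X)" "ar1 x o[E1] s1 = ident E1 (ob1 N)"
 shows "extremal P x"
proof (rule extremalI[OF x])
 fix m J g assume m: "monic P m" "m \<in> hom P J N" and g: "g \<in> hom P X J" and mg: "comp P m g = x"
 have N: "N \<in> ob P" using x by (simp add: glue_hom_iff)
 note g' = ar_hom[OF g] and m' = ar_hom[OF m(2)]
 have e: "ar0 m o[E0] (ar0 g o[E0] s0) = ar0 (ident P N)" "ar1 m o[E1] (ar1 g o[E1] s1) = ar1 (ident P N)"
  unfolding ar_ident
  using comp_assoc[OF E0 s0(1) g'(1) m'(1)] comp_assoc[OF E1 s1(1) g'(2) m'(2)] s0 s1 mg[symmetric] by (simp_all add: ar_comp)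
 have "\<exists>h. h \<in> hom P N J \<and> comp P m h = ident P N"
  using glue_hom_through_monic[OF m ident_glue_hom[OF N] comp_hom[OF E0 s0(1) g'(1)] e(1) comp_hom[OF E1 s1(1) g'(2)] e(2)]
  by blast
 then show "\<exists>t\<in>hom P N J. comp P m t = ident P N" by blast
qed

end

lemma cartesian_liftE:
 assumes "has_cartesian_lifts E S L" "Y \<in> ob E" "W \<in> ob S" "a \<in> hom S W (fob L Y)"
 obtains Z p \<omega> where "Z \<in> ob E" "p \<in> hom E Z Y" "\<omega> \<in> hom S (fob L Z) W" "iso_arr S \<omega>" "a o[S] \<omega> = far L p"
  "\<forall>V\<in>ob E. \<forall>f \<in> hom E V Y. \<forall>v \<in> hom S (fob L V) W. a o[S] v = far L f -->
    (\<exists>!g. g \<in> hom E V Z \<and> p o[E] g = f \<and> \<omega> o[S] far L g = v)"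
 using bspec[OF bspec[OF bspec[OF assms(1)[unfolded has_cartesian_lifts_def] assms(2)] assms(3)] assms(4)]
 by (elim bexE conjE) (rule that)

context gluing
begin

subsection \<open>Objects representing compatible pairs of arrows\<close>

text \<open>
 Subobject classifiers, exponentials and right adjoints to the projections are all
 instances of one construction: an object that represents pairs of arrows into \<open>R0\<close> and \<open>R1\<close>
 whose images agree in \<open>R\<close>. It is obtained by lifting the two projections of the pullback of
 \<open>r0\<close> and \<open>r1\<close> to cartesian arrows.
\<close>

lemma glue_object:
 assumes R0: "R0 \<in> ob E0" and R1: "R1 \<in> ob E1" and r0: "r0 \<in> hom S (fob L0 R0) R" and r1: "r1 \<in> hom S (fob L1 R1) R"
 obtains W p0 p1 where "W \<in> ob P" "p0 \<in> hom E0 (ob0 W) R0" "p1 \<in> hom E1 (ob1 W) R1"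
  "r0 o[S] far L0 p0 = (r1 o[S] far L1 p1) o[S] theta W"
  "\<forall>Z\<in>ob P. \<forall>f0 \<in> hom E0 (ob0 Z) R0. \<forall>f1 \<in> hom E1 (ob1 Z) R1.
    r0 o[S] far L0 f0 = (r1 o[S] far L1 f1) o[S] theta Z -->
    (\<exists>!g. g \<in> hom P Z W \<and> p0 o[E0] ar0 g = f0 \<and> p1 o[E1] ar1 g = f1)"
proof -
 obtain a0 a1 where pb: "is_pullback S r0 r1 a0 a1" using pullback_exists[OF limS r0 r1] .
 define V where "V = dom S a0"
 have a0: "a0 \<in> hom S V (fob L0 R0)" and a1: "a1 \<in> hom S V (fob L1 R1)" and ra: "r0 o[S] a0 = r1 o[S] a1"
  using pullbackD[OF pb r0 r1] by (simp_all add: V_def)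
 have V: "V \<in> ob S" using category_ob[OF S a0] by simp
 obtain W0 p0 w0 where W0: "W0 \<in> ob E0" and p0: "p0 \<in> hom E0 W0 R0" and w0: "w0 \<in> hom S (fob L0 W0) V" "iso_arr S w0"
  "a0 o[S] w0 = far L0 p0"
  and u0_all: "\<forall>Z\<in>ob E0. \<forall>f \<in> hom E0 Z R0. \<forall>v \<in> hom S (fob L0 Z) V. a0 o[S] v = far L0 f -->
   (\<exists>!g. g \<in> hom E0 Z W0 \<and> p0 o[E0] g = f \<and> w0 o[S] far L0 g = v)"
  by (rule cartesian_liftE[OF lifts0 R0 V a0]) (rule that)
 note u0 = u0_all[rule_format]
 obtain W1 p1 w1 where W1: "W1 \<in> ob E1" and p1: "p1 \<in> hom E1 W1 R1" and w1: "w1 \<in> hom S (fob L1 W1) V" "iso_arr S w1"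
  "a1 o[S] w1 = far L1 p1"
  and u1_all: "\<forall>Z\<in>ob E1. \<forall>f \<in> hom E1 Z R1. \<forall>v \<in> hom S (fob L1 Z) V. a1 o[S] v = far L1 f -->
   (\<exists>!g. g \<in> hom E1 Z W1 \<and> p1 o[E1] g = f \<and> w1 o[S] far L1 g = v)"
  by (rule cartesian_liftE[OF lifts1 R1 V a1]) (rule that)
 note u1 = u1_all[rule_format]
 obtain w' where w': "w' \<in> hom S V (fob L1 W1)" "w' o[S] w1 = ident S (fob L1 W1)" "w1 o[S] w' = ident S V"
  using iso_arrE[OF w1(2,1)] by blast
 have w'_iso: "iso_arr S w'" using iso_inverse[OF w1(1) w'] .
 define \<theta> where "\<theta> = w' o[S] w0"
 have \<theta>: "\<theta> \<in> hom S (fob L0 W0) (fob L1 W1)" unfolding \<theta>_def using comp_hom[OF S w0(1) w'(1)] .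
 have w1\<theta>: "w1 o[S] \<theta> = w0" unfolding \<theta>_def using cancel_left[OF S w'(1) w1(1) w'(3) w0(1)] .
 define W where "W = (W0, W1, \<theta>)"
 have W: "W \<in> ob P" unfolding W_def
  using glue_obI[OF W0 W1 \<theta>] iso_comp[OF S w0(1,2) w'(1) w'_iso] by (simp add: \<theta>_def)
 show thesis
 proof (rule that[OF W])
  show "p0 \<in> hom E0 (ob0 W) R0" "p1 \<in> hom E1 (ob1 W) R1" using p0 p1 by (simp_all add: W_def)
  note Lp0 = functor_hom[OF L0 p0] and Lp1 = functor_hom[OF L1 p1]
  have p1\<theta>: "far L1 p1 o[S] \<theta> = a1 o[S] w0"
   using w1(3)[symmetric] comp_assoc[OF S \<theta> w1(1) a1] w1\<theta> by simp
  have "r0 o[S] far L0 p0 = (r1 o[S] far L1 p1) o[S] \<theta>"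
   using comp_assoc[OF S \<theta> Lp1 r1] p1\<theta> comp_assoc[OF S w0(1) a1 r1] ra comp_assoc[OF S w0(1) a0 r0] w0(3) by simp
  then show "r0 o[S] far L0 p0 = (r1 o[S] far L1 p1) o[S] theta W" by (simp add: W_def)
  show "\<forall>Z\<in>ob P. \<forall>f0 \<in> hom E0 (ob0 Z) R0. \<forall>f1 \<in> hom E1 (ob1 Z) R1.
    r0 o[S] far L0 f0 = (r1 o[S] far L1 f1) o[S] theta Z -->
    (\<exists>!g. g \<in> hom P Z W \<and> p0 o[E0] ar0 g = f0 \<and> p1 o[E1] ar1 g = f1)"
  proof (intro ballI impI)
  fix Z f0 f1 assume Z: "Z \<in> ob P" and f0: "f0 \<in> hom E0 (ob0 Z) R0" and f1: "f1 \<in> hom E1 (ob1 Z) R1"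
   and e: "r0 o[S] far L0 f0 = (r1 o[S] far L1 f1) o[S] theta Z"
  have Z0: "ob0 Z \<in> ob E0" and Z1: "ob1 Z \<in> ob E1" using Z by (auto simp: glue_ob_iff)
  note tZ = theta_hom[OF Z] and Lf0 = functor_hom[OF L0 f0] and Lf1 = functor_hom[OF L1 f1]
  obtain t' where t': "t' \<in> hom S (fob L1 (ob1 Z)) (fob L0 (ob0 Z))" "t' o[S] theta Z = ident S (fob L0 (ob0 Z))"
   "theta Z o[S] t' = ident S (fob L1 (ob1 Z))"
   using iso_arrE[OF theta_iso[OF Z] tZ] by blast
  have "r0 o[S] far L0 f0 = r1 o[S] (far L1 f1 o[S] theta Z)" using e comp_assoc[OF S tZ Lf1 r1] by simp
  then obtain v where v: "v \<in> hom S (fob L0 (ob0 Z)) V" "a0 o[S] v = far L0 f0" "a1 o[S] v = far L1 f1 o[S] theta Z"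
   using pullback_ex1[OF pb r0 r1 S Lf0 comp_hom[OF S tZ Lf1]] V_def by blast
  obtain g0 where g0: "g0 \<in> hom E0 (ob0 Z) W0" "p0 o[E0] g0 = f0" "w0 o[S] far L0 g0 = v"
   using u0[OF Z0 f0 v(1,2)] by blast
  note v' = comp_hom[OF S t'(1) v(1)]
  have "a1 o[S] (v o[S] t') = far L1 f1"
   using comp_assoc[OF S t'(1) v(1) a1] v(3) cancel_right[OF S t'(1) tZ t'(3) Lf1] by simp
  then obtain g1 where g1: "g1 \<in> hom E1 (ob1 Z) W1" "p1 o[E1] g1 = f1" "w1 o[S] far L1 g1 = v o[S] t'"
   using u1[OF Z1 f1 v'] by blast
  note Lg0 = functor_hom[OF L0 g0(1)] and Lg1 = functor_hom[OF L1 g1(1)]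
  have "w1 o[S] (\<theta> o[S] far L0 g0) = v"
   using comp_assoc[OF S Lg0 \<theta> w1(1)] w1\<theta> g0(3) by simp
  moreover have "w1 o[S] (far L1 g1 o[S] theta Z) = v"
   using comp_assoc[OF S tZ Lg1 w1(1)] g1(3) cancel_right[OF S tZ t'(1,2) v(1)] by simp
  ultimately have "\<theta> o[S] far L0 g0 = far L1 g1 o[S] theta Z"
   using cancel_left[OF S w1(1) w'(1,2) comp_hom[OF S Lg0 \<theta>]] cancel_left[OF S w1(1) w'(1,2) comp_hom[OF S tZ Lg1]] by simp
  then have g: "(Z, (g0, g1), W) \<in> hom P Z W" using glue_homI[OF Z W, of g0 g1] g0 g1 by (simp add: W_def)
  have "h = (Z, (g0, g1), W)" if h: "h \<in> hom P Z W" "p0 o[E0] ar0 h = f0" "p1 o[E1] ar1 h = f1" for h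
  proof -
   have h0: "ar0 h \<in> hom E0 (ob0 Z) W0" and h1: "ar1 h \<in> hom E1 (ob1 Z) W1" using ar_hom[OF h(1)] by (simp_all add: W_def)
   have nat: "\<theta> o[S] far L0 (ar0 h) = far L1 (ar1 h) o[S] theta Z" using ar_nat[OF h(1)] by (simp add: W_def)
   note Lh0 = functor_hom[OF L0 h0] and Lh1 = functor_hom[OF L1 h1]
   have eq: "w0 o[S] far L0 (ar0 h) = (w1 o[S] far L1 (ar1 h)) o[S] theta Z"
    using w1\<theta>[symmetric] comp_assoc[OF S Lh0 \<theta> w1(1)] nat comp_assoc[OF S tZ Lh1 w1(1)] by simp
   have "w0 o[S] far L0 (ar0 h) = v"
   proof (rule pullback_eqI[OF pb r0 r1 S])
    show "w0 o[S] far L0 (ar0 h) \<in> hom S (fob L0 (ob0 Z)) (dom S a0)" "v \<in> hom S (fob L0 (ob0 Z)) (dom S a0)"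
     using comp_hom[OF S Lh0 w0(1)] v(1) by (simp_all add: V_def)
    show "a0 o[S] (w0 o[S] far L0 (ar0 h)) = a0 o[S] v"
     using comp_assoc[OF S Lh0 w0(1) a0] w0(3) functor_comp[OF L0 h0 p0] h(2) v(2) by simp
    show "a1 o[S] (w0 o[S] far L0 (ar0 h)) = a1 o[S] v"
     using eq comp_assoc[OF S tZ comp_hom[OF S Lh1 w1(1)] a1] comp_assoc[OF S Lh1 w1(1) a1] w1(3) functor_comp[OF L1 h1 p1] h(3) v(3) by simp
   qed
   then have h0': "ar0 h = g0" using u0[OF Z0 f0 v(1,2)] h0 h(2) g0 by blast
   have "w1 o[S] far L1 (ar1 h) = v o[S] t'"
    using \<open>w0 o[S] far L0 (ar0 h) = v\<close> eq cancel_right[OF S t'(1) tZ t'(3) comp_hom[OF S Lh1 w1(1)]] by simp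
   then have "ar1 h = g1" using u1[OF Z1 f1 v' \<open>a1 o[S] (v o[S] t') = far L1 f1\<close>] h1 h(3) g1 by blast
   then show ?thesis using glue_eqI[OF h(1) g] h0' by simp
  qed
  moreover have "p0 o[E0] ar0 (Z, (g0, g1), W) = f0" "p1 o[E1] ar1 (Z, (g0, g1), W) = f1" using g0 g1 by simp_all
  ultimately show "\<exists>!g. g \<in> hom P Z W \<and> p0 o[E0] ar0 g = f0 \<and> p1 o[E1] ar1 g = f1" using g by blast
  qed
 qed
qed

text \<open>The universal arrow from the projection to an object \<open>Y0\<close> of \<open>E0\<close> pairs \<open>Y0\<close> with the terminal object of \<open>E1\<close>: an arrow to the latter carries no information, so \<open>glue_object\<close> only retains the first component.\<close>

lemma pr0_universal:
 assumes Y: "Y \<in> ob E0"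
 shows "\<exists>G e. G \<in> ob P \<and> e \<in> hom E0 (fob glue_pr0 G) Y \<and>
   (\<forall>Z\<in>ob P. \<forall>f \<in> hom E0 (fob glue_pr0 Z) Y. \<exists>!g. g \<in> hom P Z G \<and> e o[E0] ar0 g = f)"
proof -
 obtain t1 where t1: "is_terminal E1 t1" using lim1 by (auto simp: has_finite_limits_def)
 have Lt: "is_terminal S (fob L1 t1)" using lex1 t1 by (simp add: preserves_finite_limits_def)
 then obtain r0 where r0: "r0 \<in> hom S (fob L0 Y) (fob L1 t1)" using terminal_hom[OF Lt functor_ob[OF L0 Y]] by blast
 have t1o: "t1 \<in> ob E1" "fob L1 t1 \<in> ob S" using t1 Lt by (auto simp: is_terminal_def)
 note r1 = ident_hom[OF S t1o(2)]
 obtain W p0 p1 where W: "W \<in> ob P" "p0 \<in> hom E0 (ob0 W) Y" "p1 \<in> hom E1 (ob1 W) t1"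
  and Weq: "r0 o[S] far L0 p0 = (ident S (fob L1 t1) o[S] far L1 p1) o[S] theta W"
  and ex1_all: "\<forall>Z\<in>ob P. \<forall>f0 \<in> hom E0 (ob0 Z) Y. \<forall>f1 \<in> hom E1 (ob1 Z) t1.
    r0 o[S] far L0 f0 = (ident S (fob L1 t1) o[S] far L1 f1) o[S] theta Z -->
    (\<exists>!g. g \<in> hom P Z W \<and> p0 o[E0] ar0 g = f0 \<and> p1 o[E1] ar1 g = f1)"
  by (rule glue_object[OF Y t1o(1) r0 r1]) (rule that)
 note ex1 = ex1_all[rule_format]
 have main: "\<exists>!g. g \<in> hom P Z W \<and> p0 o[E0] ar0 g = f" if Z: "Z \<in> ob P" and f: "f \<in> hom E0 (ob0 Z) Y" for Z f
 proof -
  obtain f1 where f1: "f1 \<in> hom E1 (ob1 Z) t1" using terminal_hom[OF t1] Z by (auto simp: glue_ob_iff)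
  have "r0 o[S] far L0 f = (ident S (fob L1 t1) o[S] far L1 f1) o[S] theta Z"
   by (rule terminal_eq[OF Lt S comp_hom[OF S functor_hom[OF L0 f] r0]
      comp_hom[OF S theta_hom[OF Z] comp_hom[OF S functor_hom[OF L1 f1] r1]]])
  from ex1[OF Z f f1 this] have ex: "\<exists>!g. g \<in> hom P Z W \<and> p0 o[E0] ar0 g = f \<and> p1 o[E1] ar1 g = f1" .
  have *: "p1 o[E1] ar1 g = f1" if "g \<in> hom P Z W" for g
   using terminal_eq[OF t1 E1 comp_hom[OF E1 ar_hom(2)[OF that] W(3)] f1] .
  have "g \<in> hom P Z W \<and> p0 o[E0] ar0 g = f \<and> p1 o[E1] ar1 g = f1 \<longleftrightarrow>
    g \<in> hom P Z W \<and> p0 o[E0] ar0 g = f" for g using * by blast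
  then show ?thesis using ex by simp
 qed
 show ?thesis unfolding glue_pr_simps
  by (rule exI[of _ W], rule exI[of _ p0]) (intro conjI ballI W(1,2) main)
qed

lemma pr1_universal:
 assumes Y: "Y \<in> ob E1"
 shows "\<exists>G e. G \<in> ob P \<and> e \<in> hom E1 (fob glue_pr1 G) Y \<and>
   (\<forall>Z\<in>ob P. \<forall>f \<in> hom E1 (fob glue_pr1 Z) Y. \<exists>!g. g \<in> hom P Z G \<and> e o[E1] ar1 g = f)"
proof -
 obtain t0 where t0: "is_terminal E0 t0" using lim0 by (auto simp: has_finite_limits_def)
 have Lt: "is_terminal S (fob L0 t0)" using lex0 t0 by (simp add: preserves_finite_limits_def)
 then obtain r1 where r1: "r1 \<in> hom S (fob L1 Y) (fob L0 t0)" using terminal_hom[OF Lt functor_ob[OF L1 Y]] by blast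
 have t0o: "t0 \<in> ob E0" "fob L0 t0 \<in> ob S" using t0 Lt by (auto simp: is_terminal_def)
 note r0 = ident_hom[OF S t0o(2)]
 obtain W p0 p1 where W: "W \<in> ob P" "p0 \<in> hom E0 (ob0 W) t0" "p1 \<in> hom E1 (ob1 W) Y"
  and Weq: "ident S (fob L0 t0) o[S] far L0 p0 = (r1 o[S] far L1 p1) o[S] theta W"
  and ex1_all: "\<forall>Z\<in>ob P. \<forall>f0 \<in> hom E0 (ob0 Z) t0. \<forall>f1 \<in> hom E1 (ob1 Z) Y.
    ident S (fob L0 t0) o[S] far L0 f0 = (r1 o[S] far L1 f1) o[S] theta Z -->
    (\<exists>!g. g \<in> hom P Z W \<and> p0 o[E0] ar0 g = f0 \<and> p1 o[E1] ar1 g = f1)"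
  by (rule glue_object[OF t0o(1) Y r0 r1]) (rule that)
 note ex1 = ex1_all[rule_format]
 have main: "\<exists>!g. g \<in> hom P Z W \<and> p1 o[E1] ar1 g = f" if Z: "Z \<in> ob P" and f: "f \<in> hom E1 (ob1 Z) Y" for Z f
 proof -
  obtain f0 where f0: "f0 \<in> hom E0 (ob0 Z) t0" using terminal_hom[OF t0] Z by (auto simp: glue_ob_iff)
  have "ident S (fob L0 t0) o[S] far L0 f0 = (r1 o[S] far L1 f) o[S] theta Z"
   by (rule terminal_eq[OF Lt S comp_hom[OF S functor_hom[OF L0 f0] r0]
      comp_hom[OF S theta_hom[OF Z] comp_hom[OF S functor_hom[OF L1 f] r1]]])
  from ex1[OF Z f0 f this] have ex: "\<exists>!g. g \<in> hom P Z W \<and> p0 o[E0] ar0 g = f0 \<and> p1 o[E1] ar1 g = f" .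
  have *: "p0 o[E0] ar0 g = f0" if "g \<in> hom P Z W" for g
   using terminal_eq[OF t0 E0 comp_hom[OF E0 ar_hom(1)[OF that] W(2)] f0] .
  have "g \<in> hom P Z W \<and> p0 o[E0] ar0 g = f0 \<and> p1 o[E1] ar1 g = f \<longleftrightarrow>
    g \<in> hom P Z W \<and> p1 o[E1] ar1 g = f" for g using * by blast
  then show ?thesis using ex by simp
 qed
 show ?thesis unfolding glue_pr_simps
  by (rule exI[of _ W], rule exI[of _ p1]) (intro conjI ballI W(1,3) main)
qed

subsection \<open>The subobject classifier\<close>

text \<open>A subobject of an object of \<open>P\<close> is a pair of subobjects whose images in \<open>S\<close> correspond along the gluing
 isomorphism. So it has two characteristic arrows, and these agree after classification in \<open>S\<close>; the
 glued classifier represents such pairs, with the classifier of \<open>S\<close> as the common target.\<close>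

lemma glue_subobject_classifier: "has_subobject_classifier P"
proof -
 obtain t0 \<Omega>0 tr0 where sc0: "subobject_classifier E0 t0 \<Omega>0 tr0"
  using topos_E0 by (auto simp: topos_def has_subobject_classifier_alt)
 obtain t1 \<Omega>1 tr1 where sc1: "subobject_classifier E1 t1 \<Omega>1 tr1"
  using topos_E1 by (auto simp: topos_def has_subobject_classifier_alt)
 obtain tS \<Omega>S trS where scS: "subobject_classifier S tS \<Omega>S trS"
  using topos_S by (auto simp: topos_def has_subobject_classifier_alt)
 have t0: "is_terminal E0 t0" and tr0: "tr0 \<in> hom E0 t0 \<Omega>0" using sc0 by (auto simp: subobject_classifier_def)
 have t1: "is_terminal E1 t1" and tr1: "tr1 \<in> hom E1 t1 \<Omega>1" using sc1 by (auto simp: subobject_classifier_def)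
 have tS: "is_terminal S tS" and trS: "trS \<in> hom S tS \<Omega>S" using scS by (auto simp: subobject_classifier_def)
 have Lt0: "is_terminal S (fob L0 t0)" and Lt1: "is_terminal S (fob L1 t1)"
  using t0 t1 lex0 lex1 by (auto simp: preserves_finite_limits_def)
 note Ltr0 = functor_hom[OF L0 tr0] and Ltr1 = functor_hom[OF L1 tr1]
 obtain r0 where r0': "r0 \<in> hom S (cod S (far L0 tr0)) \<Omega>S" "classifies S tS trS (far L0 tr0) r0"
  using scS monic_from_terminal[OF S Lt0 Ltr0] unfolding subobject_classifier_def by blast
 obtain r1 where r1': "r1 \<in> hom S (cod S (far L1 tr1)) \<Omega>S" "classifies S tS trS (far L1 tr1) r1"
  using scS monic_from_terminal[OF S Lt1 Ltr1] unfolding subobject_classifier_def by blast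
 have r0: "r0 \<in> hom S (fob L0 \<Omega>0) \<Omega>S" and r1: "r1 \<in> hom S (fob L1 \<Omega>1) \<Omega>S"
  using r0'(1) r1'(1) Ltr0 Ltr1 by (auto simp: hom_def)
 obtain k0 where k0: "k0 \<in> hom S (fob L0 t0) tS" "is_pullback S r0 trS (far L0 tr0) k0"
  using r0'(2) Ltr0 by (auto simp: classifies_def hom_def)
 obtain k1 where k1: "k1 \<in> hom S (fob L1 t1) tS" "is_pullback S r1 trS (far L1 tr1) k1"
  using r1'(2) Ltr1 by (auto simp: classifies_def hom_def)
 have Lclass0: "\<exists>u. is_pullback S (r0 o[S] far L0 c) trS (far L0 d) u"
  if c: "c \<in> hom E0 X \<Omega>0" and pb: "is_pullback E0 c tr0 d e" for c d e X
  using pullback_paste[OF S functor_hom[OF L0 c] Ltr0 r0 trS _ k0(2)] lex0 pb unfolding preserves_finite_limits_def by blast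
 have Lclass1: "\<exists>u. is_pullback S (r1 o[S] far L1 c) trS (far L1 d) u"
  if c: "c \<in> hom E1 X \<Omega>1" and pb: "is_pullback E1 c tr1 d e" for c d e X
  using pullback_paste[OF S functor_hom[OF L1 c] Ltr1 r1 trS _ k1(2)] lex1 pb unfolding preserves_finite_limits_def by blast
 \<comment> \<open>transport of a subobject of \<open>L1 X1\<close> along the gluing isomorphism of \<open>X\<close>\<close>
 have transport: "is_pullback S (c o[S] theta X) trS (t' o[S] d) u"
  if X: "X \<in> ob P" and c: "c \<in> hom S (fob L1 (ob1 X)) \<Omega>S" and pb: "is_pullback S c trS d u"
   and t': "t' \<in> hom S (fob L1 (ob1 X)) (fob L0 (ob0 X))" "t' o[S] theta X = ident S (fob L0 (ob0 X))"
    "theta X o[S] t' = ident S (fob L1 (ob1 X))" for X c d u t'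
 proof -
  have o: "tS \<in> ob S" "\<Omega>S \<in> ob S" using category_ob[OF S trS] by auto
  note iT = ident_hom[OF S o(1)] and iO = ident_hom[OF S o(2)]
  have u: "u \<in> hom S (dom S d) tS" using pullbackD(2)[OF pb c trS] .
  have cX: "c o[S] theta X \<in> hom S (fob L0 (ob0 X)) \<Omega>S" using comp_hom[OF S theta_hom[OF X] c] .
  have "is_pullback S (c o[S] theta X) trS (t' o[S] d) (ident S tS o[S] u)"
   by (rule pullback_cospan_iso[OF S cX trS c trS pb theta_hom[OF X] t' iT iT comp_ident(1)[OF S iT] comp_ident(1)[OF S iT]
      iO iO comp_ident(1)[OF S iO]])
    (use comp_ident[OF S cX] comp_ident[OF S trS] in simp_all)
  then show ?thesis using comp_ident(2)[OF S u] by simp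
 qed
 have o0: "\<Omega>0 \<in> ob E0" and o1: "\<Omega>1 \<in> ob E1" using category_ob[OF E0 tr0] category_ob[OF E1 tr1] by auto
 obtain W p0 p1 where W: "W \<in> ob P" "p0 \<in> hom E0 (ob0 W) \<Omega>0" "p1 \<in> hom E1 (ob1 W) \<Omega>1"
  and Weq: "r0 o[S] far L0 p0 = (r1 o[S] far L1 p1) o[S] theta W"
  and ex1_all: "\<forall>Z\<in>ob P. \<forall>f0 \<in> hom E0 (ob0 Z) \<Omega>0. \<forall>f1 \<in> hom E1 (ob1 Z) \<Omega>1.
    r0 o[S] far L0 f0 = (r1 o[S] far L1 f1) o[S] theta Z -->
    (\<exists>!g. g \<in> hom P Z W \<and> p0 o[E0] ar0 g = f0 \<and> p1 o[E1] ar1 g = f1)"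
  by (rule glue_object[OF o0 o1 r0 r1]) (rule that)
 note ex1 = ex1_all[rule_format]
 note p0 = W(2) and p1 = W(3) and W = W(1)
 have compat: "r0 o[S] far L0 (p0 o[E0] ar0 g) = (r1 o[S] far L1 (p1 o[E1] ar1 g)) o[S] theta Z"
  if g: "g \<in> hom P Z W" for g Z
 proof -
  have Z: "Z \<in> ob P" using g by (simp add: glue_hom_iff)
  note g' = ar_hom[OF g] and tZ = theta_hom[OF Z] and tW = theta_hom[OF W]
  note Lg0 = functor_hom[OF L0 g'(1)] and Lg1 = functor_hom[OF L1 g'(2)] and Lp0 = functor_hom[OF L0 p0] and Lp1 = functor_hom[OF L1 p1]
  have "r0 o[S] far L0 (p0 o[E0] ar0 g) = (r1 o[S] far L1 p1) o[S] (theta W o[S] far L0 (ar0 g))"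
   using functor_comp[OF L0 g'(1) p0] comp_assoc[OF S Lg0 Lp0 r0] Weq comp_assoc[OF S Lg0 tW comp_hom[OF S Lp1 r1]] by simp
  also have "\<dots> = (r1 o[S] far L1 (p1 o[E1] ar1 g)) o[S] theta Z"
   using ar_nat[OF g] comp_assoc[OF S tZ Lg1 comp_hom[OF S Lp1 r1]] comp_assoc[OF S Lg1 Lp1 r1] functor_comp[OF L1 g'(2) p1] by simp
  finally show ?thesis .
 qed
 have W_eqI: "g = h" if "g \<in> hom P Z W" "h \<in> hom P Z W" "p0 o[E0] ar0 g = p0 o[E0] ar0 h" "p1 o[E1] ar1 g = p1 o[E1] ar1 h" for g h Z
 proof -
  have Z: "Z \<in> ob P" using that(1) by (simp add: glue_hom_iff)
  show ?thesis
   using ex1[OF Z comp_hom[OF E0 ar_hom(1)[OF that(2)] p0] comp_hom[OF E1 ar_hom(2)[OF that(2)] p1] compat[OF that(2)]] that by blast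
 qed
 obtain \<theta>t where tP: "is_terminal P (t0, t1, \<theta>t)" using glue_terminal_exists[OF t0 t1] .
 define t where "t = (t0, t1, \<theta>t)"
 have tT: "is_terminal P t" and t: "t \<in> ob P" using tP by (auto simp: t_def is_terminal_def)
 have tr_eq: "r0 o[S] far L0 tr0 = (r1 o[S] far L1 tr1) o[S] theta t"
 proof -
  have th: "theta t \<in> hom S (fob L0 t0) (fob L1 t1)" using theta_hom[OF t] by (simp add: t_def)
  have "k1 o[S] theta t = k0" using terminal_eq[OF tS S comp_hom[OF S th k1(1)] k0(1)] .
  then show ?thesis
   using pullbackD(3)[OF k0(2) r0 trS] pullbackD(3)[OF k1(2) r1 trS] comp_assoc[OF S th k1(1) trS] by simp
 qed
 have "tr0 \<in> hom E0 (ob0 t) \<Omega>0" "tr1 \<in> hom E1 (ob1 t) \<Omega>1" using tr0 tr1 by (simp_all add: t_def)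
 from ex1[OF t this tr_eq] obtain tr where tr: "tr \<in> hom P t W" "p0 o[E0] ar0 tr = tr0" "p1 o[E1] ar1 tr = tr1"
  by blast
 have "\<exists>!\<chi>. \<chi> \<in> hom P (cod P m) W \<and> classifies P t tr m \<chi>" if mm: "monic P m" for m
 proof -
  define U X where UX: "U = dom P m" "X = cod P m"
  have m: "m \<in> hom P U X" using mm by (auto simp: monic_def UX hom_def[of P])
  have U: "U \<in> ob P" and X: "X \<in> ob P" using m by (auto simp: glue_hom_iff)
  note m' = ar_hom[OF m] and tX = theta_hom[OF X] and tU = theta_hom[OF U]
  note mm' = glue_monic[OF mm m]
  obtain t' where t': "t' \<in> hom S (fob L1 (ob1 X)) (fob L0 (ob0 X))" "t' o[S] theta X = ident S (fob L0 (ob0 X))"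
    "theta X o[S] t' = ident S (fob L1 (ob1 X))"
   using iso_arrE[OF theta_iso[OF X] tX] by blast
  have cd: "cod E0 (ar0 m) = ob0 X" "cod E1 (ar1 m) = ob1 X" "dom E0 (ar0 m) = ob0 U" "dom E1 (ar1 m) = ob1 U"
   using m' by (auto simp: hom_def)
  obtain c0 where c0: "c0 \<in> hom E0 (ob0 X) \<Omega>0" "classifies E0 t0 tr0 (ar0 m) c0"
   and c0_unique: "\<And>c. c \<in> hom E0 (ob0 X) \<Omega>0 ==> classifies E0 t0 tr0 (ar0 m) c ==> c = c0"
   using sc0 mm'(1) cd unfolding subobject_classifier_def by metis
  obtain c1 where c1: "c1 \<in> hom E1 (ob1 X) \<Omega>1" "classifies E1 t1 tr1 (ar1 m) c1"
   and c1_unique: "\<And>c. c \<in> hom E1 (ob1 X) \<Omega>1 ==> classifies E1 t1 tr1 (ar1 m) c ==> c = c1"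
   using sc1 mm'(2) cd unfolding subobject_classifier_def by metis
  obtain u0 where u0: "u0 \<in> hom E0 (ob0 U) t0" "is_pullback E0 c0 tr0 (ar0 m) u0" using c0(2) cd by (auto simp: classifies_def)
  obtain u1 where u1: "u1 \<in> hom E1 (ob1 U) t1" "is_pullback E1 c1 tr1 (ar1 m) u1" using c1(2) cd by (auto simp: classifies_def)
  note Lm0 = functor_hom[OF L0 m'(1)] and Lm1 = functor_hom[OF L1 m'(2)]
  note Lc0 = functor_hom[OF L0 c0(1)] and Lc1 = functor_hom[OF L1 c1(1)]
  note rc0 = comp_hom[OF S Lc0 r0] and rc1 = comp_hom[OF S Lc1 r1]
  have "r0 o[S] far L0 c0 = (r1 o[S] far L1 c1) o[S] theta X"
  proof -
   have dU: "dom S (far L0 (ar0 m)) = fob L0 (ob0 U)" "cod S (far L0 (ar0 m)) = fob L0 (ob0 X)" using Lm0 by (auto simp: hom_def)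
   obtain v0 where v0: "is_pullback S (r0 o[S] far L0 c0) trS (far L0 (ar0 m)) v0" using Lclass0[OF c0(1) u0(2)] by blast
   obtain v1 where v1: "is_pullback S (r1 o[S] far L1 c1) trS (far L1 (ar1 m)) v1" using Lclass1[OF c1(1) u1(2)] by blast
   have "is_pullback S ((r1 o[S] far L1 c1) o[S] theta X) trS (t' o[S] far L1 (ar1 m)) v1"
    by (rule transport[OF X rc1 v1 t'])
   moreover have "dom S (t' o[S] far L1 (ar1 m)) = fob L1 (ob1 U)" using comp_hom[OF S Lm1 t'(1)] by (simp add: hom_def)
   ultimately have pb: "is_pullback S ((r1 o[S] far L1 c1) o[S] theta X) trS ((t' o[S] far L1 (ar1 m)) o[S] theta U) (v1 o[S] theta U)"
    using pullback_iso[OF S comp_hom[OF S tX rc1] trS _ _ theta_iso[OF U]] tU by simp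
   have "(t' o[S] far L1 (ar1 m)) o[S] theta U = far L0 (ar0 m)"
    using comp_assoc[OF S tU Lm1 t'(1)] ar_nat[OF m, symmetric] cancel_left[OF S tX t'(1,2) Lm0] by simp
   with pb have pb: "is_pullback S ((r1 o[S] far L1 c1) o[S] theta X) trS (far L0 (ar0 m)) (v1 o[S] theta U)" by simp
   have "v0 \<in> hom S (fob L0 (ob0 U)) tS" "v1 o[S] theta U \<in> hom S (fob L0 (ob0 U)) tS"
    using pullbackD(2)[OF v0 rc0 trS] pullbackD(2)[OF pb comp_hom[OF S tX rc1] trS] dU by simp_all
   then have "classifies S tS trS (far L0 (ar0 m)) (r0 o[S] far L0 c0)"
    "classifies S tS trS (far L0 (ar0 m)) ((r1 o[S] far L1 c1) o[S] theta X)"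
    unfolding classifies_def dU using v0 pb by blast+
   moreover have "monic S (far L0 (ar0 m))" using lex_monic[OF E0 S L0 lex0 mm'(1) m'(1)] .
   ultimately show ?thesis
    using scS rc0 comp_hom[OF S tX rc1] dU unfolding subobject_classifier_def by metis
  qed
  then obtain \<chi> where \<chi>: "\<chi> \<in> hom P X W" "p0 o[E0] ar0 \<chi> = c0" "p1 o[E1] ar1 \<chi> = c1"
   using ex1[OF X c0(1) c1(1)] by blast
  note \<chi>' = ar_hom[OF \<chi>(1)] and tr' = ar_hom[OF tr(1)]
  obtain u where u: "u \<in> hom P U t" using terminal_hom[OF tT U] .
  have u': "ar0 u \<in> hom E0 (ob0 U) t0" "ar1 u \<in> hom E1 (ob1 U) t1" using ar_hom[OF u] by (simp_all add: t_def)
  have uu: "ar0 u = u0" "ar1 u = u1" using terminal_eq[OF t0 E0 u'(1) u0(1)] terminal_eq[OF t1 E1 u'(2) u1(1)] by auto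
  have "is_pullback P \<chi> tr m u"
  proof (rule pullbackI'[OF \<chi>(1) tr(1) m u])
   show "comp P \<chi> m = comp P tr u"
   proof (rule W_eqI[OF comp_glue_hom[OF m \<chi>(1)] comp_glue_hom[OF u tr(1)]])
    show "p0 o[E0] ar0 (comp P \<chi> m) = p0 o[E0] ar0 (comp P tr u)"
     using comp_assoc[OF E0 m'(1) \<chi>'(1) p0] comp_assoc[OF E0 _ tr'(1) p0] u' \<chi> tr uu pullbackD(3)[OF u0(2) c0(1) tr0] by (simp add: ar_comp t_def)
    show "p1 o[E1] ar1 (comp P \<chi> m) = p1 o[E1] ar1 (comp P tr u)"
     using comp_assoc[OF E1 m'(2) \<chi>'(2) p1] comp_assoc[OF E1 _ tr'(2) p1] u' \<chi> tr uu pullbackD(3)[OF u1(2) c1(1) tr1] by (simp add: ar_comp t_def)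
   qed
  next
   fix V a b assume a: "a \<in> hom P V X" and b: "b \<in> hom P V t" and e: "comp P \<chi> a = comp P tr b"
   note a' = ar_hom[OF a]
   have b': "ar0 b \<in> hom E0 (ob0 V) t0" "ar1 b \<in> hom E1 (ob1 V) t1" using ar_hom[OF b] by (simp_all add: t_def)
   have "c0 o[E0] ar0 a = tr0 o[E0] ar0 b"
    using arg_cong[OF e, of "\<lambda>x. p0 o[E0] ar0 x"] comp_assoc[OF E0 a'(1) \<chi>'(1) p0] comp_assoc[OF E0 _ tr'(1) p0] b' \<chi> tr by (simp add: ar_comp t_def)
   then obtain h0 where h0: "h0 \<in> hom E0 (ob0 V) (ob0 U)" "ar0 m o[E0] h0 = ar0 a"
    using pullback_ex1[OF u0(2) c0(1) tr0 E0 a'(1) b'(1)] cd by auto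
   have "c1 o[E1] ar1 a = tr1 o[E1] ar1 b"
    using arg_cong[OF e, of "\<lambda>x. p1 o[E1] ar1 x"] comp_assoc[OF E1 a'(2) \<chi>'(2) p1] comp_assoc[OF E1 _ tr'(2) p1] b' \<chi> tr by (simp add: ar_comp t_def)
   then obtain h1 where h1: "h1 \<in> hom E1 (ob1 V) (ob1 U)" "ar1 m o[E1] h1 = ar1 a"
    using pullback_ex1[OF u1(2) c1(1) tr1 E1 a'(2) b'(2)] cd by auto
   note h = glue_hom_through_monic[OF mm m a h0 h1]
   have "comp P u (V, (h0, h1), U) = b" using terminal_eq[OF tT category_glue comp_glue_hom[OF h(1) u] b] .
   then show "\<exists>h. h \<in> hom P V U \<and> comp P m h = a \<and> comp P u h = b" using h by blast
  next
   fix V h k assume "h \<in> hom P V U" "k \<in> hom P V U" "comp P m h = comp P m k"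
   then show "h = k" using monicD[OF mm m category_glue] by blast
  qed
  then have ex: "\<chi> \<in> hom P X W \<and> classifies P t tr m \<chi>" using \<chi>(1) u by (auto simp: classifies_def UX)
  have "\<psi> = \<chi>" if \<psi>: "\<psi> \<in> hom P X W" and cl: "classifies P t tr m \<psi>" for \<psi>
  proof -
   note \<psi>' = ar_hom[OF \<psi>]
   define b0 b1 where b: "b0 = p0 o[E0] ar0 \<psi>" "b1 = p1 o[E1] ar1 \<psi>"
   have b0: "b0 \<in> hom E0 (ob0 X) \<Omega>0" and b1: "b1 \<in> hom E1 (ob1 X) \<Omega>1"
    using comp_hom[OF E0 \<psi>'(1) p0] comp_hom[OF E1 \<psi>'(2) p1] by (simp_all add: b)
   obtain d0 e0 where pb0: "is_pullback E0 b0 tr0 d0 e0" using pullback_exists[OF lim0 b0 tr0] .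
   obtain d1 e1 where pb1: "is_pullback E1 b1 tr1 d1 e1" using pullback_exists[OF lim1 b1 tr1] .
   define D0 D1 where D: "D0 = dom E0 d0" "D1 = dom E1 d1"
   have d0: "d0 \<in> hom E0 D0 (ob0 X)" and e0: "e0 \<in> hom E0 D0 t0" using pullbackD[OF pb0 b0 tr0] by (simp_all add: D)
   have d1: "d1 \<in> hom E1 D1 (ob1 X)" and e1: "e1 \<in> hom E1 D1 t1" using pullbackD[OF pb1 b1 tr1] by (simp_all add: D)
   note Ld0 = functor_hom[OF L0 d0] and Ld1 = functor_hom[OF L1 d1]
   note rb0 = comp_hom[OF S functor_hom[OF L0 b0] r0] and rb1 = comp_hom[OF S functor_hom[OF L1 b1] r1]
   \<comment> \<open>the two pullbacks of truth fit together to an object \<open>D\<close> of the glued category\<close>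
   obtain v0 where v0: "is_pullback S (r0 o[S] far L0 b0) trS (far L0 d0) v0" using Lclass0[OF b0 pb0] by blast
   obtain v1 where v1: "is_pullback S (r1 o[S] far L1 b1) trS (far L1 d1) v1" using Lclass1[OF b1 pb1] by blast
   have v1': "is_pullback S (r0 o[S] far L0 b0) trS (t' o[S] far L1 d1) v1"
    using transport[OF X rb1 v1 t'] compat[OF \<psi>] by (simp add: b)
   obtain \<delta> where d': "\<delta> \<in> hom S (dom S (far L0 d0)) (dom S (t' o[S] far L1 d1))" "iso_arr S \<delta>"
    "(t' o[S] far L1 d1) o[S] \<delta> = far L0 d0"
    using pullback_unique[OF S rb0 trS v1' v0] by blast
   have \<delta>: "\<delta> \<in> hom S (fob L0 D0) (fob L1 D1)" using d'(1) Ld0 comp_hom[OF S Ld1 t'(1)] by (simp add: hom_def)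
   have \<delta>_eq: "theta X o[S] far L0 d0 = far L1 d1 o[S] \<delta>"
    using d'(3) comp_assoc[OF S \<delta> Ld1 t'(1)] cancel_left[OF S t'(1) tX t'(3) comp_hom[OF S \<delta> Ld1]] by simp
   define D where "D = (D0, D1, \<delta>)"
   have Do: "D \<in> ob P" unfolding D_def
    using glue_obI[OF _ _ \<delta> d'(2)] category_ob[OF E0 d0] category_ob[OF E1 d1] by simp
   have d: "(D, (d0, d1), X) \<in> hom P D X" using glue_homI[OF Do X, of d0 d1] d0 d1 \<delta>_eq by (simp add: D_def)
   obtain e where e: "e \<in> hom P D t" using terminal_hom[OF tT Do] .
   have e': "ar0 e = e0" "ar1 e = e1"
    using ar_hom[OF e] terminal_eq[OF t0 E0 _ e0] terminal_eq[OF t1 E1 _ e1] by (auto simp: t_def D_def)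
   have "comp P \<psi> (D, (d0, d1), X) = comp P tr e"
   proof (rule W_eqI[OF comp_glue_hom[OF d \<psi>] comp_glue_hom[OF e tr(1)]])
    show "p0 o[E0] ar0 (comp P \<psi> (D, (d0, d1), X)) = p0 o[E0] ar0 (comp P tr e)"
     using comp_assoc[OF E0 d0 \<psi>'(1) p0] comp_assoc[OF E0 _ tr'(1) p0, of e0] e0 e' tr pullbackD(3)[OF pb0 b0 tr0] by (simp add: ar_comp t_def b)
    show "p1 o[E1] ar1 (comp P \<psi> (D, (d0, d1), X)) = p1 o[E1] ar1 (comp P tr e)"
     using comp_assoc[OF E1 d1 \<psi>'(2) p1] comp_assoc[OF E1 _ tr'(2) p1, of e1] e1 e' tr pullbackD(3)[OF pb1 b1 tr1] by (simp add: ar_comp t_def b)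
   qed
   moreover obtain y where y: "is_pullback P \<psi> tr m y" using cl by (auto simp: classifies_def)
   ultimately obtain h where h: "h \<in> hom P D U" "comp P m h = (D, (d0, d1), X)"
    using pullback_ex1[OF y \<psi> tr(1) category_glue d e] UX by blast
   have y': "y \<in> hom P U t" "comp P \<psi> m = comp P tr y" using pullbackD[OF y \<psi> tr(1)] UX by auto
   have yy: "ar0 y = u0" "ar1 y = u1"
    using ar_hom[OF y'(1)] terminal_eq[OF t0 E0 _ u0(1)] terminal_eq[OF t1 E1 _ u1(1)] by (auto simp: t_def)
   have h0: "ar0 h \<in> hom E0 D0 (ob0 U)" "ar0 m o[E0] ar0 h = d0" and h1: "ar1 h \<in> hom E1 D1 (ob1 U)" "ar1 m o[E1] ar1 h = d1"
    using ar_hom[OF h(1)] arg_cong[OF h(2), of ar0] arg_cong[OF h(2), of ar1] by (simp_all add: D_def ar_comp)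
   have "is_pullback E0 b0 tr0 (ar0 m) u0"
   proof (rule pullbackI'[OF b0 tr0 m'(1) u0(1)])
    show "b0 o[E0] ar0 m = tr0 o[E0] u0"
     using arg_cong[OF y'(2), of "\<lambda>x. p0 o[E0] ar0 x"] comp_assoc[OF E0 m'(1) \<psi>'(1) p0] comp_assoc[OF E0 _ tr'(1) p0, of u0] u0 tr yy
     by (simp add: ar_comp t_def b)
    fix V x z assume x: "x \<in> hom E0 V (ob0 X)" and z: "z \<in> hom E0 V t0" and xz: "b0 o[E0] x = tr0 o[E0] z"
    obtain l where l: "l \<in> hom E0 V D0" "d0 o[E0] l = x" using pullback_ex1[OF pb0 b0 tr0 E0 x z xz] D by auto
    have "ar0 m o[E0] (ar0 h o[E0] l) = x" using comp_assoc[OF E0 l(1) h0(1) m'(1)] h0(2) l(2) by simp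
    then show "\<exists>l. l \<in> hom E0 V (ob0 U) \<and> ar0 m o[E0] l = x \<and> u0 o[E0] l = z"
     using comp_hom[OF E0 l(1) h0(1)] terminal_eq[OF t0 E0 comp_hom[OF E0 comp_hom[OF E0 l(1) h0(1)] u0(1)] z] by blast
   next
    fix V x z assume "x \<in> hom E0 V (ob0 U)" "z \<in> hom E0 V (ob0 U)" "ar0 m o[E0] x = ar0 m o[E0] z"
    then show "x = z" using monicD[OF mm'(1) m'(1) E0] by blast
   qed
   then have "classifies E0 t0 tr0 (ar0 m) b0" using u0(1) cd by (auto simp: classifies_def)
   then have b0c0: "b0 = c0" using c0_unique b0 by blast
   have "is_pullback E1 b1 tr1 (ar1 m) u1"
   proof (rule pullbackI'[OF b1 tr1 m'(2) u1(1)])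
    show "b1 o[E1] ar1 m = tr1 o[E1] u1"
     using arg_cong[OF y'(2), of "\<lambda>x. p1 o[E1] ar1 x"] comp_assoc[OF E1 m'(2) \<psi>'(2) p1] comp_assoc[OF E1 _ tr'(2) p1, of u1] u1 tr yy
     by (simp add: ar_comp t_def b)
    fix V x z assume x: "x \<in> hom E1 V (ob1 X)" and z: "z \<in> hom E1 V t1" and xz: "b1 o[E1] x = tr1 o[E1] z"
    obtain l where l: "l \<in> hom E1 V D1" "d1 o[E1] l = x" using pullback_ex1[OF pb1 b1 tr1 E1 x z xz] D by auto
    have "ar1 m o[E1] (ar1 h o[E1] l) = x" using comp_assoc[OF E1 l(1) h1(1) m'(2)] h1(2) l(2) by simp
    then show "\<exists>l. l \<in> hom E1 V (ob1 U) \<and> ar1 m o[E1] l = x \<and> u1 o[E1] l = z"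
     using comp_hom[OF E1 l(1) h1(1)] terminal_eq[OF t1 E1 comp_hom[OF E1 comp_hom[OF E1 l(1) h1(1)] u1(1)] z] by blast
   next
    fix V x z assume "x \<in> hom E1 V (ob1 U)" "z \<in> hom E1 V (ob1 U)" "ar1 m o[E1] x = ar1 m o[E1] z"
    then show "x = z" using monicD[OF mm'(2) m'(2) E1] by blast
   qed
   then have "classifies E1 t1 tr1 (ar1 m) b1" using u1(1) cd by (auto simp: classifies_def)
   then have b1c1: "b1 = c1" using c1_unique b1 by blast
   show ?thesis using W_eqI[OF \<psi> \<chi>(1)] b0c0 b1c1 \<chi> by (simp add: b)
  qed
  with ex show ?thesis unfolding UX(2)[symmetric] by blast
 qed
 then have "subobject_classifier P t W tr" using tT tr(1) by (simp add: subobject_classifier_def)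
 then show ?thesis unfolding has_subobject_classifier_alt by blast
qed

end

lemma exponential_ex1:
 assumes "exponential C X Y E P p q ev" "Z \<in> ob C" "is_product C Z X Q r s" "h \<in> hom C Q Y"
 shows "\<exists>!k. k \<in> hom C Z E \<and> transposes C P p q ev Q r s h k"
 using assms unfolding exponential_def by blast

lemma productD: "is_product C X Y P p q ==> p \<in> hom C P X" "is_product C X Y P p q ==> q \<in> hom C P Y"
 by (auto simp: is_product_def)

context gluing
begin

subsection \<open>Exponentials\<close>

lemma glue_product:
 assumes pr: "is_product P X Y Q p q"
 shows "is_product E0 (ob0 X) (ob0 Y) (ob0 Q) (ar0 p) (ar0 q)" "is_product E1 (ob1 X) (ob1 Y) (ob1 Q) (ar1 p) (ar1 q)"
proof -
 obtain t where t: "is_terminal P t" using glue_finite_limits by (auto simp: has_finite_limits_def)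
 show "is_product E0 (ob0 X) (ob0 Y) (ob0 Q) (ar0 p) (ar0 q)" "is_product E1 (ob1 X) (ob1 Y) (ob1 Q) (ar1 p) (ar1 q)"
  using preserves_product[OF category_glue E0 pr0 pr0_lex t pr] preserves_product[OF category_glue E1 pr1 pr1_lex t pr] by simp_all
qed

text \<open>An arrow \<open>Z \<times> X \<rightarrow> Y\<close> of \<open>P\<close> is a compatible pair of arrows in \<open>E0\<close> and \<open>E1\<close>, hence of their exponential transposes.
 Compatibility is tested in the exponential of \<open>S\<close> with base \<open>L1 Y1\<close> and exponent \<open>L1 X1\<close>, to which the images
 of both exponentials have a comparison arrow; \<open>glue_object\<close> represents the compatible pairs.\<close>

lemma glue_exponential:
 assumes X: "X \<in> ob P" and Y: "Y \<in> ob P"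
 shows "\<exists>E Q p q ev. exponential P X Y E Q p q ev"
proof -
 have o: "ob0 X \<in> ob E0" "ob1 X \<in> ob E1" "ob0 Y \<in> ob E0" "ob1 Y \<in> ob E1" using X Y by (auto simp: glue_ob_iff)
 note oL = functor_ob[OF L1 o(2)] functor_ob[OF L1 o(4)]
 obtain H0 Q0 p0 q0 ev0 where exp0: "exponential E0 (ob0 X) (ob0 Y) H0 Q0 p0 q0 ev0"
  using topos_E0 o unfolding topos_def cartesian_closed_alt by blast
 obtain H1 Q1 p1 q1 ev1 where exp1: "exponential E1 (ob1 X) (ob1 Y) H1 Q1 p1 q1 ev1"
  using topos_E1 o unfolding topos_def cartesian_closed_alt by blast
 obtain HS QS pS qS evS where expS: "exponential S (fob L1 (ob1 X)) (fob L1 (ob1 Y)) HS QS pS qS evS"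
  using topos_S oL unfolding topos_def cartesian_closed_alt by blast
 have H0: "H0 \<in> ob E0" and pr0': "is_product E0 H0 (ob0 X) Q0 p0 q0" and ev0: "ev0 \<in> hom E0 Q0 (ob0 Y)"
  using exp0 by (auto simp: exponential_def)
 have H1: "H1 \<in> ob E1" and pr1': "is_product E1 H1 (ob1 X) Q1 p1 q1" and ev1: "ev1 \<in> hom E1 Q1 (ob1 Y)"
  using exp1 by (auto simp: exponential_def)
 have HS: "HS \<in> ob S" and prS: "is_product S HS (fob L1 (ob1 X)) QS pS qS" and evS: "evS \<in> hom S QS (fob L1 (ob1 Y))"
  using expS by (auto simp: exponential_def)
 note pq0 = productD[OF pr0'] and pq1 = productD[OF pr1'] and pqS = productD[OF prS]
 note tX = theta_hom[OF X] and tY = theta_hom[OF Y]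
 obtain t0 where t0: "is_terminal E0 t0" using lim0 by (auto simp: has_finite_limits_def)
 obtain t1 where t1: "is_terminal E1 t1" using lim1 by (auto simp: has_finite_limits_def)
 \<comment> \<open>images of products, with second factor normalized to \<open>L1 X1\<close>\<close>
 have Lprod0: "is_product S (fob L0 Z) (fob L1 (ob1 X)) (fob L0 Q) (far L0 r) (theta X o[S] far L0 s)"
  if "is_product E0 Z (ob0 X) Q r s" for Z Q r s
  using product_iso[OF S preserves_product[OF E0 S L0 lex0 t0 that] tX theta_iso[OF X]] .
 have Lprod1: "is_product S (fob L1 Z) (fob L1 (ob1 X)) (fob L1 Q) (far L1 r) (far L1 s)"
  if "is_product E1 Z (ob1 X) Q r s" for Z Q r s
  using preserves_product[OF E1 S L1 lex1 t1 that] .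
 obtain r0 where r0: "r0 \<in> hom S (fob L0 H0) HS"
  "transposes S QS pS qS evS (fob L0 Q0) (far L0 p0) (theta X o[S] far L0 q0) (theta Y o[S] far L0 ev0) r0"
  using exponential_ex1[OF expS functor_ob[OF L0 H0] Lprod0[OF pr0'] comp_hom[OF S functor_hom[OF L0 ev0] tY]] by blast
 obtain r1 where r1: "r1 \<in> hom S (fob L1 H1) HS"
  "transposes S QS pS qS evS (fob L1 Q1) (far L1 p1) (far L1 q1) (far L1 ev1) r1"
  using exponential_ex1[OF expS functor_ob[OF L1 H1] Lprod1[OF pr1'] functor_hom[OF L1 ev1]] by blast
 obtain u0 where u0: "u0 \<in> hom S (fob L0 Q0) QS" "pS o[S] u0 = r0 o[S] far L0 p0" "qS o[S] u0 = theta X o[S] far L0 q0"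
  "evS o[S] u0 = theta Y o[S] far L0 ev0" using r0(2) unfolding transposes_def by blast
 obtain u1 where u1: "u1 \<in> hom S (fob L1 Q1) QS" "pS o[S] u1 = r1 o[S] far L1 p1" "qS o[S] u1 = far L1 q1"
  "evS o[S] u1 = far L1 ev1" using r1(2) unfolding transposes_def by blast
 note Lp0 = functor_hom[OF L0 pq0(1)] and Lq0 = functor_hom[OF L0 pq0(2)] and Lev0 = functor_hom[OF L0 ev0]
 note Lp1 = functor_hom[OF L1 pq1(1)] and Lq1 = functor_hom[OF L1 pq1(2)] and Lev1 = functor_hom[OF L1 ev1]
 \<comment> \<open>componentwise transposes are compatible if and only if the transposed arrows are\<close>
 have K: "r0 o[S] far L0 k0 = (r1 o[S] far L1 k1) o[S] theta Z \<longleftrightarrow> theta Y o[S] far L0 h0 = far L1 h1 o[S] theta Q"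
  if pr: "is_product P Z X Q r s" and k0: "k0 \<in> hom E0 (ob0 Z) H0" and k1: "k1 \<in> hom E1 (ob1 Z) H1"
   and v0: "v0 \<in> hom E0 (ob0 Q) Q0" "p0 o[E0] v0 = k0 o[E0] ar0 r" "q0 o[E0] v0 = ar0 s" "ev0 o[E0] v0 = h0"
   and v1: "v1 \<in> hom E1 (ob1 Q) Q1" "p1 o[E1] v1 = k1 o[E1] ar1 r" "q1 o[E1] v1 = ar1 s" "ev1 o[E1] v1 = h1"
  for Z Q r s k0 k1 v0 v1 h0 h1
 proof -
  note rs = productD[OF pr]
  have Z: "Z \<in> ob P" and Q: "Q \<in> ob P" using rs by (auto simp: glue_hom_iff)
  note r' = ar_hom[OF rs(1)] and s' = ar_hom[OF rs(2)] and tZ = theta_hom[OF Z] and tQ = theta_hom[OF Q]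
  note Lk0 = functor_hom[OF L0 k0] and Lk1 = functor_hom[OF L1 k1] and Lv0 = functor_hom[OF L0 v0(1)] and Lv1 = functor_hom[OF L1 v1(1)]
  note Lr0 = functor_hom[OF L0 r'(1)] and Lr1 = functor_hom[OF L1 r'(2)] and Ls0 = functor_hom[OF L0 s'(1)] and Ls1 = functor_hom[OF L1 s'(2)]
  note prQ = Lprod0[OF glue_product(1)[OF pr]]
  define w0 where "w0 = u0 o[S] far L0 v0"
  define w1 where "w1 = u1 o[S] (far L1 v1 o[S] theta Q)"
  note v1Q = comp_hom[OF S tQ Lv1]
  have w0: "w0 \<in> hom S (fob L0 (ob0 Q)) QS" and w1: "w1 \<in> hom S (fob L0 (ob0 Q)) QS"
   unfolding w0_def w1_def using comp_hom[OF S Lv0 u0(1)] comp_hom[OF S v1Q u1(1)] by simp_all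
  have a0: "pS o[S] w0 = (r0 o[S] far L0 k0) o[S] far L0 (ar0 r)"
   unfolding w0_def using comp_assoc[OF S Lv0 u0(1) pqS(1)] u0(2) comp_assoc[OF S Lv0 Lp0 r0(1)]
    functor_comp[OF L0 v0(1) pq0(1)] v0(2) functor_comp[OF L0 r'(1) k0] comp_assoc[OF S Lr0 Lk0 r0(1)] by simp
  have b0: "qS o[S] w0 = theta X o[S] far L0 (ar0 s)"
   unfolding w0_def using comp_assoc[OF S Lv0 u0(1) pqS(2)] u0(3) comp_assoc[OF S Lv0 Lq0 tX]
    functor_comp[OF L0 v0(1) pq0(2)] v0(3) by simp
  have c0: "evS o[S] w0 = theta Y o[S] far L0 h0"
   unfolding w0_def using comp_assoc[OF S Lv0 u0(1) evS] u0(4) comp_assoc[OF S Lv0 Lev0 tY]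
    functor_comp[OF L0 v0(1) ev0] v0(4) by simp
  have a1: "pS o[S] w1 = ((r1 o[S] far L1 k1) o[S] theta Z) o[S] far L0 (ar0 r)"
  proof -
   have "pS o[S] w1 = r1 o[S] (far L1 (p1 o[E1] v1) o[S] theta Q)"
    unfolding w1_def using comp_assoc[OF S v1Q u1(1) pqS(1)] u1(2) comp_assoc[OF S v1Q Lp1 r1(1)]
     functor_comp[OF L1 v1(1) pq1(1)] comp_assoc[OF S tQ Lv1 Lp1] by simp
   also have "far L1 (p1 o[E1] v1) o[S] theta Q = far L1 k1 o[S] (theta Z o[S] far L0 (ar0 r))"
    using v1(2) functor_comp[OF L1 r'(2) k1] comp_assoc[OF S tQ Lr1 Lk1] ar_nat[OF rs(1)] by simp
   finally show ?thesis
    using comp_assoc[OF S Lr0 tZ comp_hom[OF S Lk1 r1(1)]] comp_assoc[OF S comp_hom[OF S Lr0 tZ] Lk1 r1(1)] by simp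
  qed
  have b1: "qS o[S] w1 = theta X o[S] far L0 (ar0 s)"
   unfolding w1_def using comp_assoc[OF S v1Q u1(1) pqS(2)] u1(3) comp_assoc[OF S tQ Lv1 Lq1]
    functor_comp[OF L1 v1(1) pq1(2)] v1(3) ar_nat[OF rs(2)] by simp
  have c1: "evS o[S] w1 = far L1 h1 o[S] theta Q"
   unfolding w1_def using comp_assoc[OF S v1Q u1(1) evS] u1(4) comp_assoc[OF S tQ Lv1 Lev1]
    functor_comp[OF L1 v1(1) ev1] v1(4) by simp
  show ?thesis
  proof
   assume "r0 o[S] far L0 k0 = (r1 o[S] far L1 k1) o[S] theta Z"
   then have "w0 = w1" using product_eqI[OF prS S w0 w1] a0 a1 b0 b1 by simp
   then show "theta Y o[S] far L0 h0 = far L1 h1 o[S] theta Q" using c0 c1 by simp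
  next
   assume e: "theta Y o[S] far L0 h0 = far L1 h1 o[S] theta Q"
   have h: "theta Y o[S] far L0 h0 \<in> hom S (fob L0 (ob0 Q)) (fob L1 (ob1 Y))" using c0 comp_hom[OF S w0 evS] by simp
   have "transposes S QS pS qS evS (fob L0 (ob0 Q)) (far L0 (ar0 r)) (theta X o[S] far L0 (ar0 s))
     (theta Y o[S] far L0 h0) (r0 o[S] far L0 k0)"
    unfolding transposes_def using w0 a0 b0 c0 by blast
   moreover have "transposes S QS pS qS evS (fob L0 (ob0 Q)) (far L0 (ar0 r)) (theta X o[S] far L0 (ar0 s))
     (theta Y o[S] far L0 h0) ((r1 o[S] far L1 k1) o[S] theta Z)"
    unfolding transposes_def using w1 a1 b1 c1 e by (intro bexI[of _ w1]) simp_all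
   ultimately show "r0 o[S] far L0 k0 = (r1 o[S] far L1 k1) o[S] theta Z"
    using exponential_ex1[OF expS category_ob(1)[OF S tZ] prQ h] comp_hom[OF S Lk0 r0(1)]
     comp_hom[OF S tZ comp_hom[OF S Lk1 r1(1)]] by blast
  qed
 qed
 obtain W m0 m1 where W: "W \<in> ob P" "m0 \<in> hom E0 (ob0 W) H0" "m1 \<in> hom E1 (ob1 W) H1"
  and Weq: "r0 o[S] far L0 m0 = (r1 o[S] far L1 m1) o[S] theta W"
  and ex1_all: "\<forall>Z\<in>ob P. \<forall>f0 \<in> hom E0 (ob0 Z) H0. \<forall>f1 \<in> hom E1 (ob1 Z) H1.
    r0 o[S] far L0 f0 = (r1 o[S] far L1 f1) o[S] theta Z -->
    (\<exists>!g. g \<in> hom P Z W \<and> m0 o[E0] ar0 g = f0 \<and> m1 o[E1] ar1 g = f1)"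
  by (rule glue_object[OF H0 H1 r0(1) r1(1)]) (rule that)
 note ex1 = ex1_all[rule_format]
 obtain Q p q where pr: "is_product P W X Q p q" using product_exists[OF category_glue glue_finite_limits W(1) X] by blast
 note pq = productD[OF pr]
 have Q: "Q \<in> ob P" using pq by (simp add: glue_hom_iff)
 note p' = ar_hom[OF pq(1)] and q' = ar_hom[OF pq(2)]
 obtain w0 where w0: "w0 \<in> hom E0 (ob0 Q) Q0" "p0 o[E0] w0 = m0 o[E0] ar0 p" "q0 o[E0] w0 = ar0 q"
  using product_ex1[OF pr0' E0 comp_hom[OF E0 p'(1) W(2)] q'(1)] by blast
 obtain w1 where w1: "w1 \<in> hom E1 (ob1 Q) Q1" "p1 o[E1] w1 = m1 o[E1] ar1 p" "q1 o[E1] w1 = ar1 q"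
  using product_ex1[OF pr1' E1 comp_hom[OF E1 p'(2) W(3)] q'(2)] by blast
 define ev where "ev = (Q, (ev0 o[E0] w0, ev1 o[E1] w1), Y)"
 have ev: "ev \<in> hom P Q Y" unfolding ev_def
  using glue_homI[OF Q Y comp_hom[OF E0 w0(1) ev0] comp_hom[OF E1 w1(1) ev1]] K[OF pr W(2,3) w0 refl w1 refl] Weq by blast
 have ev': "ar0 ev = ev0 o[E0] w0" "ar1 ev = ev1 o[E1] w1" by (simp_all add: ev_def)
 have "\<exists>!k. k \<in> hom P Z W \<and> transposes P Q p q ev V r s h k"
  if Z: "Z \<in> ob P" and prV: "is_product P Z X V r s" and h: "h \<in> hom P V Y" for Z V r s h
 proof -
  note rs = productD[OF prV]
  note r' = ar_hom[OF rs(1)] and s' = ar_hom[OF rs(2)] and h' = ar_hom[OF h]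
  have Z': "ob0 Z \<in> ob E0" "ob1 Z \<in> ob E1" using Z by (auto simp: glue_ob_iff)
  note prV' = glue_product[OF prV]
  obtain k0 where k0: "k0 \<in> hom E0 (ob0 Z) H0" "transposes E0 Q0 p0 q0 ev0 (ob0 V) (ar0 r) (ar0 s) (ar0 h) k0"
   and k0_unique: "\<And>k. k \<in> hom E0 (ob0 Z) H0 ==> transposes E0 Q0 p0 q0 ev0 (ob0 V) (ar0 r) (ar0 s) (ar0 h) k ==> k = k0"
   using exponential_ex1[OF exp0 Z'(1) prV'(1) h'(1)] by blast
  obtain k1 where k1: "k1 \<in> hom E1 (ob1 Z) H1" "transposes E1 Q1 p1 q1 ev1 (ob1 V) (ar1 r) (ar1 s) (ar1 h) k1"
   and k1_unique: "\<And>k. k \<in> hom E1 (ob1 Z) H1 ==> transposes E1 Q1 p1 q1 ev1 (ob1 V) (ar1 r) (ar1 s) (ar1 h) k ==> k = k1"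
   using exponential_ex1[OF exp1 Z'(2) prV'(2) h'(2)] by blast
  obtain v0 where v0: "v0 \<in> hom E0 (ob0 V) Q0" "p0 o[E0] v0 = k0 o[E0] ar0 r" "q0 o[E0] v0 = ar0 s" "ev0 o[E0] v0 = ar0 h"
   using k0(2) unfolding transposes_def by blast
  obtain v1 where v1: "v1 \<in> hom E1 (ob1 V) Q1" "p1 o[E1] v1 = k1 o[E1] ar1 r" "q1 o[E1] v1 = ar1 s" "ev1 o[E1] v1 = ar1 h"
   using k1(2) unfolding transposes_def by blast
  have "r0 o[S] far L0 k0 = (r1 o[S] far L1 k1) o[S] theta Z"
   using K[OF prV k0(1) k1(1) v0 v1] ar_nat[OF h] by simp
  from ex1[OF Z k0(1) k1(1) this] obtain g where g: "g \<in> hom P Z W" "m0 o[E0] ar0 g = k0" "m1 o[E1] ar1 g = k1"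
   and g_unique: "\<And>l. l \<in> hom P Z W ==> m0 o[E0] ar0 l = k0 ==> m1 o[E1] ar1 l = k1 ==> l = g"
   by blast
  \<comment> \<open>\<open>l \<times> X\<close> followed by the comparison with the componentwise products\<close>
  have comp0: "p0 o[E0] (w0 o[E0] ar0 u) = (m0 o[E0] ar0 l) o[E0] ar0 r" "q0 o[E0] (w0 o[E0] ar0 u) = ar0 s"
   "ar0 (comp P ev u) = ev0 o[E0] (w0 o[E0] ar0 u)"
   and comp1: "p1 o[E1] (w1 o[E1] ar1 u) = (m1 o[E1] ar1 l) o[E1] ar1 r" "q1 o[E1] (w1 o[E1] ar1 u) = ar1 s"
   "ar1 (comp P ev u) = ev1 o[E1] (w1 o[E1] ar1 u)"
   if l: "l \<in> hom P Z W" and u: "u \<in> hom P V Q" "comp P p u = comp P l r" "comp P q u = s" for l u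
  proof -
   note l' = ar_hom[OF l] and u' = ar_hom[OF u(1)]
   have e: "ar0 p o[E0] ar0 u = ar0 l o[E0] ar0 r" "ar1 p o[E1] ar1 u = ar1 l o[E1] ar1 r"
    "ar0 q o[E0] ar0 u = ar0 s" "ar1 q o[E1] ar1 u = ar1 s"
    using arg_cong[OF u(2), of ar0] arg_cong[OF u(2), of ar1] arg_cong[OF u(3), of ar0] arg_cong[OF u(3), of ar1]
    by (simp_all only: ar_comp)
   show "p0 o[E0] (w0 o[E0] ar0 u) = (m0 o[E0] ar0 l) o[E0] ar0 r"
    using comp_assoc[OF E0 u'(1) w0(1) pq0(1)] w0(2) comp_assoc[OF E0 u'(1) p'(1) W(2)] e(1) comp_assoc[OF E0 r'(1) l'(1) W(2)] by simp
   show "q0 o[E0] (w0 o[E0] ar0 u) = ar0 s"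
    using comp_assoc[OF E0 u'(1) w0(1) pq0(2)] w0(3) e(3) by simp
   show "ar0 (comp P ev u) = ev0 o[E0] (w0 o[E0] ar0 u)"
    using comp_assoc[OF E0 u'(1) w0(1) ev0] ev'(1) by (simp only: ar_comp)
   show "p1 o[E1] (w1 o[E1] ar1 u) = (m1 o[E1] ar1 l) o[E1] ar1 r"
    using comp_assoc[OF E1 u'(2) w1(1) pq1(1)] w1(2) comp_assoc[OF E1 u'(2) p'(2) W(3)] e(2) comp_assoc[OF E1 r'(2) l'(2) W(3)] by simp
   show "q1 o[E1] (w1 o[E1] ar1 u) = ar1 s"
    using comp_assoc[OF E1 u'(2) w1(1) pq1(2)] w1(3) e(4) by simp
   show "ar1 (comp P ev u) = ev1 o[E1] (w1 o[E1] ar1 u)"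
    using comp_assoc[OF E1 u'(2) w1(1) ev1] ev'(2) by (simp only: ar_comp)
  qed
  obtain u where u: "u \<in> hom P V Q" "comp P p u = comp P g r" "comp P q u = s"
   using product_ex1[OF pr category_glue comp_glue_hom[OF rs(1) g(1)] rs(2)] by blast
  note u' = ar_hom[OF u(1)]
  note c0 = comp0[OF g(1) u] and c1 = comp1[OF g(1) u]
  have "w0 o[E0] ar0 u = v0"
   by (rule product_eqI[OF pr0' E0 comp_hom[OF E0 u'(1) w0(1)] v0(1)]) (use c0 v0 g in simp_all)
  moreover have "w1 o[E1] ar1 u = v1"
   by (rule product_eqI[OF pr1' E1 comp_hom[OF E1 u'(2) w1(1)] v1(1)]) (use c1 v1 g in simp_all)
  ultimately have "comp P ev u = h" using glue_eqI[OF comp_glue_hom[OF u(1) ev] h] c0 c1 v0 v1 by simp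
  then have "transposes P Q p q ev V r s h g" using u unfolding transposes_def by blast
  moreover have "l = g" if l: "l \<in> hom P Z W" and tl: "transposes P Q p q ev V r s h l" for l
  proof -
   obtain y where y: "y \<in> hom P V Q" "comp P p y = comp P l r" "comp P q y = s" and yh: "comp P ev y = h"
    using tl unfolding transposes_def by blast
   note y' = ar_hom[OF y(1)] and l' = ar_hom[OF l]
   note d0 = comp0[OF l y] and d1 = comp1[OF l y]
   have "transposes E0 Q0 p0 q0 ev0 (ob0 V) (ar0 r) (ar0 s) (ar0 h) (m0 o[E0] ar0 l)"
    unfolding transposes_def by (rule bexI[OF _ comp_hom[OF E0 y'(1) w0(1)]]) (use d0 yh in simp)
   then have "m0 o[E0] ar0 l = k0" using k0_unique[OF comp_hom[OF E0 l'(1) W(2)]] by blast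
   have "transposes E1 Q1 p1 q1 ev1 (ob1 V) (ar1 r) (ar1 s) (ar1 h) (m1 o[E1] ar1 l)"
    unfolding transposes_def by (rule bexI[OF _ comp_hom[OF E1 y'(2) w1(1)]]) (use d1 yh in simp)
   then have "m1 o[E1] ar1 l = k1" using k1_unique[OF comp_hom[OF E1 l'(2) W(3)]] by blast
   show ?thesis using g_unique[OF l \<open>m0 o[E0] ar0 l = k0\<close> \<open>m1 o[E1] ar1 l = k1\<close>] .
  qed
  ultimately show ?thesis using g(1) by blast
 qed
 then have "exponential P X Y W Q p q ev" unfolding exponential_def using W(1) pr ev by blast
 then show ?thesis by blast
qed

theorem glue_topos: "topos P"
 unfolding topos_def cartesian_closed_alt
 using category_glue glue_finite_limits glue_subobject_classifier glue_exponential
  product_exists[OF category_glue glue_finite_limits]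
 by (auto simp: has_finite_limits_def simp del: split_paired_Ex)

end

section \<open>Relabelling a category\<close>

text \<open>The universal property of a pseudopushout only speaks of toposes whose objects and arrows are elements of the universe. An isomorphism of categories moves the glued topos there.\<close>

locale iso_cats =
 fixes C :: "('o, 'm) cat" and D :: "('p, 'n) cat" and F G
 assumes C: "category C" and D: "category D" and F: "is_functor C D F" and G: "is_functor D C G"
  and GF_ob: "X \<in> ob C ==> fob G (fob F X) = X" and GF_ar: "f \<in> arr C ==> far G (far F f) = f"
  and FG_ob: "Y \<in> ob D ==> fob F (fob G Y) = Y" and FG_ar: "g \<in> arr D ==> far F (far G g) = g"
begin

lemma iso_cats_inverse: "iso_cats D C G F"
 using C D F G GF_ob GF_ar FG_ob FG_ar by unfold_locales auto

lemma G_hom': "g \<in> hom D V (fob F Y) ==> Y \<in> ob C ==> far G g \<in> hom C (fob G V) Y"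
 using functor_hom[OF G] GF_ob by metis

lemma F_hom': "f \<in> hom C (fob G V) Y ==> V \<in> ob D ==> far F f \<in> hom D V (fob F Y)"
 using functor_hom[OF F] FG_ob by metis

lemma FG: "g \<in> hom D X Y ==> far F (far G g) = g"
 using FG_ar by (simp add: hom_def)

lemma GF: "f \<in> hom C X Y ==> far G (far F f) = f"
 using GF_ar by (simp add: hom_def)

lemma F_terminal:
 assumes t: "is_terminal C t" shows "is_terminal D (fob F t)"
 unfolding is_terminal_def
proof (intro conjI ballI)
 have to: "t \<in> ob C" using t by (simp add: is_terminal_def)
 show "fob F t \<in> ob D" using functor_ob[OF F to] .
 fix X assume X: "X \<in> ob D"
 obtain f where f: "f \<in> hom C (fob G X) t" using terminal_hom[OF t functor_ob[OF G X]] .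
 have "g = far F f" if g: "g \<in> hom D X (fob F t)" for g
  using terminal_eq[OF t C G_hom'[OF g to] f] FG[OF g] by simp
 then show "\<exists>!f. f \<in> hom D X (fob F t)" using F_hom'[OF f X] by blast
qed

lemma F_pullback:
 assumes pb: "is_pullback C f g p q"
 shows "is_pullback D (far F f) (far F g) (far F p) (far F q)"
proof -
 define X Y Z P where d: "X = dom C f" "Y = dom C g" "Z = cod C f" "P = dom C p"
 have f: "f \<in> hom C X Z" and g: "g \<in> hom C Y Z" using pb by (auto simp: is_pullback_def hom_def d)
 have p: "p \<in> hom C P X" and q: "q \<in> hom C P Y" and pq: "f o[C] p = g o[C] q"
  using pullbackD[OF pb f g] by (simp_all add: d)
 have o: "X \<in> ob C" "Y \<in> ob C" "P \<in> ob C" using category_ob[OF C p] category_ob[OF C q] by auto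
 show ?thesis
 proof (rule pullbackI'[OF functor_hom[OF F f] functor_hom[OF F g] functor_hom[OF F p] functor_hom[OF F q]])
  show "far F f o[D] far F p = far F g o[D] far F q"
   using functor_comp[OF F p f] functor_comp[OF F q g] pq by simp
 next
  fix V a b assume V: "V \<in> ob D" and a: "a \<in> hom D V (fob F X)" and b: "b \<in> hom D V (fob F Y)"
   and e: "far F f o[D] a = far F g o[D] b"
  have "f o[C] far G a = g o[C] far G b"
   using arg_cong[OF e, of "far G"] functor_comp[OF G a functor_hom[OF F f]] functor_comp[OF G b functor_hom[OF F g]]
    GF[OF f] GF[OF g] by simp
  then obtain h where h: "h \<in> hom C (fob G V) P" "p o[C] h = far G a" "q o[C] h = far G b"
   using pullback_ex1[OF pb f g C G_hom'[OF a o(1)] G_hom'[OF b o(2)]] d by blast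
  have "far F p o[D] far F h = a" "far F q o[D] far F h = b"
   using functor_comp[OF F h(1) p] functor_comp[OF F h(1) q] h FG[OF a] FG[OF b] by simp_all
  then show "\<exists>h. h \<in> hom D V (fob F P) \<and> far F p o[D] h = a \<and> far F q o[D] h = b"
   using F_hom'[OF h(1) V] by blast
 next
  fix V h k assume h: "h \<in> hom D V (fob F P)" and k: "k \<in> hom D V (fob F P)"
   and e: "far F p o[D] h = far F p o[D] k" "far F q o[D] h = far F q o[D] k"
  have Gp: "far G (far F p o[D] l) = p o[C] far G l" "far G (far F q o[D] l) = q o[C] far G l"
   if "l \<in> hom D V (fob F P)" for l
   using functor_comp[OF G that functor_hom[OF F p]] functor_comp[OF G that functor_hom[OF F q]] GF[OF p] GF[OF q] by simp_all
  have "far G h = far G k"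
   using pullback_eqI[OF pb f g C, of "far G h" "fob G V" "far G k"] G_hom'[OF h o(3)] G_hom'[OF k o(3)]
    Gp[OF h] Gp[OF k] e d by simp
  then show "h = k" using FG[OF h] FG[OF k] by metis
 qed
qed

lemma F_product:
 assumes pr: "is_product C X Y P p q"
 shows "is_product D (fob F X) (fob F Y) (fob F P) (far F p) (far F q)"
 unfolding is_product_def
proof (intro conjI ballI)
 note p = productD(1)[OF pr] and q = productD(2)[OF pr]
 show "far F p \<in> hom D (fob F P) (fob F X)" "far F q \<in> hom D (fob F P) (fob F Y)"
  using functor_hom[OF F p] functor_hom[OF F q] by simp_all
 have o: "X \<in> ob C" "Y \<in> ob C" "P \<in> ob C" using category_ob[OF C p] category_ob[OF C q] by auto
 fix Z f g assume Z: "Z \<in> ob D" and f: "f \<in> hom D Z (fob F X)" and g: "g \<in> hom D Z (fob F Y)"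
 obtain h where h: "h \<in> hom C (fob G Z) P" "p o[C] h = far G f" "q o[C] h = far G g"
  using product_ex1[OF pr C G_hom'[OF f o(1)] G_hom'[OF g o(2)]] by blast
 have "far F p o[D] far F h = f" "far F q o[D] far F h = g"
  using functor_comp[OF F h(1) p] functor_comp[OF F h(1) q] h FG[OF f] FG[OF g] by simp_all
 moreover have "k = far F h" if k: "k \<in> hom D Z (fob F P)" "far F p o[D] k = f" "far F q o[D] k = g" for k
 proof -
  have "far G k = h"
   using product_eqI[OF pr C G_hom'[OF k(1) o(3)] h(1)] functor_comp[OF G k(1) functor_hom[OF F p]]
    functor_comp[OF G k(1) functor_hom[OF F q]] GF[OF p] GF[OF q] k h by simp
  then show ?thesis using FG[OF k(1)] by simp
 qed
 ultimately show "\<exists>!h. h \<in> hom D Z (fob F P) \<and> far F p o[D] h = f \<and> far F q o[D] h = g"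
  using F_hom'[OF h(1) Z] by blast
qed

lemma F_monic:
 assumes m: "monic C m" "m \<in> hom C X Y"
 shows "monic D (far F m)"
 using monic_iff_pullback[OF C m(2)] monic_iff_pullback[OF D functor_hom[OF F m(2)]] m
  F_pullback[of m m "ident C X" "ident C X"] functor_ident[OF F category_ob(1)[OF C m(2)]] by simp

lemma F_lex: "preserves_finite_limits C D F"
 by (simp add: preserves_finite_limits_def F_terminal F_pullback)

end

lemma (in iso_cats) F_extremal:
 assumes x: "extremal C x" "x \<in> hom C X N"
 shows "extremal D (far F x)"
proof (rule extremalI[OF functor_hom[OF F x(2)]])
 interpret I: iso_cats D C G F by (rule iso_cats_inverse)
 have o: "X \<in> ob C" "N \<in> ob C" using category_ob[OF C x(2)] by auto
 fix m J g assume m: "monic D m" "m \<in> hom D J (fob F N)" and g: "g \<in> hom D (fob F X) J" and e: "m o[D] g = far F x"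
 have J: "J \<in> ob D" using category_ob[OF D m(2)] by simp
 have Gm: "far G m \<in> hom C (fob G J) N" using G_hom'[OF m(2) o(2)] .
 have Gg: "far G g \<in> hom C X (fob G J)" using functor_hom[OF G g] GF_ob[OF o(1)] by simp
 have "far G m o[C] far G g = x" using functor_comp[OF G g m(2)] e GF[OF x(2)] by simp
 then obtain t where t: "t \<in> hom C N (fob G J)" "far G m o[C] t = ident C N"
  using extremalD[OF x I.F_monic[OF m] Gm Gg] by blast
 have "far F t \<in> hom D (fob F N) J" using functor_hom[OF F t(1)] FG_ob[OF J] by simp
 moreover have "m o[D] far F t = ident D (fob F N)"
  using functor_comp[OF F t(1) Gm] t(2) FG[OF m(2)] functor_ident[OF F o(2)] by simp
 ultimately show "\<exists>t\<in>hom D (fob F N) J. m o[D] t = ident D (fob F N)" by blast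
qed

lemma (in iso_cats) F_subobject_classifier:
 assumes sc: "subobject_classifier C t \<Omega> tr"
 shows "subobject_classifier D (fob F t) (fob F \<Omega>) (far F tr)"
proof -
 interpret I: iso_cats D C G F by (rule iso_cats_inverse)
 have t: "is_terminal C t" and tr: "tr \<in> hom C t \<Omega>" using sc by (auto simp: subobject_classifier_def)
 have o: "t \<in> ob C" "\<Omega> \<in> ob C" using category_ob[OF C tr] by auto
 have "\<exists>!\<chi>. \<chi> \<in> hom D (cod D m) (fob F \<Omega>) \<and> classifies D (fob F t) (far F tr) m \<chi>" if m: "monic D m" for m
 proof -
  have mh: "m \<in> hom D (dom D m) (cod D m)" using m unfolding monic_def by (blast intro: homI)
  note Gm = functor_hom[OF G mh]
  have dc: "dom C (far G m) = fob G (dom D m)" "cod C (far G m) = fob G (cod D m)" using Gm by (auto simp: hom_def)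
  have mo: "dom D m \<in> ob D" "cod D m \<in> ob D" using category_ob[OF D mh] by auto
  have "\<exists>!\<chi>. \<chi> \<in> hom C (cod C (far G m)) \<Omega> \<and> classifies C t tr (far G m) \<chi>"
   using sc I.F_monic[OF m mh] by (simp add: subobject_classifier_def)
  then obtain c where c: "c \<in> hom C (fob G (cod D m)) \<Omega>" "classifies C t tr (far G m) c"
   and uniq: "\<And>c'. c' \<in> hom C (fob G (cod D m)) \<Omega> ==> classifies C t tr (far G m) c' ==> c' = c" unfolding dc by blast
  obtain u where u: "u \<in> hom C (fob G (dom D m)) t" "is_pullback C c tr (far G m) u"
   using c(2) dc by (auto simp: classifies_def)
  have "is_pullback D (far F c) (far F tr) m (far F u)" using F_pullback[OF u(2)] FG[OF mh] by simp
  then have cl: "classifies D (fob F t) (far F tr) m (far F c)"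
   using F_hom'[OF u(1) mo(1)] by (auto simp: classifies_def)
  have "\<psi> = far F c" if psi: "\<psi> \<in> hom D (cod D m) (fob F \<Omega>)" "classifies D (fob F t) (far F tr) m \<psi>" for \<psi>
  proof -
   obtain v where v: "v \<in> hom D (dom D m) (fob F t)" "is_pullback D \<psi> (far F tr) m v"
    using psi(2) by (auto simp: classifies_def)
   have "is_pullback C (far G \<psi>) tr (far G m) (far G v)" using I.F_pullback[OF v(2)] GF[OF tr] by simp
   then have "classifies C t tr (far G m) (far G \<psi>)" using G_hom'[OF v(1) o(1)] dc by (auto simp: classifies_def)
   then have "far G \<psi> = c" using uniq[OF G_hom'[OF psi(1) o(2)]] by simp
   then show ?thesis using FG[OF psi(1)] by simp
  qed
  then show ?thesis using cl F_hom'[OF c(1) mo(2)] by blast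
 qed
 then show ?thesis using F_terminal[OF t] functor_hom[OF F tr] by (simp add: subobject_classifier_def)
qed

lemma (in iso_cats) F_exponential:
 assumes ex: "exponential C X Y E P p q ev"
 shows "exponential D (fob F X) (fob F Y) (fob F E) (fob F P) (far F p) (far F q) (far F ev)"
proof -
 interpret I: iso_cats D C G F by (rule iso_cats_inverse)
 have E: "E \<in> ob C" and pr: "is_product C E X P p q" and ev: "ev \<in> hom C P Y" using ex by (auto simp: exponential_def)
 note p = productD(1)[OF pr] and q = productD(2)[OF pr]
 have o: "P \<in> ob C" "X \<in> ob C" "Y \<in> ob C" using category_ob[OF C q] category_ob[OF C ev] by auto
 have "\<exists>!k. k \<in> hom D Z (fob F E) \<and> transposes D (fob F P) (far F p) (far F q) (far F ev) Q r s h k"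
  if Z: "Z \<in> ob D" and prQ: "is_product D Z (fob F X) Q r s" and h: "h \<in> hom D Q (fob F Y)" for Z Q r s h
 proof -
  note r = productD(1)[OF prQ] and s = productD(2)[OF prQ]
  have Q: "Q \<in> ob D" using category_ob[OF D r] by simp
  note Gr = functor_hom[OF G r]
  have prG: "is_product C (fob G Z) X (fob G Q) (far G r) (far G s)" using I.F_product[OF prQ] GF_ob[OF o(2)] by simp
  obtain k where k: "k \<in> hom C (fob G Z) E" "transposes C P p q ev (fob G Q) (far G r) (far G s) (far G h) k"
   and uniq: "\<And>k'. k' \<in> hom C (fob G Z) E ==> transposes C P p q ev (fob G Q) (far G r) (far G s) (far G h) k' ==> k' = k"
   using exponential_ex1[OF ex functor_ob[OF G Z] prG G_hom'[OF h o(3)]] by blast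
  obtain u where u: "u \<in> hom C (fob G Q) P" "p o[C] u = k o[C] far G r" "q o[C] u = far G s" "ev o[C] u = far G h"
   using k(2) unfolding transposes_def by blast
  have "far F p o[D] far F u = far F k o[D] r" "far F q o[D] far F u = s" "far F ev o[D] far F u = h"
   using functor_comp[OF F u(1) p] functor_comp[OF F u(1) q] functor_comp[OF F u(1) ev] functor_comp[OF F Gr k(1)]
    u FG[OF r] FG[OF s] FG[OF h] by simp_all
  then have tk: "transposes D (fob F P) (far F p) (far F q) (far F ev) Q r s h (far F k)"
   using F_hom'[OF u(1) Q] unfolding transposes_def by blast
  have "l = far F k" if l: "l \<in> hom D Z (fob F E)" and tl: "transposes D (fob F P) (far F p) (far F q) (far F ev) Q r s h l" for l
  proof -
   obtain v where v: "v \<in> hom D Q (fob F P)" "far F p o[D] v = l o[D] r" "far F q o[D] v = s" "far F ev o[D] v = h"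
    using tl unfolding transposes_def by blast
   have "p o[C] far G v = far G l o[C] far G r" "q o[C] far G v = far G s" "ev o[C] far G v = far G h"
    using functor_comp[OF G v(1) functor_hom[OF F p]] functor_comp[OF G v(1) functor_hom[OF F q]]
     functor_comp[OF G v(1) functor_hom[OF F ev]] functor_comp[OF G r l] v GF[OF p] GF[OF q] GF[OF ev] by simp_all
   then have "transposes C P p q ev (fob G Q) (far G r) (far G s) (far G h) (far G l)"
    using G_hom'[OF v(1) o(1)] unfolding transposes_def by blast
   then show ?thesis using uniq[OF G_hom'[OF l E]] FG[OF l] by simp
  qed
  then show ?thesis using tk F_hom'[OF k(1) Z] by blast
 qed
 then show ?thesis
  unfolding exponential_def using functor_ob[OF F E] F_product[OF pr] functor_hom[OF F ev] by blast
qed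

text \<open>All parts of the definition of a topos are invariant under isomorphism of categories.\<close>

lemma (in iso_cats) F_topos:
 assumes "topos C"
 shows "topos D"
proof -
 have lim: "has_finite_limits C" and cc: "cartesian_closed C" and sc: "has_subobject_classifier C" using assms by (auto simp: topos_def)
 have "has_finite_limits D" unfolding has_finite_limits_def
 proof (intro conjI ballI impI)
  show "\<exists>t. is_terminal D t" using lim F_terminal by (auto simp: has_finite_limits_def)
  fix f g assume fg: "f \<in> arr D" "g \<in> arr D" "cod D f = cod D g"
  have f: "f \<in> hom D (dom D f) (cod D f)" and g: "g \<in> hom D (dom D g) (cod D f)" using fg by (auto simp: hom_def)
  obtain p q where "is_pullback C (far G f) (far G g) p q"
   using pullback_exists[OF lim functor_hom[OF G f] functor_hom[OF G g]] .
  then show "\<exists>p q. is_pullback D f g p q" using F_pullback FG[OF f] FG[OF g] by fastforce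
 qed
 moreover have "\<exists>E P p q ev. exponential D X Y E P p q ev" if XY: "X \<in> ob D" "Y \<in> ob D" for X Y
 proof -
  obtain E P p q ev where "exponential C (fob G X) (fob G Y) E P p q ev"
   using cc functor_ob[OF G XY(1)] functor_ob[OF G XY(2)] unfolding cartesian_closed_alt by blast
  from F_exponential[OF this] show ?thesis unfolding FG_ob[OF XY(1)] FG_ob[OF XY(2)] by blast
 qed
 moreover have "has_subobject_classifier D"
  using sc F_subobject_classifier unfolding has_subobject_classifier_alt by blast
 ultimately show ?thesis
  unfolding topos_def cartesian_closed_alt using D product_exists[OF D] by (auto simp: has_finite_limits_def)
qed

text \<open>A category with at most as many objects and arrows as \<open>'u\<close> has elements is isomorphic to one on \<open>'u\<close>.\<close>

lemma relabel_exists: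
 fixes C :: "('o, 'm) cat" and a :: "'o => 'p" and b :: "'m => 'n"
 assumes C: "category C" and a: "inj_on a (ob C)" and b: "inj_on b (arr C)"
 shows "\<exists>(T :: ('p, 'n) cat) F G. iso_cats C T F G"
proof -
 define a' where "a' = inv_into (ob C) a"
 define b' where "b' = inv_into (arr C) b"
 have a': "a' (a X) = X" if "X \<in> ob C" for X using a that by (simp add: a'_def)
 have b': "b' (b f) = f" if "f \<in> arr C" for f using b that by (simp add: b'_def)
 define T :: "('p, 'n) cat" where "T = \<lparr>ob = a ` ob C, arr = b ` arr C, dom = (\<lambda>f. a (dom C (b' f))), cod = (\<lambda>f. a (cod C (b' f))),
  ident = (\<lambda>X. b (ident C (a' X))), comp = (\<lambda>g f. b (comp C (b' g) (b' f)))\<rparr>"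
 have T_simps: "ob T = a ` ob C" "arr T = b ` arr C" "dom T f = a (dom C (b' f))" "cod T f = a (cod C (b' f))"
  "ident T X = b (ident C (a' X))" "comp T g f = b (comp C (b' g) (b' f))" for f g X by (simp_all add: T_def)
 have dc: "dom C f \<in> ob C" "cod C f \<in> ob C" if "f \<in> arr C" for f using C that by (auto simp: category_def)
 have aeq: "a X = a Y \<longleftrightarrow> X = Y" if "X \<in> ob C" "Y \<in> ob C" for X Y using a that by (auto simp: inj_on_def)
 have bhom: "b f \<in> hom T (a X) (a Y)" if f: "f \<in> hom C X Y" for f X Y
  using f b' by (auto simp: hom_def T_simps)
 have harr: "f \<in> arr C" if "f \<in> hom C X Y" for f X Y using that by (simp add: hom_def)
 have id: "ident C X \<in> hom C X X" if "X \<in> ob C" for X using C that by (simp add: ident_hom)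
 have T: "category T" unfolding category_def
 proof (intro conjI ballI impI)
  show "dom T f \<in> ob T" "cod T f \<in> ob T" if "f \<in> arr T" for f using that dc b' by (auto simp: T_simps)
  show "ident T X \<in> hom T X X" if "X \<in> ob T" for X using that id bhom a' by (auto simp: T_simps)
  fix f assume "f \<in> arr T"
  then obtain f' where f': "f = b f'" "f' \<in> arr C" by (auto simp: T_simps)
  note fh = homI[OF f'(2)]
  show "comp T f (ident T (dom T f)) = f" "comp T (ident T (cod T f)) f = f"
   using f' b' a' dc[OF f'(2)] harr[OF id] comp_ident[OF C fh] by (simp_all add: T_simps)
  fix g assume "g \<in> arr T"
  then obtain g' where g': "g = b g'" "g' \<in> arr C" by (auto simp: T_simps)
  show "comp T g f \<in> hom T (dom T f) (cod T g)" if "cod T f = dom T g"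
  proof -
   have "cod C f' = dom C g'" using that f' g' b' aeq dc by (simp add: T_simps)
   then have "comp C g' f' \<in> hom C (dom C f') (cod C g')" using comp_hom[OF C fh] g' homI by metis
   then show ?thesis using bhom f' g' b' by (simp add: T_simps)
  qed
  fix h assume "h \<in> arr T"
  then obtain h' where h': "h = b h'" "h' \<in> arr C" by (auto simp: T_simps)
  assume "cod T f = dom T g \<and> cod T g = dom T h"
  then have e: "cod C f' = dom C g'" "cod C g' = dom C h'" using f' g' h' b' aeq dc by (simp_all add: T_simps)
  have fh: "f' \<in> hom C (dom C f') (cod C f')" and gh: "g' \<in> hom C (cod C f') (cod C g')" and hh: "h' \<in> hom C (cod C g') (cod C h')"
   using f' g' h' e by (auto simp: hom_def)
  show "comp T h (comp T g f) = comp T (comp T h g) f"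
   using f' g' h' b' harr[OF comp_hom[OF C fh gh]] harr[OF comp_hom[OF C gh hh]] comp_assoc[OF C fh gh hh] by (simp add: T_simps)
 qed
 define F where "F = \<lparr>fob = a, far = b\<rparr>"
 define G where "G = \<lparr>fob = a', far = b'\<rparr>"
 have FG_simps: "fob F = a" "far F = b" "fob G = a'" "far G = b'" by (simp_all add: F_def G_def)
 have F: "is_functor C T F" unfolding is_functor_def FG_simps
  using a' b' by (auto simp: T_simps intro!: bhom homI)
 have G: "is_functor T C G" unfolding is_functor_def FG_simps
 proof (intro conjI ballI impI)
  show "a' X \<in> ob C" if "X \<in> ob T" for X using that a' by (auto simp: T_simps)
  show "b' f \<in> hom C (a' (dom T f)) (a' (cod T f))" if "f \<in> arr T" for f
   using that a' b' dc by (auto simp: T_simps intro: homI)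
  show "b' (ident T X) = ident C (a' X)" if "X \<in> ob T" for X using that a' b' harr[OF id] by (auto simp: T_simps)
  show "b' (comp T g f) = b' g o[C] b' f" if fg: "f \<in> arr T" "g \<in> arr T" "cod T f = dom T g" for f g
  proof -
   have fg': "b' f \<in> arr C" "b' g \<in> arr C" using fg b' by (auto simp: T_simps)
   then have "cod C (b' f) = dom C (b' g)" using fg aeq dc by (auto simp: T_simps)
   then have "b' g o[C] b' f \<in> arr C" using comp_hom[OF C homI[OF fg'(1)]] homI[OF fg'(2)] harr by metis
   then show ?thesis using b' by (simp add: T_simps)
  qed
 qed
 have "iso_cats C T F G"
  by unfold_locales (use C T F G a' b' in \<open>auto simp: FG_simps T_simps\<close>)
 then show ?thesis by blast
qed

lemma lex_comp_func:
 "preserves_finite_limits C D F ==> preserves_finite_limits D E G ==> preserves_finite_limits C E (comp_func G F)"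
 by (simp add: preserves_finite_limits_def)

section \<open>The comparison with the pseudopullback\<close>

text \<open>
 The pseudopullback, with its projections as inverse images, is the vertex of a pseudococone; the
 geometric morphism that it induces from a pseudopushout has an inverse image \<open>K\<close> that composes
 with the inverse images of the coprojections to the projections.
\<close>

theorem glued_comparison:
 fixes T :: "('u, 'u) cat"
 assumes PP_def: "PP = glue S E0 E1 (inverse_image j0) (inverse_image j1)"
  and pp: "pseudopushout TYPE('u) S E0 E1 j0 j1 E i0 i1 \<phi>"
  and gl: "gluing S E0 E1 (inverse_image j0) (inverse_image j1)" and iso: "iso_cats PP T enc dec"
 obtains K \<alpha>0 \<alpha>1 where "is_functor PP E K"
  "\<And>t. is_terminal PP t ==> is_terminal E (fob K t)" "\<And>x. extremal PP x ==> extremal E (far K x)"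
  "nat_iso PP E0 (comp_func (inverse_image i0) K) glue_pr0 \<alpha>0" "nat_iso PP E1 (comp_func (inverse_image i1) K) glue_pr1 \<alpha>1"
  "\<And>X. X \<in> ob PP ==> snd (snd X) o[S] far (inverse_image j0) (\<alpha>0 X) = far (inverse_image j1) (\<alpha>1 X) o[S] \<phi> (fob K X)"
proof -
 interpret gluing S E0 E1 "inverse_image j0" "inverse_image j1" by (rule gl)
 interpret I: iso_cats PP T enc dec by (rule iso)
 interpret J: iso_cats T PP dec enc by (rule I.iso_cats_inverse)
 have toposT: "topos T" using I.F_topos glue_topos by (simp add: PP_def)
 have E: "category E" using pp by (simp add: pseudopushout_def topos_def)
 note pr0 = pr0[folded PP_def] and pr1 = pr1[folded PP_def]
 define q0 where "q0 = comp_func glue_pr0 dec"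
 define q1 where "q1 = comp_func glue_pr1 dec"
 have q0: "is_functor T E0 q0" and q1: "is_functor T E1 q1"
  unfolding q0_def q1_def using is_functor_comp_func[OF I.G pr0] is_functor_comp_func[OF I.G pr1] by simp_all
 have "\<exists>R. is_functor E0 T R \<and> adjoint T E0 q0 R"
 proof (rule adjoint_from_universal_arrows[OF I.D E0 q0])
  fix Y assume Y: "Y \<in> ob E0"
  obtain G e where G: "G \<in> ob PP" and e: "e \<in> hom E0 (fst G) Y"
   and u_all: "\<forall>Z\<in>ob PP. \<forall>f \<in> hom E0 (fst Z) Y. \<exists>!g. g \<in> hom PP Z G \<and> e o[E0] far glue_pr0 g = f"
   using pr0_universal[folded PP_def, OF Y] unfolding glue_pr_simps by (elim exE conjE) (rule that)
  note u = u_all[rule_format]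
  have "\<exists>!g. g \<in> hom T Z (fob enc G) \<and> e o[E0] far q0 g = f" if Z: "Z \<in> ob T" and f: "f \<in> hom E0 (fob q0 Z) Y" for Z f
  proof -
   obtain g where g: "g \<in> hom PP (fob dec Z) G" "e o[E0] far glue_pr0 g = f"
    and uniq: "\<And>h. h \<in> hom PP (fob dec Z) G ==> e o[E0] far glue_pr0 h = f ==> h = g"
    using u[OF functor_ob[OF I.G Z]] f unfolding q0_def comp_func_simps glue_pr_simps by blast
   have "h = far enc g" if h: "h \<in> hom T Z (fob enc G)" "e o[E0] far q0 h = f" for h
    using uniq[OF I.G_hom'[OF h(1) G]] h(2) I.FG[OF h(1)] by (simp add: q0_def)
   moreover have "e o[E0] far q0 (far enc g) = f" using g I.GF[OF g(1)] by (simp add: q0_def)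
   ultimately show ?thesis using I.F_hom'[OF g(1) Z] by blast
  qed
  then show "\<exists>G e. G \<in> ob T \<and> e \<in> hom E0 (fob q0 G) Y \<and>
   (\<forall>Z\<in>ob T. \<forall>f\<in>hom E0 (fob q0 Z) Y. \<exists>!g. g \<in> hom T Z G \<and> e o[E0] far q0 g = f)"
   using functor_ob[OF I.F G] e I.GF_ob[OF G] by (intro exI[of _ "fob enc G"] exI[of _ e]) (simp add: q0_def)
 qed
 then obtain R0 where R0: "is_functor E0 T R0" "adjoint T E0 q0 R0" by blast
 have "\<exists>R. is_functor E1 T R \<and> adjoint T E1 q1 R"
 proof (rule adjoint_from_universal_arrows[OF I.D E1 q1])
  fix Y assume Y: "Y \<in> ob E1"
  obtain G e where G: "G \<in> ob PP" and e: "e \<in> hom E1 (fst (snd G)) Y"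
   and u_all: "\<forall>Z\<in>ob PP. \<forall>f \<in> hom E1 (fst (snd Z)) Y. \<exists>!g. g \<in> hom PP Z G \<and> e o[E1] far glue_pr1 g = f"
   using pr1_universal[folded PP_def, OF Y] unfolding glue_pr_simps by (elim exE conjE) (rule that)
  note u = u_all[rule_format]
  have "\<exists>!g. g \<in> hom T Z (fob enc G) \<and> e o[E1] far q1 g = f" if Z: "Z \<in> ob T" and f: "f \<in> hom E1 (fob q1 Z) Y" for Z f
  proof -
   obtain g where g: "g \<in> hom PP (fob dec Z) G" "e o[E1] far glue_pr1 g = f"
    and uniq: "\<And>h. h \<in> hom PP (fob dec Z) G ==> e o[E1] far glue_pr1 h = f ==> h = g"
    using u[OF functor_ob[OF I.G Z]] f unfolding q1_def comp_func_simps glue_pr_simps by blast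
   have "h = far enc g" if h: "h \<in> hom T Z (fob enc G)" "e o[E1] far q1 h = f" for h
    using uniq[OF I.G_hom'[OF h(1) G]] h(2) I.FG[OF h(1)] by (simp add: q1_def)
   moreover have "e o[E1] far q1 (far enc g) = f" using g I.GF[OF g(1)] by (simp add: q1_def)
   ultimately show ?thesis using I.F_hom'[OF g(1) Z] by blast
  qed
  then show "\<exists>G e. G \<in> ob T \<and> e \<in> hom E1 (fob q1 G) Y \<and>
   (\<forall>Z\<in>ob T. \<forall>f\<in>hom E1 (fob q1 Z) Y. \<exists>!g. g \<in> hom T Z G \<and> e o[E1] far q1 g = f)"
   using functor_ob[OF I.F G] e I.GF_ob[OF G] by (intro exI[of _ "fob enc G"] exI[of _ e]) (simp add: q1_def)
 qed
 then obtain R1 where R1: "is_functor E1 T R1" "adjoint T E1 q1 R1" by blast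
 define g0 where "g0 = \<lparr>inverse_image = q0, direct_image = R0\<rparr>"
 define g1 where "g1 = \<lparr>inverse_image = q1, direct_image = R1\<rparr>"
 have geo0: "geometric_morphism E0 T g0" and geo1: "geometric_morphism E1 T g1"
  unfolding geometric_morphism_def g0_def g1_def
  using q0 q1 R0 R1 lex_comp_func[OF J.F_lex pr0_lex[folded PP_def]] lex_comp_func[OF J.F_lex pr1_lex[folded PP_def]]
  by (simp_all add: q0_def q1_def)
 define \<theta> where "\<theta> = (\<lambda>X\<in>ob T. snd (snd (fob dec X)))"
 have th: "nat_iso T S (inverse_image (comp_geom g0 j0)) (inverse_image (comp_geom g1 j1)) \<theta>"
  unfolding nat_iso_def nat_trans_def
 proof (intro conjI ballI)
  show "\<theta> \<in> extensional (ob T)" by (simp add: \<theta>_def)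
  fix X assume X: "X \<in> ob T"
  note dX = functor_ob[OF I.G X]
  show "\<theta> X \<in> hom S (fob (inverse_image (comp_geom g0 j0)) X) (fob (inverse_image (comp_geom g1 j1)) X)" "iso_arr S (\<theta> X)"
   using theta_hom[OF dX[unfolded PP_def]] theta_iso[OF dX[unfolded PP_def]] X
   by (simp_all add: \<theta>_def comp_geom_def g0_def g1_def q0_def q1_def)
 next
  fix f assume f: "f \<in> arr T"
  have fh: "f \<in> hom T (dom T f) (cod T f)" using homI[OF f] .
  have o: "dom T f \<in> ob T" "cod T f \<in> ob T" using category_ob[OF I.D fh] by auto
  show "\<theta> (cod T f) o[S] far (inverse_image (comp_geom g0 j0)) f = far (inverse_image (comp_geom g1 j1)) f o[S] \<theta> (dom T f)"
   using ar_nat[OF functor_hom[OF I.G fh, unfolded PP_def]] o by (simp add: \<theta>_def comp_geom_def g0_def g1_def q0_def q1_def)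
 qed
 let ?CC = "cocone_cat S E0 E1 j0 j1 T" and ?GC = "geom_cat E T" and ?F = "comparison_functor i0 i1 \<phi> T"
 define Q where "Q = (g0, g1, \<theta>)"
 have Q: "Q \<in> ob ?CC" using geo0 geo1 th by (simp add: Q_def cocone_cat_def)
 have eqv: "equivalence_functor ?GC ?CC ?F" using pp toposT by (simp add: pseudopushout_def)
 then obtain GG eps where GG: "is_functor ?CC ?GC GG" and eps: "nat_iso ?CC ?CC (comp_func ?F GG) id_func eps"
  unfolding equivalence_functor_def by blast
 define h where "h = fob GG Q"
 have h: "geometric_morphism E T h" using functor_ob[OF GG Q] by (simp add: h_def geom_cat_def)
 have epsQ: "eps Q \<in> hom ?CC (cocone_of i0 i1 \<phi> T h) Q" "iso_arr ?CC (eps Q)"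
  using eps Q by (auto simp: nat_iso_def nat_trans_def comparison_functor_def h_def)
 then obtain del where del: "del \<in> hom ?CC Q (cocone_of i0 i1 \<phi> T h)"
  "comp ?CC del (eps Q) = ident ?CC (cocone_of i0 i1 \<phi> T h)" "comp ?CC (eps Q) del = ident ?CC Q"
  using iso_arrE[OF epsQ(2,1)] by blast
 let ?h0 = "comp_geom h i0" and ?h1 = "comp_geom h i1" and ?\<psi> = "\<lambda>X\<in>ob T. \<phi> (fob (inverse_image h) X)"
 obtain \<alpha>0 \<alpha>1 where al: "eps Q = ((?h0, ?h1, ?\<psi>), (\<alpha>0, \<alpha>1), (g0, g1, \<theta>))"
  and al0: "nat_trans T E0 (inverse_image ?h0) (inverse_image g0) \<alpha>0"
  and al1: "nat_trans T E1 (inverse_image ?h1) (inverse_image g1) \<alpha>1"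
  and alc: "\<forall>X\<in>ob T. \<theta> X o[S] far (inverse_image j0) (\<alpha>0 X) = far (inverse_image j1) (\<alpha>1 X) o[S] ?\<psi> X"
  using epsQ(1) unfolding hom_def cocone_cat_def cocone_of_def Q_def by (auto simp: Let_def)
 obtain \<beta>0 \<beta>1 where be: "del = ((g0, g1, \<theta>), (\<beta>0, \<beta>1), (?h0, ?h1, ?\<psi>))"
  and be0: "nat_trans T E0 (inverse_image g0) (inverse_image ?h0) \<beta>0"
  and be1: "nat_trans T E1 (inverse_image g1) (inverse_image ?h1) \<beta>1"
  using del(1) unfolding hom_def cocone_cat_def cocone_of_def Q_def by (auto simp: Let_def)
 have inv0: "\<beta>0 X o[E0] \<alpha>0 X = ident E0 (fob (inverse_image ?h0) X)" "\<alpha>0 X o[E0] \<beta>0 X = ident E0 (fob (inverse_image g0) X)"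
  and inv1: "\<beta>1 X o[E1] \<alpha>1 X = ident E1 (fob (inverse_image ?h1) X)" "\<alpha>1 X o[E1] \<beta>1 X = ident E1 (fob (inverse_image g1) X)"
  if X: "X \<in> ob T" for X
 proof -
  have d1: "(\<lambda>X\<in>ob T. \<beta>0 X o[E0] \<alpha>0 X) = (\<lambda>X\<in>ob T. ident E0 (fob (inverse_image ?h0) X))"
   "(\<lambda>X\<in>ob T. \<beta>1 X o[E1] \<alpha>1 X) = (\<lambda>X\<in>ob T. ident E1 (fob (inverse_image ?h1) X))"
   using del(2) unfolding al be cocone_of_def by (simp_all add: cocone_cat_def Let_def)
  have d2: "(\<lambda>X\<in>ob T. \<alpha>0 X o[E0] \<beta>0 X) = (\<lambda>X\<in>ob T. ident E0 (fob (inverse_image g0) X))"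
   "(\<lambda>X\<in>ob T. \<alpha>1 X o[E1] \<beta>1 X) = (\<lambda>X\<in>ob T. ident E1 (fob (inverse_image g1) X))"
   using del(3)[unfolded al be] unfolding Q_def by (simp_all add: cocone_cat_def Let_def)
  show "\<beta>0 X o[E0] \<alpha>0 X = ident E0 (fob (inverse_image ?h0) X)" using fun_cong[OF d1(1), of X] X by simp
  show "\<beta>1 X o[E1] \<alpha>1 X = ident E1 (fob (inverse_image ?h1) X)" using fun_cong[OF d1(2), of X] X by simp
  show "\<alpha>0 X o[E0] \<beta>0 X = ident E0 (fob (inverse_image g0) X)" using fun_cong[OF d2(1), of X] X by simp
  show "\<alpha>1 X o[E1] \<beta>1 X = ident E1 (fob (inverse_image g1) X)" using fun_cong[OF d2(2), of X] X by simp
 qed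
 have iso0: "iso_arr E0 (\<alpha>0 X)" and iso1: "iso_arr E1 (\<alpha>1 X)" if X: "X \<in> ob T" for X
  using iso_arrI[of "\<alpha>0 X" E0 _ _ "\<beta>0 X"] iso_arrI[of "\<alpha>1 X" E1 _ _ "\<beta>1 X"] al0 al1 be0 be1 inv0[OF X] inv1[OF X] X
  unfolding nat_trans_def by blast+
 define K where "K = comp_func (inverse_image h) enc"
 have hf: "is_functor T E (inverse_image h)" "is_functor E T (direct_image h)" "adjoint T E (inverse_image h) (direct_image h)"
  "preserves_finite_limits T E (inverse_image h)" using h by (auto simp: geometric_morphism_def)
 obtain \<eta>h \<epsilon>h where "adjunction T E (inverse_image h) (direct_image h) \<eta>h \<epsilon>h"
  using adjoint_adjunction[OF I.D E hf(1-3)] by blast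
 then interpret A: adjunction T E "inverse_image h" "direct_image h" \<eta>h \<epsilon>h .
 define a0 where "a0 = (\<lambda>X\<in>ob PP. \<alpha>0 (fob enc X))"
 define a1 where "a1 = (\<lambda>X\<in>ob PP. \<alpha>1 (fob enc X))"
 show thesis
 proof (rule that)
  show "is_functor PP E K" unfolding K_def by (rule is_functor_comp_func[OF I.F hf(1)])
  show "is_terminal E (fob K t)" if "is_terminal PP t" for t
   using hf(4) I.F_terminal[OF that] by (simp add: K_def preserves_finite_limits_def)
  show "extremal E (far K x)" if x: "extremal PP x" for x
  proof -
   have xh: "x \<in> hom PP (dom PP x) (cod PP x)" using x homI by (auto simp: extremal_def)
   show ?thesis
    using A.left_adjoint_extremal[OF _ I.F_extremal[OF x xh] functor_hom[OF I.F xh]] toposT by (simp add: K_def topos_def)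
  qed
  show "nat_iso PP E0 (comp_func (inverse_image i0) K) glue_pr0 a0"
   unfolding nat_iso_def nat_trans_def
  proof (intro conjI ballI)
   show "a0 \<in> extensional (ob PP)" by (simp add: a0_def)
   fix X assume X: "X \<in> ob PP"
   note eX = functor_ob[OF I.F X]
   show "iso_arr E0 (a0 X)" using iso0[OF eX] X by (simp add: a0_def)
   have "\<alpha>0 (fob enc X) \<in> hom E0 (fob (inverse_image ?h0) (fob enc X)) (fob (inverse_image g0) (fob enc X))"
    using al0 eX unfolding nat_trans_def by blast
   then show "a0 X \<in> hom E0 (fob (comp_func (inverse_image i0) K) X) (fob glue_pr0 X)"
    using X I.GF_ob[OF X] by (simp add: a0_def comp_geom_def K_def g0_def q0_def)
  next
   fix f assume f: "f \<in> arr PP"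
   note fh = homI[OF f]
   note ef = functor_hom[OF I.F fh]
   have o: "dom PP f \<in> ob PP" "cod PP f \<in> ob PP" using category_ob[OF I.C fh] by auto
   have "\<alpha>0 (cod T (far enc f)) o[E0] far (inverse_image ?h0) (far enc f) = far (inverse_image g0) (far enc f) o[E0] \<alpha>0 (dom T (far enc f))"
    using al0 ef unfolding nat_trans_def hom_def by blast
   moreover have "dom T (far enc f) = fob enc (dom PP f)" "cod T (far enc f) = fob enc (cod PP f)" using ef by (auto simp: hom_def)
   ultimately show "a0 (cod PP f) o[E0] far (comp_func (inverse_image i0) K) f = far glue_pr0 f o[E0] a0 (dom PP f)"
    using o I.GF[OF fh] by (simp add: a0_def comp_geom_def K_def g0_def q0_def)
  qed
  show "nat_iso PP E1 (comp_func (inverse_image i1) K) glue_pr1 a1"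
   unfolding nat_iso_def nat_trans_def
  proof (intro conjI ballI)
   show "a1 \<in> extensional (ob PP)" by (simp add: a1_def)
   fix X assume X: "X \<in> ob PP"
   note eX = functor_ob[OF I.F X]
   show "iso_arr E1 (a1 X)" using iso1[OF eX] X by (simp add: a1_def)
   have "\<alpha>1 (fob enc X) \<in> hom E1 (fob (inverse_image ?h1) (fob enc X)) (fob (inverse_image g1) (fob enc X))"
    using al1 eX unfolding nat_trans_def by blast
   then show "a1 X \<in> hom E1 (fob (comp_func (inverse_image i1) K) X) (fob glue_pr1 X)"
    using X I.GF_ob[OF X] by (simp add: a1_def comp_geom_def K_def g1_def q1_def)
  next
   fix f assume f: "f \<in> arr PP"
   note fh = homI[OF f]
   note ef = functor_hom[OF I.F fh]
   have o: "dom PP f \<in> ob PP" "cod PP f \<in> ob PP" using category_ob[OF I.C fh] by auto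
   have "\<alpha>1 (cod T (far enc f)) o[E1] far (inverse_image ?h1) (far enc f) = far (inverse_image g1) (far enc f) o[E1] \<alpha>1 (dom T (far enc f))"
    using al1 ef unfolding nat_trans_def hom_def by blast
   moreover have "dom T (far enc f) = fob enc (dom PP f)" "cod T (far enc f) = fob enc (cod PP f)" using ef by (auto simp: hom_def)
   ultimately show "a1 (cod PP f) o[E1] far (comp_func (inverse_image i1) K) f = far glue_pr1 f o[E1] a1 (dom PP f)"
    using o I.GF[OF fh] by (simp add: a1_def comp_geom_def K_def g1_def q1_def)
  qed
  show "snd (snd X) o[S] far (inverse_image j0) (a0 X) = far (inverse_image j1) (a1 X) o[S] \<phi> (fob K X)" if X: "X \<in> ob PP" for X
   using bspec[OF alc functor_ob[OF I.F X]] functor_ob[OF I.F X] X I.GF_ob[OF X] by (simp add: \<theta>_def a0_def a1_def K_def)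
 qed
qed

section \<open>Smallness\<close>

lemma small_subset: "A \<subseteq> B ==> small U B ==> small U A"
 unfolding small_def using card_of_mono1 ordLeq_ordLess_trans by blast

lemma small_ordLeq: "|A| \<le>o |B| ==> small U B ==> small U A"
 unfolding small_def using ordLeq_ordLess_trans by blast

lemma small_image: "small U A ==> small U (f ` A)"
 using small_ordLeq card_of_image by blast

lemma small_inj:
 assumes "inj_on f A" "f ` A \<subseteq> B" "small U B" shows "small U A"
proof (rule small_ordLeq[OF _ assms(3)])
 show "|A| \<le>o |B|" unfolding card_of_ordLeq[symmetric] using assms(1,2) by (intro exI[of _ f] conjI)
qed

text \<open>Pairs of elements of the universe, coded as elements of the universe.\<close>

definition upair :: "'u => 'u => 'u" where
 "upair x y = (SOME p. inj p) (x, y)"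

locale universe =
 fixes U :: "'u itself"
 assumes set_universe: "set_universe U"
begin

abbreviation sm :: "'x set => bool" where "sm X \<equiv> small U X"

lemma infinite_UNIV_u: "infinite (UNIV :: 'u set)"
 using set_universe infinite_super[OF subset_UNIV] by (auto simp: set_universe_def)

lemma two_elements: "\<exists>c d :: 'u. c \<noteq> d"
proof (rule ccontr)
 assume "\<not> ?thesis"
 then have "(UNIV :: 'u set) \<subseteq> {undefined}" by blast
 then have "finite (UNIV :: 'u set)" using finite_subset by blast
 then show False using infinite_UNIV_u by simp
qed

text \<open>The universe is infinite, so it has as many pairs as elements.\<close>

lemma upair_eq [simp]: "upair x y = upair x' y' \<longleftrightarrow> x = x' \<and> y = (y' :: 'u)"
proof -
 have "|UNIV \<times> UNIV :: ('u \<times> 'u) set| \<le>o |UNIV :: 'u set|"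
  by (rule ordIso_imp_ordLeq[OF conjunct1[OF card_of_Times_infinite[OF infinite_UNIV_u UNIV_not_empty ordLeq_reflexive[OF card_of_Well_order]]]])
 then have "\<exists>p :: 'u \<times> 'u => 'u. inj p" unfolding card_of_ordLeq[symmetric] by auto
 then have "inj (SOME p :: 'u \<times> 'u => 'u. inj p)" by (rule someI_ex)
 then show ?thesis unfolding upair_def inj_on_def by blast
qed

lemma coding:
 assumes "sm A"
 obtains c :: "'x => 'u" where "inj_on c A"
proof -
 have "|A| \<le>o |UNIV :: 'u set|" using assms unfolding small_def by (rule ordLess_imp_ordLeq)
 then show thesis using that unfolding card_of_ordLeq[symmetric] by blast
qed

lemma small_uPow: "sm (A :: 'u set) ==> sm (Pow A)"
 using set_universe by (simp add: set_universe_def)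

lemma small_UN: "sm (I :: 'u set) ==> (\<And>i. i \<in> I ==> sm (F i :: 'u set)) ==> sm (\<Union>i\<in>I. F i)"
 using set_universe by (simp add: set_universe_def)

lemma small_Pow:
 assumes "sm A" shows "sm (Pow A)"
proof -
 obtain c :: "'a => 'u" where c: "inj_on c A" using coding[OF assms] .
 have "inj_on (image c) (Pow A)" using c by (rule inj_on_image_Pow)
 moreover have "image c ` Pow A \<subseteq> Pow (c ` A)" by auto
 ultimately show ?thesis by (rule small_inj) (rule small_uPow[OF small_image[OF assms]])
qed

lemma small_Times:
 assumes "sm A" "sm B" shows "sm (A \<times> B)"
proof -
 obtain a :: "'a => 'u" where a: "inj_on a A" using coding[OF assms(1)] .
 obtain b :: "'b => 'u" where b: "inj_on b B" using coding[OF assms(2)] .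
 have "sm (\<Union>x\<in>a ` A. upair x ` b ` B)"
  by (intro small_UN small_image assms)
 moreover have "inj_on (\<lambda>(x, y). upair (a x) (b y)) (A \<times> B)"
  using a b by (auto simp: inj_on_def)
 moreover have "(\<lambda>(x, y). upair (a x) (b y)) ` (A \<times> B) \<subseteq> (\<Union>x\<in>a ` A. upair x ` b ` B)" by auto
 ultimately show ?thesis using small_inj[of "\<lambda>(x, y). upair (a x) (b y)"] by simp
qed

lemma small_PiE:
 assumes "sm A" "sm B" shows "sm (A \<rightarrow>\<^sub>E B)"
proof -
 have "inj_on (\<lambda>f. (\<lambda>x. (x, f x)) ` A) (A \<rightarrow>\<^sub>E B)"
 proof (rule inj_onI)
  fix f g assume f: "f \<in> A \<rightarrow>\<^sub>E B" and g: "g \<in> A \<rightarrow>\<^sub>E B" and e: "(\<lambda>x. (x, f x)) ` A = (\<lambda>x. (x, g x)) ` A"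
  have "f x = g x" if "x \<in> A" for x using e that by force
  then show "f = g" using f g by (meson PiE_ext)
 qed
 moreover have "(\<lambda>f. (\<lambda>x. (x, f x)) ` A) ` (A \<rightarrow>\<^sub>E B) \<subseteq> Pow (A \<times> B)" by auto
 ultimately show ?thesis by (rule small_inj) (rule small_Pow[OF small_Times[OF assms]])
qed

lemma small_finite:
 assumes "finite X" shows "sm X"
 unfolding small_def
 by (rule finite_ordLess_infinite[OF card_of_Well_order card_of_Well_order]) (use assms infinite_UNIV_u in \<open>simp_all add: Field_card_of\<close>)

text \<open>Cardinality at most that of the universe.\<close>

definition classlike :: "'x set => bool" where
 "classlike X \<longleftrightarrow> |X| \<le>o |UNIV :: 'u set|"

lemma classlike_code:
 assumes "classlike X"
 obtains c :: "'x => 'u" where "inj_on c X"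
 using assms that unfolding classlike_def card_of_ordLeq[symmetric] by blast

lemma classlike_inj:
 assumes "inj_on f X" "f ` X \<subseteq> Y" "classlike Y"
 shows "classlike X"
proof -
 have "|X| \<le>o |Y|" unfolding card_of_ordLeq[symmetric] using assms(1,2) by (intro exI[of _ f] conjI)
 from ordLeq_transitive[OF this assms(3)[unfolded classlike_def]] show ?thesis by (simp add: classlike_def)
qed

lemma classlike_subset_image:
 assumes "X \<subseteq> f ` Y" "classlike Y"
 shows "classlike X"
proof -
 have "|X| \<le>o |f ` Y|" using assms(1) by (rule card_of_mono1)
 from ordLeq_transitive[OF this ordLeq_transitive[OF card_of_image assms(2)[unfolded classlike_def]]]
 show ?thesis by (simp add: classlike_def)
qed

lemma classlike_subset: "X \<subseteq> Y ==> classlike Y ==> classlike X"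
 using classlike_subset_image[of X id Y] by simp

lemma classlike_Times:
 assumes "classlike X" "classlike Y" shows "classlike (X \<times> Y)"
 unfolding classlike_def
 by (rule card_of_Times_ordLeq_infinite_Field[OF _ assms[unfolded classlike_def] card_of_Card_order])
  (simp add: Field_card_of infinite_UNIV_u)

text \<open>By regularity every small set of elements of the universe lies in a proper initial segment of a
 fixed cardinal well-ordering, and these have few subsets because the universe is a strong limit.\<close>

lemma classlike_small_sets: "classlike {X :: 'u set. sm X}"
proof -
 let ?r = "|UNIV :: 'u set|"
 have co: "Card_order ?r" and Fr: "Field ?r = UNIV" by (rule card_of_Card_order, rule Field_card_of)
 have wo: "Well_order ?r" by (rule card_of_Well_order)
 have seg: "sm (underS ?r a)" for a using card_of_underS[OF co, of a] Fr by (simp add: small_def)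
 have "\<exists>a. X \<subseteq> underS ?r a" if X: "sm X" for X :: "'u set"
 proof (rule ccontr)
  assume no: "\<not> (\<exists>a. X \<subseteq> underS ?r a)"
  have "a \<in> (\<Union>x\<in>X. insert x (underS ?r x))" for a
  proof -
   obtain x where x: "x \<in> X" "x \<notin> underS ?r a" using no by blast
   then have "x = a \<or> (x, a) \<notin> ?r" by (auto simp: underS_def)
   moreover have "x \<noteq> a ==> (x, a) \<in> ?r \<or> (a, x) \<in> ?r"
    using wo Fr unfolding well_order_on_def linear_order_on_def total_on_def by blast
   ultimately have "a \<in> insert x (underS ?r x)" by (auto simp: underS_def)
   then show ?thesis using x(1) by blast
  qed
  then have "UNIV = (\<Union>x\<in>X. insert x (underS ?r x))" by blast
  moreover have "sm (\<Union>x\<in>X. insert x (underS ?r x))"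
  proof (rule small_UN[OF X])
   fix x
   obtain c d :: 'u where cd: "c \<noteq> d" using two_elements by blast
   have "insert x (underS ?r x) = (\<Union>i\<in>{c, d}. if i = c then {x} else underS ?r x)" using cd by auto
   moreover have "sm (\<Union>i\<in>{c, d}. if i = c then {x} else underS ?r x)"
    by (rule small_UN) (auto intro: small_finite seg)
   ultimately show "sm (insert x (underS ?r x))" by simp
  qed
  ultimately have "sm (UNIV :: 'u set)" by simp
  then show False using ordLess_irreflexive unfolding small_def by blast
 qed
 then have "{X. sm X} \<subseteq> (\<Union>a\<in>UNIV. Pow (underS ?r a))" by blast
 moreover have "|\<Union>a\<in>UNIV. Pow (underS ?r a)| \<le>o ?r"
 proof (rule card_of_UNION_ordLeq_infinite[OF infinite_UNIV_u])
  show "|UNIV :: 'u set| \<le>o ?r" by (rule ordLeq_reflexive) (rule wo)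
  show "\<forall>a\<in>UNIV. |Pow (underS ?r a)| \<le>o ?r"
   using small_uPow[OF seg] ordLess_imp_ordLeq unfolding small_def by blast
 qed
 ultimately show ?thesis unfolding classlike_def by (rule ordLeq_transitive[OF card_of_mono1])
qed

end

section \<open>Realizers\<close>

abbreviation (input) s_law :: "'a opas => 'a => 'a => 'a => bool" where
 "s_law A a b v \<equiv> \<forall>c\<in>elts A. \<forall>x y z. app A a c = Some x \<and> app A b c = Some y \<and> app A x y = Some z -->
   (\<exists>w\<in>elts A. app A v c = Some w \<and> le A w z)"

locale opca_alg =
 fixes A :: "'a opas"
 assumes opca: "opca A"
begin

lemma opas: "opas A"
 using opca by (simp add: opca_def)

lemma le_refl: "a \<in> elts A ==> le A a a"
 using opas by (simp add: opas_def)

lemma le_trans: "le A a b ==> le A b c ==> a \<in> elts A ==> b \<in> elts A ==> c \<in> elts A ==> le A a c"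
 using opas unfolding opas_def by blast

lemma app_closed: "app A a b = Some c ==> a \<in> elts A ==> b \<in> elts A ==> c \<in> elts A"
 using opas unfolding opas_def by blast

lemma app_mono:
 assumes "app A a b = Some c" "le A a' a" "le A b' b" "a \<in> elts A" "b \<in> elts A" "a' \<in> elts A" "b' \<in> elts A"
 obtains c' where "app A a' b' = Some c'" "le A c' c" "c' \<in> elts A"
proof -
 have "opreceq A (app A a' b') (app A a b)" using opas assms unfolding opas_def by blast
 then show thesis using that assms app_closed by (auto simp: opreceq_def ole_def)
qed

lemma k_s_exist:
 obtains k s where "k \<in> elts A" "s \<in> elts A"
  "\<forall>a\<in>elts A. \<forall>b\<in>elts A. \<exists>u v. app A k a = Some u \<and> u \<in> elts A \<and> app A u b = Some v \<and> le A v a \<and> v \<in> elts A"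
  "\<forall>a\<in>elts A. \<forall>b\<in>elts A. \<exists>u v. app A s a = Some u \<and> u \<in> elts A \<and> app A u b = Some v \<and> v \<in> elts A \<and>
    (s_law A a b v)"
proof -
 obtain k s where k: "k \<in> elts A" and s: "s \<in> elts A"
  and ks: "\<And>a b c. a \<in> elts A ==> b \<in> elts A ==> c \<in> elts A ==>
    ole A (oapp A (app A k a) (Some b)) (Some a) \<and> oapp A (app A s a) (Some b) \<noteq> None \<and>
    opreceq A (oapp A (oapp A (app A s a) (Some b)) (Some c)) (oapp A (app A a c) (app A b c))"
  using opca unfolding opca_def by blast
 show thesis
 proof (rule that[OF k s], safe)
  fix a b assume ab: "a \<in> elts A" "b \<in> elts A"
  then have "ole A (oapp A (app A k a) (Some b)) (Some a)" using ks by blast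
  then obtain u v where "app A k a = Some u" "app A u b = Some v" "le A v a"
   by (auto simp: ole_def oapp_def split: option.splits)
  then show "\<exists>u v. app A k a = Some u \<and> u \<in> elts A \<and> app A u b = Some v \<and> le A v a \<and> v \<in> elts A"
   using app_closed k ab by blast
  have "oapp A (app A s a) (Some b) \<noteq> None" using ks[OF ab ab(1)] by blast
  then obtain u v where uv: "app A s a = Some u" "app A u b = Some v"
   by (auto simp: oapp_def split: option.splits)
  have uvE: "u \<in> elts A" "v \<in> elts A" using app_closed uv s ab by blast+
  have "\<exists>w\<in>elts A. app A v c = Some w \<and> le A w z"
   if c: "c \<in> elts A" and xyz: "app A a c = Some x" "app A b c = Some y" "app A x y = Some z" for c x y z
   using ks[OF ab c] uv xyz app_closed[OF _ uvE(2) c] by (auto simp: oapp_def opreceq_def ole_def)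
  then show "\<exists>u v. app A s a = Some u \<and> u \<in> elts A \<and> app A u b = Some v \<and> v \<in> elts A \<and>
    (s_law A a b v)"
   using uv uvE by blast
 qed
qed

end

text \<open>Applicative terms in one variable.\<close>

datatype 'a pterm = Var | Cst 'a | App "'a pterm" "'a pterm"

primrec eval_pterm :: "'a opas => 'a => 'a pterm => 'a option" where
 "eval_pterm A x Var = Some x"
| "eval_pterm A x (Cst c) = Some c"
| "eval_pterm A x (App t u) = oapp A (eval_pterm A x t) (eval_pterm A x u)"

lemma oapp_Some [simp]: "oapp A (Some a) (Some b) = app A a b"
 by (simp add: oapp_def)

lemma oapp_eq_Some: "oapp A x y = Some c \<longleftrightarrow> (\<exists>a b. x = Some a \<and> y = Some b \<and> app A a b = Some c)"
 by (auto simp: oapp_def split: option.splits)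

text \<open>A pairing on an ordered partial combinatory algebra, described by what realizers can do with it.\<close>

definition is_pairing :: "'a opas => ('a => 'a => 'a) => bool" where
 "is_pairing A pr \<longleftrightarrow> (\<forall>a\<in>elts A. \<forall>b\<in>elts A. pr a b \<in> elts A) \<and>
   (\<exists>r\<in>elts A. \<forall>a\<in>elts A. \<forall>b\<in>elts A. \<forall>c\<in>elts A. le A c (pr a b) --> (\<exists>d. app A r c = Some d \<and> le A d a)) \<and>
   (\<exists>r\<in>elts A. \<forall>a\<in>elts A. \<forall>b\<in>elts A. \<forall>c\<in>elts A. le A c (pr a b) --> (\<exists>d. app A r c = Some d \<and> le A d b)) \<and>
   (\<forall>r\<in>elts A. \<forall>s\<in>elts A. \<exists>t\<in>elts A. \<forall>a\<in>elts A. \<forall>b c. app A r a = Some b \<and> app A s a = Some c -->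
    (\<exists>d. app A t a = Some d \<and> le A d (pr b c)))"

definition pairing :: "'a opas => 'a => 'a => 'a" where
 "pairing A = (SOME pr. is_pairing A pr)"

context opca_alg
begin

lemma eval_pterm_closed: "set_pterm t \<subseteq> elts A ==> x \<in> elts A ==> eval_pterm A x t = Some b ==> b \<in> elts A"
proof (induction t arbitrary: b)
 case (App t u)
 obtain f g where fg: "eval_pterm A x t = Some f" "eval_pterm A x u = Some g" "app A f g = Some b"
  using App.prems(3) by (auto simp: oapp_eq_Some)
 have "f \<in> elts A" "g \<in> elts A" using App fg by auto
 then show ?case using app_closed fg(3) by blast
qed auto

text \<open>Bracket abstraction by induction on the term. The result is only an inequality, as the laws of the combinators are.\<close>

lemma combinatory_completeness:
 assumes "set_pterm t \<subseteq> elts A"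
 shows "\<exists>r\<in>elts A. \<forall>x\<in>elts A. \<forall>b. eval_pterm A x t = Some b --> (\<exists>c. app A r x = Some c \<and> le A c b)"
proof -
 obtain k s where k: "k \<in> elts A" and s: "s \<in> elts A"
  and K: "\<forall>a\<in>elts A. \<forall>b\<in>elts A. \<exists>u v. app A k a = Some u \<and> u \<in> elts A \<and> app A u b = Some v \<and> le A v a \<and> v \<in> elts A"
  and S: "\<forall>a\<in>elts A. \<forall>b\<in>elts A. \<exists>u v. app A s a = Some u \<and> u \<in> elts A \<and> app A u b = Some v \<and> v \<in> elts A \<and>
    (s_law A a b v)"
  by (rule k_s_exist) (rule that)
 show ?thesis using assms
 proof (induction t)
  case Var
  obtain u v where uv: "app A s k = Some u" "u \<in> elts A" "app A u k = Some v" "v \<in> elts A" 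
   and v: "s_law A k k v"
   using bspec[OF bspec[OF S k] k] by (elim exE conjE) (rule that)
  have "\<exists>c. app A v x = Some c \<and> le A c x" if x: "x \<in> elts A" for x
  proof -
   obtain y where y: "app A k x = Some y" "y \<in> elts A" using K x k by blast
   obtain z where z: "app A y y = Some z" "le A z x" "z \<in> elts A" using K x y by fastforce
   obtain w where "w \<in> elts A" "app A v x = Some w" "le A w z" using v x y z by blast
   then show ?thesis using le_trans z x by blast
  qed
  then show ?case using uv by auto
 next
  case (Cst c)
  then obtain u where u: "app A k c = Some u" "u \<in> elts A" using K k by fastforce
  have "\<exists>d. app A u x = Some d \<and> le A d c" if "x \<in> elts A" for x
   using K Cst that u by fastforce
  then show ?case using u by auto
 next
  case (App t1 t2)
  obtain r1 where r1: "r1 \<in> elts A" "\<forall>x\<in>elts A. \<forall>b. eval_pterm A x t1 = Some b --> (\<exists>c. app A r1 x = Some c \<and> le A c b)"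
   using App by auto
  obtain r2 where r2: "r2 \<in> elts A" "\<forall>x\<in>elts A. \<forall>b. eval_pterm A x t2 = Some b --> (\<exists>c. app A r2 x = Some c \<and> le A c b)"
   using App by auto
  obtain u v where uv: "app A s r1 = Some u" "u \<in> elts A" "app A u r2 = Some v" "v \<in> elts A" 
   and v: "s_law A r1 r2 v"
   using bspec[OF bspec[OF S r1(1)] r2(1)] by (elim exE conjE) (rule that)
  have "\<exists>c. app A v x = Some c \<and> le A c b" if x: "x \<in> elts A" and b: "eval_pterm A x (App t1 t2) = Some b" for x b
  proof -
   obtain f g where fg: "eval_pterm A x t1 = Some f" "eval_pterm A x t2 = Some g" "app A f g = Some b"
    using b by (auto simp: oapp_eq_Some)
   have fgE: "f \<in> elts A" "g \<in> elts A" using eval_pterm_closed[OF _ x] fg App.prems by auto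
   then have bE: "b \<in> elts A" using app_closed fg(3) by blast
   obtain f' g' where f': "app A r1 x = Some f'" "le A f' f" and g': "app A r2 x = Some g'" "le A g' g"
    using r1 r2 x fg by blast
   have fgE': "f' \<in> elts A" "g' \<in> elts A" using app_closed[OF f'(1) r1(1) x] app_closed[OF g'(1) r2(1) x] .
   obtain b' where b': "app A f' g' = Some b'" "le A b' b" "b' \<in> elts A"
    using app_mono[OF fg(3) f'(2) g'(2) fgE fgE'] .
   obtain w where "w \<in> elts A" "app A v x = Some w" "le A w b'" using v x f' g' b' by blast
   then show ?thesis using le_trans b' bE by blast
  qed
  then show ?case using uv by blast
 qed
qed

text \<open>The usual coding of pairs by combinators; a projection evaluates a pair at the corresponding selector.\<close>

lemma pairing_exists: "\<exists>pr. is_pairing A pr"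
proof -
 obtain k s where k: "k \<in> elts A" and s: "s \<in> elts A"
  and K: "\<forall>a\<in>elts A. \<forall>b\<in>elts A. \<exists>u v. app A k a = Some u \<and> u \<in> elts A \<and> app A u b = Some v \<and> le A v a \<and> v \<in> elts A"
  and S: "\<forall>a\<in>elts A. \<forall>b\<in>elts A. \<exists>u v. app A s a = Some u \<and> u \<in> elts A \<and> app A u b = Some v \<and> v \<in> elts A \<and>
    (s_law A a b v)"
  by (rule k_s_exist) (rule that)
 obtain i where i: "i \<in> elts A" "\<And>x. x \<in> elts A ==> \<exists>c. app A i x = Some c \<and> le A c x"
  using combinatory_completeness[of Var] by auto
 \<comment> \<open>the pair of \<open>a\<close> and \<open>b\<close> is \<open>\<lambda>z. z a b\<close>\<close>
 define pr_expr where "pr_expr a b = oapp A (oapp A (Some s) (oapp A (oapp A (Some s) (Some i)) (app A k a))) (app A k b)" for a b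
 have pr_expr: "\<exists>p\<in>elts A. pr_expr a b = Some p \<and>
   (\<forall>z\<in>elts A. \<forall>x y. app A z a = Some x \<and> app A x b = Some y --> (\<exists>w\<in>elts A. app A p z = Some w \<and> le A w y))"
  if a: "a \<in> elts A" and b: "b \<in> elts A" for a b
 proof -
  obtain ka where ka: "app A k a = Some ka" "ka \<in> elts A" using K a by blast
  obtain kb where kb: "app A k b = Some kb" "kb \<in> elts A" using K b by blast
  have kaz: "\<exists>v\<in>elts A. app A ka z = Some v \<and> le A v a" "\<exists>v\<in>elts A. app A kb z = Some v \<and> le A v b" if "z \<in> elts A" for z
   using bspec[OF bspec[OF K a] that] bspec[OF bspec[OF K b] that] ka kb by auto
  obtain u v where uv: "app A s i = Some u" "u \<in> elts A" "app A u ka = Some v" "v \<in> elts A" 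
   and v: "s_law A i ka v"
   using bspec[OF bspec[OF S i(1)] ka(2)] by (elim exE conjE) (rule that)
  obtain u' p where up: "app A s v = Some u'" "u' \<in> elts A" "app A u' kb = Some p" "p \<in> elts A" 
   and p: "\<forall>c\<in>elts A. \<forall>x y z. app A v c = Some x \<and> app A kb c = Some y \<and> app A x y = Some z -->
     (\<exists>w\<in>elts A. app A p c = Some w \<and> le A w z)"
   using bspec[OF bspec[OF S uv(4)] kb(2)] by (elim exE conjE) (rule that)
  have "pr_expr a b = Some p" using ka kb uv up by (simp add: pr_expr_def)
  moreover have "\<exists>w\<in>elts A. app A p z = Some w \<and> le A w y"
   if z: "z \<in> elts A" and xy: "app A z a = Some x" "app A x b = Some y" for z x y
  proof -
   have xyE: "x \<in> elts A" "y \<in> elts A" using app_closed xy z a b by blast+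
   obtain z' where z': "app A i z = Some z'" "le A z' z" using i(2) z by blast
   have z'E: "z' \<in> elts A" using app_closed z' i z by blast
   obtain a' where a': "a' \<in> elts A" "app A ka z = Some a'" "le A a' a" using kaz z by blast
   obtain b' where b': "b' \<in> elts A" "app A kb z = Some b'" "le A b' b" using kaz z by blast
   obtain x' where x': "app A z' a' = Some x'" "le A x' x" "x' \<in> elts A" using app_mono[OF xy(1) z'(2) a'(3) z a z'E a'(1)] .
   obtain x'' where x'': "x'' \<in> elts A" "app A v z = Some x''" "le A x'' x'" using v z z' a' x' by blast
   have "le A x'' x" using le_trans[OF x''(3) x'(2) x''(1) x'(3) xyE(1)] .
   then obtain y' where y': "app A x'' b' = Some y'" "le A y' y" "y' \<in> elts A"
    using app_mono[OF xy(2) _ b'(3) xyE(1) b x''(1) b'(1)] by blast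
   obtain w where w: "w \<in> elts A" "app A p z = Some w" "le A w y'" using p z x'' b' y' by blast
   then show ?thesis using le_trans[OF w(3) y'(2) w(1) y'(3) xyE(2)] by blast
  qed
  ultimately show ?thesis using up(4) by blast
 qed
 define pr where "pr a b = the (pr_expr a b)" for a b
 have prE: "pr a b \<in> elts A" and pr_eq: "pr_expr a b = Some (pr a b)" 
  and pr: "\<And>z x y. z \<in> elts A ==> app A z a = Some x ==> app A x b = Some y ==> \<exists>w\<in>elts A. app A (pr a b) z = Some w \<and> le A w y"
  if "a \<in> elts A" "b \<in> elts A" for a b
  using pr_expr[OF that] unfolding pr_def by auto
 have pr_le: "\<exists>d\<in>elts A. app A c z = Some d \<and> le A d y"
  if abc: "a \<in> elts A" "b \<in> elts A" "c \<in> elts A" "le A c (pr a b)" "z \<in> elts A" "app A z a = Some x" "app A x b = Some y" for a b c z x y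
 proof -
  obtain w where w: "w \<in> elts A" "app A (pr a b) z = Some w" "le A w y" using pr[OF abc(1,2,5,6,7)] by blast
  obtain d where d: "app A c z = Some d" "le A d w" "d \<in> elts A"
   using app_mono[OF w(2) abc(4) le_refl[OF abc(5)] prE[OF abc(1,2)] abc(5,3,5)] .
  have "y \<in> elts A" using app_closed abc by blast
  then show ?thesis using d le_trans[OF d(2) w(3) d(3) w(1)] by blast
 qed
 have "\<exists>r\<in>elts A. \<forall>a\<in>elts A. \<forall>b\<in>elts A. \<forall>c\<in>elts A. le A c (pr a b) --> (\<exists>d. app A r c = Some d \<and> le A d a)"
 proof -
  obtain r where r: "r \<in> elts A" "\<forall>x\<in>elts A. \<forall>b. eval_pterm A x (App Var (Cst k)) = Some b --> (\<exists>c. app A r x = Some c \<and> le A c b)"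
   using combinatory_completeness[of "App Var (Cst k)"] k by auto
  have "\<exists>d. app A r c = Some d \<and> le A d a" if abc: "a \<in> elts A" "b \<in> elts A" "c \<in> elts A" "le A c (pr a b)" for a b c
  proof -
   obtain x y where xy: "app A k a = Some x" "app A x b = Some y" "le A y a" "y \<in> elts A" using K abc by blast
   obtain d where d: "d \<in> elts A" "app A c k = Some d" "le A d y" using pr_le[OF abc k xy(1,2)] by blast
   obtain e where e: "app A r c = Some e" "le A e d" using r(2) abc(3) d by auto
   have eE: "e \<in> elts A" using app_closed[OF e(1) r(1) abc(3)] .
   then show ?thesis using e le_trans[OF e(2) le_trans[OF d(3) xy(3) d(1) xy(4) abc(1)] eE d(1) abc(1)] by blast
  qed
  then show ?thesis using r(1) by blast
 qed
 moreover have "\<exists>r\<in>elts A. \<forall>a\<in>elts A. \<forall>b\<in>elts A. \<forall>c\<in>elts A. le A c (pr a b) --> (\<exists>d. app A r c = Some d \<and> le A d b)"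
 proof -
  obtain ki where ki: "app A k i = Some ki" "ki \<in> elts A" using K i by blast
  obtain r where r: "r \<in> elts A" "\<forall>x\<in>elts A. \<forall>b. eval_pterm A x (App Var (Cst ki)) = Some b --> (\<exists>c. app A r x = Some c \<and> le A c b)"
   using combinatory_completeness[of "App Var (Cst ki)"] ki by auto
  have "\<exists>d. app A r c = Some d \<and> le A d b" if abc: "a \<in> elts A" "b \<in> elts A" "c \<in> elts A" "le A c (pr a b)" for a b c
  proof -
   obtain x where x: "app A ki a = Some x" "le A x i" "x \<in> elts A" using bspec[OF bspec[OF K i(1)] abc(1)] ki by auto
   obtain b' where b': "app A i b = Some b'" "le A b' b" using i(2) abc by blast
   have b'E: "b' \<in> elts A" using app_closed b' i abc by blast
   obtain y where y: "app A x b = Some y" "le A y b'" "y \<in> elts A" using app_mono[OF b'(1) x(2) le_refl[OF abc(2)] i(1) abc(2) x(3) abc(2)] .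
   obtain d where d: "d \<in> elts A" "app A c ki = Some d" "le A d y" using pr_le[OF abc ki(2) x(1) y(1)] by blast
   obtain e where e: "app A r c = Some e" "le A e d" using r(2) abc(3) d by auto
   have eE: "e \<in> elts A" using app_closed[OF e(1) r(1) abc(3)] .
   have "le A y b" using le_trans[OF y(2) b'(2) y(3) b'E abc(2)] .
   then show ?thesis using e le_trans[OF e(2) le_trans[OF d(3) _ d(1) y(3) abc(2)] eE d(1) abc(2)] by blast
  qed
  then show ?thesis using r(1) by blast
 qed
 moreover have "\<exists>t\<in>elts A. \<forall>a\<in>elts A. \<forall>b c. app A r a = Some b \<and> app A r' a = Some c --> (\<exists>d. app A t a = Some d \<and> le A d (pr b c))"
  if rr: "r \<in> elts A" "r' \<in> elts A" for r r'
 proof -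
  let ?t = "App (App (Cst s) (App (App (Cst s) (Cst i)) (App (Cst k) (App (Cst r) Var)))) (App (Cst k) (App (Cst r') Var))"
  obtain t where t: "t \<in> elts A" "\<forall>x\<in>elts A. \<forall>b. eval_pterm A x ?t = Some b --> (\<exists>c. app A t x = Some c \<and> le A c b)"
   using combinatory_completeness[of ?t] k s i rr by auto
  have "\<exists>d. app A t a = Some d \<and> le A d (pr b c)" if a: "a \<in> elts A" and bc: "app A r a = Some b" "app A r' a = Some c" for a b c
  proof -
   have "b \<in> elts A" "c \<in> elts A" using app_closed bc rr a by blast+
   then have "eval_pterm A a ?t = Some (pr b c)" using pr_eq bc by (simp add: pr_expr_def)
   then show ?thesis using t(2) a by blast
  qed
  then show ?thesis using t(1) by blast
 qed
 ultimately have "is_pairing A pr" unfolding is_pairing_def using prE by blast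
 then show ?thesis by blast
qed

lemma pairing: "is_pairing A (pairing A)"
 unfolding pairing_def using pairing_exists by (rule someI_ex)

lemma pairing_tuple:
 assumes "r \<in> elts A" "s \<in> elts A"
 shows "\<exists>t\<in>elts A. \<forall>a\<in>elts A. \<forall>b c. app A r a = Some b \<and> app A s a = Some c -->
    (\<exists>d. app A t a = Some d \<and> le A d (pairing A b c))"
proof -
 have "\<forall>r\<in>elts A. \<forall>s\<in>elts A. \<exists>t\<in>elts A. \<forall>a\<in>elts A. \<forall>b c. app A r a = Some b \<and> app A s a = Some c -->
    (\<exists>d. app A t a = Some d \<and> le A d (pairing A b c))"
  using pairing unfolding is_pairing_def by (elim conjE)
 from bspec[OF bspec[OF this assms(1)] assms(2)] show ?thesis .
qed

end

text \<open>
 Realizability of an implication, uniformly in a parameter ranging over \<open>I\<close>; the arrows of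
 assemblies, relations between assemblies and regular epimorphisms are all described by it.
\<close>

definition realizes :: "'a opas => 'a => 'a set => 'a set => bool" where
 "realizes A r p q \<longleftrightarrow> (\<forall>a\<in>p. \<exists>b. app A r a = Some b \<and> b \<in> q)"

definition tracked :: "'a opas => 'i set => ('i => 'a set) => ('i => 'a set) => bool" where
 "tracked A I P Q \<longleftrightarrow> (\<exists>r\<in>elts A. \<forall>i\<in>I. realizes A r (P i) (Q i))"

definition closed :: "'a opas => 'a set => bool" where
 "closed A q \<longleftrightarrow> q \<subseteq> elts A \<and> (\<forall>a\<in>q. \<forall>b\<in>elts A. le A b a --> b \<in> q)"

definition both :: "'a opas => 'a set => 'a set => 'a set" where
 "both A p q = {c \<in> elts A. \<exists>a\<in>p. \<exists>b\<in>q. le A c (pairing A a b)}"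

lemma downsets_iff: "D \<in> downsets A \<longleftrightarrow> closed A D \<and> D \<noteq> {}"
 by (auto simp: downsets_def closed_def)

lemma closed_elts: "closed A q ==> q \<subseteq> elts A"
 by (simp add: closed_def)

lemma closed_UN: "(\<And>i. i \<in> I ==> closed A (Q i)) ==> closed A (\<Union>i\<in>I. Q i)"
 unfolding closed_def by blast

lemma tracked_reindex:
 assumes "tracked A J P Q" "\<And>i. i \<in> I ==> f i \<in> J"
 shows "tracked A I (\<lambda>i. P (f i)) (\<lambda>i. Q (f i))"
 using assms unfolding tracked_def by blast

lemma tracked_weaken:
 assumes "tracked A I P Q" "\<And>i. i \<in> I ==> Q i \<subseteq> Q' i"
 shows "tracked A I P Q'"
 using assms unfolding tracked_def realizes_def by blast

context opca_alg
begin

lemma closed_both: "p \<subseteq> elts A ==> q \<subseteq> elts A ==> closed A (both A p q)"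
 unfolding closed_def both_def using le_trans pairing unfolding is_pairing_def by blast

lemma both_nonempty: "p \<subseteq> elts A ==> q \<subseteq> elts A ==> p \<noteq> {} ==> q \<noteq> {} ==> both A p q \<noteq> {}"
 using pairing le_refl unfolding both_def is_pairing_def by blast

lemma closed_elts_all: "closed A (elts A)"
 by (simp add: closed_def)

lemma elts_nonempty: "elts A \<noteq> {}"
 using opca unfolding opca_def by (elim conjE bexE) auto

lemma tracked_incl:
 assumes "\<And>i. i \<in> I ==> P i \<subseteq> Q i" "\<And>i. i \<in> I ==> closed A (Q i)"
 shows "tracked A I P Q"
proof -
 obtain r where r: "r \<in> elts A" "\<And>x. x \<in> elts A ==> \<exists>c. app A r x = Some c \<and> le A c x"
  using combinatory_completeness[of Var] by auto
 have "\<exists>b. app A r a = Some b \<and> b \<in> Q i" if "i \<in> I" "a \<in> P i" for i a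
 proof -
  have a: "a \<in> Q i" "a \<in> elts A" using assms that unfolding closed_def by blast+
  obtain c where c: "app A r a = Some c" "le A c a" using r a by blast
  then show ?thesis using app_closed[OF c(1) r(1) a(2)] assms(2)[OF that(1)] a unfolding closed_def by blast
 qed
 then show ?thesis unfolding tracked_def realizes_def using r(1) by blast
qed

lemma tracked_const:
 assumes c: "c \<in> elts A" "\<And>i. i \<in> I ==> c \<in> Q i" and "\<And>i. i \<in> I ==> closed A (Q i)" "\<And>i. i \<in> I ==> P i \<subseteq> elts A"
 shows "tracked A I P Q"
proof -
 obtain r where r: "r \<in> elts A" "\<And>x. x \<in> elts A ==> \<exists>d. app A r x = Some d \<and> le A d c"
  using combinatory_completeness[of "Cst c"] c by auto
 have "\<exists>b. app A r a = Some b \<and> b \<in> Q i" if "i \<in> I" "a \<in> P i" for i a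
 proof -
  have a: "a \<in> elts A" using assms that by blast
  obtain d where d: "app A r a = Some d" "le A d c" using r a by blast
  then show ?thesis using app_closed[OF d(1) r(1) a] assms(3)[OF that(1)] c(2)[OF that(1)] unfolding closed_def by blast
 qed
 then show ?thesis unfolding tracked_def realizes_def using r(1) by blast
qed

lemma tracked_trans:
 assumes PQ: "tracked A I P Q" and QR: "tracked A I Q R" and "\<And>i. i \<in> I ==> P i \<subseteq> elts A" "\<And>i. i \<in> I ==> closed A (R i)"
 shows "tracked A I P R"
proof -
 obtain r where r: "r \<in> elts A" "\<forall>i\<in>I. realizes A r (P i) (Q i)" using PQ unfolding tracked_def by blast
 obtain s where s: "s \<in> elts A" "\<forall>i\<in>I. realizes A s (Q i) (R i)" using QR unfolding tracked_def by blast
 obtain t where t: "t \<in> elts A" "\<forall>x\<in>elts A. \<forall>b. eval_pterm A x (App (Cst s) (App (Cst r) Var)) = Some b --> (\<exists>c. app A t x = Some c \<and> le A c b)"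
  using combinatory_completeness[of "App (Cst s) (App (Cst r) Var)"] r s by auto
 have "\<exists>b. app A t a = Some b \<and> b \<in> R i" if i: "i \<in> I" and a: "a \<in> P i" for i a
 proof -
  have aE: "a \<in> elts A" using assms(3) i a by blast
  obtain b where b: "app A r a = Some b" "b \<in> Q i" using r i a unfolding realizes_def by blast
  obtain c where c: "app A s b = Some c" "c \<in> R i" using s i b unfolding realizes_def by blast
  have "eval_pterm A a (App (Cst s) (App (Cst r) Var)) = Some c" using b c by simp
  then obtain d where d: "app A t a = Some d" "le A d c" using t aE by blast
  then show ?thesis using app_closed[OF d(1) t(1) aE] assms(4)[OF i] c unfolding closed_def by blast
 qed
 then show ?thesis unfolding tracked_def realizes_def using t(1) by blast
qed

lemma tracked_fst:
 assumes "\<And>i. i \<in> I ==> closed A (P i)" "\<And>i. i \<in> I ==> Q i \<subseteq> elts A"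
 shows "tracked A I (\<lambda>i. both A (P i) (Q i)) P"
proof -
 obtain r where r: "r \<in> elts A" "\<forall>a\<in>elts A. \<forall>b\<in>elts A. \<forall>c\<in>elts A. le A c (pairing A a b) --> (\<exists>d. app A r c = Some d \<and> le A d a)"
  using pairing unfolding is_pairing_def by blast
 have "\<exists>d. app A r c = Some d \<and> d \<in> P i" if i: "i \<in> I" and c: "c \<in> both A (P i) (Q i)" for i c
 proof -
  obtain a b where ab: "c \<in> elts A" "a \<in> P i" "b \<in> Q i" "le A c (pairing A a b)" using c by (auto simp: both_def)
  have abE: "a \<in> elts A" "b \<in> elts A" using assms[OF i] ab unfolding closed_def by blast+
  obtain d where d: "app A r c = Some d" "le A d a" using r ab abE by blast
  then show ?thesis using app_closed[OF d(1) r(1) ab(1)] assms(1)[OF i] ab(2) unfolding closed_def by blast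
 qed
 then show ?thesis unfolding tracked_def realizes_def using r(1) by blast
qed

lemma tracked_snd:
 assumes "\<And>i. i \<in> I ==> P i \<subseteq> elts A" "\<And>i. i \<in> I ==> closed A (Q i)"
 shows "tracked A I (\<lambda>i. both A (P i) (Q i)) Q"
proof -
 obtain r where r: "r \<in> elts A" "\<forall>a\<in>elts A. \<forall>b\<in>elts A. \<forall>c\<in>elts A. le A c (pairing A a b) --> (\<exists>d. app A r c = Some d \<and> le A d b)"
  using pairing unfolding is_pairing_def by blast
 have "\<exists>d. app A r c = Some d \<and> d \<in> Q i" if i: "i \<in> I" and c: "c \<in> both A (P i) (Q i)" for i c
 proof -
  obtain a b where ab: "c \<in> elts A" "a \<in> P i" "b \<in> Q i" "le A c (pairing A a b)" using c by (auto simp: both_def)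
  have abE: "a \<in> elts A" "b \<in> elts A" using assms[OF i] ab unfolding closed_def by blast+
  obtain d where d: "app A r c = Some d" "le A d b" using r ab abE by blast
  then show ?thesis using app_closed[OF d(1) r(1) ab(1)] assms(2)[OF i] ab(3) unfolding closed_def by blast
 qed
 then show ?thesis unfolding tracked_def realizes_def using r(1) by blast
qed

lemma tracked_pair:
 assumes PQ: "tracked A I P Q" and PR: "tracked A I P R" and P: "\<And>i. i \<in> I ==> P i \<subseteq> elts A"
 shows "tracked A I P (\<lambda>i. both A (Q i) (R i))"
proof -
 obtain r where r: "r \<in> elts A" "\<forall>i\<in>I. realizes A r (P i) (Q i)" using PQ unfolding tracked_def by blast
 obtain s where s: "s \<in> elts A" "\<forall>i\<in>I. realizes A s (P i) (R i)" using PR unfolding tracked_def by blast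
 obtain t where t: "t \<in> elts A" "\<forall>a\<in>elts A. \<forall>b c. app A r a = Some b \<and> app A s a = Some c -->
    (\<exists>d. app A t a = Some d \<and> le A d (pairing A b c))"
  using pairing_tuple[OF r(1) s(1)] by (elim bexE) (rule that)
 have "\<exists>d. app A t a = Some d \<and> d \<in> both A (Q i) (R i)" if i: "i \<in> I" and a: "a \<in> P i" for i a
 proof -
  have aE: "a \<in> elts A" using P i a by blast
  obtain b where b: "app A r a = Some b" "b \<in> Q i" using r i a unfolding realizes_def by blast
  obtain c where c: "app A s a = Some c" "c \<in> R i" using s i a unfolding realizes_def by blast
  obtain d where d: "app A t a = Some d" "le A d (pairing A b c)" using t(2) aE b c by blast
  then show ?thesis using app_closed[OF d(1) t(1) aE] b c by (auto simp: both_def)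
 qed
 then show ?thesis unfolding tracked_def realizes_def using t(1) by blast
qed

end

section \<open>The calculus of relations\<close>

text \<open>A regular epimorphism is epic: it is a coequalizer.\<close>

lemma regular_epi_cancel:
 assumes C: "category C" and e: "regular_epi C e" "e \<in> hom C Z Y"
  and f: "f \<in> hom C Y W" and g: "g \<in> hom C Y W" and eq: "f o[C] e = g o[C] e"
 shows "f = g"
proof -
 have de: "dom C e = Z" "cod C e = Y" using e(2) by (auto simp: hom_def)
 obtain V a b where a: "a \<in> hom C V Z" and b: "b \<in> hom C V Z" and ab: "e o[C] a = e o[C] b"
  and u: "\<forall>W\<in>ob C. \<forall>h \<in> hom C Z W. h o[C] a = h o[C] b --> (\<exists>!k. k \<in> hom C Y W \<and> k o[C] e = h)"
  using e(1) unfolding regular_epi_def de by (elim conjE bexE) (rule that)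
 note fe = comp_hom[OF C e(2) f]
 have "(f o[C] e) o[C] a = (f o[C] e) o[C] b"
  using comp_assoc[OF C a e(2) f] comp_assoc[OF C b e(2) f] ab by simp
 with u have "\<exists>!k. k \<in> hom C Y W \<and> k o[C] e = f o[C] e" using fe category_ob(2)[OF C f] by blast
 then show ?thesis using f g eq by metis
qed

lemma regular_epi_ident:
 assumes C: "category C" and X: "X \<in> ob C"
 shows "regular_epi C (ident C X)"
proof -
 note i = ident_hom[OF C X]
 have d: "dom C (ident C X) = X" "cod C (ident C X) = X" "ident C X \<in> arr C" using i by (auto simp: hom_def)
 have "\<exists>!k. k \<in> hom C X W \<and> k o[C] ident C X = h" if h: "h \<in> hom C X W" for W h
  using comp_ident(1)[OF C] h by (intro ex1I[of _ h]) auto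
 then show ?thesis unfolding regular_epi_def d(1,2) using d(3) X i by blast
qed

lemma relation_hom:
 assumes C: "category C" and R: "R \<in> relations C X Y" "(f, g) \<in> R"
 obtains Z where "f \<in> hom C Z X" "g \<in> hom C Z Y"
proof -
 obtain a b where ab: "R = span_relation C a b" "jointly_monic C a b" "cod C a = X" "cod C b = Y"
  using R(1) by (auto simp: relations_def)
 then obtain h where h: "f = a o[C] h" "g = b o[C] h" "h \<in> arr C" "cod C h = dom C a"
  using R(2) by (auto simp: span_relation_def)
 have "a \<in> hom C (dom C a) X" "b \<in> hom C (dom C a) Y" "h \<in> hom C (dom C h) (dom C a)"
  using ab h by (auto simp: jointly_monic_def hom_def)
 then show thesis using that h comp_hom[OF C] by blast
qed

lemma relation_precomp:
 assumes C: "category C" and R: "R \<in> relations C X Y" "(f, g) \<in> R" and f: "f \<in> hom C Z X" and k: "k \<in> hom C V Z"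
 shows "(f o[C] k, g o[C] k) \<in> R"
proof -
 obtain a b where ab: "R = span_relation C a b" "jointly_monic C a b" "cod C a = X" "cod C b = Y"
  using R(1) by (auto simp: relations_def)
 then obtain h where h: "f = a o[C] h" "g = b o[C] h" "h \<in> arr C" "cod C h = dom C a"
  using R(2) by (auto simp: span_relation_def)
 have a: "a \<in> hom C (dom C a) X" and b: "b \<in> hom C (dom C a) Y" and h': "h \<in> hom C (dom C h) (dom C a)"
  using ab h by (auto simp: jointly_monic_def hom_def)
 have "dom C h = Z" using comp_hom[OF C h' a] h(1) f by (auto simp: hom_def)
 then have h': "h \<in> hom C Z (dom C a)" using h' by simp
 have "h o[C] k \<in> arr C" "cod C (h o[C] k) = dom C a" using comp_hom[OF C k h'] by (auto simp: hom_def)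
 then show ?thesis
  using h comp_assoc[OF C k h' a] comp_assoc[OF C k h' b] unfolding ab(1) span_relation_def by blast
qed

text \<open>Membership in a relation is local for the regular topology.\<close>

lemma relation_descent:
 assumes C: "category C" and R: "R \<in> relations C X Y" and f: "f \<in> hom C Z X" and g: "g \<in> hom C Z Y"
  and e: "regular_epi C e" "e \<in> hom C V Z" and fg: "(f o[C] e, g o[C] e) \<in> R"
 shows "(f, g) \<in> R"
proof -
 obtain a b where ab: "R = span_relation C a b" "jointly_monic C a b" "cod C a = X" "cod C b = Y"
  using R(1) by (auto simp: relations_def)
 then obtain h where h: "f o[C] e = a o[C] h" "g o[C] e = b o[C] h" "h \<in> arr C" "cod C h = dom C a"
  using fg by (auto simp: span_relation_def)
 define D where "D = dom C a"
 have a: "a \<in> hom C D X" and b: "b \<in> hom C D Y" and h': "h \<in> hom C (dom C h) D"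
  using ab h by (auto simp: jointly_monic_def hom_def D_def)
 have "dom C h = V" using comp_hom[OF C h' a] h(1) comp_hom[OF C e(2) f] by (auto simp: hom_def)
 then have h': "h \<in> hom C V D" using h' by simp
 have de: "dom C e = V" "cod C e = Z" using e(2) by (auto simp: hom_def)
 obtain W c d where c: "c \<in> hom C W V" and d: "d \<in> hom C W V" and cd: "e o[C] c = e o[C] d" and W: "W \<in> ob C"
  and u: "\<forall>W\<in>ob C. \<forall>h \<in> hom C V W. h o[C] c = h o[C] d --> (\<exists>!k. k \<in> hom C Z W \<and> k o[C] e = h)"
  using e(1) unfolding regular_epi_def de by (elim conjE bexE) (rule that)
 have *: "a o[C] (h o[C] x) = f o[C] (e o[C] x)" "b o[C] (h o[C] x) = g o[C] (e o[C] x)" if "x \<in> hom C W V" for x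
  using h comp_assoc[OF C that h' a] comp_assoc[OF C that h' b] comp_assoc[OF C that e(2) f] comp_assoc[OF C that e(2) g] by simp_all
 have "h o[C] c = h o[C] d"
  using ab(2) W comp_hom[OF C c h'] comp_hom[OF C d h'] *[OF c] *[OF d] cd
  unfolding jointly_monic_def D_def[symmetric] by simp
 then obtain k where k: "k \<in> hom C Z D" "k o[C] e = h" using u h' category_ob(2)[OF C h'] by blast
 have "a o[C] k = f"
  using regular_epi_cancel[OF C e comp_hom[OF C k(1) a] f] comp_assoc[OF C e(2) k(1) a] k(2) h(1) by simp
 moreover have "b o[C] k = g"
  using regular_epi_cancel[OF C e comp_hom[OF C k(1) b] g] comp_assoc[OF C e(2) k(1) b] k(2) h(2) by simp
 ultimately show ?thesis using k(1) unfolding ab(1) span_relation_def by (auto simp: hom_def D_def)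
qed

lemma relation_converse: "R \<in> relations C X Y ==> R\<inverse> \<in> relations C Y X"
proof -
 assume "R \<in> relations C X Y"
 then obtain a b where ab: "R = span_relation C a b" "jointly_monic C a b" "cod C a = X" "cod C b = Y"
  by (auto simp: relations_def)
 have "R\<inverse> = span_relation C b a" using ab by (auto simp: span_relation_def jointly_monic_def)
 moreover have "jointly_monic C b a" using ab(2) by (auto simp: jointly_monic_def)
 ultimately show ?thesis using ab by (auto simp: relations_def)
qed

lemma graph_relation:
 assumes C: "category C" and t: "t \<in> hom C Z X"
 shows "{(g, t o[C] g) | g. g \<in> arr C \<and> cod C g = Z} \<in> relations C Z X"
proof -
 note i = ident_hom[OF C category_ob(1)[OF C t]]
 have d: "dom C (ident C Z) = Z" "cod C (ident C Z) = Z" "ident C Z \<in> arr C" "dom C t = Z" "cod C t = X" "t \<in> arr C"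
  using i t by (auto simp: hom_def)
 have "jointly_monic C (ident C Z) t" unfolding jointly_monic_def
  using d comp_ident(2)[OF C] by (metis (no_types, lifting))
 moreover have "{(g, t o[C] g) | g. g \<in> arr C \<and> cod C g = Z} = span_relation C (ident C Z) t"
  unfolding span_relation_def d using comp_ident(2)[OF C homI] by force
 ultimately show ?thesis unfolding relations_def using d by blast
qed

lemma rel_comp_mono: "R \<subseteq> R' ==> S \<subseteq> S' ==> rel_comp C R S \<subseteq> rel_comp C R' S'"
 unfolding rel_comp_def by blast

lemma rel_comp_converse: "(rel_comp C R S)\<inverse> = rel_comp C (S\<inverse>) (R\<inverse>)"
 unfolding rel_comp_def by auto

lemma rel_compI:
 assumes "f \<in> hom C Z X" "g \<in> hom C Z Y" "regular_epi C e" "e \<in> hom C V Z" "(f o[C] e, m) \<in> R" "(m, g o[C] e) \<in> S"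
 shows "(f, g) \<in> rel_comp C R S"
proof -
 have "f \<in> arr C" "g \<in> arr C" "dom C f = dom C g" "cod C e = dom C f" using assms(1,2,4) by (auto simp: hom_def)
 then show ?thesis unfolding rel_comp_def using assms(3,5,6) by blast
qed

lemma rel_compE:
 assumes "(f, g) \<in> rel_comp C R S"
 obtains Z V e m where "f \<in> hom C Z (cod C f)" "g \<in> hom C Z (cod C g)" "regular_epi C e" "e \<in> hom C V Z"
  "(f o[C] e, m) \<in> R" "(m, g o[C] e) \<in> S"
proof -
 from assms obtain e m where *: "f \<in> arr C" "g \<in> arr C" "dom C f = dom C g" "regular_epi C e" "cod C e = dom C f"
  "(f o[C] e, m) \<in> R" "(m, g o[C] e) \<in> S" unfolding rel_comp_def by blast
 have "e \<in> hom C (dom C e) (dom C f)" using *(4,5) by (auto simp: hom_def regular_epi_def)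
 then show thesis using that[of "dom C f" e "dom C e" m] * by (auto simp: hom_def)
qed

lemma rel_comp_simpleI:
 assumes C: "category C" and "f \<in> hom C Z X" "g \<in> hom C Z Y" "(f, m) \<in> R" "(m, g) \<in> S"
 shows "(f, g) \<in> rel_comp C R S"
 using rel_compI[OF assms(2,3) regular_epi_ident[OF C category_ob(1)[OF C assms(2)]] ident_hom[OF C category_ob(1)[OF C assms(2)]]]
  assms comp_ident(1)[OF C] by simp

text \<open>
 What is needed of a regular category for relations to compose: regular epimorphisms compose, and
 the composite of two relations is again a relation.
\<close>

locale rel_cat =
 fixes C :: "('o, 'm) cat"
 assumes C: "category C"
  and re_comp: "regular_epi C e ==> e \<in> hom C X Y ==> regular_epi C e' ==> e' \<in> hom C Y Z ==> regular_epi C (e' o[C] e)"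
  and rel_closed: "R \<in> relations C X Y ==> S \<in> relations C Y Z ==> rel_comp C R S \<in> relations C X Z"
begin

lemma rel_comp_hom:
 assumes "R \<in> relations C X Y" "S \<in> relations C Y Z" "(f, g) \<in> rel_comp C R S"
 obtains V where "f \<in> hom C V X" "g \<in> hom C V Z"
 using relation_hom[OF C rel_closed[OF assms(1,2)] assms(3)] .

text \<open>Both sides consist of the pairs that are connected by two intermediate elements after passage to a cover.\<close>

lemma rel_comp_assoc:
 assumes R: "R \<in> relations C W X" and S: "S \<in> relations C X Y" and T: "T \<in> relations C Y Z"
 shows "rel_comp C (rel_comp C R S) T = rel_comp C R (rel_comp C S T)"
proof (intro set_eqI iffI; clarify)
 fix f g assume "(f, g) \<in> rel_comp C (rel_comp C R S) T"
 then obtain U V e m where 1: "f \<in> hom C U (cod C f)" "g \<in> hom C U (cod C g)" "regular_epi C e" "e \<in> hom C V U"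
  "(f o[C] e, m) \<in> rel_comp C R S" "(m, g o[C] e) \<in> T" by (rule rel_compE)
 note fe = comp_hom[OF C 1(4) 1(1)] and ge = comp_hom[OF C 1(4) 1(2)]
 obtain V1 V2 e' m' where 2: "f o[C] e \<in> hom C V1 (cod C (f o[C] e))" "m \<in> hom C V1 (cod C m)" "regular_epi C e'" "e' \<in> hom C V2 V1"
  "((f o[C] e) o[C] e', m') \<in> R" "(m', m o[C] e') \<in> S" using 1(5) by (rule rel_compE)
 have "V1 = V" using 2(1) fe by (simp add: hom_def)
 then have m: "m \<in> hom C V (cod C m)" and e': "e' \<in> hom C V2 V" using 2 by simp_all
 have mY: "m \<in> hom C V Y" using relation_hom[OF C T 1(6)] m by (metis (no_types, lifting) hom_def mem_Collect_eq)
 have m'e: "(m o[C] e', (g o[C] e) o[C] e') \<in> T" using relation_precomp[OF C T 1(6) mY e'] .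
 have m'h: "m' \<in> hom C V2 X"
 proof -
  obtain Q where Q: "m' \<in> hom C Q X" "m o[C] e' \<in> hom C Q Y" using relation_hom[OF C S 2(6)] .
  then have "Q = V2" using comp_hom[OF C e' m] by (simp add: hom_def)
  then show ?thesis using Q by simp
 qed
 have "(m', (g o[C] e) o[C] e') \<in> rel_comp C S T"
  using rel_comp_simpleI[OF C m'h comp_hom[OF C e' ge] 2(6) m'e] .
 then show "(f, g) \<in> rel_comp C R (rel_comp C S T)"
  using rel_compI[OF 1(1,2) re_comp[OF 2(3) e' 1(3,4)] comp_hom[OF C e' 1(4)]] 2(5)
   comp_assoc[OF C e' 1(4) 1(1)] comp_assoc[OF C e' 1(4) 1(2)] by simp
next
 fix f g assume "(f, g) \<in> rel_comp C R (rel_comp C S T)"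
 then obtain U V e m where 1: "f \<in> hom C U (cod C f)" "g \<in> hom C U (cod C g)" "regular_epi C e" "e \<in> hom C V U"
  "(f o[C] e, m) \<in> R" "(m, g o[C] e) \<in> rel_comp C S T" by (rule rel_compE)
 note fe = comp_hom[OF C 1(4) 1(1)] and ge = comp_hom[OF C 1(4) 1(2)]
 obtain V1 V2 e' m' where 2: "m \<in> hom C V1 (cod C m)" "g o[C] e \<in> hom C V1 (cod C (g o[C] e))" "regular_epi C e'" "e' \<in> hom C V2 V1"
  "(m o[C] e', m') \<in> S" "(m', (g o[C] e) o[C] e') \<in> T" using 1(6) by (rule rel_compE)
 have "V1 = V" using 2(2) ge by (simp add: hom_def)
 then have m: "m \<in> hom C V (cod C m)" and e': "e' \<in> hom C V2 V" using 2 by simp_all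
 have feW: "f o[C] e \<in> hom C V W" using relation_hom[OF C R 1(5)] fe by (metis (no_types, lifting) hom_def mem_Collect_eq)
 have m'e: "((f o[C] e) o[C] e', m o[C] e') \<in> R" using relation_precomp[OF C R 1(5) feW e'] .
 have m'h: "m' \<in> hom C V2 Y"
 proof -
  obtain Q where Q: "m o[C] e' \<in> hom C Q X" "m' \<in> hom C Q Y" using relation_hom[OF C S 2(5)] .
  then have "Q = V2" using comp_hom[OF C e' m] by (simp add: hom_def)
  then show ?thesis using Q by simp
 qed
 have "((f o[C] e) o[C] e', m') \<in> rel_comp C R S"
  using rel_comp_simpleI[OF C comp_hom[OF C e' feW] m'h m'e 2(5)] .
 then show "(f, g) \<in> rel_comp C (rel_comp C R S) T"
  using rel_compI[OF 1(1,2) re_comp[OF 2(3) e' 1(3,4)] comp_hom[OF C e' 1(4)]] 2(6)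
   comp_assoc[OF C e' 1(4) 1(1)] comp_assoc[OF C e' 1(4) 1(2)] by simp
qed

lemma equiv_rel:
 assumes R: "internal_equiv C X R"
 shows "R \<in> relations C X X" "R\<inverse> = R" "rel_comp C R R = R" "f \<in> hom C Z X ==> (f, f) \<in> R"
  "(f, g) \<in> R ==> (g, f) \<in> R" "(f, g) \<in> R ==> (g, h) \<in> R ==> (f, h) \<in> R"
proof -
 have eq: "equiv {f \<in> arr C. cod C f = X} R" using R by (simp add: internal_equiv_def)
 show rel: "R \<in> relations C X X" using R by (simp add: internal_equiv_def)
 show refl: "(f, f) \<in> R" if "f \<in> hom C Z X" for f Z
  using eq that unfolding equiv_def refl_on_def hom_def by auto
 show s: "(f, g) \<in> R ==> (g, f) \<in> R" for f g using eq unfolding equiv_def by (blast dest: symD)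
 show t: "(f, g) \<in> R ==> (g, h) \<in> R ==> (f, h) \<in> R" for f g h using eq unfolding equiv_def by (blast dest: transD)
 show "R\<inverse> = R" using s by auto
 show "rel_comp C R R = R"
 proof (intro set_eqI iffI; clarify)
  fix f g assume fg: "(f, g) \<in> rel_comp C R R"
  obtain V where V: "f \<in> hom C V X" "g \<in> hom C V X" using rel_comp_hom[OF rel rel fg] .
  from fg obtain Z V' e m where e: "f \<in> hom C Z (cod C f)" "g \<in> hom C Z (cod C g)" "regular_epi C e" "e \<in> hom C V' Z"
   "(f o[C] e, m) \<in> R" "(m, g o[C] e) \<in> R" by (rule rel_compE)
  have "Z = V" using e(1) V(1) by (simp add: hom_def)
  then show "(f, g) \<in> R" using relation_descent[OF C rel V e(3)] e t by simp
 next
  fix f g assume fg: "(f, g) \<in> R"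
  obtain V where V: "f \<in> hom C V X" "g \<in> hom C V X" using relation_hom[OF C rel fg] .
  show "(f, g) \<in> rel_comp C R R" using rel_comp_simpleI[OF C V refl[OF V(1)] fg] .
 qed
qed

lemma internal_equivI:
 assumes rel: "R \<in> relations C X X" and refl: "\<And>f Z. f \<in> hom C Z X ==> (f, f) \<in> R"
  and "R\<inverse> = R" and "rel_comp C R R \<subseteq> R"
 shows "internal_equiv C X R"
 unfolding internal_equiv_def equiv_def
proof (intro conjI rel)
 have *: "f \<in> arr C" "g \<in> arr C" "cod C f = X" "cod C g = X" if "(f, g) \<in> R" for f g
  using relation_hom[OF C rel that] by (auto simp: hom_def)
 show "R \<subseteq> {f \<in> arr C. cod C f = X} \<times> {f \<in> arr C. cod C f = X}" using * by auto
 show "refl_on {f \<in> arr C. cod C f = X} R" using refl homI[of _ C] by (auto simp: refl_on_def)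
 show "sym R" using assms(3) by (simp add: sym_conv_converse_eq)
 show "trans R"
 proof (rule transI)
  fix f g h assume fg: "(f, g) \<in> R" and gh: "(g, h) \<in> R"
  obtain V where V: "f \<in> hom C V X" "g \<in> hom C V X" using relation_hom[OF C rel fg] .
  obtain W where W: "g \<in> hom C W X" "h \<in> hom C W X" using relation_hom[OF C rel gh] .
  have "W = V" using V W by (simp add: hom_def)
  then show "(f, h) \<in> R" using rel_comp_simpleI[OF C V(1) _ fg gh] W assms(4) by blast
 qed
qed

lemma ex_reg_ob: "P \<in> ob (ex_reg C) \<longleftrightarrow> fst P \<in> ob C \<and> internal_equiv C (fst P) (snd P)"
 by (cases P) (simp add: ex_reg_def)

lemma ex_reg_hom:
 "F \<in> hom (ex_reg C) P Q \<longleftrightarrow> P \<in> ob (ex_reg C) \<and> Q \<in> ob (ex_reg C) \<and> (\<exists>F'. F = (P, F', Q) \<and> functional_relation C P Q F')"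
 unfolding hom_def by (cases F) (auto simp: ex_reg_def)

lemma functional_relation_iff:
 "functional_relation C P Q F \<longleftrightarrow> F \<in> relations C (fst P) (fst Q) \<and> rel_comp C (snd P) F = F \<and> rel_comp C F (snd Q) = F \<and>
   snd P \<subseteq> rel_comp C F (F\<inverse>) \<and> rel_comp C (F\<inverse>) F \<subseteq> snd Q"
 by (simp add: functional_relation_def case_prod_beta)

lemma ex_reg_comp: "comp (ex_reg C) (Q, G, W) (P, F, Q') = (P, rel_comp C F G, W)"
 by (simp add: ex_reg_def)

lemma ex_reg_ident: "ident (ex_reg C) P = (P, snd P, P)"
 by (simp add: ex_reg_def)

lemma functional_ident:
 assumes "P \<in> ob (ex_reg C)" shows "functional_relation C P P (snd P)"
proof -
 have "internal_equiv C (fst P) (snd P)" using assms by (simp add: ex_reg_ob)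
 from equiv_rel(1-3)[OF this] show ?thesis by (simp add: functional_relation_iff)
qed

lemma functional_comp:
 assumes PQ: "functional_relation C P Q F" and QW: "functional_relation C Q W G"
  and P: "P \<in> ob (ex_reg C)" and Q: "Q \<in> ob (ex_reg C)" and W: "W \<in> ob (ex_reg C)"
 shows "functional_relation C P W (rel_comp C F G)"
proof -
 have F: "F \<in> relations C (fst P) (fst Q)" and F1: "rel_comp C (snd P) F = F" and F2: "rel_comp C F (snd Q) = F"
  and F3: "snd P \<subseteq> rel_comp C F (F\<inverse>)" and F4: "rel_comp C (F\<inverse>) F \<subseteq> snd Q"
  using PQ by (auto simp: functional_relation_iff)
 have G: "G \<in> relations C (fst Q) (fst W)" and G1: "rel_comp C (snd Q) G = G" and G2: "rel_comp C G (snd W) = G"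
  and G3: "snd Q \<subseteq> rel_comp C G (G\<inverse>)" and G4: "rel_comp C (G\<inverse>) G \<subseteq> snd W"
  using QW by (auto simp: functional_relation_iff)
 have RP: "snd P \<in> relations C (fst P) (fst P)" and RW: "snd W \<in> relations C (fst W) (fst W)"
  and RQ: "snd Q \<in> relations C (fst Q) (fst Q)"
  using P Q W equiv_rel(1) by (auto simp: ex_reg_ob)
 note F' = relation_converse[OF F] and G' = relation_converse[OF G]
 note FG = rel_closed[OF F G]
 show ?thesis unfolding functional_relation_iff
 proof (intro conjI FG)
  show "rel_comp C (snd P) (rel_comp C F G) = rel_comp C F G" using rel_comp_assoc[OF RP F G] F1 by simp
  show "rel_comp C (rel_comp C F G) (snd W) = rel_comp C F G" using rel_comp_assoc[OF F G RW] G2 by simp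
  have "snd P \<subseteq> rel_comp C (rel_comp C F (snd Q)) (F\<inverse>)" using F2 F3 by simp
  also have "\<dots> \<subseteq> rel_comp C (rel_comp C F (rel_comp C G (G\<inverse>))) (F\<inverse>)" using G3 by (intro rel_comp_mono order_refl)
  also have "\<dots> = rel_comp C (rel_comp C F G) (rel_comp C (G\<inverse>) (F\<inverse>))"
   using rel_comp_assoc[OF F G G'] rel_comp_assoc[OF FG G' F'] by simp
  finally show "snd P \<subseteq> rel_comp C (rel_comp C F G) ((rel_comp C F G)\<inverse>)" by (simp add: rel_comp_converse)
  have "rel_comp C ((rel_comp C F G)\<inverse>) (rel_comp C F G) = rel_comp C (rel_comp C (G\<inverse>) (rel_comp C (F\<inverse>) F)) G"
   unfolding rel_comp_converse using rel_comp_assoc[OF G' F' FG] rel_comp_assoc[OF F' F G] rel_comp_assoc[OF G' rel_closed[OF F' F] G] by simp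
  also have "\<dots> \<subseteq> rel_comp C (rel_comp C (G\<inverse>) (snd Q)) G" using F4 by (intro rel_comp_mono order_refl)
  also have "\<dots> = rel_comp C (G\<inverse>) G" using rel_comp_assoc[OF G' RQ G] G1 by simp
  finally show "rel_comp C ((rel_comp C F G)\<inverse>) (rel_comp C F G) \<subseteq> snd W" using G4 by simp
 qed
qed

lemma functional_rel: "functional_relation C P Q F ==> F \<in> relations C (fst P) (fst Q)"
 by (simp add: functional_relation_iff)

text \<open>Identities and associativity are inherited from composition of relations; an equivalence relation is neutral for the functional relations that it is a domain or codomain of.\<close>

lemma category_ex_reg: "category (ex_reg C)"
proof -
 have ci: "F \<in> arr (ex_reg C) ==> F \<in> hom (ex_reg C) (dom (ex_reg C) F) (cod (ex_reg C) F)" for F by (rule homI)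
 have ch: "comp (ex_reg C) G F \<in> hom (ex_reg C) P W" if F: "F \<in> hom (ex_reg C) P Q" and G: "G \<in> hom (ex_reg C) Q W" for F G P Q W
 proof -
  obtain F' where F': "F = (P, F', Q)" "functional_relation C P Q F'" using F unfolding ex_reg_hom by blast
  obtain G' where G': "G = (Q, G', W)" "functional_relation C Q W G'" using G unfolding ex_reg_hom by blast
  have "P \<in> ob (ex_reg C)" "Q \<in> ob (ex_reg C)" "W \<in> ob (ex_reg C)" using F G by (auto simp: ex_reg_hom)
  then show ?thesis using functional_comp[OF F'(2) G'(2)] by (simp add: ex_reg_hom F' G' ex_reg_comp)
 qed
 show ?thesis unfolding category_def
 proof (intro conjI ballI impI)
  fix F assume "F \<in> arr (ex_reg C)"
  note F = ci[OF this]
  show "dom (ex_reg C) F \<in> ob (ex_reg C)" "cod (ex_reg C) F \<in> ob (ex_reg C)" using F by (auto simp: ex_reg_hom)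
  obtain F' where F': "F = (dom (ex_reg C) F, F', cod (ex_reg C) F)" "functional_relation C (dom (ex_reg C) F) (cod (ex_reg C) F) F'"
   using F unfolding ex_reg_hom by blast
  show "comp (ex_reg C) F (ident (ex_reg C) (dom (ex_reg C) F)) = F"
   by (subst (1 3) F'(1)) (use F'(2) in \<open>simp add: ex_reg_ident ex_reg_comp functional_relation_iff\<close>)
  show "comp (ex_reg C) (ident (ex_reg C) (cod (ex_reg C) F)) F = F"
   by (subst (2 3) F'(1)) (use F'(2) in \<open>simp add: ex_reg_ident ex_reg_comp functional_relation_iff\<close>)
 next
  show "ident (ex_reg C) P \<in> hom (ex_reg C) P P" if "P \<in> ob (ex_reg C)" for P
   using that functional_ident by (simp add: ex_reg_hom ex_reg_ident)
 next
  fix F G assume FG: "F \<in> arr (ex_reg C)" "G \<in> arr (ex_reg C)" "cod (ex_reg C) F = dom (ex_reg C) G"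
  show "comp (ex_reg C) G F \<in> hom (ex_reg C) (dom (ex_reg C) F) (cod (ex_reg C) G)"
   using ch[OF ci[OF FG(1)]] ci[OF FG(2)] FG(3) by simp
 next
  fix F G H assume a: "F \<in> arr (ex_reg C)" "G \<in> arr (ex_reg C)" "H \<in> arr (ex_reg C)"
   "cod (ex_reg C) F = dom (ex_reg C) G \<and> cod (ex_reg C) G = dom (ex_reg C) H"
  define P Q W Z where d: "P = dom (ex_reg C) F" "Q = cod (ex_reg C) F" "W = cod (ex_reg C) G" "Z = cod (ex_reg C) H"
  have F: "F \<in> hom (ex_reg C) P Q" and G: "G \<in> hom (ex_reg C) Q W" and H: "H \<in> hom (ex_reg C) W Z"
   using a by (auto simp: hom_def d)
  obtain F' where F': "F = (P, F', Q)" "functional_relation C P Q F'" using F unfolding ex_reg_hom by blast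
  obtain G' where G': "G = (Q, G', W)" "functional_relation C Q W G'" using G unfolding ex_reg_hom by blast
  obtain H' where H': "H = (W, H', Z)" "functional_relation C W Z H'" using H unfolding ex_reg_hom by blast
  show "comp (ex_reg C) H (comp (ex_reg C) G F) = comp (ex_reg C) (comp (ex_reg C) H G) F"
   using rel_comp_assoc[OF functional_rel[OF F'(2)] functional_rel[OF G'(2)] functional_rel[OF H'(2)]]
   by (simp add: F' G' H' ex_reg_comp)
 qed
qed

subsection \<open>Projective objects\<close>

abbreviation "\<Delta> X \<equiv> {(g, g) | g. g \<in> arr C \<and> cod C g = X}"
abbreviation "y X \<equiv> (X, \<Delta> X)"
abbreviation "gr t \<equiv> {(g, t o[C] g) | g. g \<in> arr C \<and> cod C g = dom C t}"

lemma embedding_simps: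
 "fob (ex_reg_embedding C) X = y X" "far (ex_reg_embedding C) t = (y (dom C t), gr t, y (cod C t))"
 by (simp_all add: ex_reg_embedding_def Let_def)

text \<open>Composition with a graph is substitution, since membership in a relation descends along covers.\<close>

lemma graph_comp:
 assumes t: "t \<in> hom C Z X" and G: "G \<in> relations C X Y"
 shows "rel_comp C (gr t) G = {(f, g). f \<in> arr C \<and> cod C f = Z \<and> (t o[C] f, g) \<in> G}"
proof -
 have dt: "dom C t = Z" using t by (simp add: hom_def)
 have gt: "gr t \<in> relations C Z X" using graph_relation[OF C t] dt by simp
 have "(f, g) \<in> rel_comp C (gr t) G \<longleftrightarrow> f \<in> arr C \<and> cod C f = Z \<and> (t o[C] f, g) \<in> G" for f g
 proof
  assume fg: "(f, g) \<in> rel_comp C (gr t) G"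
  obtain V where V: "f \<in> hom C V Z" "g \<in> hom C V Y" using rel_comp_hom[OF gt G fg] .
  from fg obtain W V' e m where e: "f \<in> hom C W (cod C f)" "g \<in> hom C W (cod C g)" "regular_epi C e" "e \<in> hom C V' W"
   "(f o[C] e, m) \<in> gr t" "(m, g o[C] e) \<in> G" by (rule rel_compE)
  have W: "W = V" using e(1) V(1) by (simp add: hom_def)
  have "m = t o[C] (f o[C] e)" using e(5) by auto
  then have "((t o[C] f) o[C] e, g o[C] e) \<in> G" using e(6) comp_assoc[OF C e(4)[unfolded W] V(1) t] by simp
  then have "(t o[C] f, g) \<in> G"
   using relation_descent[OF C G comp_hom[OF C V(1) t] V(2) e(3)] e(4) W by simp
  then show "f \<in> arr C \<and> cod C f = Z \<and> (t o[C] f, g) \<in> G" using V by (simp add: hom_def)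
 next
  assume *: "f \<in> arr C \<and> cod C f = Z \<and> (t o[C] f, g) \<in> G"
  then have f: "f \<in> arr C" "cod C f = Z" and tfg: "(t o[C] f, g) \<in> G" by auto
  have fh: "f \<in> hom C (dom C f) Z" using f by (simp add: hom_def)
  obtain V where V: "t o[C] f \<in> hom C V X" "g \<in> hom C V Y" using relation_hom[OF C G tfg] .
  have "V = dom C f" using V comp_hom[OF C fh t] by (simp add: hom_def)
  moreover have "(f, t o[C] f) \<in> gr t" using f dt by auto
  ultimately show "(f, g) \<in> rel_comp C (gr t) G"
   using rel_comp_simpleI[OF C fh _ _ tfg] V by simp
 qed
 then show ?thesis by auto
qed

lemma diag_ob:
 assumes "X \<in> ob C" shows "y X \<in> ob (ex_reg C)"
proof -
 note i = ident_hom[OF C assms]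
 have "gr (ident C X) \<in> relations C X X" using graph_relation[OF C i] i by (simp add: hom_def)
 moreover have "gr (ident C X) = \<Delta> X" using comp_ident(2)[OF C homI] i by (force simp: hom_def)
 ultimately have rel: "\<Delta> X \<in> relations C X X" by simp
 have "rel_comp C (\<Delta> X) (\<Delta> X) \<subseteq> \<Delta> X"
 proof clarify
  fix f g assume fg: "(f, g) \<in> rel_comp C (\<Delta> X) (\<Delta> X)"
  obtain V where V: "f \<in> hom C V X" "g \<in> hom C V X" using rel_comp_hom[OF rel rel fg] .
  from fg obtain W V' e m where e: "f \<in> hom C W (cod C f)" "g \<in> hom C W (cod C g)" "regular_epi C e" "e \<in> hom C V' W"
   "(f o[C] e, m) \<in> \<Delta> X" "(m, g o[C] e) \<in> \<Delta> X" by (rule rel_compE)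
  have W: "W = V" using e(1) V(1) by (simp add: hom_def)
  have "f o[C] e = g o[C] e" using e(5,6) by auto
  then have "f = g" using regular_epi_cancel[OF C e(3) e(4)[unfolded W] V] by simp
  then show "\<exists>ga. (f, g) = (ga, ga) \<and> ga \<in> arr C \<and> cod C ga = X" using V by (auto simp: hom_def)
 qed
 then have "internal_equiv C X (\<Delta> X)"
  by (intro internal_equivI[OF rel]) (auto simp: hom_def)
 then show ?thesis using assms by (simp add: ex_reg_ob)
qed

lemma diag_left:
 assumes X: "X \<in> ob C" and G: "G \<in> relations C X Y"
 shows "rel_comp C (\<Delta> X) G = G"
proof -
 note i = ident_hom[OF C X]
 have e: "gr (ident C X) = \<Delta> X" using comp_ident(2)[OF C homI] i by (force simp: hom_def)
 have "f \<in> arr C \<and> cod C f = X \<and> (ident C X o[C] f, g) \<in> G \<longleftrightarrow> (f, g) \<in> G" for f g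
 proof
  assume a: "f \<in> arr C \<and> cod C f = X \<and> (ident C X o[C] f, g) \<in> G"
  then have "ident C X o[C] f = f" using comp_ident(2)[OF C homI[of f]] by auto
  then show "(f, g) \<in> G" using a by simp
 next
  assume a: "(f, g) \<in> G"
  obtain V where "f \<in> hom C V X" using relation_hom[OF C G a] .
  then show "f \<in> arr C \<and> cod C f = X \<and> (ident C X o[C] f, g) \<in> G" using a comp_ident(2)[OF C] by (auto simp: hom_def)
 qed
 then show ?thesis using graph_comp[OF i G] unfolding e by auto
qed

lemma cover_hom:
 assumes P: "(X, R) \<in> ob (ex_reg C)"
 shows "(y X, R, (X, R)) \<in> hom (ex_reg C) (y X) (X, R)"
proof -
 have X: "X \<in> ob C" and R: "internal_equiv C X R" using P by (auto simp: ex_reg_ob)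
 note r = equiv_rel[OF R]
 have "(g, g) \<in> R" if "g \<in> arr C" "cod C g = X" for g using r(4)[of g "dom C g"] that by (simp add: hom_def)
 then have "\<Delta> X \<subseteq> R" by auto
 then show ?thesis
  unfolding ex_reg_hom functional_relation_iff using diag_ob[OF X] P r(1-3) diag_left[OF X r(1)] by auto
qed

lemma embedding_hom:
 assumes t: "t \<in> hom C Z X"
 shows "(y Z, gr t, y X) \<in> hom (ex_reg C) (y Z) (y X)"
proof -
 have Z: "Z \<in> ob C" and X: "X \<in> ob C" using category_ob[OF C t] by auto
 have dt: "dom C t = Z" using t by (simp add: hom_def)
 have g: "gr t \<in> relations C Z X" using graph_relation[OF C t] dt by simp
 have dX: "\<Delta> X \<in> relations C X X" using diag_ob[OF X] equiv_rel(1) by (auto simp: ex_reg_ob)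
 have tf: "t o[C] f \<in> arr C \<and> cod C (t o[C] f) = X" if "f \<in> arr C" "cod C f = Z" for f
  using comp_hom[OF C _ t, of f "dom C f"] that by (simp add: hom_def)
 have 1: "rel_comp C (gr t) (\<Delta> X) = gr t"
  unfolding graph_comp[OF t dX] using tf dt by auto
 have 2: "\<Delta> Z \<subseteq> rel_comp C (gr t) ((gr t)\<inverse>)"
  unfolding graph_comp[OF t relation_converse[OF g]] using dt by auto
 have 3: "rel_comp C ((gr t)\<inverse>) (gr t) \<subseteq> \<Delta> X"
 proof clarify
  fix f h assume fh: "(f, h) \<in> rel_comp C ((gr t)\<inverse>) (gr t)"
  obtain V where V: "f \<in> hom C V X" "h \<in> hom C V X" using rel_comp_hom[OF relation_converse[OF g] g fh] .
  from fh obtain W V' e m where e: "f \<in> hom C W (cod C f)" "h \<in> hom C W (cod C h)" "regular_epi C e" "e \<in> hom C V' W"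
   "(f o[C] e, m) \<in> (gr t)\<inverse>" "(m, h o[C] e) \<in> gr t" by (rule rel_compE)
  have W: "W = V" using e(1) V(1) by (simp add: hom_def)
  have "f o[C] e = h o[C] e" using e(5,6) by auto
  then have "f = h" using regular_epi_cancel[OF C e(3) e(4)[unfolded W] V] by simp
  then show "\<exists>ga. (f, h) = (ga, ga) \<and> ga \<in> arr C \<and> cod C ga = X" using V by (auto simp: hom_def)
 qed
 show ?thesis
  unfolding ex_reg_hom functional_relation_iff using diag_ob[OF Z] diag_ob[OF X] g diag_left[OF Z g] 1 2 3 by auto
qed

lemma embedding_functor: "is_functor C (ex_reg C) (ex_reg_embedding C)"
 unfolding is_functor_def embedding_simps
proof (intro conjI ballI impI)
 show "y X \<in> ob (ex_reg C)" if "X \<in> ob C" for X using diag_ob[OF that] .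
 show "(y (dom C f), gr f, y (cod C f)) \<in> hom (ex_reg C) (y (dom C f)) (y (cod C f))" if "f \<in> arr C" for f
  using embedding_hom[OF homI[OF that]] .
 show "(y (dom C (ident C X)), gr (ident C X), y (cod C (ident C X))) = ident (ex_reg C) (y X)" if X: "X \<in> ob C" for X
 proof -
  note i = ident_hom[OF C X]
  have "gr (ident C X) = \<Delta> X" using comp_ident(2)[OF C homI] i by (force simp: hom_def)
  then show ?thesis using i by (simp add: ex_reg_ident hom_def)
 qed
 fix f g assume fg: "f \<in> arr C" "g \<in> arr C" "cod C f = dom C g"
 then have f: "f \<in> hom C (dom C f) (dom C g)" and g: "g \<in> hom C (dom C g) (cod C g)" by (auto simp: hom_def)
 note gf = comp_hom[OF C f g]
 have d: "dom C (g o[C] f) = dom C f" "cod C (g o[C] f) = cod C g" using gf by (auto simp: hom_def)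
 have assoc: "(g o[C] f) o[C] h = g o[C] (f o[C] h)" if "h \<in> arr C" "cod C h = dom C f" for h
  using comp_assoc[OF C _ f g, of h "dom C h"] that by (simp add: hom_def)
 have fh: "f o[C] h \<in> arr C \<and> cod C (f o[C] h) = dom C g" if "h \<in> arr C" "cod C h = dom C f" for h
  using comp_hom[OF C _ f, of h "dom C h"] that by (simp add: hom_def)
 have "rel_comp C (gr f) (gr g) = gr (g o[C] f)"
  unfolding graph_comp[OF f graph_relation[OF C g]] d using assoc fh by auto
 then show "(y (dom C (g o[C] f)), gr (g o[C] f), y (cod C (g o[C] f))) =
   comp (ex_reg C) (y (dom C g), gr g, y (cod C g)) (y (dom C f), gr f, y (cod C f))"
  by (simp add: ex_reg_comp d)
qed

text \<open>The arrow \<open>Z \<rightarrow> (X, R)\<close> named by \<open>t : Z \<rightarrow> X\<close>.\<close>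

definition name :: "'o \<times> ('m \<times> 'm) set => 'm => ('o \<times> ('m \<times> 'm) set) \<times> ('m \<times> 'm) set \<times> ('o \<times> ('m \<times> 'm) set)" where
 "name P t = comp (ex_reg C) (y (fst P), snd P, P) (far (ex_reg_embedding C) t)"

lemma name_hom:
 assumes P: "P \<in> ob (ex_reg C)" and t: "t \<in> hom C Z (fst P)"
 shows "name P t \<in> hom (ex_reg C) (y Z) P"
proof -
 have dt: "dom C t = Z" "cod C t = fst P" using t by (auto simp: hom_def)
 show ?thesis
  unfolding name_def embedding_simps dt
  using comp_hom[OF category_ex_reg embedding_hom[OF t] cover_hom[of "fst P" "snd P"]] P dt by simp
qed

lemma name_eq:
 assumes P: "P \<in> ob (ex_reg C)" and t: "t \<in> hom C Z (fst P)"
 shows "name P t = (y Z, {(f, g). f \<in> arr C \<and> cod C f = Z \<and> (t o[C] f, g) \<in> snd P}, P)"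
proof -
 have dt: "dom C t = Z" "cod C t = fst P" using t by (auto simp: hom_def)
 have "snd P \<in> relations C (fst P) (fst P)" using P equiv_rel(1) by (auto simp: ex_reg_ob)
 from graph_comp[OF t this] show ?thesis unfolding name_def embedding_simps dt ex_reg_comp by (simp add: dt)
qed

text \<open>Precomposition acts on names, so that points of an arrow \<open>y Z \<rightarrow> P\<close> can be computed on names.\<close>

lemma name_precomp:
 assumes P: "P \<in> ob (ex_reg C)" and t: "t \<in> hom C Z (fst P)" and k: "k \<in> hom C V Z"
 shows "comp (ex_reg C) (name P t) (far (ex_reg_embedding C) k) = name P (t o[C] k)"
proof -
 have P': "(y (fst P), snd P, P) \<in> hom (ex_reg C) (y (fst P)) P" using cover_hom[of "fst P" "snd P"] P by simp
 note ft = functor_hom[OF embedding_functor t] and fk = functor_hom[OF embedding_functor k]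
 show ?thesis unfolding name_def functor_comp[OF embedding_functor k t]
  using comp_assoc[OF category_ex_reg fk ft] P' by (simp add: embedding_simps)
qed

lemma name_diag:
 assumes t: "t \<in> hom C Z X"
 shows "name (y X) t = far (ex_reg_embedding C) t"
proof -
 have X: "X \<in> ob C" using category_ob[OF C t] by simp
 show ?thesis
  unfolding name_def using comp_ident(2)[OF category_ex_reg embedding_hom[OF t]] t
  by (simp add: embedding_simps ex_reg_ident hom_def)
qed

definition rprojective :: "'o => bool" where
 "rprojective Z \<longleftrightarrow> Z \<in> ob C \<and> (\<forall>e V. regular_epi C e \<and> e \<in> hom C V Z --> (\<exists>s \<in> hom C Z V. e o[C] s = ident C Z))"

text \<open>A pair in a composite relation has an intermediate element over a cover, and a splitting of the cover brings it back.\<close>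

lemma rprojective_lift:
 assumes Z: "rprojective Z" and t: "t \<in> hom C Z X" and g: "g \<in> hom C Z Y"
  and R: "R \<in> relations C X W" and S: "S \<in> relations C W Y" and tg: "(t, g) \<in> rel_comp C R S"
 obtains v where "v \<in> hom C Z W" "(t, v) \<in> R" "(v, g) \<in> S"
proof -
 from tg obtain Z' V e m where e: "t \<in> hom C Z' (cod C t)" "g \<in> hom C Z' (cod C g)" "regular_epi C e" "e \<in> hom C V Z'"
   "(t o[C] e, m) \<in> R" "(m, g o[C] e) \<in> S" by (rule rel_compE)
 have Z': "Z' = Z" using e(1) t by (simp add: hom_def)
 obtain s where s: "s \<in> hom C Z V" "e o[C] s = ident C Z" using Z e(3,4) Z' unfolding rprojective_def by blast
 have e4: "e \<in> hom C V Z" using e(4) Z' by simp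
 obtain Q where Q: "t o[C] e \<in> hom C Q X" "m \<in> hom C Q W" using relation_hom[OF C R e(5)] .
 have "Q = V" using Q(1) comp_hom[OF C e4 t] by (simp add: hom_def)
 then have m: "m \<in> hom C V W" using Q by simp
 have c: "(x o[C] e) o[C] s = x" if "x \<in> hom C Z T" for x T
  using comp_assoc[OF C s(1) e4 that] s(2) comp_ident(1)[OF C that] by simp
 show thesis
  using that[OF comp_hom[OF C s(1) m]] relation_precomp[OF C R e(5) comp_hom[OF C e4 t] s(1)]
   relation_precomp[OF C S e(6) m s(1)] c[OF t] c[OF g] by simp
qed

text \<open>A functional relation is total up to a cover of its domain. On a projective object the cover splits, and the composite of the splitting with the value on the cover is an arrow that names the relation.\<close>

lemma projective_arrow_named:
 assumes Z: "rprojective Z" and F: "F \<in> hom (ex_reg C) (y Z) P"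
 obtains t where "t \<in> hom C Z (fst P)" "F = name P t"
proof -
 have Zo: "Z \<in> ob C" using Z by (simp add: rprojective_def)
 have P: "P \<in> ob (ex_reg C)" using F by (simp add: ex_reg_hom)
 obtain F' where F': "F = (y Z, F', P)" "functional_relation C (y Z) P F'" using F unfolding ex_reg_hom by blast
 have rel: "F' \<in> relations C Z (fst P)" and F2: "rel_comp C F' (snd P) = F'" and F3: "\<Delta> Z \<subseteq> rel_comp C F' (F'\<inverse>)"
  and F4: "rel_comp C (F'\<inverse>) F' \<subseteq> snd P" using F'(2) by (auto simp: functional_relation_iff)
 note i = ident_hom[OF C Zo]
 have "(ident C Z, ident C Z) \<in> rel_comp C F' (F'\<inverse>)" using F3 i by (auto simp: hom_def)
 then obtain t where t: "t \<in> hom C Z (fst P)" "(ident C Z, t) \<in> F'"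
  using rprojective_lift[OF Z i i rel relation_converse[OF rel]] by metis
 have ft: "(f, t o[C] f) \<in> F'" if "f \<in> hom C V Z" for f V
  using relation_precomp[OF C rel t(2) i that] comp_ident(2)[OF C that] by simp
 have "F' = {(f, g). f \<in> arr C \<and> cod C f = Z \<and> (t o[C] f, g) \<in> snd P}"
 proof (intro set_eqI iffI; clarify)
  fix f g
  { assume fg: "(f, g) \<in> F'"
   obtain V where V: "f \<in> hom C V Z" "g \<in> hom C V (fst P)" using relation_hom[OF C rel fg] .
   have "(t o[C] f, g) \<in> rel_comp C (F'\<inverse>) F'"
    using rel_comp_simpleI[OF C comp_hom[OF C V(1) t(1)] V(2)] ft[OF V(1)] fg by blast
   then show "f \<in> arr C \<and> cod C f = Z \<and> (t o[C] f, g) \<in> snd P" using V F4 by (auto simp: hom_def) }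
  assume f: "f \<in> arr C" "Z = cod C f" and fg: "(t o[C] f, g) \<in> snd P"
  have fh: "f \<in> hom C (dom C f) Z" using f by (simp add: hom_def)
  have "snd P \<in> relations C (fst P) (fst P)" using P equiv_rel(1) by (auto simp: ex_reg_ob)
  from relation_hom[OF C this fg] obtain V where V: "t o[C] f \<in> hom C V (fst P)" "g \<in> hom C V (fst P)" .
  have "V = dom C f" using V comp_hom[OF C fh t(1)] by (simp add: hom_def)
  then show "(f, g) \<in> F'" using rel_comp_simpleI[OF C fh _ ft[OF fh] fg] V F2 by blast
 qed
 then show thesis using that[OF t(1)] name_eq[OF P t(1)] F'(1) by simp
qed

text \<open>
 The image of \<open>G : (V, R) \<rightarrow> (X, S)\<close> is \<open>(V, G G\<^sup>o)\<close>, with \<open>G\<close> itself as the inclusion. Hence an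
 extremal \<open>G\<close> satisfies \<open>G\<^sup>o G = S\<close>, that is, it is surjective in the internal logic.
\<close>

lemma extremal_surjective:
 assumes G: "(P, G, Q) \<in> hom (ex_reg C) P Q" and ex: "extremal (ex_reg C) (P, G, Q)"
 shows "snd Q \<subseteq> rel_comp C (G\<inverse>) G"
proof -
 have P: "P \<in> ob (ex_reg C)" and Q: "Q \<in> ob (ex_reg C)" and fG: "functional_relation C P Q G"
  using G by (auto simp: ex_reg_hom)
 have rel: "G \<in> relations C (fst P) (fst Q)" and G1: "rel_comp C (snd P) G = G" and G2: "rel_comp C G (snd Q) = G"
  and G3: "snd P \<subseteq> rel_comp C G (G\<inverse>)" and G4: "rel_comp C (G\<inverse>) G \<subseteq> snd Q" using fG by (auto simp: functional_relation_iff)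
 note rel' = relation_converse[OF rel]
 have eP: "internal_equiv C (fst P) (snd P)" and eQ: "internal_equiv C (fst Q) (snd Q)" using P Q by (auto simp: ex_reg_ob)
 note rP = equiv_rel(1)[OF eP] and rQ = equiv_rel(1)[OF eQ]
 define K where "K = rel_comp C G (G\<inverse>)"
 have K: "K \<in> relations C (fst P) (fst P)" unfolding K_def by (rule rel_closed[OF rel rel'])
 have K': "K\<inverse> = K" by (simp add: K_def rel_comp_converse)
 have KG: "rel_comp C K G = G"
 proof
  have "rel_comp C K G = rel_comp C G (rel_comp C (G\<inverse>) G)" unfolding K_def using rel_comp_assoc[OF rel rel' rel] .
  also have "\<dots> \<subseteq> rel_comp C G (snd Q)" using G4 by (intro rel_comp_mono order_refl)
  finally show "rel_comp C K G \<subseteq> G" using G2 by simp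
  have "G = rel_comp C (snd P) G" using G1 by simp
  also have "\<dots> \<subseteq> rel_comp C K G" unfolding K_def using G3 by (intro rel_comp_mono order_refl)
  finally show "G \<subseteq> rel_comp C K G" .
 qed
 have KK: "rel_comp C K K = K"
  using rel_comp_assoc[OF K rel rel'] KG by (simp add: K_def)
 have refl: "(f, f) \<in> K" if "f \<in> hom C Z (fst P)" for f Z
  using equiv_rel(4)[OF eP that] G3 unfolding K_def by blast
 have eK: "internal_equiv C (fst P) K" using internal_equivI[OF K refl K'] KK by simp
 define J where "J = (fst P, K)"
 have J: "J \<in> ob (ex_reg C)" using P eK by (simp add: ex_reg_ob J_def)
 have m: "(J, G, Q) \<in> hom (ex_reg C) J Q"
  unfolding ex_reg_hom functional_relation_iff using J Q rel KG G2 G4 by (simp add: J_def K_def)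
 have PK: "rel_comp C (snd P) K = K" unfolding K_def using rel_comp_assoc[OF rP rel rel'] G1 by simp
 have g: "(P, K, J) \<in> hom (ex_reg C) P J"
  unfolding ex_reg_hom functional_relation_iff using P J K PK KK K' G3 by (simp add: J_def) (simp add: K_def)
 have "monic (ex_reg C) (J, G, Q)"
  unfolding monic_def
 proof (intro conjI ballI impI)
  show "(J, G, Q) \<in> arr (ex_reg C)" using m by (simp add: hom_def)
  fix Z f h assume f: "f \<in> hom (ex_reg C) Z (dom (ex_reg C) (J, G, Q))" and h: "h \<in> hom (ex_reg C) Z (dom (ex_reg C) (J, G, Q))"
   and e: "comp (ex_reg C) (J, G, Q) f = comp (ex_reg C) (J, G, Q) h"
  have dJ: "dom (ex_reg C) (J, G, Q) = J" using m by (simp add: hom_def)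
  obtain f' where f': "f = (Z, f', J)" "functional_relation C Z J f'" using f dJ unfolding ex_reg_hom by auto
  obtain h' where h': "h = (Z, h', J)" "functional_relation C Z J h'" using h dJ unfolding ex_reg_hom by auto
  have e': "rel_comp C f' G = rel_comp C h' G" using e by (simp add: f' h' ex_reg_comp)
  have fr: "f' \<in> relations C (fst Z) (fst P)" "rel_comp C f' K = f'" and hr: "h' \<in> relations C (fst Z) (fst P)" "rel_comp C h' K = h'"
   using f'(2) h'(2) by (auto simp: functional_relation_iff J_def)
  have "f' = rel_comp C (rel_comp C f' G) (G\<inverse>)" using fr rel_comp_assoc[OF fr(1) rel rel'] by (simp add: K_def)
  also have "\<dots> = h'" using hr rel_comp_assoc[OF hr(1) rel rel'] e' by (simp add: K_def)
  finally show "f = h" by (simp add: f' h')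
 qed
 moreover have "comp (ex_reg C) (J, G, Q) (P, K, J) = (P, G, Q)" using KG by (simp add: ex_reg_comp)
 ultimately obtain t where t: "t \<in> hom (ex_reg C) Q J" "comp (ex_reg C) (J, G, Q) t = ident (ex_reg C) Q"
  using extremalD[OF ex G _ m g] by blast
 obtain t' where t': "t = (Q, t', J)" "functional_relation C Q J t'" using t(1) unfolding ex_reg_hom by blast
 have tr: "t' \<in> relations C (fst Q) (fst P)" and t4: "rel_comp C (t'\<inverse>) t' \<subseteq> K" using t'(2) by (auto simp: functional_relation_iff J_def)
 have tG: "rel_comp C t' G = snd Q" using t(2) by (simp add: t' ex_reg_comp ex_reg_ident)
 note tr' = relation_converse[OF tr]
 have "snd Q = rel_comp C ((snd Q)\<inverse>) (snd Q)" using equiv_rel(2,3)[OF eQ] by simp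
 also have "\<dots> = rel_comp C (G\<inverse>) (rel_comp C (rel_comp C (t'\<inverse>) t') G)"
  unfolding tG[symmetric] rel_comp_converse
  using rel_comp_assoc[OF rel' tr' rel_closed[OF tr rel]] rel_comp_assoc[OF tr' tr rel] by simp
 also have "\<dots> \<subseteq> rel_comp C (G\<inverse>) (rel_comp C K G)" using t4 by (intro rel_comp_mono order_refl)
 finally show ?thesis using KG by simp
qed

text \<open>An extremal arrow is surjective up to a cover of the domain of the lifted arrow, and over a projective object the cover splits.\<close>

lemma projective_lift_extremal:
 assumes Z: "rprojective Z" and G: "G \<in> hom (ex_reg C) P Q" "extremal (ex_reg C) G" and T: "T \<in> hom (ex_reg C) (y Z) Q"
 obtains w where "w \<in> hom (ex_reg C) (y Z) P" "comp (ex_reg C) G w = T"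
proof -
 have P: "P \<in> ob (ex_reg C)" and Q: "Q \<in> ob (ex_reg C)" using G by (auto simp: ex_reg_hom)
 obtain G' where G': "G = (P, G', Q)" "functional_relation C P Q G'" using G(1) unfolding ex_reg_hom by blast
 have rel: "G' \<in> relations C (fst P) (fst Q)" and G1: "rel_comp C (snd P) G' = G'" and G2: "rel_comp C G' (snd Q) = G'"
  and G4: "rel_comp C (G'\<inverse>) G' \<subseteq> snd Q" using G'(2) by (auto simp: functional_relation_iff)
 have rP: "snd P \<in> relations C (fst P) (fst P)" using P equiv_rel(1) by (auto simp: ex_reg_ob)
 have eQ: "internal_equiv C (fst Q) (snd Q)" using Q by (simp add: ex_reg_ob)
 note rQ = equiv_rel(1)[OF eQ]
 obtain t where t: "t \<in> hom C Z (fst Q)" "T = name Q t" using projective_arrow_named[OF Z T] .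
 have "(t, t) \<in> rel_comp C (G'\<inverse>) G'"
  using extremal_surjective[of P G' Q] G G'(1) equiv_rel(4)[OF eQ t(1)] by auto
 then obtain v where v: "v \<in> hom C Z (fst P)" "(v, t) \<in> G'"
  using rprojective_lift[OF Z t(1) t(1) relation_converse[OF rel] rel] by metis
 have dv: "dom C v = Z" "cod C v = fst P" using v(1) by (auto simp: hom_def)
 have "comp (ex_reg C) G (name P v) = (y Z, rel_comp C (rel_comp C (gr v) (snd P)) G', Q)"
  by (simp add: name_def embedding_simps ex_reg_comp G'(1) dv)
 also have "rel_comp C (rel_comp C (gr v) (snd P)) G' = rel_comp C (gr v) G'"
  using rel_comp_assoc[OF _ rP rel, of "gr v" Z] graph_relation[OF C v(1)] G1 dv by simp
 also have "\<dots> = {(f, g). f \<in> arr C \<and> cod C f = Z \<and> (v o[C] f, g) \<in> G'}" by (rule graph_comp[OF v(1) rel])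
 also have "\<dots> = {(f, g). f \<in> arr C \<and> cod C f = Z \<and> (t o[C] f, g) \<in> snd Q}"
 proof -
  have "(v o[C] f, g) \<in> G' \<longleftrightarrow> (t o[C] f, g) \<in> snd Q" if f: "f \<in> arr C" "cod C f = Z" for f g
  proof -
   have fh: "f \<in> hom C (dom C f) Z" using f by (simp add: hom_def)
   note vf = comp_hom[OF C fh v(1)] and tf = comp_hom[OF C fh t(1)]
   have vt: "(v o[C] f, t o[C] f) \<in> G'" using relation_precomp[OF C rel v(2) v(1) fh] .
   show ?thesis
   proof
    assume a: "(v o[C] f, g) \<in> G'"
    obtain V where V: "v o[C] f \<in> hom C V (fst P)" "g \<in> hom C V (fst Q)" using relation_hom[OF C rel a] .
    have "V = dom C f" using V vf by (simp add: hom_def)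
    then show "(t o[C] f, g) \<in> snd Q" using rel_comp_simpleI[OF C tf _ _ a] V vt G4 by blast
   next
    assume a: "(t o[C] f, g) \<in> snd Q"
    obtain V where V: "t o[C] f \<in> hom C V (fst Q)" "g \<in> hom C V (fst Q)" using relation_hom[OF C rQ a] .
    have "V = dom C f" using V tf by (simp add: hom_def)
    then show "(v o[C] f, g) \<in> G'" using rel_comp_simpleI[OF C vf _ vt a] V G2 by blast
   qed
  qed
  then show ?thesis by auto
 qed
 finally have "comp (ex_reg C) G (name P v) = T" using t(2) name_eq[OF Q t(1)] by simp
 then show thesis using that[OF name_hom[OF P v(1)]] by blast
qed

end

section \<open>Assemblies\<close>

definition ufst :: "'u => 'u" where "ufst w = (THE x. \<exists>y. w = upair x y)"
definition usnd :: "'u => 'u" where "usnd w = (THE y. \<exists>x. w = upair x y)"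

lemma (in universe) ufst_usnd [simp]: "ufst (upair x y) = (x :: 'u)" "usnd (upair x y) = (y :: 'u)"
 unfolding ufst_def usnd_def by auto

lemma tracked_UN:
 assumes "tracked A K P Q'" "\<And>i j. i \<in> I ==> j \<in> J i ==> j \<in> K" "\<And>i j. i \<in> I ==> j \<in> J i ==> Q' j \<subseteq> Q i"
 shows "tracked A I (\<lambda>i. \<Union>j\<in>J i. P j) Q"
proof -
 obtain r where r: "r \<in> elts A" "\<forall>j\<in>K. realizes A r (P j) (Q' j)" using assms(1) unfolding tracked_def by blast
 have "realizes A r (\<Union>j\<in>J i. P j) (Q i)" if "i \<in> I" for i
  using r(2) assms(2,3)[OF that] unfolding realizes_def by blast
 then show ?thesis using r(1) unfolding tracked_def by blast
qed

lemma tracked_cong: "(\<And>i. i \<in> I ==> P i = P' i) ==> (\<And>i. i \<in> I ==> Q i = Q' i) ==> tracked A I P Q \<longleftrightarrow> tracked A I P' Q'"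
 unfolding tracked_def by simp

abbreviation fn :: "'p \<times> 'f \<times> 'q => 'f" where "fn F \<equiv> fst (snd F)"

locale asm_univ = universe U + opca_alg A for U :: "'u itself" and A :: "'a opas"
begin

abbreviation AA :: "(('u, 'a) asm, ('u, 'a) asm_arr) cat" where "AA \<equiv> Asm A"
abbreviation RTA :: "(('u, 'a) rt_ob, ('u, 'a) rt_arr) cat" where "RTA \<equiv> RT A"

lemma small_TYPE: "small TYPE('u) X \<longleftrightarrow> sm X"
 by (simp add: small_def)

lemma asm_ob_iff: "P \<in> ob AA \<longleftrightarrow> sm (fst P) \<and> snd P \<in> fst P \<rightarrow>\<^sub>E downsets A"
 by (cases P) (simp add: Asm_def concrete_cat_def small_TYPE)

lemma asm_ob_real:
 assumes "P \<in> ob AA" "x \<in> fst P"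
 shows "closed A (snd P x)" "snd P x \<noteq> {}" "snd P x \<subseteq> elts A"
 using assms PiE_mem[of "snd P" "fst P" "\<lambda>_. downsets A" x] closed_elts unfolding asm_ob_iff downsets_iff by auto

lemma asm_obI:
 assumes "sm X" "\<And>x. x \<in> X ==> closed A (E x)" "\<And>x. x \<in> X ==> E x \<noteq> {}"
 shows "(X, restrict E X) \<in> ob AA"
 using assms by (auto simp: asm_ob_iff downsets_iff)

lemma asm_hom_iff:
 "F \<in> hom AA P Q \<longleftrightarrow> P \<in> ob AA \<and> Q \<in> ob AA \<and> F = (P, fn F, Q) \<and> fn F \<in> fst P \<rightarrow>\<^sub>E fst Q \<and>
   tracked A (fst P) (snd P) (\<lambda>x. snd Q (fn F x))"
proof -
 obtain P' f Q' where F: "F = (P', f, Q')" by (metis prod.collapse)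
 show ?thesis unfolding hom_def[of AA]
  by (auto simp: F Asm_def concrete_cat_def asm_hom_def tracked_def realizes_def)
qed

lemma asm_homI:
 assumes "P \<in> ob AA" "Q \<in> ob AA" "\<And>x. x \<in> fst P ==> f x \<in> fst Q" "tracked A (fst P) (snd P) (\<lambda>x. snd Q (f x))"
 shows "(P, restrict f (fst P), Q) \<in> hom AA P Q"
proof -
 have "tracked A (fst P) (snd P) (\<lambda>x. snd Q (restrict f (fst P) x))"
  using assms(4) by (subst tracked_cong[of _ _ "snd P" _ "\<lambda>x. snd Q (f x)"]) simp_all
 then show ?thesis unfolding asm_hom_iff using assms(1-3) by simp
qed

lemma fn_mem: "F \<in> hom AA P Q ==> x \<in> fst P ==> fn F x \<in> fst Q"
 unfolding asm_hom_iff by (blast dest: PiE_mem)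

lemma fn_tracked: "F \<in> hom AA P Q ==> tracked A (fst P) (snd P) (\<lambda>x. snd Q (fn F x))"
 unfolding asm_hom_iff by blast

lemma asm_hom_ob: "F \<in> hom AA P Q ==> P \<in> ob AA" "F \<in> hom AA P Q ==> Q \<in> ob AA"
 unfolding asm_hom_iff by blast+

lemma asm_eqI:
 assumes F: "F \<in> hom AA P Q" and G: "G \<in> hom AA P Q" and "\<And>x. x \<in> fst P ==> fn F x = fn G x"
 shows "F = G"
proof -
 have "F = (P, fn F, Q)" "G = (P, fn G, Q)" "fn F \<in> fst P \<rightarrow>\<^sub>E fst Q" "fn G \<in> fst P \<rightarrow>\<^sub>E fst Q"
  using F G unfolding asm_hom_iff by blast+
 moreover have "fn F = fn G" using calculation(3,4) assms(3) by (rule PiE_ext)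
 ultimately show ?thesis by metis
qed

lemma asm_comp: "comp AA (Q, g, W) (P, f, Q') = (P, compose (fst P) g f, W)"
 by (simp add: Asm_def concrete_cat_def)

lemma asm_ident: "ident AA P = (P, \<lambda>x\<in>fst P. x, P)"
 by (simp add: Asm_def concrete_cat_def)

lemma asm_comp_eq:
 assumes F: "F \<in> hom AA P Q" and G: "G \<in> hom AA Q W"
 shows "comp AA G F = (P, \<lambda>x\<in>fst P. fn G (fn F x), W)"
proof -
 have F': "F = (P, fn F, Q)" using F unfolding asm_hom_iff by blast
 have G': "G = (Q, fn G, W)" using G unfolding asm_hom_iff by blast
 show ?thesis by (rule trans[OF arg_cong2[OF G' F', of "comp AA"]]) (simp add: asm_comp compose_def)
qed

lemma fn_comp: "F \<in> hom AA P Q ==> G \<in> hom AA Q W ==> x \<in> fst P ==> fn (comp AA G F) x = fn G (fn F x)"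
 by (simp add: asm_comp_eq)

lemma asm_comp_hom:
 assumes F: "F \<in> hom AA P Q" and G: "G \<in> hom AA Q W"
 shows "comp AA G F \<in> hom AA P W"
 unfolding asm_comp_eq[OF F G]
proof (rule asm_homI)
 show "P \<in> ob AA" "W \<in> ob AA" using asm_hom_ob F G by blast+
 show "fn G (fn F x) \<in> fst W" if "x \<in> fst P" for x using fn_mem[OF G fn_mem[OF F that]] .
 show "tracked A (fst P) (snd P) (\<lambda>x. snd W (fn G (fn F x)))"
  by (rule tracked_trans[OF fn_tracked[OF F] tracked_reindex[OF fn_tracked[OF G]]])
   (simp_all add: asm_ob_real(3)[OF asm_hom_ob(1)[OF F]] asm_ob_real(1)[OF asm_hom_ob(2)[OF G]] fn_mem[OF F] fn_mem[OF G])
qed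

lemma category_Asm: "category AA"
proof -
 have i: "ident AA P \<in> hom AA P P" if "P \<in> ob AA" for P
  unfolding asm_ident using that asm_ob_real by (intro asm_homI tracked_incl) auto
 have fni: "fn (ident AA P) x = x" if "x \<in> fst P" for P :: "('u, 'a) asm" and x using that by (simp add: asm_ident)
 show ?thesis unfolding category_def
 proof (intro conjI ballI impI)
  fix F assume "F \<in> arr AA"
  then have F: "F \<in> hom AA (dom AA F) (cod AA F)" by (rule homI)
  show o: "dom AA F \<in> ob AA" "cod AA F \<in> ob AA" using asm_hom_ob F by blast+
  show "comp AA F (ident AA (dom AA F)) = F"
   by (rule asm_eqI[OF asm_comp_hom[OF i[OF o(1)] F] F]) (use fn_comp[OF i[OF o(1)] F] fni in simp)
  show "comp AA (ident AA (cod AA F)) F = F"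
   by (rule asm_eqI[OF asm_comp_hom[OF F i[OF o(2)]] F]) (use fn_comp[OF F i[OF o(2)]] fni fn_mem[OF F] in simp)
 next
  show "ident AA P \<in> hom AA P P" if "P \<in> ob AA" for P using i[OF that] .
  fix F G assume "F \<in> arr AA" "G \<in> arr AA" "cod AA F = dom AA G"
  then have F: "F \<in> hom AA (dom AA F) (cod AA F)" and G: "G \<in> hom AA (cod AA F) (cod AA G)" by (auto simp: hom_def[of AA])
  show "comp AA G F \<in> hom AA (dom AA F) (cod AA G)" using asm_comp_hom[OF F G] .
 next
  fix F G H assume "F \<in> arr AA" "G \<in> arr AA" "H \<in> arr AA" "cod AA F = dom AA G \<and> cod AA G = dom AA H"
  then have F: "F \<in> hom AA (dom AA F) (cod AA F)" and G: "G \<in> hom AA (cod AA F) (cod AA G)" and H: "H \<in> hom AA (cod AA G) (cod AA H)"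
   by (auto simp: hom_def[of AA])
  note GF = asm_comp_hom[OF F G] and HG = asm_comp_hom[OF G H]
  show "comp AA H (comp AA G F) = comp AA (comp AA H G) F"
   by (rule asm_eqI[OF asm_comp_hom[OF GF H] asm_comp_hom[OF F HG]])
    (use fn_comp[OF GF H] fn_comp[OF F G] fn_comp[OF F HG] fn_comp[OF G H fn_mem[OF F]] in simp)
 qed
qed

subsection \<open>Regular epimorphisms of assemblies\<close>

text \<open>The realizers of \<open>y\<close> in the image of \<open>e\<close>.\<close>

definition im :: "('u, 'a) asm => ('u, 'a) asm_arr => 'u => 'a set" where
 "im Z e y = (\<Union>z\<in>{z \<in> fst Z. fn e z = y}. snd Z z)"

lemma im_closed: "Z \<in> ob AA ==> closed A (im Z e y)"
 unfolding im_def by (rule closed_UN) (use asm_ob_real in blast)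

text \<open>The image of \<open>e\<close> consists of its values, with the realizers \<open>im Z e\<close>. Being a coequalizer, \<open>e\<close> factors through no smaller subobject of \<open>Y\<close>, so realizers in \<open>Y\<close> can be turned into realizers in the image.\<close>

lemma regular_epiD:
 assumes e: "e \<in> hom AA Z Y" and re: "regular_epi AA e"
 shows "tracked A (fst Y) (snd Y) (im Z e)"
proof -
 have Z: "Z \<in> ob AA" and Y: "Y \<in> ob AA" using asm_hom_ob e by blast+
 have de: "dom AA e = Z" "cod AA e = Y" using e by (auto simp: hom_def[of AA])
 obtain V a b where a: "a \<in> hom AA V Z" and b: "b \<in> hom AA V Z" and ab: "comp AA e a = comp AA e b"
  and u: "\<forall>W\<in>ob AA. \<forall>h \<in> hom AA Z W. comp AA h a = comp AA h b --> (\<exists>!k. k \<in> hom AA Y W \<and> comp AA k e = h)"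
  using re unfolding regular_epi_def de by (elim conjE bexE) (rule that)
 \<comment> \<open>factor \<open>e\<close> through its image; by the universal property the inclusion of the image is an isomorphism\<close>
 define I where "I = (fn e ` fst Z, restrict (im Z e) (fn e ` fst Z))"
 have I: "I \<in> ob AA" unfolding I_def
  by (rule asm_obI) (use Z asm_ob_iff small_image im_closed[OF Z] asm_ob_real[OF Z] in \<open>auto simp: im_def\<close>)
 have eI: "(Z, restrict (fn e) (fst Z), I) \<in> hom AA Z I"
 proof (rule asm_homI[OF Z I])
  show "fn e x \<in> fst I" if "x \<in> fst Z" for x using that by (simp add: I_def)
  show "tracked A (fst Z) (snd Z) (\<lambda>x. snd I (fn e x))"
   by (rule tracked_incl) (use im_closed[OF Z] in \<open>auto simp: I_def im_def\<close>)
 qed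
 have \<iota>: "(I, restrict (\<lambda>y. y) (fst I), Y) \<in> hom AA I Y"
 proof (rule asm_homI[OF I Y])
  show "x \<in> fst Y" if "x \<in> fst I" for x using that fn_mem[OF e] by (auto simp: I_def)
  have "tracked A (fst I) (im Z e) (snd Y)" unfolding im_def
   by (rule tracked_UN[OF fn_tracked[OF e]]) auto
  then show "tracked A (fst I) (snd I) (\<lambda>x. snd Y x)"
   by (subst tracked_cong[of _ _ "im Z e" _ "snd Y"]) (simp_all add: I_def)
 qed
 let ?e = "(Z, restrict (fn e) (fst Z), I)" and ?i = "(I, restrict (\<lambda>y. y) (fst I), Y)"
 have "comp AA ?e a = comp AA ?e b"
 proof (rule asm_eqI[OF asm_comp_hom[OF a eI] asm_comp_hom[OF b eI]])
  fix x assume x: "x \<in> fst V"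
  have "fn e (fn a x) = fn e (fn b x)" using fn_comp[OF a e x] fn_comp[OF b e x] ab by simp
  then show "fn (comp AA ?e a) x = fn (comp AA ?e b) x"
   using fn_comp[OF a eI x] fn_comp[OF b eI x] fn_mem[OF a x] fn_mem[OF b x] by simp
 qed
 then obtain k where k: "k \<in> hom AA Y I" "comp AA k e = ?e" using u I eI by blast
 have "comp AA (comp AA ?i k) e = e"
 proof (rule asm_eqI[OF asm_comp_hom[OF e asm_comp_hom[OF k(1) \<iota>]] e])
  fix x assume x: "x \<in> fst Z"
  have "fn k (fn e x) = fn e x" using fn_comp[OF e k(1) x] k(2) x by simp
  then show "fn (comp AA (comp AA ?i k) e) x = fn e x"
   using fn_comp[OF e asm_comp_hom[OF k(1) \<iota>] x] fn_comp[OF k(1) \<iota> fn_mem[OF e x]] fn_mem[OF k(1) fn_mem[OF e x]] by simp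
 qed
 moreover have "comp AA (ident AA Y) e = e" using comp_ident(2)[OF category_Asm e] .
 moreover have "comp AA e a = comp AA e b" by (rule ab)
 ultimately have "comp AA ?i k = ident AA Y"
  using u Y e asm_comp_hom[OF k(1) \<iota>] ident_hom[OF category_Asm Y] by blast
 then have kx: "fn k y = y" if "y \<in> fst Y" for y
  using fn_comp[OF k(1) \<iota> that] fn_mem[OF k(1) that] that by (simp add: asm_ident)
 have mem: "y \<in> fst I" if "y \<in> fst Y" for y using fn_mem[OF k(1) that] kx[OF that] by simp
 show ?thesis
  using fn_tracked[OF k(1)] by (subst tracked_cong[of _ _ "snd Y" _ "\<lambda>x. snd I (fn k x)"]) (use kx mem in \<open>simp_all add: I_def\<close>)
qed

text \<open>Conversely, if realizers can be lifted along \<open>e\<close>, then a function that is constant on the fibres is realized on the codomain as soon as it is on the domain. The kernel pair consists of pairs in the same fibre, with paired realizers.\<close>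

lemma regular_epiI:
 assumes e: "e \<in> hom AA Z Y" and t: "tracked A (fst Y) (snd Y) (im Z e)"
 shows "regular_epi AA e"
proof -
 have Z: "Z \<in> ob AA" and Y: "Y \<in> ob AA" using asm_hom_ob e by blast+
 have de: "dom AA e = Z" "cod AA e = Y" "e \<in> arr AA" using e by (auto simp: hom_def[of AA])
 have surj: "\<exists>z\<in>fst Z. fn e z = y" if y: "y \<in> fst Y" for y
 proof -
  obtain r where "realizes A r (snd Y y) (im Z e y)" using t y unfolding tracked_def by blast
  then have "im Z e y \<noteq> {}" using asm_ob_real(2)[OF Y y] unfolding realizes_def by blast
  then show ?thesis unfolding im_def by blast
 qed
 \<comment> \<open>\<open>e\<close> is the coequalizer of its kernel pair\<close>
 define K where "K = {upair z z' | z z'. z \<in> fst Z \<and> z' \<in> fst Z \<and> fn e z = fn e z'}"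
 define EK where "EK w = both A (snd Z (ufst w)) (snd Z (usnd w))" for w
 define V where "V = (K, restrict EK K)"
 have Kd: "ufst w \<in> fst Z" "usnd w \<in> fst Z" "fn e (ufst w) = fn e (usnd w)" if "w \<in> K" for w using that by (auto simp: K_def)
 have smZ: "sm (fst Z)" using Z by (simp add: asm_ob_iff)
 have smK: "sm K"
  by (rule small_subset[OF _ small_image[OF small_Times[OF smZ smZ], of "\<lambda>(z, z'). upair z z'"]]) (auto simp: K_def)
 have V: "V \<in> ob AA" unfolding V_def
 proof (rule asm_obI[OF smK])
  fix w assume w: "w \<in> K"
  show "closed A (EK w)" unfolding EK_def using asm_ob_real(3)[OF Z] Kd[OF w] by (intro closed_both) auto
  show "EK w \<noteq> {}" unfolding EK_def using asm_ob_real(2,3)[OF Z] Kd[OF w] by (intro both_nonempty) auto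
 qed
 have trV: "tracked A K (snd V) (\<lambda>w. snd Z (ufst w))" "tracked A K (snd V) (\<lambda>w. snd Z (usnd w))"
 proof -
  have "tracked A K EK (\<lambda>w. snd Z (ufst w))" unfolding EK_def
   by (rule tracked_fst) (use asm_ob_real[OF Z] Kd in auto)
  then show "tracked A K (snd V) (\<lambda>w. snd Z (ufst w))"
   by (subst tracked_cong[of _ _ EK _ "\<lambda>w. snd Z (ufst w)"]) (simp_all add: V_def)
  have "tracked A K EK (\<lambda>w. snd Z (usnd w))" unfolding EK_def
   by (rule tracked_snd) (use asm_ob_real[OF Z] Kd in auto)
  then show "tracked A K (snd V) (\<lambda>w. snd Z (usnd w))"
   by (subst tracked_cong[of _ _ EK _ "\<lambda>w. snd Z (usnd w)"]) (simp_all add: V_def)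
 qed
 define a where "a = (V, restrict ufst (fst V), Z)"
 define b where "b = (V, restrict usnd (fst V), Z)"
 have a: "a \<in> hom AA V Z" unfolding a_def by (rule asm_homI[OF V Z]) (use Kd trV in \<open>simp_all add: V_def\<close>)
 have b: "b \<in> hom AA V Z" unfolding b_def by (rule asm_homI[OF V Z]) (use Kd trV in \<open>simp_all add: V_def\<close>)
 have fna: "fn a w = ufst w" "fn b w = usnd w" if "w \<in> K" for w using that by (simp_all add: a_def b_def V_def)
 have fV: "fst V = K" by (simp add: V_def)
 have ab: "comp AA e a = comp AA e b"
  by (rule asm_eqI[OF asm_comp_hom[OF a e] asm_comp_hom[OF b e]])
   (use fn_comp[OF a e] fn_comp[OF b e] fna Kd fV in simp)
 have "\<exists>!k. k \<in> hom AA Y W \<and> comp AA k e = h" if h: "h \<in> hom AA Z W" and hab: "comp AA h a = comp AA h b" for W h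
 proof -
  have W: "W \<in> ob AA" using asm_hom_ob(2)[OF h] .
  have hk: "fn h z = fn h z'" if "z \<in> fst Z" "z' \<in> fst Z" "fn e z = fn e z'" for z z'
  proof -
   have w: "upair z z' \<in> fst V" using that by (auto simp: V_def K_def)
   show ?thesis using fn_comp[OF a h w] fn_comp[OF b h w] hab fna[of "upair z z'"] w fV by simp
  qed
  define f where "f y = fn h (SOME z. z \<in> fst Z \<and> fn e z = y)" for y
  have f: "f (fn e z) = fn h z" if z: "z \<in> fst Z" for z
  proof -
   have "(SOME z'. z' \<in> fst Z \<and> fn e z' = fn e z) \<in> fst Z \<and> fn e (SOME z'. z' \<in> fst Z \<and> fn e z' = fn e z) = fn e z"
    by (rule someI[of _ z]) (use z in simp)
   then show ?thesis unfolding f_def using hk z by blast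
  qed
  have k: "(Y, restrict f (fst Y), W) \<in> hom AA Y W"
  proof (rule asm_homI[OF Y W])
   show "f y \<in> fst W" if "y \<in> fst Y" for y using surj[OF that] f fn_mem[OF h] by auto
   have "tracked A (fst Y) (im Z e) (\<lambda>y. snd W (f y))" unfolding im_def
    by (rule tracked_UN[OF fn_tracked[OF h]]) (use f in auto)
   then show "tracked A (fst Y) (snd Y) (\<lambda>y. snd W (f y))"
    by (rule tracked_trans[OF t]) (use asm_ob_real[OF Y] asm_ob_real[OF W] surj f fn_mem[OF h] in \<open>auto, metis\<close>)
  qed
  let ?k = "(Y, restrict f (fst Y), W)"
  have "comp AA ?k e = h"
   by (rule asm_eqI[OF asm_comp_hom[OF e k] h]) (use fn_comp[OF e k] f fn_mem[OF e] in simp)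
  moreover have "l = ?k" if l: "l \<in> hom AA Y W" "comp AA l e = h" for l
  proof (rule asm_eqI[OF l(1) k])
   fix y assume y: "y \<in> fst Y"
   obtain z where z: "z \<in> fst Z" "fn e z = y" using surj[OF y] by blast
   show "fn l y = fn ?k y" using fn_comp[OF e l(1) z(1)] l(2) z f y by auto
  qed
  ultimately show ?thesis using k by blast
 qed
 then show ?thesis unfolding regular_epi_def de(1,2) using de(3) asm_hom_ob(1)[OF a] a b ab by blast
qed

lemma regular_epi_comp:
 assumes e: "regular_epi AA e" "e \<in> hom AA X Y" and e': "regular_epi AA e'" "e' \<in> hom AA Y Z"
 shows "regular_epi AA (comp AA e' e)"
proof (rule regular_epiI[OF asm_comp_hom[OF e(2) e'(2)]])
 have X: "X \<in> ob AA" and Y: "Y \<in> ob AA" and Z: "Z \<in> ob AA" using asm_hom_ob e(2) e'(2) by blast+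
 have "tracked A (fst Z) (im Y e') (im X (comp AA e' e))"
  by (subst (1) im_def[abs_def], rule tracked_UN[OF regular_epiD[OF e(2,1)]])
   (use fn_comp[OF e(2) e'(2)] in \<open>auto simp: im_def\<close>)
 then show "tracked A (fst Z) (snd Z) (im X (comp AA e' e))"
  by (rule tracked_trans[OF regular_epiD[OF e'(2,1)]]) (use asm_ob_real[OF Z] im_closed[OF X] in auto)
qed

subsection \<open>Composition of relations between assemblies\<close>

lemma both_UN: "both A p (\<Union>i\<in>I. q i) = (\<Union>i\<in>I. both A p (q i))"
 by (auto simp: both_def)

text \<open>The composite relation is represented by the assembly of all pairs \<open>(x, z)\<close> with a common partner \<open>y\<close>; a realizer
 of \<open>(x, z)\<close> is a pair of realizers of the two memberships at some such \<open>y\<close>. The surjection from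
 the pullback of the two relations lifts realizers, so it is a cover.\<close>

lemma relations_composite:
 assumes R: "R \<in> relations AA X Y" and S: "S \<in> relations AA Y Z"
 shows "rel_comp AA R S \<in> relations AA X Z"
proof -
 obtain a b where R_eq: "R = span_relation AA a b" and jR: "jointly_monic AA a b" and cR: "cod AA a = X" "cod AA b = Y"
  using R by (auto simp: relations_def)
 obtain c d where S_eq: "S = span_relation AA c d" and jS: "jointly_monic AA c d" and cS: "cod AA c = Y" "cod AA d = Z"
  using S by (auto simp: relations_def)
 define U' V' where UV: "U' = dom AA a" "V' = dom AA c"
 have a: "a \<in> hom AA U' X" and b: "b \<in> hom AA U' Y" using jR cR by (auto simp: jointly_monic_def UV hom_def[of AA])
 have c: "c \<in> hom AA V' Y" and d: "d \<in> hom AA V' Z" using jS cS by (auto simp: jointly_monic_def UV hom_def[of AA])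
 have obs: "U' \<in> ob AA" "V' \<in> ob AA" "X \<in> ob AA" "Z \<in> ob AA" using asm_hom_ob a c d by blast+
 define J where "J w = {(u, v). u \<in> fst U' \<and> v \<in> fst V' \<and> fn b u = fn c v \<and> w = upair (fn a u) (fn d v)}" for w
 define EJ where "EJ = (\<lambda>(u, v). both A (snd U' u) (snd V' v))"
 define K where "K = {w. J w \<noteq> {}}"
 define EK where "EK w = (\<Union>j\<in>J w. EJ j)" for w
 have EJ': "closed A (EJ j) \<and> EJ j \<noteq> {}" if jj: "j \<in> fst U' \<times> fst V'" for j
 proof -
  obtain u v where j: "j = (u, v)" "u \<in> fst U'" "v \<in> fst V'" using jj by auto
  show ?thesis
   using closed_both[OF asm_ob_real(3)[OF obs(1) j(2)] asm_ob_real(3)[OF obs(2) j(3)]]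
    both_nonempty[OF asm_ob_real(3)[OF obs(1) j(2)] asm_ob_real(3)[OF obs(2) j(3)] asm_ob_real(2)[OF obs(1) j(2)] asm_ob_real(2)[OF obs(2) j(3)]]
   by (simp add: EJ_def j(1))
 qed
 have EJ: "closed A (EJ j)" "EJ j \<noteq> {}" if "j \<in> J w" for j w
  using EJ'[of j] that unfolding J_def by auto
 have smK: "sm K"
  by (rule small_subset[OF _ small_image[OF small_Times, of "fst U'" "fst V'" "\<lambda>(u, v). upair (fn a u) (fn d v)"]])
   (use obs in \<open>auto simp: K_def J_def asm_ob_iff\<close>)
 define W where "W = (K, restrict EK K)"
 have W: "W \<in> ob AA" unfolding W_def
 proof (rule asm_obI[OF smK])
  fix w assume w: "w \<in> K"
  show "closed A (EK w)" unfolding EK_def using EJ(1) by (rule closed_UN)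
  show "EK w \<noteq> {}" using w EJ(2) unfolding EK_def K_def by blast
 qed
 have EW: "snd W w = EK w" if "w \<in> K" for w using that by (simp add: W_def)
 have fW: "fst W = K" by (simp add: W_def)
 let ?I = "fst U' \<times> fst V'"
 have trU: "tracked A ?I EJ (\<lambda>j. snd U' (fst j))" unfolding EJ_def case_prod_beta
  by (rule tracked_fst) (simp_all add: asm_ob_real(1)[OF obs(1)] asm_ob_real(3)[OF obs(2)] mem_Times_iff)
 have trV: "tracked A ?I EJ (\<lambda>j. snd V' (snd j))" unfolding EJ_def case_prod_beta
  by (rule tracked_snd) (simp_all add: asm_ob_real(3)[OF obs(1)] asm_ob_real(1)[OF obs(2)] mem_Times_iff)
 have EJI: "EJ j \<subseteq> elts A" if "j \<in> ?I" for j
  using EJ'[OF that] closed_elts by blast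
 have trX: "tracked A ?I EJ (\<lambda>j. snd X (fn a (fst j)))"
  by (rule tracked_trans[OF trU tracked_reindex[OF fn_tracked[OF a]]])
   (simp_all only: EJI asm_ob_real(1)[OF obs(3)] fn_mem[OF a] mem_Times_iff)
 have trZ: "tracked A ?I EJ (\<lambda>j. snd Z (fn d (snd j)))"
  by (rule tracked_trans[OF trV tracked_reindex[OF fn_tracked[OF d]]])
   (simp_all only: EJI asm_ob_real(1)[OF obs(4)] fn_mem[OF d] mem_Times_iff)
 have tK: "tracked A K (snd W) Q" if "tracked A K EK Q" for Q
  using that by (subst tracked_cong[of _ _ EK _ Q]) (simp_all add: EW)
 define l where "l = (W, restrict ufst (fst W), X)"
 define r where "r = (W, restrict usnd (fst W), Z)"
 have l: "l \<in> hom AA W X" unfolding l_def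
 proof (rule asm_homI[OF W obs(3)])
  show "ufst w \<in> fst X" if "w \<in> fst W" for w using that fn_mem[OF a] by (auto simp: fW K_def J_def)
  have "tracked A K EK (\<lambda>w. snd X (ufst w))" unfolding EK_def by (rule tracked_UN[OF trX]) (auto simp: J_def)
  then show "tracked A (fst W) (snd W) (\<lambda>w. snd X (ufst w))" using tK fW by simp
 qed
 have r: "r \<in> hom AA W Z" unfolding r_def
 proof (rule asm_homI[OF W obs(4)])
  show "usnd w \<in> fst Z" if "w \<in> fst W" for w using that fn_mem[OF d] by (auto simp: fW K_def J_def)
  have "tracked A K EK (\<lambda>w. snd Z (usnd w))" unfolding EK_def by (rule tracked_UN[OF trZ]) (auto simp: J_def)
  then show "tracked A (fst W) (snd W) (\<lambda>w. snd Z (usnd w))" using tK fW by simp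
 qed
 have fnl: "fn l w = ufst w" "fn r w = usnd w" if "w \<in> K" for w using that by (simp_all add: l_def r_def fW)
 have K_upair: "w = upair (ufst w) (usnd w)" if "w \<in> K" for w using that by (auto simp: K_def J_def)
 have dl: "dom AA l = W" "dom AA r = W" "cod AA l = X" "cod AA r = Z" "l \<in> arr AA" "r \<in> arr AA"
  using l r by (auto simp: hom_def[of AA])
 have jm: "jointly_monic AA l r" unfolding jointly_monic_def dl
 proof (intro conjI ballI impI dl refl)
  fix Q f g assume f: "f \<in> hom AA Q W" and g: "g \<in> hom AA Q W" and e: "comp AA l f = comp AA l g \<and> comp AA r f = comp AA r g"
  show "f = g"
  proof (rule asm_eqI[OF f g])
   fix x assume x: "x \<in> fst Q"
   have m: "fn f x \<in> K" "fn g x \<in> K" using fn_mem[OF f x] fn_mem[OF g x] fW by auto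
   have "ufst (fn f x) = ufst (fn g x)" "usnd (fn f x) = usnd (fn g x)"
    using fn_comp[OF f l x] fn_comp[OF g l x] fn_comp[OF f r x] fn_comp[OF g r x] e fnl m by auto
   then show "fn f x = fn g x" using K_upair[OF m(1)] K_upair[OF m(2)] by simp
  qed
 qed
 have main: "(f, g) \<in> rel_comp AA R S \<longleftrightarrow> (f, g) \<in> span_relation AA l r" for f g
 proof
   assume "(f, g) \<in> rel_comp AA R S"
   then obtain Q V e m where 1: "f \<in> hom AA Q (cod AA f)" "g \<in> hom AA Q (cod AA g)" "regular_epi AA e" "e \<in> hom AA V Q"
    "(comp AA f e, m) \<in> R" "(m, comp AA g e) \<in> S" by (rule rel_compE)
   obtain h where h: "comp AA f e = comp AA a h" "m = comp AA b h" "h \<in> arr AA" "cod AA h = U'"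
    using 1(5) by (auto simp: R_eq span_relation_def UV)
   obtain h' where h': "m = comp AA c h'" "comp AA g e = comp AA d h'" "h' \<in> arr AA" "cod AA h' = V'"
    using 1(6) by (auto simp: S_eq span_relation_def UV)
   have hh: "h \<in> hom AA (dom AA h) U'" and hh': "h' \<in> hom AA (dom AA h') V'" using h h' by (auto simp: hom_def[of AA])
   note fe = asm_comp_hom[OF 1(4) 1(1)] and ah = asm_comp_hom[OF hh a] and ge = asm_comp_hom[OF 1(4) 1(2)] and dh = asm_comp_hom[OF hh' d]
   have dh1: "dom AA h = V" "cod AA f = X" using fe ah h(1) by (auto simp: hom_def[of AA])
   have dh2: "dom AA h' = V" "cod AA g = Z" using ge dh h'(2) by (auto simp: hom_def[of AA])
   have f: "f \<in> hom AA Q X" and g: "g \<in> hom AA Q Z" using 1 dh1 dh2 by auto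
   have hh: "h \<in> hom AA V U'" and hh': "h' \<in> hom AA V V'" using hh hh' dh1 dh2 by auto
   have Q: "Q \<in> ob AA" and Vo: "V \<in> ob AA" using asm_hom_ob 1(4) by blast+
   have J: "(fn h v, fn h' v) \<in> J (upair (fn f (fn e v)) (fn g (fn e v)))" if v: "v \<in> fst V" for v
    using fn_comp[OF 1(4) f v] fn_comp[OF 1(4) g v] fn_comp[OF hh a v] fn_comp[OF hh b v] fn_comp[OF hh' c v] fn_comp[OF hh' d v]
     h h' fn_mem[OF hh v] fn_mem[OF hh' v] by (auto simp: J_def)
   have surj: "\<exists>v\<in>fst V. fn e v = q" if q: "q \<in> fst Q" for q
   proof -
    obtain r where "realizes A r (snd Q q) (im V e q)" using regular_epiD[OF 1(4,3)] q unfolding tracked_def by blast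
    then have "im V e q \<noteq> {}" using asm_ob_real(2)[OF Q q] unfolding realizes_def by blast
    then show ?thesis unfolding im_def by blast
   qed
   define k where "k = (Q, restrict (\<lambda>q. upair (fn f q) (fn g q)) (fst Q), W)"
   have kK: "upair (fn f q) (fn g q) \<in> K" if "q \<in> fst Q" for q using surj[OF that] J by (auto simp: K_def)
   have k: "k \<in> hom AA Q W" unfolding k_def
   proof (rule asm_homI[OF Q W])
    show "upair (fn f q) (fn g q) \<in> fst W" if "q \<in> fst Q" for q using kK[OF that] fW by simp
    have "tracked A (fst V) (snd V) (\<lambda>v. both A (snd U' (fn h v)) (snd V' (fn h' v)))"
     by (rule tracked_pair[OF fn_tracked[OF hh] fn_tracked[OF hh']]) (rule asm_ob_real(3)[OF Vo])
    then have "tracked A (fst V) (snd V) (\<lambda>v. EK (upair (fn f (fn e v)) (fn g (fn e v))))"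
     by (rule tracked_weaken) (use J in \<open>auto simp: EK_def EJ_def\<close>)
    then have "tracked A (fst Q) (im V e) (\<lambda>q. EK (upair (fn f q) (fn g q)))" unfolding im_def
     by (rule tracked_UN) auto
    then have "tracked A (fst Q) (snd Q) (\<lambda>q. EK (upair (fn f q) (fn g q)))"
     by (rule tracked_trans[OF regular_epiD[OF 1(4,3)]]) (simp_all add: asm_ob_real(3)[OF Q] EK_def closed_UN[OF EJ(1)])
    then show "tracked A (fst Q) (snd Q) (\<lambda>q. snd W (upair (fn f q) (fn g q)))"
     by (subst tracked_cong[of _ _ "snd Q" _ "\<lambda>q. EK (upair (fn f q) (fn g q))"]) (use kK EW in simp_all)
   qed
   have "comp AA l k = f"
    by (rule asm_eqI[OF asm_comp_hom[OF k l] f]) (use fn_comp[OF k l] fnl kK in \<open>simp add: k_def\<close>)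
   moreover have "comp AA r k = g"
    by (rule asm_eqI[OF asm_comp_hom[OF k r] g]) (use fn_comp[OF k r] fnl kK in \<open>simp add: k_def\<close>)
   moreover have "k \<in> arr AA" "cod AA k = W" using k by (auto simp: hom_def[of AA])
   ultimately show "(f, g) \<in> span_relation AA l r" unfolding span_relation_def dl by blast
  next
   assume "(f, g) \<in> span_relation AA l r"
   then obtain k where k': "f = comp AA l k" "g = comp AA r k" "k \<in> arr AA" "cod AA k = W"
    unfolding span_relation_def dl by blast
   define Q where "Q = dom AA k"
   have k: "k \<in> hom AA Q W" using k' by (auto simp: hom_def[of AA] Q_def)
   have Q: "Q \<in> ob AA" using asm_hom_ob(1)[OF k] .
   have f: "f \<in> hom AA Q X" and g: "g \<in> hom AA Q Z" using asm_comp_hom[OF k l] asm_comp_hom[OF k r] k' by auto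
   have kK: "fn k q \<in> K" if "q \<in> fst Q" for q using fn_mem[OF k that] fW by simp
   define H where "H = {upair q (upair u v) | q u v. q \<in> fst Q \<and> (u, v) \<in> J (fn k q)}"
   define EH where "EH w = both A (snd Q (ufst w)) (EJ (ufst (usnd w), usnd (usnd w)))" for w
   have Hd: "ufst w \<in> fst Q" "(ufst (usnd w), usnd (usnd w)) \<in> J (fn k (ufst w))" if "w \<in> H" for w using that by (auto simp: H_def)
   have Jd: "u \<in> fst U'" "v \<in> fst V'" "fn b u = fn c v" "ufst w = fn a u" "usnd w = fn d v" if "(u, v) \<in> J w" for u v w
    using that by (auto simp: J_def)
   have "H \<subseteq> (\<lambda>(q, u, v). upair q (upair u v)) ` (fst Q \<times> fst U' \<times> fst V')"
    using Jd(1,2) unfolding H_def by force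
   then have smH: "sm H"
    by (rule small_subset) (use Q obs asm_ob_iff in \<open>intro small_image small_Times, auto\<close>)
   define V where "V = (H, restrict EH H)"
   have EHc: "closed A (EH w)" "EH w \<noteq> {}" if "w \<in> H" for w
    unfolding EH_def
    using closed_both[OF asm_ob_real(3)[OF Q Hd(1)[OF that]] closed_elts[OF EJ(1)[OF Hd(2)[OF that]]]]
     both_nonempty[OF asm_ob_real(3)[OF Q Hd(1)[OF that]] closed_elts[OF EJ(1)[OF Hd(2)[OF that]]]
      asm_ob_real(2)[OF Q Hd(1)[OF that]] EJ(2)[OF Hd(2)[OF that]]] by simp_all
   have V: "V \<in> ob AA" unfolding V_def by (rule asm_obI[OF smH EHc])
   have fV: "fst V = H" and EV: "\<And>w. w \<in> H ==> snd V w = EH w" by (simp_all add: V_def)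
   have tV: "tracked A H (snd V) Q'" if "tracked A H EH Q'" for Q'
    using that by (subst tracked_cong[of _ _ EH _ Q']) (simp_all add: EV)
   have EJs: "EJ (ufst (usnd w), usnd (usnd w)) \<subseteq> elts A" "closed A (EJ (ufst (usnd w), usnd (usnd w)))" if "w \<in> H" for w
    using EJ(1)[OF Hd(2)[OF that]] closed_elts by auto
   define e where "e = (V, restrict ufst (fst V), Q)"
   have e: "e \<in> hom AA V Q" unfolding e_def
   proof (rule asm_homI[OF V Q])
    show "ufst w \<in> fst Q" if "w \<in> fst V" for w using Hd(1) that fV by simp
    have "tracked A H EH (\<lambda>w. snd Q (ufst w))" unfolding EH_def
     by (rule tracked_fst) (simp_all only: asm_ob_real(1)[OF Q] Hd(1) EJs(1))
    then show "tracked A (fst V) (snd V) (\<lambda>w. snd Q (ufst w))" using tV fV by simp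
   qed
   have trJ: "tracked A H EH (\<lambda>w. EJ (ufst (usnd w), usnd (usnd w)))" unfolding EH_def
    by (rule tracked_snd) (simp_all only: asm_ob_real(3)[OF Q] Hd(1) EJs(2))
   have HI: "(ufst (usnd w), usnd (usnd w)) \<in> ?I" if "w \<in> H" for w using Jd(1,2)[OF Hd(2)[OF that]] by simp
   define h where "h = (V, restrict (\<lambda>w. ufst (usnd w)) (fst V), U')"
   define h' where "h' = (V, restrict (\<lambda>w. usnd (usnd w)) (fst V), V')"
   have h: "h \<in> hom AA V U'" unfolding h_def
   proof (rule asm_homI[OF V obs(1)])
    show "ufst (usnd w) \<in> fst U'" if "w \<in> fst V" for w using HI that fV by simp
    have "tracked A H EH (\<lambda>w. snd U' (fst (ufst (usnd w), usnd (usnd w))))"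
     by (rule tracked_trans[OF trJ tracked_reindex[OF trU HI]])
      (use closed_elts[OF EHc(1)] HI in \<open>simp_all add: asm_ob_real(1)[OF obs(1)]\<close>)
    then show "tracked A (fst V) (snd V) (\<lambda>w. snd U' (ufst (usnd w)))" using tV fV by simp
   qed
   have h': "h' \<in> hom AA V V'" unfolding h'_def
   proof (rule asm_homI[OF V obs(2)])
    show "usnd (usnd w) \<in> fst V'" if "w \<in> fst V" for w using HI that fV by simp
    have "tracked A H EH (\<lambda>w. snd V' (snd (ufst (usnd w), usnd (usnd w))))"
     by (rule tracked_trans[OF trJ tracked_reindex[OF trV HI]])
      (use closed_elts[OF EHc(1)] HI in \<open>simp_all add: asm_ob_real(1)[OF obs(2)]\<close>)
    then show "tracked A (fst V) (snd V) (\<lambda>w. snd V' (usnd (usnd w)))" using tV fV by simp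
   qed
   have fns: "fn e w = ufst w" "fn h w = ufst (usnd w)" "fn h' w = usnd (usnd w)" if "w \<in> H" for w
    using that by (simp_all add: e_def h_def h'_def fV)
   have "regular_epi AA e"
   proof (rule regular_epiI[OF e])
    have tk: "tracked A (fst Q) (snd Q) (\<lambda>q. EK (fn k q))"
     using fn_tracked[OF k] by (subst tracked_cong[of _ _ "snd Q" _ "\<lambda>q. snd W (fn k q)"]) (use kK EW in simp_all)
    have "tracked A (fst Q) (snd Q) (\<lambda>q. both A (snd Q q) (EK (fn k q)))"
     by (rule tracked_pair[OF tracked_incl tk]) (simp_all add: asm_ob_real[OF Q])
    then show "tracked A (fst Q) (snd Q) (im V e)"
    proof (rule tracked_weaken)
     fix q assume q: "q \<in> fst Q"
     have "both A (snd Q q) (EJ (u, v)) \<subseteq> im V e q" if uv: "(u, v) \<in> J (fn k q)" for u v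
     proof -
      have w: "upair q (upair u v) \<in> H" using q uv by (auto simp: H_def)
      then have "snd V (upair q (upair u v)) = both A (snd Q q) (EJ (u, v))" using EV by (simp add: EH_def)
      then show ?thesis using w fns(1)[OF w] unfolding im_def fV by fastforce
     qed
     then show "both A (snd Q q) (EK (fn k q)) \<subseteq> im V e q" unfolding EK_def both_UN by fast
    qed
   qed
   moreover have "comp AA f e = comp AA a h"
   proof (rule asm_eqI[OF asm_comp_hom[OF e f] asm_comp_hom[OF h a]])
    fix w assume "w \<in> fst V"
    then have w: "w \<in> H" "w \<in> fst V" using fV by auto
    have "fn f (ufst w) = ufst (fn k (ufst w))" using fn_comp[OF k l Hd(1)[OF w(1)]] k'(1) fnl kK Hd(1)[OF w(1)] by simp
    then show "fn (comp AA f e) w = fn (comp AA a h) w"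
     using fn_comp[OF e f w(2)] fn_comp[OF h a w(2)] fns[OF w(1)] Jd(4)[OF Hd(2)[OF w(1)]] by simp
   qed
   moreover have "comp AA b h = comp AA c h'"
   proof (rule asm_eqI[OF asm_comp_hom[OF h b] asm_comp_hom[OF h' c]])
    fix w assume "w \<in> fst V"
    then have w: "w \<in> H" "w \<in> fst V" using fV by auto
    show "fn (comp AA b h) w = fn (comp AA c h') w"
     using fn_comp[OF h b w(2)] fn_comp[OF h' c w(2)] fns[OF w(1)] Jd(3)[OF Hd(2)[OF w(1)]] by simp
   qed
   moreover have "comp AA g e = comp AA d h'"
   proof (rule asm_eqI[OF asm_comp_hom[OF e g] asm_comp_hom[OF h' d]])
    fix w assume "w \<in> fst V"
    then have w: "w \<in> H" "w \<in> fst V" using fV by auto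
    have "fn g (ufst w) = usnd (fn k (ufst w))" using fn_comp[OF k r Hd(1)[OF w(1)]] k'(2) fnl kK Hd(1)[OF w(1)] by simp
    then show "fn (comp AA g e) w = fn (comp AA d h') w"
     using fn_comp[OF e g w(2)] fn_comp[OF h' d w(2)] fns[OF w(1)] Jd(5)[OF Hd(2)[OF w(1)]] by simp
   qed
   moreover have "h \<in> arr AA" "cod AA h = dom AA a" "h' \<in> arr AA" "cod AA h' = dom AA c" using h h' by (auto simp: hom_def[of AA] UV)
   then have "(comp AA a h, comp AA b h) \<in> R" "(comp AA c h', comp AA d h') \<in> S"
    unfolding R_eq S_eq span_relation_def by blast+
   ultimately show "(f, g) \<in> rel_comp AA R S" using rel_compI[OF f g _ e, of "comp AA b h" R S] by simp
 qed
 have "rel_comp AA R S = span_relation AA l r" by (rule set_eqI) (metis main prod.collapse)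
 then show ?thesis unfolding relations_def using jm dl by blast
qed

sublocale rel_cat AA
 by unfold_locales (use category_Asm regular_epi_comp relations_composite in blast)+

end

section \<open>Constant objects\<close>

lemma (in universe) small_TYPE': "small TYPE('u) X \<longleftrightarrow> sm X"
 by (simp add: small_def)

lemma set_hom_iff:
 fixes F :: "'u set_arr"
 shows "F \<in> hom Set_cat X Y \<longleftrightarrow> small TYPE('u) X \<and> small TYPE('u) Y \<and> F = (X, fn F, Y) \<and> fn F \<in> X \<rightarrow>\<^sub>E Y"
proof -
 obtain X' f Y' where "F = (X', f, Y')" by (metis prod.collapse)
 then show ?thesis unfolding hom_def[of Set_cat] by (auto simp: Set_cat_def concrete_cat_def)
qed

lemma set_ob_iff: "(X :: 'u set) \<in> ob Set_cat \<longleftrightarrow> small TYPE('u) X"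
 by (simp add: Set_cat_def concrete_cat_def)

lemma set_comp: "comp Set_cat (Q, g, W) (P, f, Q') = (P, compose P g f, W)"
 by (simp add: Set_cat_def concrete_cat_def)

lemma set_ident: "ident Set_cat P = (P, \<lambda>x\<in>P. x, P)"
 by (simp add: Set_cat_def concrete_cat_def)

lemma set_comp_eq:
 assumes F: "F \<in> hom Set_cat P Q" and G: "G \<in> hom Set_cat Q W"
 shows "comp Set_cat G F = (P, \<lambda>x\<in>P. fn G (fn F x), W)"
proof -
 have F': "F = (P, fn F, Q)" using F unfolding set_hom_iff by blast
 have G': "G = (Q, fn G, W)" using G unfolding set_hom_iff by blast
 show ?thesis by (rule trans[OF arg_cong2[OF G' F', of "comp Set_cat"]]) (simp add: set_comp compose_def)
qed

lemma set_eqI: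
 assumes F: "F \<in> hom Set_cat P Q" and G: "G \<in> hom Set_cat P Q" and "\<And>x. x \<in> P ==> fn F x = fn G x"
 shows "F = G"
proof -
 have "F = (P, fn F, Q)" "G = (P, fn G, Q)" "fn F \<in> P \<rightarrow>\<^sub>E Q" "fn G \<in> P \<rightarrow>\<^sub>E Q"
  using F G unfolding set_hom_iff by blast+
 moreover have "fn F = fn G" using calculation(3,4) assms(3) by (rule PiE_ext)
 ultimately show ?thesis by metis
qed

lemma set_fn_mem: "F \<in> hom Set_cat P Q ==> x \<in> P ==> fn F x \<in> Q"
 unfolding set_hom_iff by (blast dest: PiE_mem)

text \<open>The element \<open>s\<close> of \<open>S\<close> as an arrow from a fixed one-element set.\<close>

definition pt :: "'u set" where "pt = {undefined}"

definition elem :: "'u set => 'u => 'u set_arr" where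
 "elem S s = (pt, \<lambda>x\<in>pt. s, S)"

abbreviation nab :: "'a opas => ('u set, 'u set_arr, ('u, 'a) rt_ob, ('u, 'a) rt_arr) func" where
 "nab A \<equiv> comp_func (ex_reg_embedding (Asm A)) (Nabla A)"

context universe
begin

lemma small_pt: "small TYPE('u) (pt :: 'u set)"
 unfolding small_TYPE' pt_def by (rule small_finite) simp

lemma elem_hom: "small TYPE('u) S ==> s \<in> S ==> elem S s \<in> hom Set_cat pt (S :: 'u set)"
 unfolding set_hom_iff elem_def using small_pt by simp

lemma elem_comp:
 assumes g: "g \<in> hom Set_cat S W" and s: "s \<in> S"
 shows "comp Set_cat g (elem S s) = elem W (fn g s :: 'u)"
proof -
 have "small TYPE('u) S" using g unfolding set_hom_iff by blast
 have "(\<lambda>x\<in>pt. fn g (fn (elem S s) x)) = (\<lambda>x\<in>pt. fn g s)" by (rule restrict_ext) (simp add: elem_def)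
 then show ?thesis unfolding set_comp_eq[OF elem_hom[OF \<open>small TYPE('u) S\<close> s] g] by (simp add: elem_def)
qed

lemma category_Set: "category (Set_cat :: ('u set, 'u set_arr) cat)"
proof -
 have i: "ident Set_cat P \<in> hom Set_cat P P" if "small TYPE('u) P" for P :: "'u set"
  using that by (simp add: set_hom_iff set_ident)
 have c: "comp Set_cat G F \<in> hom Set_cat P W" if F: "F \<in> hom Set_cat P Q" and G: "G \<in> hom Set_cat Q W"
  for F G :: "'u set_arr" and P Q W
  unfolding set_comp_eq[OF F G] using F G set_fn_mem[OF G set_fn_mem[OF F]] by (simp add: set_hom_iff)
 have sh: "small TYPE('u) P" "small TYPE('u) Q" if "F \<in> hom Set_cat P Q" for F :: "'u set_arr" and P Q
  using that unfolding set_hom_iff by blast+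
 show ?thesis unfolding category_def
 proof (intro conjI ballI impI)
  fix F :: "'u set_arr" assume "F \<in> arr Set_cat"
  then have F: "F \<in> hom Set_cat (dom Set_cat F) (cod Set_cat F)" by (rule homI)
  note s = sh[OF F]
  show "dom Set_cat F \<in> ob Set_cat" "cod Set_cat F \<in> ob Set_cat" using s by (simp_all add: set_ob_iff)
  show "comp Set_cat F (ident Set_cat (dom Set_cat F)) = F"
   by (rule set_eqI[OF c[OF i[OF s(1)] F] F]) (unfold set_comp_eq[OF i[OF s(1)] F], simp add: set_ident)
  show "comp Set_cat (ident Set_cat (cod Set_cat F)) F = F"
   by (rule set_eqI[OF c[OF F i[OF s(2)]] F]) (unfold set_comp_eq[OF F i[OF s(2)]], simp add: set_ident set_fn_mem[OF F])
 next
  show "ident Set_cat P \<in> hom Set_cat P P" if "P \<in> ob Set_cat" for P :: "'u set" using i that by (simp add: set_ob_iff)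
  fix F G :: "'u set_arr" assume "F \<in> arr Set_cat" "G \<in> arr Set_cat" "cod Set_cat F = dom Set_cat G"
  then have F: "F \<in> hom Set_cat (dom Set_cat F) (cod Set_cat F)" and G: "G \<in> hom Set_cat (cod Set_cat F) (cod Set_cat G)"
   by (auto simp: hom_def[of Set_cat])
  show "comp Set_cat G F \<in> hom Set_cat (dom Set_cat F) (cod Set_cat G)" using c[OF F G] .
 next
  fix F G H :: "'u set_arr"
  assume "F \<in> arr Set_cat" "G \<in> arr Set_cat" "H \<in> arr Set_cat" "cod Set_cat F = dom Set_cat G \<and> cod Set_cat G = dom Set_cat H"
  then have F: "F \<in> hom Set_cat (dom Set_cat F) (cod Set_cat F)" and G: "G \<in> hom Set_cat (cod Set_cat F) (cod Set_cat G)"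
   and H: "H \<in> hom Set_cat (cod Set_cat G) (cod Set_cat H)" by (auto simp: hom_def[of Set_cat])
  note GF = c[OF F G] and HG = c[OF G H]
  show "comp Set_cat H (comp Set_cat G F) = comp Set_cat (comp Set_cat H G) F"
   by (rule set_eqI[OF c[OF GF H] c[OF F HG]])
    (unfold set_comp_eq[OF GF H] set_comp_eq[OF F HG], unfold set_comp_eq[OF F G] set_comp_eq[OF G H], simp add: set_fn_mem[OF F])
 qed
qed

end

context asm_univ
begin

lemma nabla_simps:
 "fob (Nabla A) Y = (Y, \<lambda>y\<in>Y. elts A)" "far (Nabla A) (X, f, Y) = (fob (Nabla A) X, f, fob (Nabla A) Y)"
 by (simp_all add: Nabla_def Let_def)

lemma nabla_ob: "small TYPE('u) Y ==> fob (Nabla A) Y \<in> ob AA"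
 unfolding nabla_simps small_TYPE by (rule asm_obI) (auto simp: closed_elts_all elts_nonempty)

lemma fst_nabla [simp]: "fst (fob (Nabla A) Y) = Y"
 by (simp add: nabla_simps)

lemma nabla_far:
 assumes "F \<in> hom Set_cat X Y" shows "far (Nabla A) F = (fob (Nabla A) X, fn F, fob (Nabla A) Y)"
proof -
 have "F = (X, fn F, Y)" using assms unfolding set_hom_iff by blast
 then show ?thesis by (metis nabla_simps(2))
qed

lemma nabla_hom:
 assumes F: "F \<in> hom Set_cat X Y"
 shows "far (Nabla A) F \<in> hom AA (fob (Nabla A) X) (fob (Nabla A) Y)"
proof -
 have s: "small TYPE('u) X" "small TYPE('u) Y" and f: "fn F \<in> X \<rightarrow>\<^sub>E Y" using F unfolding set_hom_iff by blast+
 have "tracked A X (snd (fob (Nabla A) X)) (\<lambda>x. snd (fob (Nabla A) Y) (fn F x))"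
  by (rule tracked_incl) (use set_fn_mem[OF F] in \<open>simp_all add: nabla_simps closed_elts_all\<close>)
 then show ?thesis unfolding nabla_far[OF F] asm_hom_iff using nabla_ob[OF s(1)] nabla_ob[OF s(2)] f by simp
qed

lemma nabla_functor: "is_functor (Set_cat :: ('u set, 'u set_arr) cat) AA (Nabla A)"
 unfolding is_functor_def
proof (intro conjI ballI impI)
 show "fob (Nabla A) X \<in> ob AA" if "X \<in> ob Set_cat" for X :: "'u set" using that nabla_ob by (simp add: set_ob_iff)
 show "far (Nabla A) F \<in> hom AA (fob (Nabla A) (dom Set_cat F)) (fob (Nabla A) (cod Set_cat F))" if "F \<in> arr Set_cat" for F :: "'u set_arr"
  using nabla_hom[OF homI[OF that]] .
 show "far (Nabla A) (ident Set_cat X) = ident AA (fob (Nabla A) X)" if "X \<in> ob Set_cat" for X :: "'u set"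
  by (simp add: set_ident asm_ident nabla_simps)
 fix F G :: "'u set_arr" assume "F \<in> arr Set_cat" "G \<in> arr Set_cat" "cod Set_cat F = dom Set_cat G"
 then have F: "F \<in> hom Set_cat (dom Set_cat F) (cod Set_cat F)" and G: "G \<in> hom Set_cat (cod Set_cat F) (cod Set_cat G)"
  by (auto simp: hom_def[of Set_cat])
 show "far (Nabla A) (comp Set_cat G F) = comp AA (far (Nabla A) G) (far (Nabla A) F)"
  unfolding set_comp_eq[OF F G] asm_comp_eq[OF nabla_hom[OF F] nabla_hom[OF G]] by (simp add: nabla_simps nabla_far[OF F] nabla_far[OF G])
qed

lemma nab_functor: "is_functor (Set_cat :: ('u set, 'u set_arr) cat) (RT A) (nab A)"
 unfolding RT_def by (rule is_functor_comp_func[OF nabla_functor embedding_functor])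

lemma category_RT: "category RTA"
 unfolding RT_def by (rule category_ex_reg)

text \<open>Arrows from a constant assembly are the families with a common realizer.\<close>

lemma uniform_family:
 assumes M: "M \<in> ob AA" and S: "small TYPE('u) S" and m: "\<And>s. s \<in> S ==> m s \<in> fst M" and c: "c \<in> elts A" "\<And>s. s \<in> S ==> c \<in> snd M (m s)"
 shows "(fob (Nabla A) S, restrict m S, M) \<in> hom AA (fob (Nabla A) S) M"
proof -
 have "tracked A S (snd (fob (Nabla A) S)) (\<lambda>s. snd M (m s))"
  by (rule tracked_const[OF c]) (use m in \<open>simp_all add: asm_ob_real(1)[OF M] nabla_simps\<close>)
 then show ?thesis using asm_homI[OF nabla_ob[OF S] M, of m] m by simp
qed

text \<open>All points of a constant object share their realizers, so a realizer of the arrow applied to one of them realizes all values at once.\<close>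

lemma common_realizer:
 assumes t: "t \<in> hom AA (fob (Nabla A) S) M"
 obtains c where "c \<in> elts A" "\<And>s. s \<in> S ==> c \<in> snd M (fn t s)"
proof -
 obtain r where r: "r \<in> elts A" "\<forall>s\<in>S. realizes A r (elts A) (snd M (fn t s))"
  using fn_tracked[OF t] unfolding tracked_def by (auto simp: nabla_simps)
 obtain a where a: "a \<in> elts A" using elts_nonempty by blast
 show thesis
 proof (cases "S = {}")
  case True then show thesis using that a by blast
 next
  case False
  then obtain s0 where "s0 \<in> S" by blast
  then obtain c where c: "app A r a = Some c" using r a unfolding realizes_def by blast
  have "c \<in> snd M (fn t s)" if "s \<in> S" for s
   using r(2) that a c unfolding realizes_def by fastforce
  then show thesis using that app_closed[OF c r(1) a] by blast
 qed
qed

text \<open>A cover of a constant object lifts realizers uniformly; applied to one fixed realizer this yields one realizer for some point of each fibre, and the axiom of choice collects such points to a section.\<close>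

lemma nabla_projective:
 assumes S: "small TYPE('u) S"
 shows "rprojective (fob (Nabla A) S)"
 unfolding rprojective_def
proof (intro conjI allI impI)
 show "fob (Nabla A) S \<in> ob AA" by (rule nabla_ob[OF S])
 fix e V assume "regular_epi AA e \<and> e \<in> hom AA V (fob (Nabla A) S)"
 then have re: "regular_epi AA e" and e: "e \<in> hom AA V (fob (Nabla A) S)" by auto
 have V: "V \<in> ob AA" using asm_hom_ob(1)[OF e] .
 obtain r where r: "r \<in> elts A" "\<forall>s\<in>S. realizes A r (elts A) (im V e s)"
  using regular_epiD[OF e re] unfolding tracked_def by (auto simp: nabla_simps)
 obtain a where a: "a \<in> elts A" using elts_nonempty by blast
 define c where "c = the (app A r a)"
 have c: "c \<in> im V e s" if "s \<in> S" for s using r(2) that a unfolding realizes_def c_def by fastforce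
 have "\<exists>v. v \<in> fst V \<and> fn e v = s \<and> c \<in> snd V v" if "s \<in> S" for s using c[OF that] unfolding im_def by blast
 then obtain \<sigma> where \<sigma>: "\<And>s. s \<in> S ==> \<sigma> s \<in> fst V \<and> fn e (\<sigma> s) = s \<and> c \<in> snd V (\<sigma> s)" by metis
 have "(fob (Nabla A) S, restrict \<sigma> S, V) \<in> hom AA (fob (Nabla A) S) V"
 proof (cases "S = {}")
  case True then show ?thesis using uniform_family[OF V S, of \<sigma> a] a by simp
 next
  case False
  then have "c \<in> elts A" using c im_closed[OF V] closed_elts by blast
  then show ?thesis using uniform_family[OF V S, of \<sigma> c] \<sigma> by blast
 qed
 moreover have "comp AA e (fob (Nabla A) S, restrict \<sigma> S, V) = ident AA (fob (Nabla A) S)"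
  by (rule asm_eqI[OF asm_comp_hom[OF calculation e] ident_hom[OF category_Asm nabla_ob[OF S]]])
   (use fn_comp[OF calculation e] \<sigma> in \<open>simp add: asm_ident\<close>)
 ultimately show "\<exists>s\<in>hom AA (fob (Nabla A) S) V. comp AA e s = ident AA (fob (Nabla A) S)" by blast
qed

lemma nab_ob_eq: "fob (nab A) S = y (fob (Nabla A) S)"
 by (simp add: embedding_simps)

lemma nab_arrow_named:
 fixes S :: "'u set"
 assumes S: "small TYPE('u) S" and F: "F \<in> hom (RT A) (fob (nab A) S) P"
 obtains t where "t \<in> hom AA (fob (Nabla A) S) (fst P)" "F = name P t"
 using projective_arrow_named[OF nabla_projective[OF S]] F unfolding RT_def nab_ob_eq by blast

text \<open>The embedding is full on arrows from constant objects, because these are projective.\<close>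

lemma nabla_arrow_embedded:
 fixes S :: "'u set"
 assumes S: "small TYPE('u) S" and F: "F \<in> hom (RT A) (fob (nab A) S) (fob (ex_reg_embedding AA) M)" and M: "M \<in> ob AA"
 obtains t where "t \<in> hom AA (fob (Nabla A) S) M" "F = far (ex_reg_embedding AA) t"
proof -
 obtain t where t: "t \<in> hom AA (fob (Nabla A) S) M" "F = name (y M) t"
  using nab_arrow_named[OF S F] unfolding embedding_simps fst_conv by blast
 then show thesis using that name_diag by simp
qed

text \<open>
 Points of an object of the realizability topos can be coloured by realizers, in such a way that
 points of the same colour form an arrow from a constant object.
\<close>

lemma colouring:
 assumes P: "P \<in> ob RTA"
 obtains col where "\<And>F. F \<in> hom (RT A) (fob (nab A) pt) P ==> col F \<in> elts A"
  "\<And>S F c. small TYPE('u) S ==> (\<And>s. s \<in> S ==> F s \<in> hom (RT A) (fob (nab A) pt) P) ==> (\<And>s. s \<in> S ==> col (F s) = c) ==>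
    \<exists>\<Xi> \<in> hom (RT A) (fob (nab A) S) P. \<forall>s\<in>S. comp (RT A) \<Xi> (far (nab A) (elem S s)) = F s"
proof -
 have P': "P \<in> ob (ex_reg AA)" using P by (simp add: RT_def)
 have M: "fst P \<in> ob AA" using P' by (simp add: ex_reg_ob)
 have un: "undefined \<in> pt" by (simp add: pt_def)
 have "\<exists>t c. t \<in> hom AA (fob (Nabla A) pt) (fst P) \<and> F = name P t \<and> c \<in> elts A \<and> c \<in> snd (fst P) (fn t undefined)"
  if F: "F \<in> hom (RT A) (fob (nab A) pt) P" for F
 proof -
  obtain t where t: "t \<in> hom AA (fob (Nabla A) pt) (fst P)" "F = name P t"
   by (rule nab_arrow_named[OF small_pt F]) (rule that)
  obtain c where "c \<in> elts A" "\<And>s. s \<in> pt ==> c \<in> snd (fst P) (fn t s)" by (rule common_realizer[OF t(1)]) (rule that)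
  then show ?thesis using t un by blast
 qed
 then obtain t col where tc: "\<And>F. F \<in> hom (RT A) (fob (nab A) pt) P ==>
   t F \<in> hom AA (fob (Nabla A) pt) (fst P) \<and> F = name P (t F) \<and> col F \<in> elts A \<and> col F \<in> snd (fst P) (fn (t F) undefined)"
  by metis
 show thesis
 proof (rule that[of col])
  show "col F \<in> elts A" if "F \<in> hom (RT A) (fob (nab A) pt) P" for F using tc[OF that] by blast
  fix S :: "'u set" and F c
  assume S: "small TYPE('u) S" and F: "\<And>s. s \<in> S ==> F s \<in> hom (RT A) (fob (nab A) pt) P" and c: "\<And>s. s \<in> S ==> col (F s) = c"
  define m where "m s = fn (t (F s)) undefined" for s
  have m: "m s \<in> fst (fst P)" if "s \<in> S" for s
  proof -
   have "t (F s) \<in> hom AA (fob (Nabla A) pt) (fst P)" using tc[OF F[OF that]] by blast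
   from fn_mem[OF this] show ?thesis using un by (simp add: m_def)
  qed
  have cm: "c \<in> elts A \<and> c \<in> snd (fst P) (m s)" if "s \<in> S" for s using tc[OF F[OF that]] c[OF that] by (simp add: m_def)
  define T where "T = (fob (Nabla A) S, restrict m S, fst P)"
  have T: "T \<in> hom AA (fob (Nabla A) S) (fst P)"
  proof (cases "S = {}")
   case True
   obtain a where "a \<in> elts A" using elts_nonempty by blast
   then show ?thesis using uniform_family[OF M S, of m a] True by (simp add: T_def)
  next
   case False
   then show ?thesis using uniform_family[OF M S, of m c] m cm unfolding T_def by blast
  qed
  have "comp (RT A) (name P T) (far (nab A) (elem S s)) = F s" if s: "s \<in> S" for s
  proof -
   note e = nabla_hom[OF elem_hom[OF S s]]
   have ts: "t (F s) \<in> hom AA (fob (Nabla A) pt) (fst P)" "F s = name P (t (F s))" using tc[OF F[OF s]] by blast+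
   have "comp AA T (far (Nabla A) (elem S s)) = t (F s)"
   proof (rule asm_eqI[OF asm_comp_hom[OF e T] ts(1)])
    fix x :: 'u assume "x \<in> fst (fob (Nabla A) pt)"
    then have x: "x = undefined" "x \<in> fst (fob (Nabla A) pt)" by (simp_all add: pt_def)
    have "fn (far (Nabla A) (elem S s)) undefined = s"
     unfolding nabla_far[OF elem_hom[OF S s]] by (simp add: elem_def un)
    then show "fn (comp AA T (far (Nabla A) (elem S s))) x = fn (t (F s)) x"
     using fn_comp[OF e T x(2)] x(1) s by (simp add: T_def m_def)
   qed
   then show ?thesis using name_precomp[OF P' T e] ts(2) by (simp add: RT_def)
  qed
  moreover have "name P T \<in> hom (RT A) (fob (nab A) S) P" using name_hom[OF P' T] by (simp add: RT_def embedding_simps)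
  ultimately show "\<exists>\<Xi> \<in> hom (RT A) (fob (nab A) S) P. \<forall>s\<in>S. comp (RT A) \<Xi> (far (nab A) (elem S s)) = F s" by blast
 qed
qed

lemma nabla_lift_extremal:
 fixes S :: "'u set"
 assumes "small TYPE('u) S" "G \<in> hom (RT A) P Q" "extremal (RT A) G" "T \<in> hom (RT A) (fob (nab A) S) Q"
 obtains w where "w \<in> hom (RT A) (fob (nab A) S) P" "comp (RT A) G w = T"
 using projective_lift_extremal[OF nabla_projective[OF assms(1)], of G P Q T] assms(2-4) that
 unfolding RT_def nab_ob_eq by blast

lemma nabla_pt_terminal: "is_terminal AA (fob (Nabla A) pt)"
 unfolding is_terminal_def
proof (intro conjI ballI)
 show T: "fob (Nabla A) pt \<in> ob AA" by (rule nabla_ob[OF small_pt])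
 fix X assume X: "X \<in> ob AA"
 have "(X, restrict (\<lambda>_. undefined) (fst X), fob (Nabla A) pt) \<in> hom AA X (fob (Nabla A) pt)"
 proof (rule asm_homI[OF X T])
  show "undefined \<in> fst (fob (Nabla A) pt)" by (simp add: pt_def)
  show "tracked A (fst X) (snd X) (\<lambda>x. snd (fob (Nabla A) pt) undefined)"
   by (rule tracked_incl) (simp_all add: nabla_simps pt_def asm_ob_real(3)[OF X] closed_elts_all)
 qed
 moreover have "f = g" if "f \<in> hom AA X (fob (Nabla A) pt)" "g \<in> hom AA X (fob (Nabla A) pt)" for f g
  using asm_eqI[OF that] fn_mem[OF that(1)] fn_mem[OF that(2)] by (simp add: pt_def)
 ultimately show "\<exists>!f. f \<in> hom AA X (fob (Nabla A) pt)" by blast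
qed

text \<open>The graph of the map to the terminal assembly is a functional relation on every object.\<close>

lemma to_point:
 assumes P: "P \<in> ob RTA"
 shows "\<exists>F. F \<in> hom (RT A) P (fob (nab A) pt)"
proof -
 let ?T = "fob (Nabla A) pt"
 have P': "P \<in> ob (ex_reg AA)" using P by (simp add: RT_def)
 have X: "fst P \<in> ob AA" and R: "internal_equiv AA (fst P) (snd P)" using P' by (auto simp: ex_reg_ob)
 note T = nabla_pt_terminal
 obtain b where b: "b \<in> hom AA (fst P) ?T" using terminal_hom[OF T X] .
 have db: "dom AA b = fst P" using b by (simp add: hom_def[of AA])
 note r = equiv_rel[OF R]
 have bf: "comp AA b f = g" if "f \<in> hom AA V (fst P)" "g \<in> hom AA V ?T" for f g V
  using terminal_eq[OF T category_Asm asm_comp_hom[OF that(1) b] that(2)] .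
 have g: "gr b \<in> relations AA (fst P) ?T" using graph_relation[OF category_Asm b] db by simp
 have grI: "(f, h) \<in> gr b" if "f \<in> hom AA V (fst P)" "h \<in> hom AA V ?T" for f h V
 proof -
  have "(f, comp AA b f) \<in> gr b" using that(1) db by (auto simp: hom_def[of AA] simp del: split_paired_Ex)
  then show ?thesis using bf[OF that] by simp
 qed
 note e = embedding_hom[OF b]
 then have fe: "functional_relation AA (y (fst P)) (y ?T) (gr b)" by (auto simp: ex_reg_hom)
 have f2: "rel_comp AA (gr b) (\<Delta> ?T) = gr b" and f4: "rel_comp AA ((gr b)\<inverse>) (gr b) \<subseteq> \<Delta> ?T"
  using fe by (auto simp: functional_relation_iff)
 have f1: "rel_comp AA (snd P) (gr b) = gr b"
 proof (intro equalityI subrelI)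
  fix f h assume fh: "(f, h) \<in> rel_comp AA (snd P) (gr b)"
  obtain V where "f \<in> hom AA V (fst P)" "h \<in> hom AA V ?T" using rel_comp_hom[OF r(1) g fh] .
  then show "(f, h) \<in> gr b" by (rule grI)
 next
  fix f h assume fh: "(f, h) \<in> gr b"
  obtain V where V: "f \<in> hom AA V (fst P)" "h \<in> hom AA V ?T" using relation_hom[OF category_Asm g fh] .
  show "(f, h) \<in> rel_comp AA (snd P) (gr b)" using rel_comp_simpleI[OF category_Asm V r(4)[OF V(1)] fh] .
 qed
 have f3: "snd P \<subseteq> rel_comp AA (gr b) ((gr b)\<inverse>)"
 proof (rule subrelI)
  fix f h assume fh: "(f, h) \<in> snd P"
  obtain V where V: "f \<in> hom AA V (fst P)" "h \<in> hom AA V (fst P)" using relation_hom[OF category_Asm r(1) fh] .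
  note bV = asm_comp_hom[OF V(1) b]
  show "(f, h) \<in> rel_comp AA (gr b) ((gr b)\<inverse>)"
   by (rule rel_comp_simpleI[OF category_Asm V grI[OF V(1) bV] converseI[OF grI[OF V(2) bV]]])
 qed
 have "(P, gr b, y ?T) \<in> hom (ex_reg AA) P (y ?T)"
 proof -
  have "y ?T \<in> ob (ex_reg AA)" using e unfolding ex_reg_hom by blast
  moreover have "functional_relation AA P (y ?T) (gr b)"
   unfolding functional_relation_iff fst_conv snd_conv by (intro conjI g f1 f2 f3 f4)
  ultimately show ?thesis using P' unfolding ex_reg_hom by blast
 qed
 then show ?thesis unfolding RT_def nab_ob_eq by blast
qed

subsection \<open>Underlying sets\<close>

lemma Gamma_rel_diag: "Gamma_rel (\<Delta> M) = {(x, x) | x. x \<in> fst M}" if M: "M \<in> ob AA"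
proof (intro equalityI subrelI)
 fix x z assume "(x, z) \<in> Gamma_rel (\<Delta> M)"
 then obtain P Q Q' f g w where *: "x = f w" "z = g w" "((P, f, Q), (P, g, Q')) \<in> \<Delta> M" "w \<in> fst P"
  unfolding Gamma_rel_def by blast
 then have fM: "(P, f, Q) \<in> arr AA" "cod AA (P, f, Q) = M" "f = g" by auto
 have dP: "dom AA (P, f, Q) = P" by (simp add: Asm_def concrete_cat_def)
 have "(P, f, Q) \<in> hom AA P M" using fM dP by (simp add: hom_def[of AA])
 from fn_mem[OF this *(4)] show "(x, z) \<in> {(x, x) | x. x \<in> fst M}" using * fM by simp
next
 fix x z assume "(x, z) \<in> {(x, x) | x. x \<in> fst M}"
 then have x: "x = z" "x \<in> fst M" by auto
 have i: "ident AA M \<in> arr AA" "cod AA (ident AA M) = M" using ident_hom[OF category_Asm M] by (auto simp: hom_def[of AA])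
 then have "((M, \<lambda>x\<in>fst M. x, M), (M, \<lambda>x\<in>fst M. x, M)) \<in> \<Delta> M" unfolding asm_ident by blast
 moreover have "x = (\<lambda>x\<in>fst M. x) x" "z = (\<lambda>x\<in>fst M. x) x" using x by auto
 ultimately show "(x, z) \<in> Gamma_rel (\<Delta> M)" unfolding Gamma_rel_def using x(2) by blast
qed

lemma Gamma_repr_diag: "M \<in> ob AA ==> x \<in> fst M ==> Gamma_repr (y M) x = x"
 unfolding Gamma_repr_def snd_conv Gamma_rel_diag by simp

lemma Gamma_repr_image: "Gamma_repr (y M) ` fst M = fst M" if M: "M \<in> ob AA"
proof -
 have "Gamma_repr (y M) ` fst M = (\<lambda>x. x) ` fst M" by (rule image_cong[OF refl]) (rule Gamma_repr_diag[OF M])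
 then show ?thesis by (simp only: image_ident)
qed

lemma Gamma_hat_simps:
 "fob Gamma_hat P = Gamma_repr P ` fst (fst P)"
 "far Gamma_hat (P, F, Q) = (Gamma_repr P ` fst (fst P),
   \<lambda>x\<in>Gamma_repr P ` fst (fst P). Gamma_repr Q (SOME y. (x, y) \<in> Gamma_rel F), Gamma_repr Q ` fst (fst Q))"
 by (simp_all add: Gamma_hat_def Let_def Gamma_def)

lemma Gamma_hat_ob: "M \<in> ob AA ==> fob Gamma_hat (fob (ex_reg_embedding AA) M) = fst M"
 unfolding embedding_simps Gamma_hat_simps fst_conv by (rule Gamma_repr_image)

lemma Gamma_hat_ar:
 assumes t: "t \<in> hom AA M M'"
 shows "far Gamma_hat (far (ex_reg_embedding AA) t) = (fst M, fn t, fst M')"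
proof -
 have M: "M \<in> ob AA" and M': "M' \<in> ob AA" using asm_hom_ob t by blast+
 have dt: "dom AA t = M" "cod AA t = M'" using t by (auto simp: hom_def[of AA])
 have rel: "(x, z) \<in> Gamma_rel (gr t) \<longleftrightarrow> z = fn t x" if x: "x \<in> fst M" for x z
 proof
  assume "(x, z) \<in> Gamma_rel (gr t)"
  then obtain P Q Q' f g w where *: "x = f w" "z = g w" "((P, f, Q), (P, g, Q')) \<in> gr t" "w \<in> fst P"
   unfolding Gamma_rel_def by blast
  then have fM: "(P, f, Q) \<in> arr AA" "cod AA (P, f, Q) = M" "(P, g, Q') = comp AA t (P, f, Q)" using dt by auto
  have dP: "dom AA (P, f, Q) = P" by (simp add: Asm_def concrete_cat_def)
  have h: "(P, f, Q) \<in> hom AA P M" using fM dP by (simp add: hom_def[of AA])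
  show "z = fn t x" using fn_comp[OF h t *(4)] * fM(3)[symmetric] by simp
 next
  assume z: "z = fn t x"
  have i: "ident AA M \<in> hom AA M M" using ident_hom[OF category_Asm M] .
  have ti: "comp AA t (ident AA M) = t" using comp_ident(1)[OF category_Asm t] .
  have "t = (M, fn t, M')" using t unfolding asm_hom_iff by blast
  then have "((M, \<lambda>x\<in>fst M. x, M), (M, fn t, M')) \<in> gr t"
  proof -
   have "\<exists>g. (M, \<lambda>x\<in>fst M. x, M) = g \<and> (M, fn t, M') = comp AA t g \<and> g \<in> arr AA \<and> cod AA g = dom AA t"
    using i ti dt \<open>t = (M, fn t, M')\<close> unfolding asm_ident hom_def[of AA] by (metis (mono_tags, lifting) mem_Collect_eq)
   then show ?thesis by blast
  qed
  moreover have "x = (\<lambda>x\<in>fst M. x) x" using x by auto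
  ultimately show "(x, z) \<in> Gamma_rel (gr t)" unfolding Gamma_rel_def using x z by blast
 qed
 have ft: "fn t \<in> fst M \<rightarrow>\<^sub>E fst M'" using t unfolding asm_hom_iff by blast
 have "(\<lambda>x\<in>fst M. Gamma_repr (y M') (SOME z. (x, z) \<in> Gamma_rel (gr t))) = fn t"
 proof (rule PiE_ext[OF _ ft])
  show "(\<lambda>x\<in>fst M. Gamma_repr (y M') (SOME z. (x, z) \<in> Gamma_rel (gr t))) \<in> fst M \<rightarrow>\<^sub>E fst M'"
   using rel Gamma_repr_diag[OF M'] fn_mem[OF t] by simp
  show "(\<lambda>x\<in>fst M. Gamma_repr (y M') (SOME z. (x, z) \<in> Gamma_rel (gr t))) x = fn t x" if "x \<in> fst M" for x
   using rel Gamma_repr_diag[OF M'] fn_mem[OF t that] that by simp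
 qed
 then show ?thesis unfolding embedding_simps dt Gamma_hat_simps fst_conv Gamma_repr_image[OF M] Gamma_repr_image[OF M'] by simp
qed

lemma Gamma_nab_ob: "small TYPE('u) S ==> fob Gamma_hat (fob (nab A) S) = S" for S :: "'u set"
 using Gamma_hat_ob[OF nabla_ob] by simp

lemma Gamma_nab_ar:
 fixes F :: "'u set_arr"
 assumes F: "F \<in> hom Set_cat X Y"
 shows "far Gamma_hat (far (nab A) F) = F"
proof -
 have "F = (X, fn F, Y)" using F unfolding set_hom_iff by blast
 then show ?thesis using Gamma_hat_ar[OF nabla_hom[OF F]] nabla_far[OF F] by simp
qed

text \<open>The composite of \<open>nab A\<close> and \<open>Gamma_hat\<close> is the identity, so the counit at \<open>S\<close> is a function from \<open>S\<close> to itself; by naturality with respect to the elements of \<open>S\<close> it fixes all of them.\<close>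

lemma Gamma_counit_iso:
 assumes adj: "adjunction RTA Set_cat Gamma_hat (nab A) \<eta> \<epsilon>" and S: "S \<in> ob Set_cat"
 shows "iso_arr Set_cat (\<epsilon> S)"
proof -
 interpret adjunction "RT A" Set_cat Gamma_hat "nab A" \<eta> \<epsilon> by (rule adj)
 have sS: "small TYPE('u) S" using S by (simp add: set_ob_iff)
 have eps: "\<epsilon> X \<in> hom Set_cat X X" if "small TYPE('u) X" for X using eps_hom[of X] that Gamma_nab_ob[OF that] by (simp add: set_ob_iff)
 have "fn (\<epsilon> S) s = s" if s: "s \<in> S" for s
 proof -
  note e = elem_hom[OF sS s]
  have "comp Set_cat (\<epsilon> S) (elem S s) = comp Set_cat (elem S s) (\<epsilon> pt)"
   using eps_nat[OF e] unfolding Gamma_nab_ar[OF e] .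
  then have "fn (\<epsilon> S) s = fn (comp Set_cat (elem S s) (\<epsilon> pt)) undefined"
   unfolding elem_comp[OF eps[OF sS] s] by (metis elem_def fst_conv insertI1 pt_def restrict_apply' snd_conv)
  also have "\<dots> = s" unfolding set_comp_eq[OF eps[OF small_pt] e]
   using set_fn_mem[OF eps[OF small_pt], of undefined] by (simp add: elem_def pt_def)
  finally show ?thesis .
 qed
 then have "\<epsilon> S = ident Set_cat S"
  by (intro set_eqI[OF eps[OF sS] ident_hom[OF category_Set S]]) (simp add: set_ident)
 then show ?thesis using iso_ident[OF category_Set S] by simp
qed

subsection \<open>Sizes\<close>

text \<open>An assembly is determined by its underlying set and by the set of coded pairs of an element and a realizer of it, both of them small.\<close>

lemma classlike_Asm:
 assumes A: "sm (elts A)"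
 shows "classlike (ob AA)" "classlike (arr AA)"
proof -
 obtain c :: "'a => 'u" where c: "inj_on c (elts A)" using coding[OF A] .
 let ?V = "{X :: 'u set. sm X}"
 define gE where "gE P = (\<lambda>(x, a). upair x (c a)) ` (SIGMA x:fst P. snd P x)" for P :: "('u, 'a) asm"
 have sub: "(SIGMA x:fst P. snd P x) \<subseteq> fst P \<times> elts A" if "P \<in> ob AA" for P using asm_ob_real(3)[OF that] by auto
 have "inj_on (\<lambda>P. (fst P, gE P)) (ob AA)"
 proof (rule inj_onI)
  fix P Q assume P: "P \<in> ob AA" and Q: "Q \<in> ob AA" and e: "(fst P, gE P) = (fst Q, gE Q)"
  have *: "snd P' x \<subseteq> snd Q' x" if P': "P' \<in> ob AA" and Q': "Q' \<in> ob AA" and e: "fst P' = fst Q'" "gE P' = gE Q'" and x: "x \<in> fst P'" for P' Q' x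
  proof
   fix a assume a: "a \<in> snd P' x"
   then have "upair x (c a) \<in> gE Q'" using x e(2)[symmetric] by (force simp: gE_def)
   then obtain b where b: "b \<in> snd Q' x" "c a = c b" by (auto simp: gE_def)
   have "a \<in> elts A" "b \<in> elts A" using asm_ob_real(3)[OF P' x] asm_ob_real(3)[OF Q', of x] a b x e by auto
   then show "a \<in> snd Q' x" using b c by (auto simp: inj_on_def)
  qed
  have f: "fst P = fst Q" "gE P = gE Q" using e by auto
  have "snd P \<in> fst P \<rightarrow>\<^sub>E downsets A" "snd Q \<in> fst P \<rightarrow>\<^sub>E downsets A" using P Q f(1) by (auto simp: asm_ob_iff)
  then have "snd P = snd Q"
   by (rule PiE_ext) (use *[OF P Q f] *[OF Q P f[symmetric]] f(1) in blast)
  then show "P = Q" using f(1) by (simp add: prod_eq_iff)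
 qed
 moreover have "(\<lambda>P. (fst P, gE P)) ` ob AA \<subseteq> ?V \<times> ?V"
  using small_image[OF small_subset[OF sub small_Times[OF _ A]]] by (auto simp: gE_def asm_ob_iff)
 ultimately show obA: "classlike (ob AA)"
  by (rule classlike_inj[OF _ _ classlike_Times[OF classlike_small_sets classlike_small_sets]])
 define gf where "gf F = (\<lambda>x. upair x (fn F x)) ` fst (fst F)" for F :: "('u, 'a) asm_arr"
 have "inj_on (\<lambda>F. (fst F, gf F, snd (snd F))) (arr AA)"
 proof (rule inj_onI)
  fix F G assume a: "F \<in> arr AA" "G \<in> arr AA" and e: "(fst F, gf F, snd (snd F)) = (fst G, gf G, snd (snd G))"
  note F = homI[OF a(1)] and G = homI[OF a(2)]
  have d: "dom AA F = fst F" "cod AA F = snd (snd F)" "dom AA G = fst G" "cod AA G = snd (snd G)"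
   by (simp_all add: Asm_def concrete_cat_def case_prod_beta)
  have G': "G \<in> hom AA (dom AA F) (cod AA F)" using G d e by simp
  show "F = G"
  proof (rule asm_eqI[OF F G'])
   fix x assume x: "x \<in> fst (dom AA F)"
   then have "upair x (fn F x) \<in> gf G" using e d by (force simp: gf_def)
   then show "fn F x = fn G x" by (auto simp: gf_def)
  qed
 qed
 moreover have "(\<lambda>F. (fst F, gf F, snd (snd F))) ` arr AA \<subseteq> ob AA \<times> ?V \<times> ob AA"
 proof (rule image_subsetI)
  fix F assume "F \<in> arr AA"
  then have "fst F \<in> ob AA" "snd (snd F) \<in> ob AA" by (auto simp: Asm_def concrete_cat_def)
  moreover have "sm (gf F)" using calculation(1) by (simp add: gf_def asm_ob_iff small_image)
  ultimately show "(fst F, gf F, snd (snd F)) \<in> ob AA \<times> ?V \<times> ob AA" by blast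
 qed
 ultimately show "classlike (arr AA)"
  by (rule classlike_inj[OF _ _ classlike_Times[OF obA classlike_Times[OF classlike_small_sets obA]]])
qed

text \<open>Relations are represented by spans of arrows between assemblies.\<close>

lemma classlike_RT:
 assumes A: "sm (elts A)"
 shows "classlike (ob RTA)" "classlike (arr RTA)"
proof -
 note c = classlike_Asm[OF A]
 have rel: "\<exists>a\<in>arr AA. \<exists>b\<in>arr AA. R = span_relation AA a b" if "R \<in> relations AA X Y" for R X Y
  using that unfolding relations_def jointly_monic_def by blast
 have "ob (ex_reg AA) \<subseteq> (\<lambda>(P, a, b). (P, span_relation AA a b)) ` (ob AA \<times> arr AA \<times> arr AA)"
 proof
  fix P assume "P \<in> ob (ex_reg AA)"
  then have P: "fst P \<in> ob AA" "snd P \<in> relations AA (fst P) (fst P)" by (auto simp: ex_reg_ob internal_equiv_def)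
  obtain a b where "a \<in> arr AA" "b \<in> arr AA" "snd P = span_relation AA a b" using rel[OF P(2)] by blast
  then have "P = (\<lambda>(P, a, b). (P, span_relation AA a b)) (fst P, a, b)" "(fst P, a, b) \<in> ob AA \<times> arr AA \<times> arr AA"
   using P(1) by (simp_all add: prod_eq_iff)
  then show "P \<in> (\<lambda>(P, a, b). (P, span_relation AA a b)) ` (ob AA \<times> arr AA \<times> arr AA)"
   by (rule image_eqI)
 qed
 then have ob: "classlike (ob (ex_reg AA))"
  by (rule classlike_subset_image[OF _ classlike_Times[OF c(1) classlike_Times[OF c(2) c(2)]]])
 have "arr (ex_reg AA) \<subseteq> (\<lambda>(P, a, b, Q). (P, span_relation AA a b, Q)) ` (ob (ex_reg AA) \<times> arr AA \<times> arr AA \<times> ob (ex_reg AA))"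
 proof
  fix F assume "F \<in> arr (ex_reg AA)"
  from homI[OF this] obtain P Q F' where F: "F = (P, F', Q)" "P \<in> ob (ex_reg AA)" "Q \<in> ob (ex_reg AA)" "functional_relation AA P Q F'"
   unfolding ex_reg_hom by blast
  obtain a b where "a \<in> arr AA" "b \<in> arr AA" "F' = span_relation AA a b" using rel[OF functional_rel[OF F(4)]] by blast
  then have "F = (\<lambda>(P, a, b, Q). (P, span_relation AA a b, Q)) (P, a, b, Q)" "(P, a, b, Q) \<in> ob (ex_reg AA) \<times> arr AA \<times> arr AA \<times> ob (ex_reg AA)"
   using F by simp_all
  then show "F \<in> (\<lambda>(P, a, b, Q). (P, span_relation AA a b, Q)) ` (ob (ex_reg AA) \<times> arr AA \<times> arr AA \<times> ob (ex_reg AA))"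
   by (rule image_eqI)
 qed
 then have "classlike (arr (ex_reg AA))"
  by (rule classlike_subset_image[OF _ classlike_Times[OF ob classlike_Times[OF c(2) classlike_Times[OF c(2) ob]]]])
 then show "classlike (ob RTA)" "classlike (arr RTA)"
  using ob by (simp_all add: RT_def)
qed

end

lemma (in universe) classlike_Set_arr: "classlike (arr (Set_cat :: ('u set, 'u set_arr) cat))"
proof -
 let ?V = "{X :: 'u set. sm X}"
 define gf where "gf F = (\<lambda>x. upair x (fn F x)) ` fst F" for F :: "'u set_arr"
 have "inj_on (\<lambda>F. (fst F, gf F, snd (snd F))) (arr (Set_cat :: ('u set, 'u set_arr) cat))"
 proof (rule inj_onI)
  fix F G :: "'u set_arr" assume a: "F \<in> arr Set_cat" "G \<in> arr Set_cat" and e: "(fst F, gf F, snd (snd F)) = (fst G, gf G, snd (snd G))"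
  note F = homI[OF a(1)] and G = homI[OF a(2)]
  have d: "dom Set_cat F = fst F" "cod Set_cat F = snd (snd F)" "dom Set_cat G = fst G" "cod Set_cat G = snd (snd G)"
   by (simp_all add: Set_cat_def concrete_cat_def case_prod_beta)
  have G': "G \<in> hom Set_cat (dom Set_cat F) (cod Set_cat F)" using G d e by simp
  show "F = G"
  proof (rule set_eqI[OF F G'])
   fix x assume x: "x \<in> dom Set_cat F"
   then have "upair x (fn F x) \<in> gf G" using e d by (force simp: gf_def)
   then show "fn F x = fn G x" by (auto simp: gf_def)
  qed
 qed
 moreover have "(\<lambda>F. (fst F, gf F, snd (snd F))) ` arr Set_cat \<subseteq> ?V \<times> ?V \<times> ?V"
 proof (rule image_subsetI)
  fix F :: "'u set_arr" assume "F \<in> arr Set_cat"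
  then have "sm (fst F)" "sm (snd (snd F))" by (auto simp: Set_cat_def concrete_cat_def small_TYPE')
  moreover have "sm (gf F)" using calculation(1) by (simp add: gf_def small_image)
  ultimately show "(fst F, gf F, snd (snd F)) \<in> ?V \<times> ?V \<times> ?V" by blast
 qed
 ultimately show ?thesis
  by (rule classlike_inj[OF _ _ classlike_Times[OF classlike_small_sets classlike_Times[OF classlike_small_sets classlike_small_sets]]])
qed

section \<open>Projectivity of constant objects in the glued category\<close>

subsection \<open>Equivalences\<close>

lemma iso_left_cancel:
 assumes K: "category K" and i: "iso_arr K i" "i \<in> hom K Y Z" and f: "f \<in> hom K X Y" and g: "g \<in> hom K X Y" and e: "i o[K] f = i o[K] g"
 shows "f = g"
proof -
 obtain j where j: "j \<in> hom K Z Y" "j o[K] i = ident K Y" "i o[K] j = ident K Z" by (rule iso_arrE[OF i])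
 show ?thesis using cancel_left[OF K i(2) j(1,2) f] cancel_left[OF K i(2) j(1,2) g] e by metis
qed

lemma iso_right_cancel:
 assumes K: "category K" and i: "iso_arr K i" "i \<in> hom K X Y" and f: "f \<in> hom K Y Z" and g: "g \<in> hom K Y Z" and e: "f o[K] i = g o[K] i"
 shows "f = g"
proof -
 obtain j where j: "j \<in> hom K Y X" "j o[K] i = ident K X" "i o[K] j = ident K Y" by (rule iso_arrE[OF i])
 show ?thesis using cancel_right[OF K j(1) i(2) j(3) f] cancel_right[OF K j(1) i(2) j(3) g] e by metis
qed

text \<open>No triangle identities are assumed between \<open>\<eta>\<close> and \<open>\<epsilon>\<close>; naturality and invertibility suffice for what follows.\<close>

locale equivalence =
 fixes C :: "('o, 'm) cat" and D :: "('p, 'n) cat" and F G \<eta> \<epsilon>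
 assumes C: "category C" and D: "category D" and F: "is_functor C D F" and G: "is_functor D C G"
  and eta: "nat_iso C C id_func (comp_func G F) \<eta>" and eps: "nat_iso D D (comp_func F G) id_func \<epsilon>"
begin

lemma eta_hom: "X \<in> ob C ==> \<eta> X \<in> hom C X (fob G (fob F X))" and eta_iso: "X \<in> ob C ==> iso_arr C (\<eta> X)"
 using eta by (simp_all add: nat_iso_def nat_trans_def)

lemma eps_hom: "Y \<in> ob D ==> \<epsilon> Y \<in> hom D (fob F (fob G Y)) Y" and eps_iso: "Y \<in> ob D ==> iso_arr D (\<epsilon> Y)"
 using eps by (simp_all add: nat_iso_def nat_trans_def)

lemma eta_nat: "f \<in> hom C X Y ==> \<eta> Y o[C] f = far G (far F f) o[C] \<eta> X"
 using eta by (auto simp: nat_iso_def nat_trans_def hom_def)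

lemma eps_nat: "f \<in> hom D X Y ==> \<epsilon> Y o[D] far F (far G f) = f o[D] \<epsilon> X"
 using eps by (auto simp: nat_iso_def nat_trans_def hom_def)

lemma faithful:
 assumes f: "f \<in> hom C X Y" and g: "g \<in> hom C X Y" and e: "far F f = far F g"
 shows "f = g"
proof -
 have Y: "Y \<in> ob C" using category_ob[OF C f] by simp
 show ?thesis by (rule iso_left_cancel[OF C eta_iso[OF Y] eta_hom[OF Y] f g]) (simp add: eta_nat[OF f] eta_nat[OF g] e)
qed

lemma inverse_faithful:
 assumes f: "f \<in> hom D X Y" and g: "g \<in> hom D X Y" and e: "far G f = far G g"
 shows "f = g"
proof -
 have X: "X \<in> ob D" using category_ob[OF D f] by simp
 show ?thesis by (rule iso_right_cancel[OF D eps_iso[OF X] eps_hom[OF X] f g]) (simp add: eps_nat[OF f, symmetric] eps_nat[OF g, symmetric] e)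
qed

lemma terminal:
 assumes t: "is_terminal C t"
 shows "is_terminal D (fob F t)"
 unfolding is_terminal_def
proof (intro conjI ballI)
 have tC: "t \<in> ob C" using t by (simp add: is_terminal_def)
 show "fob F t \<in> ob D" by (rule functor_ob[OF F tC])
 fix X assume X: "X \<in> ob D"
 obtain f where f: "f \<in> hom C (fob G X) t" using terminal_hom[OF t functor_ob[OF G X]] .
 obtain e where e: "e \<in> hom D X (fob F (fob G X))" using iso_arrE[OF eps_iso[OF X] eps_hom[OF X]] by metis
 have "is_terminal C (fob G (fob F t))" by (rule terminal_transfer[OF C t eta_hom[OF tC] eta_iso[OF tC]])
 then have "g = h" if "g \<in> hom D X (fob F t)" "h \<in> hom D X (fob F t)" for g h
  using inverse_faithful[OF that] terminal_eq[OF _ C functor_hom[OF G that(1)] functor_hom[OF G that(2)]] by blast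
 then show "\<exists>!g. g \<in> hom D X (fob F t)" using comp_hom[OF D e functor_hom[OF F f]] by blast
qed

lemma extremal:
 assumes x: "extremal C x" "x \<in> hom C X N"
 shows "extremal D (far F x)"
proof (rule extremalI[OF functor_hom[OF F x(2)]])
 fix m J g assume m: "monic D m" "m \<in> hom D J (fob F N)" and g: "g \<in> hom D (fob F X) J" and mg: "m o[D] g = far F x"
 have X: "X \<in> ob C" and N: "N \<in> ob C" using category_ob[OF C x(2)] by auto
 have J: "J \<in> ob D" and FN: "fob F N \<in> ob D" using category_ob[OF D m(2)] by auto
 note eN = eta_hom[OF N] and eX = eta_hom[OF X] and Gm = functor_hom[OF G m(2)] and Gg = functor_hom[OF G g]
 obtain i where i: "i \<in> hom C (fob G (fob F N)) N" "i o[C] \<eta> N = ident C N" "\<eta> N o[C] i = ident C (fob G (fob F N))"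
  by (rule iso_arrE[OF eta_iso[OF N] eN])
 have im: "i o[C] far G m \<in> hom C (fob G J) N" by (rule comp_hom[OF C Gm i(1)])
 have mono: "monic C (i o[C] far G m)"
 proof -
  have "f = h" if f: "f \<in> hom C Z (fob G J)" and h: "h \<in> hom C Z (fob G J)" and e: "(i o[C] far G m) o[C] f = (i o[C] far G m) o[C] h" for f h Z
  proof -
   note Ff = functor_hom[OF F f] and Fh = functor_hom[OF F h]
   have "i o[C] (far G m o[C] f) = i o[C] (far G m o[C] h)"
    using e comp_assoc[OF C f Gm i(1)] comp_assoc[OF C h Gm i(1)] by simp
   then have "far G m o[C] f = far G m o[C] h"
    using iso_left_cancel[OF C iso_inverse[OF eN i] i(1) comp_hom[OF C f Gm] comp_hom[OF C h Gm]] by blast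
   then have "far F (far G m) o[D] far F f = far F (far G m) o[D] far F h"
    using functor_comp[OF F f Gm] functor_comp[OF F h Gm] by simp
   then have "\<epsilon> (fob F N) o[D] (far F (far G m) o[D] far F f) = \<epsilon> (fob F N) o[D] (far F (far G m) o[D] far F h)" by simp
   then have "(m o[D] \<epsilon> J) o[D] far F f = (m o[D] \<epsilon> J) o[D] far F h"
    using comp_assoc[OF D Ff functor_hom[OF F Gm] eps_hom[OF FN]] comp_assoc[OF D Fh functor_hom[OF F Gm] eps_hom[OF FN]]
     eps_nat[OF m(2)] by simp
   then have "m o[D] (\<epsilon> J o[D] far F f) = m o[D] (\<epsilon> J o[D] far F h)"
    using comp_assoc[OF D Ff eps_hom[OF J] m(2)] comp_assoc[OF D Fh eps_hom[OF J] m(2)] by simp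
   then have "\<epsilon> J o[D] far F f = \<epsilon> J o[D] far F h"
    using monicD[OF m D comp_hom[OF D Ff eps_hom[OF J]] comp_hom[OF D Fh eps_hom[OF J]]] by blast
   then have "far F f = far F h" by (rule iso_left_cancel[OF D eps_iso[OF J] eps_hom[OF J] Ff Fh])
   then show ?thesis by (rule faithful[OF f h])
  qed
  then show ?thesis using im unfolding monic_def by (auto simp: hom_def[of C])
 qed
 have "(i o[C] far G m) o[C] (far G g o[C] \<eta> X) = i o[C] ((far G m o[C] far G g) o[C] \<eta> X)"
  using comp_assoc[OF C comp_hom[OF C eX Gg] Gm i(1)] comp_assoc[OF C eX Gg Gm] by simp
 also have "\<dots> = i o[C] (\<eta> N o[C] x)" using functor_comp[OF G g m(2)] mg eta_nat[OF x(2)] by simp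
 also have "\<dots> = x" by (rule cancel_left[OF C eN i(1,2) x(2)])
 finally have xf: "(i o[C] far G m) o[C] (far G g o[C] \<eta> X) = x" .
 obtain t where t: "t \<in> hom C N (fob G J)" "(i o[C] far G m) o[C] t = ident C N"
  by (rule extremalD[OF x mono im comp_hom[OF C eX Gg] xf])
 note Ft = functor_hom[OF F t(1)]
 have mt: "far G m o[C] t = \<eta> N"
 proof (rule iso_left_cancel[OF C iso_inverse[OF eN i] i(1) comp_hom[OF C t(1) Gm] eN])
  show "i o[C] (far G m o[C] t) = i o[C] \<eta> N" using t(2) comp_assoc[OF C t(1) Gm i(1)] i(2) by simp
 qed
 let ?u = "\<epsilon> (fob F N) o[D] far F (\<eta> N)"
 have u: "?u \<in> hom D (fob F N) (fob F N)" by (rule comp_hom[OF D functor_hom[OF F eN] eps_hom[OF FN]])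
 have "iso_arr D ?u" by (rule iso_comp[OF D functor_hom[OF F eN] functor_iso[OF F C eN eta_iso[OF N]] eps_hom[OF FN] eps_iso[OF FN]])
 then obtain v where v: "v \<in> hom D (fob F N) (fob F N)" "v o[D] ?u = ident D (fob F N)" "?u o[D] v = ident D (fob F N)"
  by (rule iso_arrE[OF _ u])
 have et: "\<epsilon> J o[D] far F t \<in> hom D (fob F N) J" by (rule comp_hom[OF D Ft eps_hom[OF J]])
 have "m o[D] (\<epsilon> J o[D] far F t) = (\<epsilon> (fob F N) o[D] far F (far G m)) o[D] far F t"
  using comp_assoc[OF D Ft eps_hom[OF J] m(2)] eps_nat[OF m(2)] by simp
 also have "\<dots> = ?u"
  using comp_assoc[OF D Ft functor_hom[OF F Gm] eps_hom[OF FN]] functor_comp[OF F t(1) Gm] mt by simp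
 finally have mu: "m o[D] (\<epsilon> J o[D] far F t) = ?u" .
 have "m o[D] ((\<epsilon> J o[D] far F t) o[D] v) = ident D (fob F N)"
  using comp_assoc[OF D v(1) et m(2)] unfolding mu v(3) by (rule sym)
 then show "\<exists>t \<in> hom D (fob F N) J. m o[D] t = ident D (fob F N)" using comp_hom[OF D v(1) et] by blast
qed

end

subsection \<open>Colourings\<close>

text \<open>Otherwise each \<open>\<kappa>\<close> has a value that is not taken at \<open>\<kappa>\<close> by any function of colour \<open>\<kappa>\<close>; the function that consists of these values has no possible colour.\<close>

lemma diagonal_value:
 assumes "\<And>f. f \<in> K \<rightarrow>\<^sub>E S ==> col f \<in> K"
 obtains \<kappa> where "\<kappa> \<in> K" "\<forall>s\<in>S. \<exists>f. f \<in> K \<rightarrow>\<^sub>E S \<and> col f = \<kappa> \<and> f \<kappa> = s"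
proof -
 have "\<exists>\<kappa>\<in>K. \<forall>s\<in>S. \<exists>f. f \<in> K \<rightarrow>\<^sub>E S \<and> col f = \<kappa> \<and> f \<kappa> = s"
 proof (rule ccontr)
  assume "\<not> ?thesis"
  then have "\<forall>\<kappa>\<in>K. \<exists>s. s \<in> S \<and> \<not> (\<exists>f. f \<in> K \<rightarrow>\<^sub>E S \<and> col f = \<kappa> \<and> f \<kappa> = s)" by meson
  from bchoice[OF this] obtain d where d: "\<forall>\<kappa>\<in>K. d \<kappa> \<in> S \<and> \<not> (\<exists>f. f \<in> K \<rightarrow>\<^sub>E S \<and> col f = \<kappa> \<and> f \<kappa> = d \<kappa>)" ..
  then have f: "restrict d K \<in> K \<rightarrow>\<^sub>E S" by simp
  note c = assms[OF f]
  have "restrict d K (col (restrict d K)) = d (col (restrict d K))" using c by simp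
  then show False using bspec[OF d c] f by (metis (no_types))
 qed
 then show thesis using that by blast
qed

text \<open>The functor \<open>n\<close> provides the constant objects, and \<open>K\<close> is the set of colours.\<close>

definition colourable :: "('o, 'm) cat => ('u set, 'u set_arr, 'o, 'm) func => 'k set => bool" where
 "colourable D n K \<longleftrightarrow> (\<forall>Q\<in>ob D. \<exists>col. (\<forall>F \<in> hom D (fob n pt) Q. col F \<in> K) \<and>
   (\<forall>S F c. small TYPE('u) S --> (\<forall>s\<in>S. F s \<in> hom D (fob n pt) Q \<and> col (F s) = c) -->
    (\<exists>\<Xi> \<in> hom D (fob n S) Q. \<forall>s\<in>S. \<Xi> o[D] far n (elem S s) = F s)))"

lemma colourableE:
 fixes n :: "('u set, 'u set_arr, 'o, 'm) func"
 assumes "colourable D n K" "Q \<in> ob D"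
 obtains col where "\<forall>F \<in> hom D (fob n pt) Q. col F \<in> K"
  "\<forall>S F c. small TYPE('u) S --> (\<forall>s\<in>S. F s \<in> hom D (fob n pt) Q \<and> col (F s) = c) -->
    (\<exists>\<Xi> \<in> hom D (fob n S) Q. \<forall>s\<in>S. \<Xi> o[D] far n (elem S s) = F s)"
 using bspec[OF assms(1)[unfolded colourable_def] assms(2)] by (elim exE conjE) (rule that)

text \<open>Let \<open>S'\<close> be the set of functions from the set of all pairs of colours to \<open>S\<close>, coded in the universe. Each
 element of \<open>S'\<close> has a colour in \<open>KD\<close>, as a point of \<open>H (nP S')\<close>, and one in \<open>KP\<close>, as a point of \<open>k (nD S')\<close>. By the
 diagonal argument there are \<open>\<sigma> : S \<rightarrow> S'\<close> with values of one colour and \<open>g : S' \<rightarrow> S\<close>, evaluation at this colour,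
 with \<open>g \<sigma> = 1\<close>. Hence \<open>\<sigma>\<close> gives arrows \<open>t : nD S \<rightarrow> H (nP S')\<close> and \<open>\<beta> : nP S \<rightarrow> k (nD S')\<close>. As \<open>H x\<close> is extremal,
 \<open>H (nP g) t : nD S \<rightarrow> H (nP S)\<close> lifts to \<open>w : nD S \<rightarrow> H X\<close>, and \<open>k w\<close> composed with \<open>k (nD g) \<beta>\<close> is an arrow
 \<open>nP S \<rightarrow> k (H X) \<cong> X\<close> that is a section of \<open>x\<close> on points.\<close>

theorem (in universe) constants_projective:
 fixes nP :: "('u set, 'u set_arr, 'po, 'pm) func" and nD :: "('u set, 'u set_arr, 'do, 'dm) func" and KP :: "'k set" and KD :: "'l set"
 assumes P: "category P" and D: "category D" and nP: "is_functor Set_cat P nP" and nD: "is_functor Set_cat D nD"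
  and colP: "colourable P nP KP" "sm KP" and colD: "colourable D nD KD" "sm KD"
  and H: "is_functor P D H" and k: "is_functor D P k"
  and l_hom: "\<And>X. X \<in> ob P ==> l X \<in> hom P (fob k (fob H X)) X" and l_iso: "\<And>X. X \<in> ob P ==> iso_arr P (l X)"
  and l_nat: "\<And>X Y f. f \<in> hom P X Y ==> l Y o[P] far k (far H f) = f o[P] l X"
  and O: "is_terminal D (fob H (fob nP pt))" and o': "o' \<in> hom D (fob H (fob nP pt)) (fob nD pt)"
  and Hext: "\<And>x. extremal P x ==> extremal D (far H x)"
  and lift: "\<And>S G T Y Q. small TYPE('u) S ==> G \<in> hom D Y Q ==> extremal D G ==> T \<in> hom D (fob nD S) Q ==>
   \<exists>w \<in> hom D (fob nD S) Y. G o[D] w = T"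
  and S: "small TYPE('u) S" and x: "x \<in> hom P X (fob nP S)" "extremal P x"
 obtains \<Xi> where "\<Xi> \<in> hom P (fob nP S) X" "\<forall>s\<in>S. x o[P] (\<Xi> o[P] far nP (elem S s)) = far nP (elem S s)"
proof -
 define K where "K = KD \<times> KP"
 have smF: "sm (K \<rightarrow>\<^sub>E S)" unfolding K_def by (intro small_PiE small_Times colP colD S[unfolded small_TYPE'])
 obtain code :: "('l \<times> 'k => 'u) => 'u" where code: "inj_on code (K \<rightarrow>\<^sub>E S)" using coding[OF smF] .
 define S' where "S' = code ` (K \<rightarrow>\<^sub>E S)"
 have S': "small TYPE('u) S'" unfolding small_TYPE' S'_def by (rule small_image[OF smF])
 have obS: "S \<in> ob Set_cat" "S' \<in> ob Set_cat" "(pt :: 'u set) \<in> ob Set_cat" using S S' small_pt by (simp_all add: set_ob_iff)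
 note nPpt = functor_ob[OF nP obS(3)] and nDpt = functor_ob[OF nD obS(3)]
 \<comment> \<open>the terminal object \<open>H (nP pt)\<close> is a retract of \<open>nD pt\<close>, so arrows from it can be extended to \<open>nD pt\<close>, where they have colours\<close>
 obtain oo where oo: "oo \<in> hom D (fob nD pt) (fob H (fob nP pt))" using terminal_hom[OF O nDpt] .
 have oo': "oo o[D] o' = ident D (fob H (fob nP pt))"
  by (rule terminal_eq[OF O D comp_hom[OF D o' oo] ident_hom[OF D functor_ob[OF H nPpt]]])
 note lpt = l_hom[OF nPpt]
 obtain li where li: "li \<in> hom P (fob nP pt) (fob k (fob H (fob nP pt)))" "li o[P] l (fob nP pt) = ident P (fob k (fob H (fob nP pt)))"
  "l (fob nP pt) o[P] li = ident P (fob nP pt)" by (rule iso_arrE[OF l_iso[OF nPpt] lpt])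
 define N' where "N' = fob H (fob nP S')"
 have N': "N' \<in> ob D" unfolding N'_def by (rule functor_ob[OF H functor_ob[OF nP obS(2)]])
 define Z where "Z = fob k (fob nD S')"
 have Z: "Z \<in> ob P" unfolding Z_def by (rule functor_ob[OF k functor_ob[OF nD obS(2)]])
 \<comment> \<open>the two points that an element of \<open>S'\<close> gives rise to\<close>
 define F where "F z = far H (far nP (elem S' z)) o[D] oo" for z
 define G where "G z = far k (far nD (elem S' z) o[D] o') o[P] li" for z
 have He: "far H (far nP (elem S' z)) \<in> hom D (fob H (fob nP pt)) N'" if "z \<in> S'" for z
  unfolding N'_def by (rule functor_hom[OF H functor_hom[OF nP elem_hom[OF S' that]]])
 have F: "F z \<in> hom D (fob nD pt) N'" if "z \<in> S'" for z unfolding F_def by (rule comp_hom[OF D oo He[OF that]])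
 have q': "far nD (elem S' z) o[D] o' \<in> hom D (fob H (fob nP pt)) (fob nD S')" if "z \<in> S'" for z
  by (rule comp_hom[OF D o' functor_hom[OF nD elem_hom[OF S' that]]])
 have G: "G z \<in> hom P (fob nP pt) Z" if "z \<in> S'" for z unfolding G_def Z_def by (rule comp_hom[OF P li(1) functor_hom[OF k q'[OF that]]])
 obtain cD where cD: "\<forall>F \<in> hom D (fob nD pt) N'. cD F \<in> KD"
  "\<forall>S F c. small TYPE('u) S --> (\<forall>s\<in>S. F s \<in> hom D (fob nD pt) N' \<and> cD (F s) = c) -->
    (\<exists>\<Xi> \<in> hom D (fob nD S) N'. \<forall>s\<in>S. \<Xi> o[D] far nD (elem S s) = F s)" by (rule colourableE[OF colD(1) N']) (rule that)
 obtain cP where cP: "\<forall>F \<in> hom P (fob nP pt) Z. cP F \<in> KP"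
  "\<forall>S F c. small TYPE('u) S --> (\<forall>s\<in>S. F s \<in> hom P (fob nP pt) Z \<and> cP (F s) = c) -->
    (\<exists>\<Xi> \<in> hom P (fob nP S) Z. \<forall>s\<in>S. \<Xi> o[P] far nP (elem S s) = F s)" by (rule colourableE[OF colP(1) Z]) (rule that)
 define col where "col f = (cD (F (code f)), cP (G (code f)))" for f
 have "col f \<in> K" if "f \<in> K \<rightarrow>\<^sub>E S" for f
  using cD(1) cP(1) F[of "code f"] G[of "code f"] that by (auto simp: col_def K_def S'_def)
 then obtain \<kappa> where \<kappa>: "\<kappa> \<in> K" "\<forall>s\<in>S. \<exists>f. f \<in> K \<rightarrow>\<^sub>E S \<and> col f = \<kappa> \<and> f \<kappa> = s" by (rule diagonal_value)
 from bchoice[OF \<kappa>(2)] obtain fs where fs: "\<forall>s\<in>S. fs s \<in> K \<rightarrow>\<^sub>E S \<and> col (fs s) = \<kappa> \<and> fs s \<kappa> = s" ..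
 \<comment> \<open>\<open>\<sigma>\<close> selects for each value a function of colour \<open>\<kappa>\<close> with this value at \<open>\<kappa>\<close>, and \<open>g\<close> is evaluation at \<open>\<kappa>\<close>\<close>
 define \<sigma> where "\<sigma> s = code (fs s)" for s
 have \<sigma>: "\<sigma> s \<in> S'" if "s \<in> S" for s using fs that by (simp add: \<sigma>_def S'_def)
 define g where "g = (S', \<lambda>z\<in>S'. inv_into (K \<rightarrow>\<^sub>E S) code z \<kappa>, S)"
 have inv: "inv_into (K \<rightarrow>\<^sub>E S) code (code f) = f" if "f \<in> K \<rightarrow>\<^sub>E S" for f using code that by (rule inv_into_f_f)
 have gh: "g \<in> hom Set_cat S' S" unfolding set_hom_iff g_def using S S' inv \<kappa>(1) by (auto simp: S'_def)
 have g\<sigma>: "comp Set_cat g (elem S' (\<sigma> s)) = elem S s" if s: "s \<in> S" for s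
 proof -
  have "fn g (\<sigma> s) = s" using \<sigma>[OF s] fs s inv by (simp add: g_def \<sigma>_def)
  then show ?thesis using elem_comp[OF gh \<sigma>[OF s]] by simp
 qed
 have "\<exists>\<Xi> \<in> hom D (fob nD S) N'. \<forall>s\<in>S. \<Xi> o[D] far nD (elem S s) = F (\<sigma> s)"
  by (rule cD(2)[THEN spec, THEN spec[of _ "\<lambda>s. F (\<sigma> s)"], THEN spec[of _ "fst \<kappa>"], THEN mp, OF S, THEN mp])
   (use F \<sigma> fs in \<open>force simp: col_def \<sigma>_def\<close>)
 then obtain t where t: "t \<in> hom D (fob nD S) N'" "\<forall>s\<in>S. t o[D] far nD (elem S s) = F (\<sigma> s)" by blast
 have "\<exists>\<Xi> \<in> hom P (fob nP S) Z. \<forall>s\<in>S. \<Xi> o[P] far nP (elem S s) = G (\<sigma> s)"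
  by (rule cP(2)[THEN spec, THEN spec[of _ "\<lambda>s. G (\<sigma> s)"], THEN spec[of _ "snd \<kappa>"], THEN mp, OF S, THEN mp])
   (use G \<sigma> fs in \<open>force simp: col_def \<sigma>_def\<close>)
 then obtain \<beta> where \<beta>: "\<beta> \<in> hom P (fob nP S) Z" "\<forall>s\<in>S. \<beta> o[P] far nP (elem S s) = G (\<sigma> s)" by blast
 note Hx = functor_hom[OF H x(1)] and ng = functor_hom[OF nP gh] and dg = functor_hom[OF nD gh]
 note Hg = functor_hom[OF H ng, folded N'_def]
 obtain w where w: "w \<in> hom D (fob nD S) (fob H X)" "far H x o[D] w = far H (far nP g) o[D] t"
  using lift[OF S Hx Hext[OF x(2)] comp_hom[OF D t(1) Hg]] by blast
 have X: "X \<in> ob P" and N: "fob nP S \<in> ob P" using category_ob[OF P x(1)] by auto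
 note kw = functor_hom[OF k w(1)] and kg = functor_hom[OF k dg, folded Z_def] and lX = l_hom[OF X] and lN = l_hom[OF N]
 define \<Xi> where "\<Xi> = l X o[P] (far k w o[P] (far k (far nD g) o[P] \<beta>))"
 note g\<beta> = comp_hom[OF P \<beta>(1) kg]
 note wg\<beta> = comp_hom[OF P g\<beta> kw]
 have \<Xi>: "\<Xi> \<in> hom P (fob nP S) X" unfolding \<Xi>_def by (rule comp_hom[OF P wg\<beta> lX])
 have "x o[P] (\<Xi> o[P] far nP (elem S s)) = far nP (elem S s)" if s: "s \<in> S" for s
 proof -
  let ?e = "far nP (elem S s)" and ?e' = "elem S' (\<sigma> s)"
  note \<sigma>s = \<sigma>[OF s]
  have e: "?e \<in> hom P (fob nP pt) (fob nP S)" by (rule functor_hom[OF nP elem_hom[OF S s]])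
  have e': "?e' \<in> hom Set_cat pt S'" by (rule elem_hom[OF S' \<sigma>s])
  note nDe = functor_hom[OF nD elem_hom[OF S s]] and nDe' = functor_hom[OF nD e'] and nPe' = functor_hom[OF nP e']
  define q where "q = far nD (elem S s) o[D] o'"
  have q: "q \<in> hom D (fob H (fob nP pt)) (fob nD S)" unfolding q_def by (rule comp_hom[OF D o' nDe])
  have gq: "far nD g o[D] (far nD ?e' o[D] o') = q"
   using comp_assoc[OF D o' nDe' dg] functor_comp[OF nD e' gh] g\<sigma>[OF s] by (simp add: q_def)
  note kq' = functor_hom[OF k q'[OF \<sigma>s], folded Z_def] and kq = functor_hom[OF k q]
  have "far k (far nD g) o[P] (\<beta> o[P] ?e) = (far k (far nD g) o[P] far k (far nD ?e' o[D] o')) o[P] li"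
   using \<beta>(2) s comp_assoc[OF P li(1) kq' kg] by (simp add: G_def)
  also have "\<dots> = far k q o[P] li" using functor_comp[OF k q'[OF \<sigma>s] dg] gq by simp
  finally have b: "far k (far nD g) o[P] (\<beta> o[P] ?e) = far k q o[P] li" .
  define v where "v = w o[D] q"
  have v: "v \<in> hom D (fob H (fob nP pt)) (fob H X)" unfolding v_def by (rule comp_hom[OF D q w(1)])
  note kv = functor_hom[OF k v]
  have "\<Xi> o[P] ?e = l X o[P] (far k w o[P] (far k (far nD g) o[P] (\<beta> o[P] ?e)))"
   unfolding \<Xi>_def comp_assoc[OF P e wg\<beta> lX] comp_assoc[OF P e g\<beta> kw] comp_assoc[OF P e \<beta>(1) kg] ..
  also have "\<dots> = l X o[P] (far k v o[P] li)"
   unfolding b using comp_assoc[OF P li(1) kq kw] functor_comp[OF k q w(1)] by (simp add: v_def)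
  finally have "x o[P] (\<Xi> o[P] ?e) = (x o[P] l X) o[P] (far k v o[P] li)"
   using comp_assoc[OF P comp_hom[OF P li(1) kv] lX x(1)] by simp
  also have "\<dots> = l (fob nP S) o[P] (far k (far H x) o[P] (far k v o[P] li))"
   using comp_assoc[OF P comp_hom[OF P li(1) kv] functor_hom[OF k Hx] lN] l_nat[OF x(1)] by simp
  also have "\<dots> = l (fob nP S) o[P] (far k (far H x o[D] v) o[P] li)"
   using comp_assoc[OF P li(1) kv functor_hom[OF k Hx]] functor_comp[OF k v Hx] by simp
  also have "far H x o[D] v = far H ?e"
  proof -
   have "far H x o[D] v = (far H (far nP g) o[D] t) o[D] q"
    unfolding v_def using comp_assoc[OF D q w(1) Hx] w(2) by simp
   also have "\<dots> = far H (far nP g) o[D] ((t o[D] far nD (elem S s)) o[D] o')"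
    using comp_assoc[OF D q t(1) Hg] comp_assoc[OF D o' nDe t(1)] by (simp add: q_def)
   also have "(t o[D] far nD (elem S s)) o[D] o' = far H (far nP ?e')"
    using t(2) s comp_assoc[OF D o' oo He[OF \<sigma>s]] oo' comp_ident(1)[OF D He[OF \<sigma>s]] by (simp add: F_def)
   also have "far H (far nP g) o[D] far H (far nP ?e') = far H (far nP (comp Set_cat g ?e'))"
    using functor_comp[OF H nPe' ng] functor_comp[OF nP e' gh] by simp
   finally show ?thesis unfolding g\<sigma>[OF s] .
  qed
  also have "l (fob nP S) o[P] (far k (far H ?e) o[P] li) = (?e o[P] l (fob nP pt)) o[P] li"
   using comp_assoc[OF P li(1) functor_hom[OF k functor_hom[OF H e]] lN] l_nat[OF e] by simp
  also have "\<dots> = ?e" using comp_assoc[OF P li(1) lpt e] li(3) comp_ident(1)[OF P e] by simp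
  finally show ?thesis .
 qed
 then show thesis using that[OF \<Xi>] by blast
qed

section \<open>The glued category over the pseudopushout\<close>

text \<open>The inverses of the components are automatically compatible with the gluing isomorphisms.\<close>

lemma (in gluing) glue_isoI:
 assumes f: "f \<in> hom P X Y" and i0: "iso_arr E0 (ar0 f)" and i1: "iso_arr E1 (ar1 f)"
 shows "iso_arr P f"
proof -
 have X: "X \<in> ob P" and Y: "Y \<in> ob P" using category_ob[OF category_glue f] by auto
 note f' = ar_hom[OF f] and tX = theta_hom[OF X] and tY = theta_hom[OF Y]
 obtain g0 where g0: "g0 \<in> hom E0 (ob0 Y) (ob0 X)" "g0 o[E0] ar0 f = ident E0 (ob0 X)" "ar0 f o[E0] g0 = ident E0 (ob0 Y)"
  by (rule iso_arrE[OF i0 f'(1)])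
 obtain g1 where g1: "g1 \<in> hom E1 (ob1 Y) (ob1 X)" "g1 o[E1] ar1 f = ident E1 (ob1 X)" "ar1 f o[E1] g1 = ident E1 (ob1 Y)"
  by (rule iso_arrE[OF i1 f'(2)])
 note Lg0 = functor_hom[OF L0 g0(1)] and Lg1 = functor_hom[OF L1 g1(1)] and Lf0 = functor_hom[OF L0 f'(1)] and Lf1 = functor_hom[OF L1 f'(2)]
 have e0: "far L0 (ar0 f) o[S] far L0 g0 = ident S (fob L0 (ob0 Y))"
  using functor_comp[OF L0 g0(1) f'(1)] g0(3) functor_ident[OF L0 category_ob(2)[OF E0 f'(1)]] by simp
 have e1: "far L1 g1 o[S] far L1 (ar1 f) = ident S (fob L1 (ob1 X))"
  using functor_comp[OF L1 f'(2) g1(1)] g1(2) functor_ident[OF L1 category_ob(1)[OF E1 f'(2)]] by simp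
 have "theta X o[S] far L0 g0 = far L1 g1 o[S] (far L1 (ar1 f) o[S] (theta X o[S] far L0 g0))"
  using cancel_left[OF S Lf1 Lg1 e1 comp_hom[OF S Lg0 tX]] by simp
 also have "far L1 (ar1 f) o[S] (theta X o[S] far L0 g0) = (theta Y o[S] far L0 (ar0 f)) o[S] far L0 g0"
  using comp_assoc[OF S Lg0 tX Lf1] ar_nat[OF f] by simp
 also have "\<dots> = theta Y" using comp_assoc[OF S Lg0 Lf0 tY] e0 comp_ident(1)[OF S tY] by simp
 finally have g: "(Y, (g0, g1), X) \<in> hom P Y X" by (rule glue_homI[OF Y X g0(1) g1(1)])
 show ?thesis
 proof (rule iso_arrI[OF f g])
  show "(Y, (g0, g1), X) o[P] f = ident P X"
   by (rule glue_eqI[OF comp_glue_hom[OF f g] ident_glue_hom[OF X]]) (simp_all only: ar_comp ar_ident glue_pr_simps g0 g1)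
  show "f o[P] (Y, (g0, g1), X) = ident P Y"
   by (rule glue_eqI[OF comp_glue_hom[OF g f] ident_glue_hom[OF Y]]) (simp_all only: ar_comp ar_ident glue_pr_simps g0 g1)
 qed
qed

lemma (in equivalence) unit_inverse:
 obtains i where "\<forall>X\<in>ob C. i X \<in> hom C (fob G (fob F X)) X \<and> iso_arr C (i X)"
  "\<forall>X Y f. f \<in> hom C X Y --> i Y o[C] far G (far F f) = f o[C] i X"
proof -
 have "\<forall>X\<in>ob C. \<exists>i. i \<in> hom C (fob G (fob F X)) X \<and> i o[C] \<eta> X = ident C X \<and> \<eta> X o[C] i = ident C (fob G (fob F X))"
  using iso_arrE[OF eta_iso eta_hom] by blast
 from bchoice[OF this] obtain i where i: "\<forall>X\<in>ob C. i X \<in> hom C (fob G (fob F X)) X \<and> i X o[C] \<eta> X = ident C X \<and> \<eta> X o[C] i X = ident C (fob G (fob F X))" ..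
 have iso: "iso_arr C (i X)" if "X \<in> ob C" for X using iso_inverse[OF eta_hom[OF that]] i that by blast
 have "i Y o[C] far G (far F f) = f o[C] i X" if f: "f \<in> hom C X Y" for X Y f
 proof -
  have X: "X \<in> ob C" and Y: "Y \<in> ob C" using category_ob[OF C f] by auto
  have iX: "i X \<in> hom C (fob G (fob F X)) X" "\<eta> X o[C] i X = ident C (fob G (fob F X))" using i X by blast+
  have iY: "i Y \<in> hom C (fob G (fob F Y)) Y" "i Y o[C] \<eta> Y = ident C Y" using i Y by blast+
  note GF = functor_hom[OF G functor_hom[OF F f]]
  have "i Y o[C] (far G (far F f) o[C] (\<eta> X o[C] i X)) = i Y o[C] ((\<eta> Y o[C] f) o[C] i X)"
   using comp_assoc[OF C iX(1) eta_hom[OF X] GF] eta_nat[OF f] by simp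
  also have "\<dots> = f o[C] i X"
   using comp_assoc[OF C iX(1) f eta_hom[OF Y]] cancel_left[OF C eta_hom[OF Y] iY comp_hom[OF C iX(1) f]] by simp
  finally show ?thesis using iX(2) comp_ident(1)[OF C GF] by simp
 qed
 then show thesis using that[of i] i iso by blast
qed

text \<open>The pseudococone with vertex \<open>E\<close> is a functor from \<open>E\<close> to the pseudopullback, and the functor \<open>K\<close> of
 \<open>glued_comparison\<close> is a section of it up to isomorphism; both are transported along the equivalence with \<open>D\<close>.\<close>

theorem comparison_retract:
 fixes T :: "('u, 'u) cat"
 assumes PP_def: "PP = glue S E0 E1 (inverse_image j0) (inverse_image j1)"
  and pp: "pseudopushout TYPE('u) S E0 E1 j0 j1 E i0 i1 \<phi>"
  and gl: "gluing S E0 E1 (inverse_image j0) (inverse_image j1)" and iso: "iso_cats PP T enc dec"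
  and D: "category D" and eq: "equivalent_cats E D"
 obtains H k l where "is_functor PP D H" "is_functor D PP k"
  "\<forall>X\<in>ob PP. l X \<in> hom PP (fob k (fob H X)) X \<and> iso_arr PP (l X)"
  "\<forall>X Y f. f \<in> hom PP X Y --> l Y o[PP] far k (far H f) = f o[PP] l X"
  "\<forall>t. is_terminal PP t --> is_terminal D (fob H t)" "\<forall>x. extremal PP x --> extremal D (far H x)"
proof -
 interpret gluing S E0 E1 "inverse_image j0" "inverse_image j1" by (rule gl)
 obtain K \<alpha>0 \<alpha>1 where K: "is_functor PP E K"
  and Kt: "\<And>t. is_terminal PP t ==> is_terminal E (fob K t)" and Kx: "\<And>x. extremal PP x ==> extremal E (far K x)"
  and a0: "nat_iso PP E0 (comp_func (inverse_image i0) K) glue_pr0 \<alpha>0" and a1: "nat_iso PP E1 (comp_func (inverse_image i1) K) glue_pr1 \<alpha>1"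
  and compat: "\<And>X. X \<in> ob PP ==> snd (snd X) o[S] far (inverse_image j0) (\<alpha>0 X) = far (inverse_image j1) (\<alpha>1 X) o[S] \<phi> (fob K X)"
  using glued_comparison[OF PP_def pp gl iso] by blast
 have E: "category E" and gm: "geometric_morphism E0 E i0" "geometric_morphism E1 E i1"
  and phi: "nat_iso E S (inverse_image (comp_geom i0 j0)) (inverse_image (comp_geom i1 j1)) \<phi>"
  using pp by (auto simp: pseudopushout_def topos_def)
 have I0: "is_functor E E0 (inverse_image i0)" and I1: "is_functor E E1 (inverse_image i1)" using gm by (auto simp: geometric_morphism_def)
 have phi_hom: "\<phi> Z \<in> hom S (fob (inverse_image j0) (fob (inverse_image i0) Z)) (fob (inverse_image j1) (fob (inverse_image i1) Z))"
  and phi_iso: "iso_arr S (\<phi> Z)" if "Z \<in> ob E" for Z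
  using phi that by (simp_all add: nat_iso_def nat_trans_def comp_geom_def)
 have phi_nat: "\<phi> Z' o[S] far (inverse_image j0) (far (inverse_image i0) f) = far (inverse_image j1) (far (inverse_image i1) f) o[S] \<phi> Z"
  if "f \<in> hom E Z Z'" for f Z Z'
  using phi that by (auto simp: nat_iso_def nat_trans_def comp_geom_def hom_def[of E])
 define kob where "kob Z = (fob (inverse_image i0) Z, fob (inverse_image i1) Z, \<phi> Z)" for Z
 define kE where "kE = \<lparr>fob = kob, far = (\<lambda>f. (kob (dom E f), (far (inverse_image i0) f, far (inverse_image i1) f), kob (cod E f)))\<rparr>"
 have kob: "kob Z \<in> ob P" if "Z \<in> ob E" for Z
  unfolding kob_def by (rule glue_obI[OF functor_ob[OF I0 that] functor_ob[OF I1 that] phi_hom[OF that] phi_iso[OF that]])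
 have far_kE: "far kE f = (kob Z, (far (inverse_image i0) f, far (inverse_image i1) f), kob Z')" if "f \<in> hom E Z Z'" for f Z Z'
  using that by (simp add: kE_def hom_def[of E])
 have kE_hom: "far kE f \<in> hom P (kob Z) (kob Z')" if f: "f \<in> hom E Z Z'" for f Z Z'
  unfolding far_kE[OF f]
  by (rule glue_homI[OF kob[OF category_ob(1)[OF E f]] kob[OF category_ob(2)[OF E f]]])
   (simp_all add: kob_def functor_hom[OF I0 f] functor_hom[OF I1 f] phi_nat[OF f])
 have fob_kE: "fob kE Z = kob Z" for Z by (simp add: kE_def)
 have kE: "is_functor E P kE" unfolding is_functor_def
 proof (intro conjI ballI impI)
  fix Z assume Z: "Z \<in> ob E"
  show "fob kE Z \<in> ob P" using kob[OF Z] by (simp add: kE_def)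
  note i = ident_hom[OF E Z]
  show "far kE (ident E Z) = ident P (fob kE Z)"
   unfolding fob_kE
   by (rule glue_eqI[OF kE_hom[OF i] ident_glue_hom[OF kob[OF Z]]])
    (simp_all add: ar_ident far_kE[OF i] functor_ident[OF I0 Z] functor_ident[OF I1 Z] kob_def[of Z])
 next
  fix f assume "f \<in> arr E" then show "far kE f \<in> hom P (fob kE (dom E f)) (fob kE (cod E f))" using kE_hom[OF homI] by (simp add: kE_def)
  fix g assume "g \<in> arr E" "cod E f = dom E g"
  then have f: "f \<in> hom E (dom E f) (cod E f)" and g: "g \<in> hom E (cod E f) (cod E g)" using \<open>f \<in> arr E\<close> by (auto simp: hom_def[of E])
  show "far kE (g o[E] f) = far kE g o[P] far kE f"
   by (rule glue_eqI[OF kE_hom[OF comp_hom[OF E f g]] comp_glue_hom[OF kE_hom[OF f] kE_hom[OF g]]])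
    (simp_all add: ar_comp far_kE[OF comp_hom[OF E f g]] far_kE[OF f] far_kE[OF g] functor_comp[OF I0 f g] functor_comp[OF I1 f g])
 qed
 have PPP: "PP = P" by (rule PP_def)
 \<comment> \<open>compatibility of \<open>\<alpha>0\<close> and \<open>\<alpha>1\<close> with \<open>\<phi>\<close> says that they form an arrow of the pseudopullback\<close>
 define m where "m X = (kob (fob K X), (\<alpha>0 X, \<alpha>1 X), X)" for X
 have a0h: "\<alpha>0 X \<in> hom E0 (fob (inverse_image i0) (fob K X)) (ob0 X)" "iso_arr E0 (\<alpha>0 X)"
  and a1h: "\<alpha>1 X \<in> hom E1 (fob (inverse_image i1) (fob K X)) (ob1 X)" "iso_arr E1 (\<alpha>1 X)" if "X \<in> ob P" for X
  using a0 a1 that by (simp_all add: nat_iso_def nat_trans_def PPP)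
 have m_hom: "m X \<in> hom P (kob (fob K X)) X" if X: "X \<in> ob P" for X
  unfolding m_def
  by (rule glue_homI[OF kob[OF functor_ob[OF K]] X]) (use X a0h[OF X] a1h[OF X] compat[of X] in \<open>simp_all add: kob_def PPP\<close>)
 have m_iso: "iso_arr P (m X)" if X: "X \<in> ob P" for X
  by (rule glue_isoI[OF m_hom[OF X]]) (simp_all add: m_def a0h[OF X] a1h[OF X])
 have m_nat: "m Y o[P] far kE (far K f) = f o[P] m X" if f: "f \<in> hom P X Y" for f X Y
 proof -
  have X: "X \<in> ob P" and Y: "Y \<in> ob P" using category_ob[OF category_glue f] by auto
  have Kf: "far K f \<in> hom E (fob K X) (fob K Y)" using functor_hom[OF K] f by (simp add: PPP)
  have n: "\<alpha>0 Y o[E0] far (inverse_image i0) (far K f) = ar0 f o[E0] \<alpha>0 X" "\<alpha>1 Y o[E1] far (inverse_image i1) (far K f) = ar1 f o[E1] \<alpha>1 X"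
   using a0 a1 f by (auto simp: nat_iso_def nat_trans_def PPP hom_def[of P])
  show ?thesis
   by (rule glue_eqI[OF comp_glue_hom[OF kE_hom[OF Kf] m_hom[OF Y]] comp_glue_hom[OF m_hom[OF X] f]])
    (simp_all add: ar_comp m_def far_kE[OF Kf] n)
 qed
 obtain F G \<eta> \<epsilon> where FG: "is_functor E D F" "is_functor D E G" "nat_iso E E id_func (comp_func G F) \<eta>" "nat_iso D D (comp_func F G) id_func \<epsilon>"
  using eq unfolding equivalent_cats_def equivalence_functor_def by blast
 interpret eq: equivalence E D F G \<eta> \<epsilon> by unfold_locales (use E D FG in auto)
 obtain i where i: "\<forall>X\<in>ob E. i X \<in> hom E (fob G (fob F X)) X \<and> iso_arr E (i X)"
  "\<forall>X Y f. f \<in> hom E X Y --> i Y o[E] far G (far F f) = f o[E] i X" by (rule eq.unit_inverse) (rule that)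
 define l where "l X = m X o[P] far kE (i (fob K X))" for X
 have ki: "far kE (i (fob K X)) \<in> hom P (kob (fob G (fob F (fob K X)))) (kob (fob K X)) \<and> iso_arr P (far kE (i (fob K X)))" if X: "X \<in> ob P" for X
 proof -
  have "fob K X \<in> ob E" using functor_ob[OF K] X by (simp add: PPP)
  then have "i (fob K X) \<in> hom E (fob G (fob F (fob K X))) (fob K X)" "iso_arr E (i (fob K X))" using i(1) by blast+
  then show ?thesis using kE_hom functor_iso[OF kE E] by blast
 qed
 show thesis
 proof (rule that[of "comp_func F K" "comp_func kE G" l])
  show "is_functor PP D (comp_func F K)" by (rule is_functor_comp_func[OF K FG(1)])
  show "is_functor D PP (comp_func kE G)" unfolding PPP by (rule is_functor_comp_func[OF FG(2) kE])
  show "\<forall>X\<in>ob PP. l X \<in> hom PP (fob (comp_func kE G) (fob (comp_func F K) X)) X \<and> iso_arr PP (l X)"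
   unfolding PPP l_def comp_func_simps fob_kE using ki m_hom m_iso comp_glue_hom iso_comp[OF category_glue] by blast
  show "\<forall>X Y f. f \<in> hom PP X Y --> l Y o[PP] far (comp_func kE G) (far (comp_func F K) f) = f o[PP] l X"
  proof (intro allI impI)
   fix X Y f assume "f \<in> hom PP X Y"
   then have f: "f \<in> hom P X Y" by (simp add: PPP)
   then have X: "X \<in> ob P" and Y: "Y \<in> ob P" using category_ob[OF category_glue f] by auto
   have Kf: "far K f \<in> hom E (fob K X) (fob K Y)" using functor_hom[OF K] f by (simp add: PPP)
   have iX: "i (fob K X) \<in> hom E (fob G (fob F (fob K X))) (fob K X)" and iY: "i (fob K Y) \<in> hom E (fob G (fob F (fob K Y))) (fob K Y)"
    using i(1) category_ob[OF E Kf] by blast+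
   note GF = functor_hom[OF FG(2) functor_hom[OF FG(1) Kf]]
   have "l Y o[P] far kE (far G (far F (far K f))) = m Y o[P] far kE (i (fob K Y) o[E] far G (far F (far K f)))"
    unfolding l_def functor_comp[OF kE GF iY] by (rule comp_assoc[OF category_glue kE_hom[OF GF] kE_hom[OF iY] m_hom[OF Y]])
   also have "\<dots> = m Y o[P] (far kE (far K f) o[P] far kE (i (fob K X)))"
    using i(2) Kf functor_comp[OF kE iX Kf] by simp
   also have "\<dots> = (f o[P] m X) o[P] far kE (i (fob K X))"
    unfolding m_nat[OF f, symmetric] by (rule comp_assoc[OF category_glue kE_hom[OF iX] kE_hom[OF Kf] m_hom[OF Y], symmetric])
   also have "\<dots> = f o[P] l X" unfolding l_def by (rule comp_assoc[OF category_glue kE_hom[OF iX] m_hom[OF X] f])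
   finally show "l Y o[PP] far (comp_func kE G) (far (comp_func F K) f) = f o[PP] l X" by (simp add: PPP)
  qed
  show "\<forall>t. is_terminal PP t --> is_terminal D (fob (comp_func F K) t)" using Kt eq.terminal by simp
  show "\<forall>x. extremal PP x --> extremal D (far (comp_func F K) x)"
  proof (intro allI impI)
   fix x assume x: "extremal PP x"
   then have "x \<in> arr PP" by (simp add: extremal_def)
   then have "far K x \<in> hom E (fob K (dom PP x)) (fob K (cod PP x))" using functor_hom[OF K homI] by blast
   then show "extremal D (far (comp_func F K) x)" using eq.extremal[OF Kx[OF x]] by simp
  qed
 qed
qed

section \<open>Gluing realizability toposes\<close>

lemma pt_terminal: "universe TYPE('u) ==> is_terminal Set_cat (pt :: 'u set)"
 unfolding is_terminal_def
proof (intro conjI ballI)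
 assume "universe TYPE('u)"
 then interpret universe "TYPE('u)" .
 show "(pt :: 'u set) \<in> ob Set_cat" using small_pt by (simp add: set_ob_iff)
 fix X :: "'u set" assume "X \<in> ob Set_cat"
 then have "(X, \<lambda>_\<in>X. undefined, pt) \<in> hom Set_cat X pt" using small_pt by (simp add: set_hom_iff set_ob_iff pt_def)
 moreover have "F = G" if "F \<in> hom Set_cat X pt" "G \<in> hom Set_cat X pt" for F G
  using set_eqI[OF that] set_fn_mem[OF that(1)] set_fn_mem[OF that(2)] by (simp add: pt_def)
 ultimately show "\<exists>!F. F \<in> hom Set_cat X pt" by blast
qed

text \<open>The set \<open>pt\<close> generates the category of sets.\<close>

lemma (in universe) elem_ext:
 fixes F G :: "'u set_arr"
 assumes F: "F \<in> hom Set_cat S W" and G: "G \<in> hom Set_cat S W" and "\<And>s. s \<in> S ==> comp Set_cat F (elem S s) = comp Set_cat G (elem S s)"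
 shows "F = G"
proof (rule set_eqI[OF F G])
 fix s assume s: "s \<in> S"
 then have "elem W (fn F s) = elem W (fn G s)" using assms(3) elem_comp[OF F s] elem_comp[OF G s] by simp
 then have "(\<lambda>x\<in>(pt :: 'u set). fn F s) = (\<lambda>x\<in>pt. fn G s)" by (simp add: elem_def)
 from fun_cong[OF this, of undefined] show "fn F s = fn G s" unfolding restrict_def pt_def by simp
qed

lemma (in adjunction) right_adjoint_terminal:
 assumes t: "is_terminal D t"
 shows "is_terminal C (fob R t)"
 unfolding is_terminal_def
proof (intro conjI ballI)
 have tD: "t \<in> ob D" using t by (simp add: is_terminal_def)
 show "fob R t \<in> ob C" by (rule functor_ob[OF R tD])
 fix Z assume Z: "Z \<in> ob C"
 obtain f where f: "f \<in> hom D (fob L Z) t" using terminal_hom[OF t functor_ob[OF L Z]] .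
 have "g = h" if g: "g \<in> hom C Z (fob R t)" and h: "h \<in> hom C Z (fob R t)" for g h
  by (rule transpose_eqI[OF tD g h])
   (rule terminal_eq[OF t D comp_hom[OF D functor_hom[OF L g] eps_hom[OF tD]] comp_hom[OF D functor_hom[OF L h] eps_hom[OF tD]]])
 then show "\<exists>!g. g \<in> hom C Z (fob R t)" using transpose(1)[OF Z f] by blast
qed

context asm_univ
begin

lemma RT_colourable: "colourable RTA (nab A) (elts A)"
 unfolding colourable_def
proof (intro ballI)
 fix Q :: "('u, 'a) rt_ob" assume Q: "Q \<in> ob (RT A)"
 show "\<exists>col. (\<forall>F \<in> hom (RT A) (fob (nab A) pt) Q. col F \<in> elts A) \<and>
   (\<forall>S F c. small TYPE('u) S --> (\<forall>s\<in>S. F s \<in> hom (RT A) (fob (nab A) pt) Q \<and> col (F s) = c) -->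
    (\<exists>\<Xi> \<in> hom (RT A) (fob (nab A) S) Q. \<forall>s\<in>S. comp (RT A) \<Xi> (far (nab A) (elem S s)) = F s))"
 proof (rule colouring[OF Q], goal_cases)
  case (1 col)
  show ?case
  proof (intro exI[of _ col] conjI ballI allI impI)
   show "col F \<in> elts A" if "F \<in> hom (RT A) (fob (nab A) pt) Q" for F using 1(1)[OF that] .
   fix S :: "'u set" and F c
   assume S: "small TYPE('u) S" and F: "\<forall>s\<in>S. F s \<in> hom (RT A) (fob (nab A) pt) Q \<and> col (F s) = c"
   show "\<exists>\<Xi> \<in> hom (RT A) (fob (nab A) S) Q. \<forall>s\<in>S. comp (RT A) \<Xi> (far (nab A) (elem S s)) = F s"
    by (rule 1(2)[OF S, of F c]) (use F in blast)+
  qed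
 qed
qed

lemma inclusion_properties:
 assumes t: "topos RTA" and g: "geometric_morphism Set_cat (RT A) (Set_inclusion A :: (_, _, ('u, 'a) rt_ob, ('u, 'a) rt_arr) geom)"
 shows "is_functor RTA Set_cat Gamma_hat"
  "preserves_finite_limits RTA Set_cat Gamma_hat"
  "has_cartesian_lifts RTA Set_cat Gamma_hat"
  "is_terminal (RT A) (fob (nab A) (pt :: 'u set))"
proof -
 have ii: "inverse_image (Set_inclusion A) = Gamma_hat" "direct_image (Set_inclusion A) = nab A" by (simp_all add: Set_inclusion_def)
 show L: "is_functor RTA Set_cat Gamma_hat"
  and lex: "preserves_finite_limits RTA Set_cat Gamma_hat"
  using g by (simp_all only: geometric_morphism_def ii)
 have "adjoint RTA Set_cat Gamma_hat (nab A)"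
  using g by (simp only: geometric_morphism_def ii)
 then obtain \<eta> \<epsilon> where adj: "adjunction RTA Set_cat Gamma_hat (nab A) \<eta> \<epsilon>"
  by (rule adjoint_adjunction[OF category_RT category_Set L nab_functor])
 have lim: "has_finite_limits RTA" using t by (simp add: topos_def)
 show "has_cartesian_lifts RTA Set_cat Gamma_hat"
  by (rule reflection_has_cartesian_lifts[OF category_RT category_Set lim L nab_functor adj lex]) (rule Gamma_counit_iso[OF adj])
 have "universe TYPE('u)" using set_universe by (simp add: universe_def set_universe_def small_def)
 then show "is_terminal (RT A) (fob (nab A) (pt :: 'u set))" by (rule adjunction.right_adjoint_terminal[OF adj pt_terminal])
qed

text \<open>Over every element of \<open>S\<close> lies a copy of \<open>T\<close>. The point over \<open>s\<close> with label \<open>v\<close> is hard to realize, by the elements below \<open>a s\<close> only; for the other points every element is a realizer.\<close>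

definition half :: "'u set => 'u set => 'u => ('u => 'a) => ('u, 'a) asm" where
 "half S T v a = (let W = (\<lambda>(s, b). upair s b) ` (S \<times> T) in (W, \<lambda>z\<in>W. {r \<in> elts A. \<forall>s. z = upair s v --> le A r (a s)}))"

lemma half:
 assumes S: "sm S" and T: "sm T" and a: "\<And>s. s \<in> S ==> a s \<in> elts A"
 shows half_ob: "half S T v a \<in> ob AA" and half_proj: "(half S T v a, \<lambda>z\<in>fst (half S T v a). ufst z, fob (Nabla A) S) \<in> hom AA (half S T v a) (fob (Nabla A) S)"
  and half_section: "v' \<in> T ==> v' \<noteq> v ==> (fob (Nabla A) S, \<lambda>s\<in>S. upair s v', half S T v a) \<in> hom AA (fob (Nabla A) S) (half S T v a)"
proof -
 let ?M = "half S T v a"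
 define E where "E z = {r \<in> elts A. \<forall>s. z = upair s v --> le A r (a s)}" for z
 define W where "W = (\<lambda>(s, b). upair s b) ` (S \<times> T)"
 have M: "?M = (W, restrict E W)" by (simp add: half_def W_def E_def Let_def restrict_def fun_eq_iff)
 have E: "closed A (E z) \<and> E z \<noteq> {}" if zW: "z \<in> W" for z
 proof -
  obtain s b where z: "z = upair s b" "s \<in> S" using zW by (auto simp: W_def)
  have "a s \<in> E z" using z a le_refl by (auto simp: E_def)
  moreover have "closed A (E z)" unfolding closed_def
  proof (intro conjI ballI impI)
   show "E z \<subseteq> elts A" by (auto simp: E_def)
   fix r r' assume r: "r \<in> E z" and r': "r' \<in> elts A" and l: "le A r' r"
   have "le A r' (a s')" if e: "z = upair s' v" for s'
   proof -
    have "s' \<in> S" using e z by simp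
    then show ?thesis using le_trans[OF l _ r' _ a] r e by (simp add: E_def)
   qed
   then show "r' \<in> E z" using r' by (simp add: E_def)
  qed
  ultimately show ?thesis by blast
 qed
 show ob: "?M \<in> ob AA" unfolding M
  by (rule asm_obI) (use E S T in \<open>auto simp: W_def intro!: small_image small_Times\<close>)
 have N: "fob (Nabla A) S \<in> ob AA" using nabla_ob S by (simp add: small_TYPE)
 have W: "ufst z \<in> S" if "z \<in> W" for z using that by (auto simp: W_def)
 show "(?M, \<lambda>z\<in>fst ?M. ufst z, fob (Nabla A) S) \<in> hom AA ?M (fob (Nabla A) S)"
  by (rule asm_homI[OF ob N])
   (use W in \<open>auto simp: M nabla_simps E_def closed_elts_all intro!: tracked_incl\<close>)
 assume v': "v' \<in> T" "v' \<noteq> v"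
 have sW: "upair s v' \<in> W" if "s \<in> S" for s using that v' by (force simp: W_def)
 have sE: "E (upair s v') = elts A" for s using v' by (auto simp: E_def)
 have "(fob (Nabla A) S, restrict (\<lambda>s. upair s v') (fst (fob (Nabla A) S)), ?M) \<in> hom AA (fob (Nabla A) S) ?M"
  by (rule asm_homI[OF N ob])
   (use sW in \<open>auto simp: M nabla_simps sE closed_elts_all intro!: tracked_incl\<close>)
 then show "(fob (Nabla A) S, \<lambda>s\<in>S. upair s v', ?M) \<in> hom AA (fob (Nabla A) S) ?M" by simp
qed

end

locale glued_toposes = zero: asm_univ U A0 + one: asm_univ U A1 +
  gluing "Set_cat :: ('u set, 'u set_arr) cat" "RT A0 :: (('u, 'a) rt_ob, ('u, 'a) rt_arr) cat" "RT A1 :: (('u, 'b) rt_ob, ('u, 'b) rt_arr) cat" Gamma_hat Gamma_hat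
 for U :: "'u itself" and A0 :: "'a opas" and A1 :: "'b opas"
begin

definition const_ob :: "'u set => (('u, 'a) rt_ob, ('u, 'b) rt_ob, 'u set_arr) glue_ob" where
 "const_ob S = (fob (nab A0) S, fob (nab A1) S, ident Set_cat S)"

definition const :: "('u set, 'u set_arr, (('u, 'a) rt_ob, ('u, 'b) rt_ob, 'u set_arr) glue_ob,
  (('u, 'a) rt_ob, ('u, 'a) rt_arr, ('u, 'b) rt_ob, ('u, 'b) rt_arr, 'u set_arr) glue_arr) func" where
 "const = \<lparr>fob = const_ob, far = (\<lambda>F. (const_ob (dom Set_cat F), (far (nab A0) F, far (nab A1) F), const_ob (cod Set_cat F)))\<rparr>"

lemma fob_const: "fob const S = const_ob S"
 by (simp add: const_def)

lemma far_const: "F \<in> hom Set_cat X Y ==> far const F = (const_ob X, (far (nab A0) F, far (nab A1) F), const_ob Y)"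
 by (simp add: const_def hom_def[of Set_cat])

lemma const_ob_simps: "ob0 (const_ob S) = fob (nab A0) S" "ob1 (const_ob S) = fob (nab A1) S" "theta (const_ob S) = ident Set_cat S"
 by (simp_all add: const_ob_def)

lemma const_ob:
 assumes X: "small TYPE('u) X"
 shows "const_ob X \<in> ob P"
proof -
 have oX: "X \<in> ob Set_cat" using X by (simp add: set_ob_iff)
 show ?thesis unfolding const_ob_def
  by (rule glue_obI[OF functor_ob[OF zero.nab_functor oX] functor_ob[OF one.nab_functor oX]])
   (simp_all only: zero.Gamma_nab_ob[OF X] one.Gamma_nab_ob[OF X] ident_hom[OF S oX] iso_ident[OF S oX])
qed

lemma const_hom:
 assumes F: "F \<in> hom Set_cat X Y"
 shows "far const F \<in> hom P (const_ob X) (const_ob Y)"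
proof -
 have X: "small TYPE('u) X" and Y: "small TYPE('u) Y" using F unfolding set_hom_iff by blast+
 show ?thesis unfolding far_const[OF F]
  by (rule glue_homI[OF const_ob[OF X] const_ob[OF Y]])
   (simp_all only: const_ob_simps functor_hom[OF zero.nab_functor F] functor_hom[OF one.nab_functor F]
    zero.Gamma_nab_ar[OF F] one.Gamma_nab_ar[OF F] comp_ident[OF S F])
qed

lemma const_functor: "is_functor Set_cat P const"
 unfolding is_functor_def
proof (intro conjI ballI impI)
 show "fob const X \<in> ob P" if "X \<in> ob Set_cat" for X using that const_ob by (simp add: fob_const set_ob_iff)
 show "far const F \<in> hom P (fob const (dom Set_cat F)) (fob const (cod Set_cat F))" if "F \<in> arr Set_cat" for F
  using const_hom[OF homI[OF that]] by (simp only: fob_const)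
 show "far const (ident Set_cat X) = ident P (fob const X)" if X: "X \<in> ob Set_cat" for X
  unfolding fob_const
  by (rule glue_eqI[OF const_hom[OF ident_hom[OF S X]] ident_glue_hom[OF const_ob]])
   (use X in \<open>simp_all only: set_ob_iff far_const[OF ident_hom[OF S X]] glue_pr_simps ar_ident const_ob_simps
    functor_ident[OF zero.nab_functor X] functor_ident[OF one.nab_functor X]\<close>)
 fix F G :: "'u set_arr" assume "F \<in> arr Set_cat" "G \<in> arr Set_cat" "cod Set_cat F = dom Set_cat G"
 then have F: "F \<in> hom Set_cat (dom Set_cat F) (cod Set_cat F)" and G: "G \<in> hom Set_cat (cod Set_cat F) (cod Set_cat G)"
  by (auto simp: hom_def[of Set_cat])
 show "far const (comp Set_cat G F) = far const G o[P] far const F"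
  by (rule glue_eqI[OF const_hom[OF comp_hom[OF S F G]] comp_glue_hom[OF const_hom[OF F] const_hom[OF G]]])
   (simp_all only: ar_comp far_const[OF comp_hom[OF S F G]] far_const[OF F] far_const[OF G] glue_pr_simps
    functor_comp[OF zero.nab_functor F G] functor_comp[OF one.nab_functor F G])
qed

text \<open>The colour of a point is the pair of the colours of its components. An amalgamated pair of arrows is compatible with the gluing, since this can be tested on points.\<close>

lemma glue_colourable: "colourable P const (elts A0 \<times> elts A1)"
 unfolding colourable_def
proof (intro ballI)
 fix Q assume Q: "Q \<in> ob P"
 have Q0: "ob0 Q \<in> ob (RT A0)" and Q1: "ob1 Q \<in> ob (RT A1)" using Q functor_ob[OF pr0] functor_ob[OF pr1] by auto
 obtain c0 where c0: "\<forall>F \<in> hom (RT A0) (fob (nab A0) (pt :: 'u set)) (ob0 Q). c0 F \<in> elts A0"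
  "\<forall>S F c. small TYPE('u) S --> (\<forall>s\<in>S. F s \<in> hom (RT A0) (fob (nab A0) (pt :: 'u set)) (ob0 Q) \<and> c0 (F s) = c) -->
    (\<exists>\<Xi> \<in> hom (RT A0) (fob (nab A0) S) (ob0 Q). \<forall>s\<in>S. comp (RT A0) \<Xi> (far (nab A0) (elem S s)) = F s)"
  by (rule colourableE[OF zero.RT_colourable Q0]) (rule that)
 obtain c1 where c1: "\<forall>F \<in> hom (RT A1) (fob (nab A1) (pt :: 'u set)) (ob1 Q). c1 F \<in> elts A1"
  "\<forall>S F c. small TYPE('u) S --> (\<forall>s\<in>S. F s \<in> hom (RT A1) (fob (nab A1) (pt :: 'u set)) (ob1 Q) \<and> c1 (F s) = c) -->
    (\<exists>\<Xi> \<in> hom (RT A1) (fob (nab A1) S) (ob1 Q). \<forall>s\<in>S. comp (RT A1) \<Xi> (far (nab A1) (elem S s)) = F s)"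
  by (rule colourableE[OF one.RT_colourable Q1]) (rule that)
 define col where "col F = (c0 (ar0 F), c1 (ar1 F))" for F
 have ar: "ar0 F \<in> hom (RT A0) (fob (nab A0) pt) (ob0 Q)" "ar1 F \<in> hom (RT A1) (fob (nab A1) pt) (ob1 Q)" if "F \<in> hom P (fob const pt) Q" for F
  using ar_hom[OF that] by (simp_all only: fob_const const_ob_simps)
 have "\<exists>\<Xi> \<in> hom P (fob const S') Q. \<forall>s\<in>S'. \<Xi> o[P] far const (elem S' s) = F s"
  if S': "small TYPE('u) S'" and F: "\<forall>s\<in>S'. F s \<in> hom P (fob const pt) Q \<and> col (F s) = c" for S' F c
 proof -
  have Fs: "F s \<in> hom P (fob const pt) Q" "col (F s) = c" if "s \<in> S'" for s using F that by blast+
  note Fh = Fs(1)[unfolded fob_const]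
  have p0: "\<forall>s\<in>S'. ar0 (F s) \<in> hom (RT A0) (fob (nab A0) pt) (ob0 Q) \<and> c0 (ar0 (F s)) = fst c"
   and p1: "\<forall>s\<in>S'. ar1 (F s) \<in> hom (RT A1) (fob (nab A1) pt) (ob1 Q) \<and> c1 (ar1 (F s)) = snd c"
   using ar[OF Fs(1)] by (auto simp only: Fs(2)[symmetric] col_def fst_conv snd_conv)
  have "\<exists>\<Xi> \<in> hom (RT A0) (fob (nab A0) S') (ob0 Q). \<forall>s\<in>S'. comp (RT A0) \<Xi> (far (nab A0) (elem S' s)) = ar0 (F s)"
   by (rule c0(2)[THEN spec, THEN spec[of _ "\<lambda>s. ar0 (F s)"], THEN spec[of _ "fst c"], THEN mp, OF S', THEN mp])
    (rule p0)
  then obtain \<Xi>0 where \<Xi>0: "\<Xi>0 \<in> hom (RT A0) (fob (nab A0) S') (ob0 Q)" "\<forall>s\<in>S'. comp (RT A0) \<Xi>0 (far (nab A0) (elem S' s)) = ar0 (F s)" by blast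
  have "\<exists>\<Xi> \<in> hom (RT A1) (fob (nab A1) S') (ob1 Q). \<forall>s\<in>S'. comp (RT A1) \<Xi> (far (nab A1) (elem S' s)) = ar1 (F s)"
   by (rule c1(2)[THEN spec, THEN spec[of _ "\<lambda>s. ar1 (F s)"], THEN spec[of _ "snd c"], THEN mp, OF S', THEN mp])
    (rule p1)
  then obtain \<Xi>1 where \<Xi>1: "\<Xi>1 \<in> hom (RT A1) (fob (nab A1) S') (ob1 Q)" "\<forall>s\<in>S'. comp (RT A1) \<Xi>1 (far (nab A1) (elem S' s)) = ar1 (F s)" by blast
  have L\<Xi>0: "far Gamma_hat \<Xi>0 \<in> hom Set_cat S' (fob Gamma_hat (ob0 Q))" using functor_hom[OF L0 \<Xi>0(1)] by (simp only: zero.Gamma_nab_ob[OF S'])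
  have L\<Xi>1: "far Gamma_hat \<Xi>1 \<in> hom Set_cat S' (fob Gamma_hat (ob1 Q))" using functor_hom[OF L1 \<Xi>1(1)] by (simp only: one.Gamma_nab_ob[OF S'])
  note th = theta_hom[OF Q]
  have oS: "S' \<in> ob Set_cat" using S' by (simp add: set_ob_iff)
  have "comp Set_cat (theta Q) (far Gamma_hat \<Xi>0) = far Gamma_hat \<Xi>1"
  proof (rule zero.elem_ext[OF comp_hom[OF S L\<Xi>0 th] L\<Xi>1])
   fix s assume s: "s \<in> S'"
   note e = zero.elem_hom[OF S' s]
   have "far Gamma_hat \<Xi>0 o[Set_cat] elem S' s = far Gamma_hat (ar0 (F s))" "far Gamma_hat \<Xi>1 o[Set_cat] elem S' s = far Gamma_hat (ar1 (F s))"
    using functor_comp[OF L0 functor_hom[OF zero.nab_functor e] \<Xi>0(1)] functor_comp[OF L1 functor_hom[OF one.nab_functor e] \<Xi>1(1)]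
     \<Xi>0(2) \<Xi>1(2) s zero.Gamma_nab_ar[OF e] one.Gamma_nab_ar[OF e] by simp_all
   moreover have "theta Q o[Set_cat] far Gamma_hat (ar0 (F s)) = far Gamma_hat (ar1 (F s))"
    using ar_nat[OF Fh[OF s]] comp_ident(1)[OF S functor_hom[OF L1 ar_hom(2)[OF Fh[OF s]]]]
    by (simp only: const_ob_simps one.Gamma_nab_ob[OF zero.small_pt])
   ultimately show "(theta Q o[Set_cat] far Gamma_hat \<Xi>0) o[Set_cat] elem S' s = far Gamma_hat \<Xi>1 o[Set_cat] elem S' s"
    using comp_assoc[OF S e L\<Xi>0 th] by simp
  qed
  then have \<Xi>: "(const_ob S', (\<Xi>0, \<Xi>1), Q) \<in> hom P (const_ob S') Q"
   by (intro glue_homI[OF const_ob[OF S'] Q]) (simp_all only: const_ob_simps \<Xi>0(1) \<Xi>1(1) comp_ident(1)[OF S L\<Xi>1])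
  have "(const_ob S', (\<Xi>0, \<Xi>1), Q) o[P] far const (elem S' s) = F s" if s: "s \<in> S'" for s
  proof -
   note e = zero.elem_hom[OF S' s]
   show ?thesis
    by (rule glue_eqI[OF comp_glue_hom[OF const_hom[OF e] \<Xi>] Fh[OF s]])
     (use \<Xi>0(2) \<Xi>1(2) s in \<open>simp_all only: ar_comp far_const[OF e] glue_pr_simps\<close>)
  qed
  then show ?thesis using \<Xi> unfolding fob_const by blast
 qed
 moreover have "col F \<in> elts A0 \<times> elts A1" if "F \<in> hom P (fob const pt) Q" for F
  using ar[OF that] c0(1) c1(1) by (simp add: col_def)
 ultimately show "\<exists>col. (\<forall>F \<in> hom P (fob const pt) Q. col F \<in> elts A0 \<times> elts A1) \<and>
   (\<forall>S F c. small TYPE('u) S --> (\<forall>s\<in>S. F s \<in> hom P (fob const pt) Q \<and> col (F s) = c) -->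
    (\<exists>\<Xi> \<in> hom P (fob const S) Q. \<forall>s\<in>S. \<Xi> o[P] far const (elem S s) = F s))" by blast
qed

lemma glue_classlike:
 assumes sm: "zero.sm (elts A0)" "zero.sm (elts A1)"
 shows "zero.classlike (ob P)" "zero.classlike (arr P)"
proof -
 note c0 = zero.classlike_RT[OF sm(1)] and c1 = one.classlike_RT[OF sm(2)] and T = zero.classlike_Times
 have "ob P \<subseteq> ob (RT A0) \<times> ob (RT A1) \<times> arr Set_cat"
 proof
  fix X assume X: "X \<in> ob P"
  have "theta X \<in> arr Set_cat" using theta_hom[OF X] by (simp add: hom_def)
  then show "X \<in> ob (RT A0) \<times> ob (RT A1) \<times> arr Set_cat"
   using functor_ob[OF pr0 X] functor_ob[OF pr1 X] by (cases X) simp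
 qed
 then show o: "zero.classlike (ob P)" by (rule zero.classlike_subset[OF _ T[OF c0(1) T[OF c1(1) zero.classlike_Set_arr]]])
 have "arr P \<subseteq> ob P \<times> (arr (RT A0) \<times> arr (RT A1)) \<times> ob P"
 proof
  fix f assume "f \<in> arr P"
  then have f: "f \<in> hom P (dom P f) (cod P f)" by (rule homI)
  have "ar0 f \<in> arr (RT A0)" "ar1 f \<in> arr (RT A1)" "f = (dom P f, (ar0 f, ar1 f), cod P f)" "dom P f \<in> ob P" "cod P f \<in> ob P"
   using ar_hom[OF f] f category_ob[OF category_glue f] unfolding glue_hom_iff by (simp_all add: hom_def)
  then show "f \<in> ob P \<times> (arr (RT A0) \<times> arr (RT A1)) \<times> ob P" by (metis mem_Sigma_iff)
 qed
 then show "zero.classlike (arr P)" by (rule zero.classlike_subset[OF _ T[OF o T[OF T[OF c0(2) c1(2)] o]]])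
qed

end

section \<open>One of the two algebras has a least element\<close>

text \<open>The functions to and from the one-element algebra that pick the least element \<open>d\<close> are morphisms because combinators realize \<open>d d \<le> d\<close> and constant functions; every element is above \<open>d\<close>, so the composite is below the identity.\<close>

lemma (in opca_alg) least_element_trivial:
 assumes d: "d \<in> elts A" and least: "\<And>a. a \<in> elts A ==> le A d a"
 shows "trivial_opca A"
proof -
 obtain k where k: "k \<in> elts A" "\<forall>a\<in>elts A. \<forall>b\<in>elts A. \<exists>u v. app A k a = Some u \<and> u \<in> elts A \<and> app A u b = Some v \<and> le A v a \<and> v \<in> elts A"
  by (rule k_s_exist)
 obtain i where i: "i \<in> elts A" "\<forall>x\<in>elts A. \<exists>c. app A i x = Some c \<and> le A c x"
  using combinatory_completeness[of Var] by auto
 obtain r where r: "r \<in> elts A" "\<forall>x\<in>elts A. \<exists>c. app A r x = Some c \<and> le A c d"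
  using combinatory_completeness[of "Cst d"] d by auto
 obtain u v where uv: "app A k d = Some u" "app A u d = Some v" "le A v d" using k d by blast
 obtain c where c: "app A i d = Some c" "le A c d" using i d by blast
 have c_in: "c \<in> elts A" using app_closed[OF c(1) i(1) d] .
 have "opca_morphism A one_opca (\<lambda>_. ())"
  by (auto simp: opca_morphism_def one_opca_def oapp_def opreceq_def ole_def)
 moreover have "opca_morphism one_opca A (\<lambda>_. d)"
  unfolding opca_morphism_def
 proof (intro conjI)
  show "(\<lambda>_. d) ` elts one_opca \<subseteq> elts A" using d by auto
  show "\<exists>t\<in>elts A. \<forall>a\<in>elts one_opca. \<forall>a'\<in>elts one_opca. opreceq A (oapp A (app A t d) (Some d)) (map_option (\<lambda>_. d) (app one_opca a a'))"
   by (rule bexI[of _ k]) (use uv k in \<open>simp_all add: one_opca_def oapp_def opreceq_def ole_def\<close>)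
  show "\<exists>u\<in>elts A. \<forall>a\<in>elts one_opca. \<forall>a'\<in>elts one_opca. le one_opca a' a --> ole A (app A u d) (Some d)"
   by (rule bexI[of _ i]) (use c i in \<open>simp_all add: ole_def\<close>)
 qed
 moreover have "opca_morphism_le A A ((\<lambda>_. d) \<circ> (\<lambda>_. ())) id"
  unfolding opca_morphism_le_def using c i(1) le_trans[OF c(2) least c_in d] by (auto simp: ole_def intro!: bexI[of _ i])
 moreover have "opca_morphism_le A A id ((\<lambda>_. d) \<circ> (\<lambda>_. ()))"
  unfolding opca_morphism_le_def using r by (force simp: ole_def intro!: bexI[of _ r])
 moreover have "opca_morphism_le one_opca one_opca ((\<lambda>_. ()) \<circ> (\<lambda>_. d)) id" "opca_morphism_le one_opca one_opca id ((\<lambda>_. ()) \<circ> (\<lambda>_. d))"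
  by (simp_all add: opca_morphism_le_def one_opca_def ole_def)
 ultimately show ?thesis unfolding trivial_opca_def opca_equivalent_def by blast
qed

lemma (in asm_univ) embedded_compI:
 assumes "t \<in> hom AA M M'" "t' \<in> hom AA M' M''"
 shows "comp (RT A) (far (ex_reg_embedding AA) t') (far (ex_reg_embedding AA) t) = far (ex_reg_embedding AA) (comp AA t' t)"
 unfolding RT_def by (rule functor_comp[OF embedding_functor assms, symmetric])

lemma (in asm_univ) embedded_hom:
 assumes "t \<in> hom AA M M'"
 shows "far (ex_reg_embedding AA) t \<in> hom (RT A) (fob (ex_reg_embedding AA) M) (fob (ex_reg_embedding AA) M')"
 unfolding RT_def by (rule functor_hom[OF embedding_functor assms])

text \<open>A function that chooses a label for every \<open>s\<close> is a section of the projection that forgets labels.\<close>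

lemma (in asm_univ) embedded_section:
 assumes S: "small TYPE('u) S" and p: "(M, \<lambda>z\<in>fst M. ufst z, fob (Nabla A) S) \<in> hom AA M (fob (Nabla A) S)"
  and s: "(fob (Nabla A) S, \<lambda>s\<in>S. upair s v, M) \<in> hom AA (fob (Nabla A) S) M"
 shows "comp (RT A) (far (ex_reg_embedding AA) (M, \<lambda>z\<in>fst M. ufst z, fob (Nabla A) S)) (far (ex_reg_embedding AA) (fob (Nabla A) S, \<lambda>s\<in>S. upair s v, M))
  = ident (RT A) (fob (nab A) S)"
proof -
 have N: "fob (Nabla A) S \<in> ob AA" by (rule nabla_ob[OF S])
 have "comp AA (M, \<lambda>z\<in>fst M. ufst z, fob (Nabla A) S) (fob (Nabla A) S, \<lambda>s\<in>S. upair s v, M) = ident AA (fob (Nabla A) S)"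
 proof (rule asm_eqI[OF asm_comp_hom[OF s p] ident_hom[OF category_Asm N]])
  fix x assume x: "x \<in> fst (fob (Nabla A) S)"
  then show "fn (comp AA (M, \<lambda>z\<in>fst M. ufst z, fob (Nabla A) S) (fob (Nabla A) S, \<lambda>s\<in>S. upair s v, M)) x = fn (ident AA (fob (Nabla A) S)) x"
   unfolding fn_comp[OF s p x] using fn_mem[OF s x] by (simp add: asm_ident)
 qed
 then have "comp (RT A) (far (ex_reg_embedding AA) (M, \<lambda>z\<in>fst M. ufst z, fob (Nabla A) S)) (far (ex_reg_embedding AA) (fob (Nabla A) S, \<lambda>s\<in>S. upair s v, M))
  = far (ex_reg_embedding AA) (ident AA (fob (Nabla A) S))"
  using embedded_compI[OF s p] by simp
 also have "\<dots> = ident (RT A) (fob (nab A) S)" unfolding RT_def comp_func_simps by (rule functor_ident[OF embedding_functor N])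
 finally show ?thesis .
qed

lemma (in asm_univ) embedded_point:
 assumes S: "small TYPE('u) S" and f: "f \<in> hom AA (fob (Nabla A) S) M" and p: "p \<in> hom AA M (fob (Nabla A) S)" and s: "s \<in> S"
  and e: "comp (RT A) (far (ex_reg_embedding AA) p) (comp (RT A) (far (ex_reg_embedding AA) f) (far (nab A) (elem S s))) = far (nab A) (elem S s)"
 shows "fn p (fn f s) = s"
proof -
 have el: "elem S s \<in> hom Set_cat pt S" by (rule elem_hom[OF S s])
 note n = nabla_hom[OF el]
 have u: "undefined \<in> fst (fob (Nabla A) (pt :: 'u set))" by (simp add: pt_def)
 have "far (ex_reg_embedding AA) (comp AA p (comp AA f (far (Nabla A) (elem S s)))) = far (ex_reg_embedding AA) (far (Nabla A) (elem S s))"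
  using e embedded_compI[OF n f] embedded_compI[OF asm_comp_hom[OF n f] p] by simp
 then have "far Gamma_hat (far (ex_reg_embedding AA) (comp AA p (comp AA f (far (Nabla A) (elem S s))))) = (far Gamma_hat (far (ex_reg_embedding AA) (far (Nabla A) (elem S s))) :: 'u set_arr)"
  by (rule arg_cong)
 then have "fn (comp AA p (comp AA f (far (Nabla A) (elem S s)))) undefined = fn (far (Nabla A) (elem S s)) undefined"
  unfolding Gamma_hat_ar[OF asm_comp_hom[OF asm_comp_hom[OF n f] p]] Gamma_hat_ar[OF n] by simp
 moreover have "fn (far (Nabla A) (elem S s)) undefined = s" unfolding nabla_far[OF el] by (simp add: elem_def pt_def)
 ultimately show ?thesis using fn_comp[OF asm_comp_hom[OF n f] p u] fn_comp[OF n f u] by simp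
qed

text \<open>The assemblies \<open>M0\<close> and \<open>M1\<close> have the same underlying set, the pairs of (the code of) some \<open>(a0, a1)\<close> and a bit
 \<open>u0\<close> or \<open>u1\<close>. In \<open>M0\<close> it is the bit \<open>u1\<close> that is hard to realize, in \<open>M1\<close> the bit \<open>u0\<close>; so \<open>u0\<close> and
 \<open>u1\<close>, respectively, are the choices that define sections. A section that works for both has to
 solve one of the two hard problems for each \<open>(a0, a1)\<close>, and it does so with a fixed realizer.\<close>

lemma (in glued_toposes) least_element_of_splitting:
 assumes sm: "zero.sm (elts A0)" "zero.sm (elts A1)"
  and split: "\<And>S X x. small TYPE('u) S ==> x \<in> hom P X (const_ob S) ==> extremal P x ==>
   \<exists>\<Xi> \<in> hom P (const_ob S) X. \<forall>s\<in>S. x o[P] (\<Xi> o[P] far const (elem S s)) = far const (elem S s)"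
 shows "(\<exists>d\<in>elts A0. \<forall>a\<in>elts A0. le A0 d a) \<or> (\<exists>d\<in>elts A1. \<forall>a\<in>elts A1. le A1 d a)"
proof -
 let ?y0 = "ex_reg_embedding (Asm A0 :: (('u, 'a) asm, ('u, 'a) asm_arr) cat)" and ?y1 = "ex_reg_embedding (Asm A1 :: (('u, 'b) asm, ('u, 'b) asm_arr) cat)"
 obtain u0 u1 :: 'u where u: "u0 \<noteq> u1" using zero.two_elements by blast
 have smT: "zero.sm {u0, u1}" by (rule zero.small_finite) simp
 have smA: "zero.sm (elts A0 \<times> elts A1)" by (rule zero.small_Times[OF sm])
 obtain code :: "'a \<times> 'b => 'u" where code: "inj_on code (elts A0 \<times> elts A1)" using zero.coding[OF smA] .
 define Z where "Z = code ` (elts A0 \<times> elts A1)"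
 define dec where "dec = inv_into (elts A0 \<times> elts A1) code"
 have dec: "dec (code p) = p" if "p \<in> elts A0 \<times> elts A1" for p unfolding dec_def using code that by (rule inv_into_f_f)
 have decZ: "fst (dec s) \<in> elts A0" "snd (dec s) \<in> elts A1" if "s \<in> Z" for s using that dec by (auto simp: Z_def)
 have smZ: "zero.sm Z" unfolding Z_def by (rule small_image[OF smA])
 have Z: "small TYPE('u) Z" using smZ by (simp add: small_def)
 have oZ: "Z \<in> ob Set_cat" using Z by (simp add: set_ob_iff)
 define M0 where "M0 = zero.half Z {u0, u1} u1 (\<lambda>s. fst (dec s))"
 define M1 where "M1 = one.half Z {u0, u1} u0 (\<lambda>s. snd (dec s))"
 define p0 where "p0 = (M0, \<lambda>z\<in>fst M0. ufst z, fob (Nabla A0) Z)"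
 define p1 where "p1 = (M1, \<lambda>z\<in>fst M1. ufst z, fob (Nabla A1) Z)"
 define s0 where "s0 = (fob (Nabla A0) Z, \<lambda>s\<in>Z. upair s u0, M0)"
 define s1 where "s1 = (fob (Nabla A1) Z, \<lambda>s\<in>Z. upair s u1, M1)"
 have M0: "M0 \<in> ob zero.AA" unfolding M0_def by (rule zero.half_ob[OF smZ smT decZ(1)])
 have M1: "M1 \<in> ob one.AA" unfolding M1_def by (rule one.half_ob[OF smZ smT decZ(2)])
 have p0: "p0 \<in> hom zero.AA M0 (fob (Nabla A0) Z)" unfolding p0_def M0_def by (rule zero.half_proj[OF smZ smT decZ(1)])
 have p1: "p1 \<in> hom one.AA M1 (fob (Nabla A1) Z)" unfolding p1_def M1_def by (rule one.half_proj[OF smZ smT decZ(2)])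
 have s0: "s0 \<in> hom zero.AA (fob (Nabla A0) Z) M0" unfolding s0_def M0_def by (rule zero.half_section[OF smZ smT decZ(1)]) (use u in auto)
 have s1: "s1 \<in> hom one.AA (fob (Nabla A1) Z) M1" unfolding s1_def M1_def by (rule one.half_section[OF smZ smT decZ(2)]) (use u in auto)
 define W where "W = (\<lambda>(s, b). upair s b) ` (Z \<times> {u0, u1})"
 have W: "fst M0 = W" "fst M1 = W" by (simp_all add: M0_def M1_def W_def zero.half_def one.half_def Let_def)
 have real0: "snd M0 z = {r \<in> elts A0. \<forall>s. z = upair s u1 --> le A0 r (fst (dec s))}" if "z \<in> W" for z
  using that by (simp add: M0_def W_def zero.half_def Let_def)
 have real1: "snd M1 z = {r \<in> elts A1. \<forall>s. z = upair s u0 --> le A1 r (snd (dec s))}" if "z \<in> W" for z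
  using that by (simp add: M1_def W_def one.half_def Let_def)
 have oW: "W \<in> ob Set_cat" using M0 W(1) by (auto simp: zero.asm_ob_iff set_ob_iff zero.small_TYPE)
 define X where "X = (fob ?y0 M0, fob ?y1 M1, ident Set_cat W)"
 have X_simps: "ob0 X = fob ?y0 M0" "ob1 X = fob ?y1 M1" "theta X = ident Set_cat W" by (simp_all add: X_def)
 have GX: "fob Gamma_hat (fob ?y0 M0) = W" "fob Gamma_hat (fob ?y1 M1) = W" using zero.Gamma_hat_ob[OF M0] one.Gamma_hat_ob[OF M1] W by simp_all
 have y0: "fob ?y0 M0 \<in> ob (RT A0)" unfolding RT_def by (rule functor_ob[OF zero.embedding_functor M0])
 have y1: "fob ?y1 M1 \<in> ob (RT A1)" unfolding RT_def by (rule functor_ob[OF one.embedding_functor M1])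
 have X: "X \<in> ob P" unfolding X_def by (rule glue_obI[OF y0 y1]) (simp_all only: GX ident_hom[OF S oW] iso_ident[OF S oW])
 have nab_eq: "fob (nab A0) Z = fob ?y0 (fob (Nabla A0) Z)" "fob (nab A1) Z = fob ?y1 (fob (Nabla A1) Z)" by simp_all
 define \<pi> where "\<pi> = (W, \<lambda>z\<in>W. ufst z, Z)"
 have G\<pi>: "far Gamma_hat (far ?y0 p0) = \<pi>" "far Gamma_hat (far ?y1 p1) = \<pi>"
  using zero.Gamma_hat_ar[OF p0] one.Gamma_hat_ar[OF p1] W by (simp_all add: \<pi>_def p0_def p1_def)
 have \<pi>: "\<pi> \<in> hom Set_cat W Z"
  using functor_hom[OF L0 zero.embedded_hom[OF p0]] by (simp only: G\<pi> GX nab_eq(1)[symmetric] zero.Gamma_nab_ob[OF Z])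
 define x where "x = (X, (far ?y0 p0, far ?y1 p1), const_ob Z)"
 have x: "x \<in> hom P X (const_ob Z)" unfolding x_def
  by (rule glue_homI[OF X const_ob[OF Z]])
   (simp_all only: X_simps const_ob_simps nab_eq zero.embedded_hom[OF p0] one.embedded_hom[OF p1] G\<pi> comp_ident[OF S \<pi>])
 have "extremal P x"
 proof (rule glue_extremal[OF x])
  show "far ?y0 s0 \<in> hom (RT A0) (ob0 (const_ob Z)) (ob0 X)" "far ?y1 s1 \<in> hom (RT A1) (ob1 (const_ob Z)) (ob1 X)"
   unfolding X_simps const_ob_simps nab_eq by (rule zero.embedded_hom[OF s0], rule one.embedded_hom[OF s1])
  show "ar0 x o[RT A0] far ?y0 s0 = ident (RT A0) (ob0 (const_ob Z))"
   unfolding x_def glue_pr_simps const_ob_simps p0_def s0_def by (rule zero.embedded_section[OF Z p0[unfolded p0_def] s0[unfolded s0_def]])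
  show "ar1 x o[RT A1] far ?y1 s1 = ident (RT A1) (ob1 (const_ob Z))"
   unfolding x_def glue_pr_simps const_ob_simps p1_def s1_def by (rule one.embedded_section[OF Z p1[unfolded p1_def] s1[unfolded s1_def]])
 qed
 then obtain \<Xi> where \<Xi>: "\<Xi> \<in> hom P (const_ob Z) X" "\<forall>s\<in>Z. x o[P] (\<Xi> o[P] far const (elem Z s)) = far const (elem Z s)"
  using split[OF Z x] by blast
 obtain f0 where f0: "f0 \<in> hom zero.AA (fob (Nabla A0) Z) M0" "ar0 \<Xi> = far ?y0 f0"
  by (rule zero.nabla_arrow_embedded[OF Z ar_hom(1)[OF \<Xi>(1), unfolded X_simps const_ob_simps] M0]) (rule that)
 obtain f1 where f1: "f1 \<in> hom one.AA (fob (Nabla A1) Z) M1" "ar1 \<Xi> = far ?y1 f1"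
  by (rule one.nabla_arrow_embedded[OF Z ar_hom(2)[OF \<Xi>(1), unfolded X_simps const_ob_simps] M1]) (rule that)
 have G0: "far Gamma_hat (far ?y0 f0) = (Z, fn f0, W)" and G1: "far Gamma_hat (far ?y1 f1) = (Z, fn f1, W)"
  using zero.Gamma_hat_ar[OF f0(1)] one.Gamma_hat_ar[OF f1(1)] W by simp_all
 have h0: "(Z, fn f0, W) \<in> hom Set_cat Z W" and h1: "(Z, fn f1, W) \<in> hom Set_cat Z W"
  using functor_hom[OF L0 zero.embedded_hom[OF f0(1)]] functor_hom[OF L1 one.embedded_hom[OF f1(1)]]
  by (simp_all only: G0 G1 GX nab_eq[symmetric] zero.Gamma_nab_ob[OF Z] one.Gamma_nab_ob[OF Z])
 \<comment> \<open>the gluing isomorphisms are identities, so both components have the same underlying function\<close>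
 have "(Z, fn f0, W) = (Z, fn f1, W)"
  using ar_nat[OF \<Xi>(1)] by (simp only: X_simps const_ob_simps f0(2) f1(2) G0 G1 comp_ident[OF S h0] comp_ident[OF S h1])
 then have ff: "fn f1 = fn f0" by simp
 have sec: "ufst (fn f0 s) = s" "fn f0 s \<in> W" if s: "s \<in> Z" for s
 proof -
  have "elem Z s \<in> hom Set_cat pt Z" by (rule zero.elem_hom[OF Z s])
  note fc = far_const[OF this]
  have "ar0 (x o[P] (\<Xi> o[P] far const (elem Z s))) = ar0 (far const (elem Z s))" using \<Xi>(2) s by simp
  then have "comp (RT A0) (far ?y0 p0) (comp (RT A0) (far ?y0 f0) (far (nab A0) (elem Z s))) = far (nab A0) (elem Z s)"
   unfolding ar_comp fc glue_pr_simps f0(2) by (simp only: x_def glue_pr_simps)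
  then have "fn p0 (fn f0 s) = s" by (rule zero.embedded_point[OF Z f0(1) p0 s])
  moreover show "fn f0 s \<in> W" using zero.fn_mem[OF f0(1), of s] s W by simp
  ultimately show "ufst (fn f0 s) = s" using W by (simp add: p0_def)
 qed
 obtain d0 where d0: "d0 \<in> elts A0" "\<And>s. s \<in> Z ==> d0 \<in> snd M0 (fn f0 s)" by (rule zero.common_realizer[OF f0(1)]) (rule that)
 obtain d1 where d1: "d1 \<in> elts A1" "\<And>s. s \<in> Z ==> d1 \<in> snd M1 (fn f0 s)"
  by (rule one.common_realizer[OF f1(1)]) (use that ff in simp)
 have "le A0 d0 a0 \<or> le A1 d1 a1" if a: "a0 \<in> elts A0" "a1 \<in> elts A1" for a0 a1
 proof -
  define s where "s = code (a0, a1)"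
  have s: "s \<in> Z" "dec s = (a0, a1)" using a dec by (auto simp: s_def Z_def)
  obtain s' b where w: "fn f0 s = upair s' b" "b = u0 \<or> b = u1" using sec(2)[OF s(1)] by (auto simp: W_def)
  have "s' = s" using sec(1)[OF s(1)] w(1) by simp
  then show ?thesis using w d0(2)[OF s(1)] d1(2)[OF s(1)] real0[OF sec(2)[OF s(1)]] real1[OF sec(2)[OF s(1)]] s(2) by auto
 qed
 then show ?thesis using d0(1) d1(1) by blast
qed

theorem proposition6p3:
 fixes A0 :: "'a opas" and A1 :: "'b opas" and C :: "'c opas"
  and E :: "('eo, 'em) cat"
  and i0 :: "(('u, 'a) rt_ob, ('u, 'a) rt_arr, 'eo, 'em) geom"
  and i1 :: "(('u, 'b) rt_ob, ('u, 'b) rt_arr, 'eo, 'em) geom"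
  and \<phi> :: "'eo => 'u set_arr"
 assumes "set_universe TYPE('u)"
  and "opca A0" and "small TYPE('u) (elts A0)"
  and "opca A1" and "small TYPE('u) (elts A1)"
  and "pseudocoproduct TYPE('u) A0 A1 E i0 i1 \<phi>"
  and "realizability_topos TYPE('u) C E"
 shows "trivial_opca A0 \<or> trivial_opca A1"
proof -
 have C: "opca C" "small TYPE('u) (elts C)" and eq: "equivalent_cats E (RT C :: (('u, 'c) rt_ob, ('u, 'c) rt_arr) cat)"
  using assms(7) by (auto simp: realizability_topos_def)
 interpret a0: asm_univ "TYPE('u)" A0 by unfold_locales (rule assms)+
 interpret a1: asm_univ "TYPE('u)" A1 by unfold_locales (rule assms)+
 interpret c: asm_univ "TYPE('u)" C by unfold_locales (rule assms C)+
 note pp = assms(6)[unfolded pseudocoproduct_def]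
 have t: "topos (Set_cat :: ('u set, 'u set_arr) cat)" "topos (RT A0 :: (('u, 'a) rt_ob, ('u, 'a) rt_arr) cat)" "topos (RT A1 :: (('u, 'b) rt_ob, ('u, 'b) rt_arr) cat)"
  and g0: "geometric_morphism Set_cat (RT A0) (Set_inclusion A0 :: (_, _, ('u, 'a) rt_ob, ('u, 'a) rt_arr) geom)"
  and g1: "geometric_morphism Set_cat (RT A1) (Set_inclusion A1 :: (_, _, ('u, 'b) rt_ob, ('u, 'b) rt_arr) geom)"
  using pp unfolding pseudopushout_def by blast+
 note q0 = a0.inclusion_properties[OF t(2) g0] and q1 = a1.inclusion_properties[OF t(3) g1]
 interpret g: glued_toposes "TYPE('u)" A0 A1 
  by (intro glued_toposes.intro gluing.intro a0.asm_univ_axioms a1.asm_univ_axioms t q0(1,2,3) q1(1,2,3))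
 obtain oc :: "(('u, 'a) rt_ob, ('u, 'b) rt_ob, 'u set_arr) glue_ob => 'u" where oc: "inj_on oc (ob g.P)"
  using a0.classlike_code[OF g.glue_classlike(1)[OF assms(3,5)]] .
 obtain ac :: "(('u, 'a) rt_ob, ('u, 'a) rt_arr, ('u, 'b) rt_ob, ('u, 'b) rt_arr, 'u set_arr) glue_arr => 'u" where ac: "inj_on ac (arr g.P)"
  using a0.classlike_code[OF g.glue_classlike(2)[OF assms(3,5)]] .
 \<comment> \<open>a copy of the glued topos on elements of the universe\<close>
 obtain T :: "('u, 'u) cat" and enc dec where iso: "iso_cats g.P T enc dec" using relabel_exists[OF g.category_glue oc ac] by blast
 have ii: "inverse_image (Set_inclusion A0) = Gamma_hat" "inverse_image (Set_inclusion A1) = Gamma_hat" by (simp_all add: Set_inclusion_def)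
 have P_eq: "g.P = glue Set_cat (RT A0) (RT A1) (inverse_image (Set_inclusion A0)) (inverse_image (Set_inclusion A1))" by (simp only: ii)
 have gl: "gluing (Set_cat :: ('u set, 'u set_arr) cat) (RT A0) (RT A1) (inverse_image (Set_inclusion A0)) (inverse_image (Set_inclusion A1))"
  unfolding ii by (rule g.gluing_axioms)
 obtain H k l where H: "is_functor g.P (RT C :: (('u, 'c) rt_ob, ('u, 'c) rt_arr) cat) H" and k: "is_functor (RT C) g.P k"
  and l: "\<forall>X\<in>ob g.P. l X \<in> hom g.P (fob k (fob H X)) X \<and> iso_arr g.P (l X)"
  and ln: "\<forall>X Y f. f \<in> hom g.P X Y --> l Y o[g.P] far k (far H f) = f o[g.P] l X"
  and Ht: "\<forall>t. is_terminal g.P t --> is_terminal (RT C) (fob H t)" and Hx: "\<forall>x. extremal g.P x --> extremal (RT C) (far H x)"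
  by (rule comparison_retract[OF P_eq pp gl iso c.category_RT eq]) (rule that)
 have pt: "is_terminal g.P (fob g.const (pt :: 'u set))" unfolding g.fob_const
  by (rule g.glue_terminal[OF g.const_ob[OF a0.small_pt]]) (simp_all only: g.const_ob_simps q0(4) q1(4))
 then have O: "is_terminal (RT C) (fob H (fob g.const (pt :: 'u set)))" using Ht by blast
 then have "fob H (fob g.const (pt :: 'u set)) \<in> ob (RT C)" by (simp add: is_terminal_def)
 then obtain o' where o': "o' \<in> hom (RT C) (fob H (fob g.const (pt :: 'u set))) (fob (nab C) pt)" using c.to_point by blast
 have lift: "\<exists>w \<in> hom (RT C) (fob (nab C) S) Y. G o[RT C] w = T"
  if "small TYPE('u) S" "G \<in> hom (RT C) Y Q" "extremal (RT C) G" "T \<in> hom (RT C) (fob (nab C) S) Q" for S :: "'u set" and G T Y Q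
  by (rule c.nabla_lift_extremal[OF that]) blast
 have "\<exists>\<Xi> \<in> hom g.P (g.const_ob S) X. \<forall>s\<in>S. x o[g.P] (\<Xi> o[g.P] far g.const (elem S s)) = far g.const (elem S s)"
  if S: "small TYPE('u) S" and x: "x \<in> hom g.P X (g.const_ob S)" "extremal g.P x" for S X x
 proof (rule a0.constants_projective[OF g.category_glue c.category_RT g.const_functor c.nab_functor g.glue_colourable
    a0.small_Times[OF assms(3,5)] c.RT_colourable C(2) H k _ _ _ O o' _ lift S x(1)[folded g.fob_const] x(2)], goal_cases)
  case (9 \<Xi>)
  then show ?case unfolding g.fob_const by blast
 qed (use l ln Hx in blast)+
 then have "(\<exists>d\<in>elts A0. \<forall>a\<in>elts A0. le A0 d a) \<or> (\<exists>d\<in>elts A1. \<forall>a\<in>elts A1. le A1 d a)"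
  by (rule g.least_element_of_splitting[OF assms(3,5)])
 then show ?thesis using a0.least_element_trivial a1.least_element_trivial by blast
qed

end
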